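(* With the notation of the context, let $$\Lambda_J=\mathrm{diag}\Bigl(\tfrac{d_{J,1}(p-2)}{n-k_J-p+1},\dots,\tfrac{d_{J,k_J}(p-2)}{n-k_J-p+1}\Bigr),\qquad C_J=\mathrm{diag}\bigl(x_{J,1}^\top S_J^{-1}x_{J,1},\dots,x_{J,k_J}^\top S_J^{-1}x_{J,k_J}\bigr),$$ $\hat B_{J,\mathrm B}=P_J(I_{k_J}-\Lambda_JC_J^{-1})D_JP_J^\top A_J^\top Y$, let $\hat\Sigma_J=\frac1nS_J$ be the maximum likelihood estimator of $\Sigma$ under the model $J$, and let $$\mathrm{ZKLIC}(J)=n\log\Bigl|\tfrac1nS_J\Bigr|+np\log 2\pi+\frac{np(n+k_J)}{n-k_J-p-1}-n\,\frac{p-2}{n-k_J-p+1}\,\mathrm{tr}(\Lambda_JC_J^{-1}).$$ If the true model $J_*$ satisfies $J_*\subset J$, then $\mathrm{ZKLIC}(J)$ is a uniformly minimum variance unbiased estimator of the Kullback–Leibler risk $R_{\mathrm{KL}}\bigl(B_{J_*},\Sigma,f(\cdot\mid\hat B_{J,\mathrm B},\hat\Sigma_J)\bigr)$.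
   Context: $\mathcal N_{n\times p}(M,\Sigma\otimes I_n)$ is the law of an $n\times p$ random matrix with mean $M$ whose rows are independent $p$-variate normal with covariance $\Sigma$. $A$ is an $n\times k$ matrix of explanatory variables with $\mathrm{rank}(A)=k$; $n-p-k-1>0$; $F=\{1,\dots,k\}$. For $J\subset F$, $k_J=|J|$, $A_J$ is the $n\times k_J$ submatrix of $A$ with columns indexed by $J$, and the candidate model $J$ is $Y\sim\mathcal N_{n\times p}(A_JB_J,\Sigma\otimes I_n)$ with unknown $k_J\times p$ matrix $B_J$ and unknown $p\times p$ covariance matrix $\Sigma$. The true model is the candidate model for $J_*\subset F$: $Y\sim\mathcal N_{n\times p}(A_{J_*}B_{J_*},\Sigma\otimes I_n)$. $P_J$ is an orthogonal matrix with $P_J^\top(A_J^\top A_J)^{-1}P_J=D_J=\mathrm{diag}(d_{J,1},\dots,d_{J,k_J})$, $d_{J,1}\ge\cdots\ge d_{J,k_J}$. $X_J=D_JP_J^\top A_J^\top Y$ is the $k_J\times p$ matrix with rows $x_{J,1}^\top,\dots,x_{J,k_J}^\top$ ($x_{J,i}\in\mathbb R^p$). $S_J=Y^\top(I_n-A_J(A_J^\top A_J)^{-1}A_J^\top)Y$. For a $k_J\times p$ matrix $\Phi$ and positive definite $\Psi$, $f(\cdot\mid\Phi,\Psi)$ is the density of $\mathcal N_{n\times p}(A_J\Phi,\Psi\otimes I_n)$; $f(\cdot\mid B_{J_*},\Sigma)$ is the true density, that of $\mathcal N_{n\times p}(A_{J_*}B_{J_*},\Sigma\otimes I_n)$. For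 a predictive density $\hat f(\cdot\mid Y)$, the Kullback–Leibler risk is $$R_{\mathrm{KL}}(B_{J_*},\Sigma,\hat f)=E_{\tilde Y,Y}\left[\log\frac{f(\tilde Y\mid B_{J_*},\Sigma)}{\hat f(\tilde Y\mid Y)}\right],$$ where $\tilde Y$ is an independent copy of $Y$. A uniformly minimum variance unbiased estimator of a function of the parameters is an unbiased estimator whose variance is, for all parameter values, no larger than that of any other unbiased estimator.
   Formalization: The risk R_KL is replaced by 2(R_KL − E log f(Ỹ|B_{J*},Σ)), i.e. −2 times the expected log predictive density, since ZKLIC(J) is not unbiased for R_KL itself; p=1 with J nonempty is excluded; J_*⊂J is treated as part of the unknown parameter. *)

theory Defs
  imports "HOL-Analysis.Analysis" "Jordan_Normal_Form.Gauss_Jordan_Elimination"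
    "Jordan_Normal_Form.DL_Rank" "Jordan_Normal_Form.DL_Submatrix"
begin

(* All matrices are Jordan_Normal_Form matrices, whose dimensions are values; this makes the
   k_J-dimensional objects attached to a varying subset J (possibly empty) directly expressible.
   HOL-Analysis reuses several matrix names and symbols, hence the qualified names. *)
unbundle no vec_syntax
no_notation inner (infix "\<bullet>" 70)

subsection \<open>Matrices\<close>

(* Totalised by the zero matrix; the arguments below are invertible almost surely. *)
definition inv_mat :: "real mat \<Rightarrow> real mat" where
  "inv_mat A =
     (case mat_inverse A of Some B \<Rightarrow> B | None \<Rightarrow> 0\<^sub>m (dim_row A) (dim_row A))"

definition trace_mat :: "real mat \<Rightarrow> real" where
  "trace_mat A = (\<Sum>i<dim_row A. A $$ (i, i))"

definition pos_def_mat :: "nat \<Rightarrow> real mat \<Rightarrow> bool" where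
  "pos_def_mat p S \<longleftrightarrow> S \<in> carrier_mat p p \<and> transpose_mat S = S \<and>
     (\<forall>v \<in> carrier_vec p. v \<noteq> 0\<^sub>v p \<longrightarrow> v \<bullet> (S *\<^sub>v v) > 0)"

subsection \<open>The matrix normal distribution\<close>

definition mvnormal_pdf :: "real Matrix.vec \<Rightarrow> real mat \<Rightarrow> real Matrix.vec \<Rightarrow> real" where
  "mvnormal_pdf m S x =
     exp (- ((x - m) \<bullet> (inv_mat S *\<^sub>v (x - m))) / 2)
       / sqrt ((2 * pi) ^ dim_vec m * Determinant.det S)"

(* Independent rows: the joint density is the product of the densities of the rows. *)
definition matnormal_pdf :: "real mat \<Rightarrow> real mat \<Rightarrow> real mat \<Rightarrow> real" where
  "matnormal_pdf M S Y =
     (\<Prod>i<dim_row M. mvnormal_pdf (Matrix.row M i) S (Matrix.row Y i))"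

(* Lebesgue measure on carrier_mat n p. *)
definition lborel_mat :: "nat \<Rightarrow> nat \<Rightarrow> real mat measure" where
  "lborel_mat n p =
     embed_measure (\<Pi>\<^sub>M ij \<in> {..<n} \<times> {..<p}. (lborel :: real measure)) (Matrix.mat n p)"

definition matnormal :: "real mat \<Rightarrow> real mat \<Rightarrow> real mat measure" where
  "matnormal M S =
     density (lborel_mat (dim_row M) (dim_col M)) (\<lambda>Y. ennreal (matnormal_pdf M S Y))"

subsection \<open>Candidate models\<close>

(* Columns are numbered from 0, so the full index set is {..<k}. *)
definition cols_of :: "real mat \<Rightarrow> nat set \<Rightarrow> real mat" where
  "cols_of A J = submatrix A UNIV J"

definition model_pdf :: "real mat \<Rightarrow> nat set \<Rightarrow> real mat \<Rightarrow> real mat \<Rightarrow> real mat \<Rightarrow> real" where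
  "model_pdf A J \<Phi> \<Psi> = matnormal_pdf (cols_of A J * \<Phi>) \<Psi>"

definition model_law :: "real mat \<Rightarrow> nat set \<Rightarrow> real mat \<Rightarrow> real mat \<Rightarrow> real mat measure" where
  "model_law A J \<Phi> \<Psi> = matnormal (cols_of A J * \<Phi>) \<Psi>"

(* The unknown parameter is the true model together with its coefficients and covariance;
   J is known to include the true model. *)
definition true_params :: "nat \<Rightarrow> nat set \<Rightarrow> (nat set \<times> real mat \<times> real mat) set" where
  "true_params p J =
     {(J\<^sub>0, B, S). J\<^sub>0 \<subseteq> J \<and> B \<in> carrier_mat (card J\<^sub>0) p \<and> pos_def_mat p S}"

definition gram_inv :: "real mat \<Rightarrow> nat set \<Rightarrow> real mat" where
  "gram_inv A J = inv_mat (transpose_mat (cols_of A J) * cols_of A J)"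

subsection \<open>Kullback--Leibler risk\<close>

(* A predictive density is written fh y yt, for the density at yt predicted from the data y. *)
definition kl_integrand ::
  "real mat \<Rightarrow> nat set \<Rightarrow> real mat \<Rightarrow> real mat \<Rightarrow> (real mat \<Rightarrow> real mat \<Rightarrow> real)
     \<Rightarrow> real mat \<times> real mat \<Rightarrow> real" where
  "kl_integrand A J B S fh = (\<lambda>(yt, y). ln (model_pdf A J B S yt / fh y yt))"

definition kl_risk ::
  "real mat \<Rightarrow> nat set \<Rightarrow> real mat \<Rightarrow> real mat \<Rightarrow> (real mat \<Rightarrow> real mat \<Rightarrow> real) \<Rightarrow> real" where
  "kl_risk A J B S fh =
     (LINT z|(model_law A J B S \<Otimes>\<^sub>M model_law A J B S). kl_integrand A J B S fh z)"

(* The part of the risk that depends neither on the candidate model nor on the predictive density.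
   Criteria on the usual scale of minus twice the expected predictive log density target
   2 * (kl_risk - exp_log_true_pdf), not kl_risk itself. *)
definition exp_log_true_pdf ::
  "real mat \<Rightarrow> nat set \<Rightarrow> real mat \<Rightarrow> real mat \<Rightarrow> real" where
  "exp_log_true_pdf A J B S = (LINT yt|model_law A J B S. ln (model_pdf A J B S yt))"

subsection \<open>The estimators and the criterion\<close>

definition S_of :: "real mat \<Rightarrow> nat set \<Rightarrow> real mat \<Rightarrow> real mat" where
  "S_of A J Y = transpose_mat Y *
     (1\<^sub>m (dim_row A) - cols_of A J * gram_inv A J * transpose_mat (cols_of A J)) * Y"

definition X_of ::
  "real mat \<Rightarrow> nat set \<Rightarrow> real mat \<Rightarrow> (nat \<Rightarrow> real) \<Rightarrow> real mat \<Rightarrow> real mat" where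
  "X_of A J P d Y =
     mat_diag (card J) d * transpose_mat P * transpose_mat (cols_of A J) * Y"

definition Lambda_mat :: "nat \<Rightarrow> nat \<Rightarrow> nat set \<Rightarrow> (nat \<Rightarrow> real) \<Rightarrow> real mat" where
  "Lambda_mat n p J d = mat_diag (card J)
     (\<lambda>i. d i * (real p - 2) / (real n - real (card J) - real p + 1))"

definition C_of ::
  "real mat \<Rightarrow> nat set \<Rightarrow> real mat \<Rightarrow> (nat \<Rightarrow> real) \<Rightarrow> real mat \<Rightarrow> real mat" where
  "C_of A J P d Y = mat_diag (card J)
     (\<lambda>i. Matrix.row (X_of A J P d Y) i \<bullet>
            (inv_mat (S_of A J Y) *\<^sub>v Matrix.row (X_of A J P d Y) i))"

definition Bhat ::
  "real mat \<Rightarrow> nat set \<Rightarrow> real mat \<Rightarrow> (nat \<Rightarrow> real) \<Rightarrow> real mat \<Rightarrow> real mat" where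
  "Bhat A J P d Y =
     P * (1\<^sub>m (card J) - Lambda_mat (dim_row Y) (dim_col Y) J d * inv_mat (C_of A J P d Y))
       * mat_diag (card J) d * transpose_mat P * transpose_mat (cols_of A J) * Y"

definition Sigma_hat :: "real mat \<Rightarrow> nat set \<Rightarrow> real mat \<Rightarrow> real mat" where
  "Sigma_hat A J Y = (1 / real (dim_row Y)) \<cdot>\<^sub>m S_of A J Y"

definition plugin_pdf ::
  "real mat \<Rightarrow> nat set \<Rightarrow> real mat \<Rightarrow> (nat \<Rightarrow> real) \<Rightarrow> real mat \<Rightarrow> real mat \<Rightarrow> real" where
  "plugin_pdf A J P d Y = model_pdf A J (Bhat A J P d Y) (Sigma_hat A J Y)"

definition zklic ::
  "real mat \<Rightarrow> nat set \<Rightarrow> real mat \<Rightarrow> (nat \<Rightarrow> real) \<Rightarrow> real mat \<Rightarrow> real" where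
  "zklic A J P d Y =
     (let n = dim_row Y; p = dim_col Y in
        real n * ln (Determinant.det ((1 / real n) \<cdot>\<^sub>m S_of A J Y))
        + real n * real p * ln (2 * pi)
        + real n * real p * (real n + real (card J)) / (real n - real (card J) - real p - 1)
        - real n * ((real p - 2) / (real n - real (card J) - real p + 1))
            * trace_mat (Lambda_mat n p J d * inv_mat (C_of A J P d Y)))"

subsection \<open>Uniformly minimum variance unbiased estimation\<close>

definition unbiased_estimator ::
  "'t set \<Rightarrow> ('t \<Rightarrow> 'a measure) \<Rightarrow> ('t \<Rightarrow> real) \<Rightarrow> ('a \<Rightarrow> real) \<Rightarrow> bool" where
  "unbiased_estimator \<Theta> L g \<delta> \<longleftrightarrow>
     (\<forall>\<theta>\<in>\<Theta>. integrable (L \<theta>) \<delta> \<and> integral\<^sup>L (L \<theta>) \<delta> = g \<theta>)"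

(* Values in [0, \<infinity>]: an unbiased estimator need not have a finite second moment. *)
definition estimator_variance :: "'a measure \<Rightarrow> ('a \<Rightarrow> real) \<Rightarrow> ennreal" where
  "estimator_variance M \<delta> = (\<integral>\<^sup>+ y. ennreal ((\<delta> y - integral\<^sup>L M \<delta>)\<^sup>2) \<partial>M)"

definition umvu_estimator ::
  "'t set \<Rightarrow> ('t \<Rightarrow> 'a measure) \<Rightarrow> ('t \<Rightarrow> real) \<Rightarrow> ('a \<Rightarrow> real) \<Rightarrow> bool" where
  "umvu_estimator \<Theta> L g \<delta> \<longleftrightarrow>
     unbiased_estimator \<Theta> L g \<delta> \<and>
     (\<forall>\<delta>'. unbiased_estimator \<Theta> L g \<delta>' \<longrightarrow>
        (\<forall>\<theta>\<in>\<Theta>. estimator_variance (L \<theta>) \<delta> \<le> estimator_variance (L \<theta>) \<delta>'))"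

end

(*
  Whitening the data by a Cholesky factor of Sigma and splitting along an orthonormal basis of the
  column space of A_J turns minus twice the expected predictive log density into the expectation
  of n log|S_J / n| plus a quadratic loss. With W the residual part and x a vector independent of
  W, the loss is evaluated by Stein's identity in the entries of W (Haff's identity) applied to the
  function 1 / (x^T S^{-1} x): the cross term produced by the shrinkage is (p - 2) / (n - k_J - p + 1)
  times the expectation of that function, so zklic has the expectation claimed. Integrability is
  obtained by replacing S with S + epsilon I and letting epsilon tend to 0.

  For minimum variance, let h be the difference of another unbiased estimator and zklic; its
  integral vanishes for all parameters. Multiplying a model density by
  exp(- tr(K Y^T Y) / 2 + tr(eta^T A_J^T Y)) with K positive semidefinite gives, up to a constant,
  another model density. So h is orthogonal to this multiplicative class, hence to the sigma-algebra
  generated by it, which makes A_J^T Y and Y^T Y measurable, and with them zklic. Therefore zklic is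
  the conditional expectation of the other estimator, and Jensen's inequality finishes the proof.
*)

theory Submission
  imports Defs "HOL-Probability.Probability"
begin

unbundle no vec_syntax
no_notation inner (infix "\<bullet>" 70)

subsection \<open>Gaussian integration by parts\<close>

text \<open>The obstacle is integrability: 1 / (y^T S^{-1} y) is singular, while Stein's identity is
  available for fields of polynomial growth. The limit in \<open>\<epsilon>\<close> needs a majorant
  free of \<open>\<epsilon>\<close>. It is (tr S + 1) / |y|^2, because |y|^2 <= tr S * y^T S^{-1} y;
  that it is integrable, also after multiplication by tr S^{-1}, is drawn from Stein and Haff
  identities whose error terms have a favourable sign. The constant (p - 2) / (n - k_J - p + 1)
  comes from comparing two identities for the field f(y) = S^{-1} y / (y^T S^{-1} y). Stein's
  identity along a basis direction of the column space gives E div f = E x^T f(y). Haff's identity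
  for W times the Jacobian of f gives (n - k_J - p + 1) E div f = (p - 2) E 1 / (y^T S^{-1} y). For
  p = 2 the last expectation is infinite, but the constant is 0 and only its products with the
  constant occur. For the variance it matters that J itself is among the possible true models:
  tilting usually leaves the true model but never the model J.\<close>

definition gauss :: "real measure" where
  "gauss = density lborel (\<lambda>x. ennreal (std_normal_density x))"

abbreviation gaussM :: "'i set \<Rightarrow> ('i \<Rightarrow> real) measure" where
  "gaussM I \<equiv> \<Pi>\<^sub>M i\<in>I. gauss"

lemma sets_gauss [simp, measurable_cong]: "sets gauss = sets borel"
  and space_gauss [simp]: "space gauss = UNIV"
  by (simp_all add: gauss_def)

lemma prob_space_gauss: "prob_space gauss"
  unfolding gauss_def by (rule prob_space_normal_density) simp

interpretation gauss: prob_space gauss by (rule prob_space_gauss)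
interpretation gaussP: product_prob_space "\<lambda>_. gauss" UNIV by unfold_locales

lemma prob_space_gaussM: "prob_space (gaussM I)"
  by (intro prob_space_PiM prob_space_gauss)

lemma sets_gaussM [measurable_cong]: "sets (gaussM I) = sets (\<Pi>\<^sub>M i\<in>I. borel)"
  by (intro sets_PiM_cong) auto

lemma integrable_gauss_moment: "integrable gauss (\<lambda>x. x ^ k)"
  unfolding gauss_def
  by (subst integrable_density) (auto intro: integrable_std_normal_moment)

lemma integrable_gauss_pow1: "integrable gauss (\<lambda>x. (1 + x\<^sup>2) ^ k)"
proof -
  have eq: "(\<lambda>x::real. (1 + x\<^sup>2) ^ k) = (\<lambda>x. \<Sum>i\<le>k. of_nat (k choose i) * (x ^ (2 * (k - i))))"
    by (rule ext) (simp add: binomial_ring power_mult)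
  show ?thesis unfolding eq
    by (intro Bochner_Integration.integrable_sum integrable_mult_right integrable_gauss_moment)
qed

text \<open>Up to a constant factor the density is exp of -(1 + x^2) / 2, so with y = (1 + x^2) / 2
  the claim becomes the limit of y^k / exp y.\<close>

lemma gauss_pow_tendsto_0:
  fixes k :: nat
  shows "((\<lambda>x::real. std_normal_density x * (1 + x\<^sup>2) ^ k) \<longlongrightarrow> 0) at_top"
proof -
  have 1: "((\<lambda>y::real. y ^ k / exp y) \<longlongrightarrow> 0) at_top"
    by (rule tendsto_power_div_exp_0)
  have 2: "filterlim (\<lambda>x::real. (1 + x\<^sup>2) / 2) at_top at_top"
    by real_asymp
  have "((\<lambda>x::real. (1 / sqrt (2 * pi)) * exp (1/2) * 2 ^ k * (((1 + x\<^sup>2) / 2) ^ k / exp ((1 + x\<^sup>2) / 2)))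
      \<longlongrightarrow> (1 / sqrt (2 * pi)) * exp (1/2) * 2 ^ k * 0) at_top"
    by (intro tendsto_mult tendsto_const filterlim_compose[OF 1 2])
  moreover have "(1 / sqrt (2 * pi)) * exp (1/2) * 2 ^ k * (((1 + x\<^sup>2) / 2) ^ k / exp ((1 + x\<^sup>2) / 2))
     = std_normal_density x * (1 + x\<^sup>2) ^ k" for x :: real
  proof -
    have "exp ((1 + x\<^sup>2) / 2) = exp (1/2) * exp (x\<^sup>2 / 2)"
      by (simp add: exp_add [symmetric] add_divide_distrib)
    then show ?thesis
      by (simp add: std_normal_density_def power_divide exp_minus field_simps)
  qed
  ultimately show ?thesis by simp
qed

text \<open>The density times \<open>F' x - x * F x\<close> is the derivative of the density times
  \<open>F\<close>. Over the interval from -j to j the integral is therefore a difference of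
  boundary values, and polynomial growth sends these to 0.\<close>

lemma stein_1d:
  fixes F F' :: "real \<Rightarrow> real"
  assumes der: "\<And>x. (F has_real_derivative F' x) (at x)"
    and m: "F' \<in> borel_measurable borel"
    and bF: "\<And>x. \<bar>F x\<bar> \<le> C * (1 + x\<^sup>2) ^ k"
    and bF': "\<And>x. \<bar>F' x\<bar> \<le> C * (1 + x\<^sup>2) ^ k"
  shows "integral\<^sup>L gauss (\<lambda>x. F' x - x * F x) = 0"
proof -
  have "continuous_on UNIV F"
    using der by (meson DERIV_continuous continuous_at_imp_continuous_on)
  then have mF [measurable]: "F \<in> borel_measurable borel" by (rule borel_measurable_continuous_onI)
  note m [measurable]
  have C0: "0 \<le> C" using bF[of 0] by auto
  define G where "G x = std_normal_density x * F x" for x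
  define G' where "G' x = std_normal_density x * (F' x - x * F x)" for x
  have derS: "(std_normal_density has_real_derivative - x * std_normal_density x) (at x)" for x
    unfolding std_normal_density_def
    by (rule derivative_eq_intros refl | simp add: field_simps)+
  have derG: "(G has_real_derivative G' x) (at x)" for x
    unfolding G_def G'_def
    by (rule derivative_eq_intros derS der refl | simp add: algebra_simps)+
  have "integrable gauss (\<lambda>x. F' x - x * F x)"
  proof (rule Bochner_Integration.integrable_bound)
    show "integrable gauss (\<lambda>x. 2 * C * (1 + x\<^sup>2) ^ (k+1))"
      by (intro integrable_mult_right integrable_gauss_pow1)
    show "AE x in gauss. norm (F' x - x * F x) \<le> norm (2 * C * (1 + x\<^sup>2) ^ (k + 1))"
    proof (rule AE_I2)
      fix x :: real
      have ax: "\<bar>x\<bar> \<le> 1 + x\<^sup>2"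
        using zero_le_power2[of "\<bar>x\<bar> - 1"] by (simp add: power2_eq_square algebra_simps abs_mult_self_eq)
      have pos: "0 \<le> (1 + x\<^sup>2) ^ k" by simp
      have "\<bar>F' x - x * F x\<bar> \<le> \<bar>F' x\<bar> + \<bar>x\<bar> * \<bar>F x\<bar>"
        by (metis abs_mult abs_triangle_ineq4)
      also have "\<dots> \<le> C * (1 + x\<^sup>2) ^ k + (1 + x\<^sup>2) * (C * (1 + x\<^sup>2) ^ k)"
        by (intro add_mono mult_mono bF bF' ax) auto
      also have "\<dots> \<le> (1 + x\<^sup>2) * (C * (1 + x\<^sup>2) ^ k) + (1 + x\<^sup>2) * (C * (1 + x\<^sup>2) ^ k)"
        using mult_right_mono[of 1 "1 + x\<^sup>2" "C * (1 + x\<^sup>2) ^ k"] C0 pos by (simp del: mult_cancel_right2 add: algebra_simps)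
      also have "\<dots> = 2 * C * (1 + x\<^sup>2) ^ (k + 1)" by simp
      finally show "norm (F' x - x * F x) \<le> norm (2 * C * (1 + x\<^sup>2) ^ (k + 1))"
        using C0 by simp
    qed
  qed measurable
  then have intG': "integrable lborel G'"
    unfolding gauss_def G'_def by (subst (asm) integrable_density) auto
  have G0: "(G \<longlongrightarrow> 0) at_top" "((\<lambda>x. G (- x)) \<longlongrightarrow> 0) at_top"
  proof -
    have lim: "((\<lambda>x::real. C * (std_normal_density x * (1 + x\<^sup>2) ^ k)) \<longlongrightarrow> 0) at_top"
      using tendsto_mult_right_zero[OF gauss_pow_tendsto_0] by simp
    have b: "norm (G x) \<le> C * (std_normal_density x * (1 + x\<^sup>2) ^ k)" for x
      unfolding G_def using mult_left_mono[OF bF[of x], of "std_normal_density x"]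
      by (simp add: abs_mult algebra_simps)
    have b': "norm (G (- x)) \<le> C * (std_normal_density x * (1 + x\<^sup>2) ^ k)" for x
      using b[of "- x"] by (simp add: std_normal_density_def)
    show "(G \<longlongrightarrow> 0) at_top"
      by (rule Lim_null_comparison[OF _ lim]) (use b in simp)
    show "((\<lambda>x. G (- x)) \<longlongrightarrow> 0) at_top"
      by (rule Lim_null_comparison[OF _ lim]) (use b' in simp)
  qed
  have "(\<lambda>j. LBINT x. indicator {- real j..real j} x *\<^sub>R G' x) \<longlonglongrightarrow> integral\<^sup>L lborel G'"
  proof (rule integral_dominated_convergence[where w="\<lambda>x. \<bar>G' x\<bar>"])
    show "AE x in lborel. (\<lambda>j. indicator {- real j..real j} x *\<^sub>R G' x) \<longlonglongrightarrow> G' x"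
    proof (rule AE_I2, rule tendsto_eventually)
      fix x :: real
      show "\<forall>\<^sub>F j in sequentially. indicator {- real j..real j} x *\<^sub>R G' x = G' x"
        using eventually_ge_at_top[of "nat \<lceil>\<bar>x\<bar>\<rceil>"]
        by eventually_elim (auto simp: indicator_def nat_le_iff, linarith+)
    qed
    show "integrable lborel (\<lambda>x. \<bar>G' x\<bar>)" using intG' by simp
    show "G' \<in> borel_measurable lborel" unfolding G'_def by measurable
    show "(\<lambda>x. indicator {- real j..real j} x *\<^sub>R G' x) \<in> borel_measurable lborel" for j
      unfolding G'_def by measurable
  qed (auto simp: indicator_def)
  moreover have "(LBINT x. indicator {- real j..real j} x *\<^sub>R G' x) = G (real j) - G (- real j)" for j :: nat
  proof -
    have "set_integrable lborel {- real j..real j} G'"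
      unfolding set_integrable_def using intG' by (intro integrable_mult_indicator) auto
    from set_borel_integral_eq_integral(2)[OF this]
    have "(LBINT x:{- real j..real j}. G' x) = integral {- real j..real j} G'" .
    moreover have "(G' has_integral (G (real j) - G (- real j))) {- real j..real j}"
      by (rule fundamental_theorem_of_calculus)
        (auto intro: has_field_derivative_at_within derG simp: has_real_derivative_iff_has_vector_derivative[symmetric])
    ultimately show ?thesis
      by (simp add: set_lebesgue_integral_def integral_unique)
  qed
  moreover have "(\<lambda>j. G (real j) - G (- real j)) \<longlonglongrightarrow> 0 - 0"
    by (intro tendsto_diff filterlim_compose[OF G0(1) filterlim_real_sequentially]
        filterlim_compose[OF G0(2) filterlim_real_sequentially])
  ultimately have "integral\<^sup>L lborel G' = 0"
    using LIMSEQ_unique by fastforce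
  then show ?thesis
    unfolding gauss_def G'_def by (subst integral_density) auto
qed

section \<open>Functions of polynomial growth and Stein's identity in several variables\<close>

text \<open>The bound is required at every function, not only on the space of the product measure,
  because coordinates are updated freely below. Leaving the exponent open makes the class closed
  under products, so integrability can be read off the shape of an expression.\<close>

definition polybd :: "'i set \<Rightarrow> (('i \<Rightarrow> real) \<Rightarrow> real) \<Rightarrow> bool" where
  "polybd I F \<longleftrightarrow> (\<exists>C k. \<forall>w. \<bar>F w\<bar> \<le> C * (1 + (\<Sum>i\<in>I. (w i)\<^sup>2)) ^ k)"

lemma polybdI: "(\<And>w. \<bar>F w\<bar> \<le> C * (1 + (\<Sum>i\<in>I. (w i)\<^sup>2)) ^ k) \<Longrightarrow> polybd I F"
  unfolding polybd_def by blast

lemma polybdE: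
  assumes "polybd I F"
  obtains C k where "0 \<le> C" "\<And>w. \<bar>F w\<bar> \<le> C * (1 + (\<Sum>i\<in>I. (w i)\<^sup>2)) ^ k"
proof -
  obtain C k where b: "\<And>w. \<bar>F w\<bar> \<le> C * (1 + (\<Sum>i\<in>I. (w i)\<^sup>2)) ^ k"
    using assms unfolding polybd_def by blast
  have "0 \<le> C" using b[of "\<lambda>_. 0"] by (auto simp: )
  with b that show ?thesis by blast
qed

lemma polybd_mono:
  assumes "polybd I G" "\<And>w. \<bar>F w\<bar> \<le> \<bar>G w\<bar>" shows "polybd I F"
  using assms unfolding polybd_def by (meson order_trans)

lemma polybd_bounded: "(\<And>w. \<bar>F w\<bar> \<le> C) \<Longrightarrow> polybd I F"
  by (rule polybdI[where C=C and k=0]) simp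

lemma polybd_const [simp, intro]: "polybd I (\<lambda>w. c)"
  by (rule polybd_bounded[where C="\<bar>c\<bar>"]) simp

lemma polybd_coord [intro]:
  assumes "finite I" "i \<in> I" shows "polybd I (\<lambda>w. w i)"
proof (rule polybdI[where C=1 and k=1])
  fix w :: "'a \<Rightarrow> real"
  have "(w i)\<^sup>2 \<le> (\<Sum>i\<in>I. (w i)\<^sup>2)"
    using assms by (intro member_le_sum) auto
  moreover have "\<bar>w i\<bar> \<le> 1 + (w i)\<^sup>2"
    using zero_le_power2[of "\<bar>w i\<bar> - 1"] by (simp add: power2_eq_square algebra_simps abs_mult_self_eq)
  ultimately show "\<bar>w i\<bar> \<le> 1 * (1 + (\<Sum>i\<in>I. (w i)\<^sup>2)) ^ 1" by simp
qed

lemma polybd_mult [intro]: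
  assumes "polybd I F" "polybd I G" shows "polybd I (\<lambda>w. F w * G w)"
proof -
  obtain C k where F: "0 \<le> C" "\<And>w. \<bar>F w\<bar> \<le> C * (1 + (\<Sum>i\<in>I. (w i)\<^sup>2)) ^ k" using polybdE[OF assms(1)] by blast
  obtain D l where G: "0 \<le> D" "\<And>w. \<bar>G w\<bar> \<le> D * (1 + (\<Sum>i\<in>I. (w i)\<^sup>2)) ^ l" using polybdE[OF assms(2)] by blast
  show ?thesis
  proof (rule polybdI[where C="C*D" and k="k+l"])
    fix w
    have "\<bar>F w * G w\<bar> \<le> (C * (1 + (\<Sum>i\<in>I. (w i)\<^sup>2)) ^ k) * (D * (1 + (\<Sum>i\<in>I. (w i)\<^sup>2)) ^ l)"
      unfolding abs_mult using F(1) by (intro mult_mono F G mult_nonneg_nonneg zero_le_power) (auto intro!: add_nonneg_nonneg sum_nonneg)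
    then show "\<bar>F w * G w\<bar> \<le> C * D * (1 + (\<Sum>i\<in>I. (w i)\<^sup>2)) ^ (k + l)"
      by (simp add: power_add algebra_simps)
  qed
qed

lemma polybd_add [intro]:
  assumes "polybd I F" "polybd I G" shows "polybd I (\<lambda>w. F w + G w)"
proof -
  obtain C k where F: "0 \<le> C" "\<And>w. \<bar>F w\<bar> \<le> C * (1 + (\<Sum>i\<in>I. (w i)\<^sup>2)) ^ k" using polybdE[OF assms(1)] by blast
  obtain D l where G: "0 \<le> D" "\<And>w. \<bar>G w\<bar> \<le> D * (1 + (\<Sum>i\<in>I. (w i)\<^sup>2)) ^ l" using polybdE[OF assms(2)] by blast
  show ?thesis
  proof (rule polybdI[where C="C+D" and k="k+l"])
    fix w :: "'a \<Rightarrow> real"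
    let ?s = "1 + (\<Sum>i\<in>I. (w i)\<^sup>2)"
    have s: "1 \<le> ?s" by (auto intro!: sum_nonneg)
    have "\<bar>F w + G w\<bar> \<le> C * ?s ^ k + D * ?s ^ l" using F(2)[of w] G(2)[of w] by linarith
    also have "\<dots> \<le> C * ?s ^ (k + l) + D * ?s ^ (k + l)"
      using s F(1) G(1) by (intro add_mono mult_left_mono power_increasing) auto
    finally show "\<bar>F w + G w\<bar> \<le> (C + D) * ?s ^ (k + l)" by (simp add: algebra_simps)
  qed
qed

lemma polybd_minus [intro]: "polybd I F \<Longrightarrow> polybd I (\<lambda>w. - F w)"
  by (erule polybd_mono) simp

lemma polybd_diff [intro]: "polybd I F \<Longrightarrow> polybd I G \<Longrightarrow> polybd I (\<lambda>w. F w - G w)"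
  using polybd_add[OF _ polybd_minus, of I F G] by simp

lemma polybd_power [intro]: "polybd I F \<Longrightarrow> polybd I (\<lambda>w. F w ^ k)"
  by (induction k) auto

lemma polybd_sum [intro]: "(\<And>j. j \<in> A \<Longrightarrow> polybd I (F j)) \<Longrightarrow> polybd I (\<lambda>w. \<Sum>j\<in>A. F j w)"
  by (induction A rule: infinite_finite_induct) auto

text \<open>1 plus the sum of the squares is at most the product of the factors 1 + (w i)^2, and a
  product of functions of single coordinates is integrable factor by factor.\<close>

lemma polybd_integrable:
  assumes "finite I" "polybd I F" "F \<in> borel_measurable (gaussM I)"
  shows "integrable (gaussM I) F"
proof -
  obtain C k where F: "0 \<le> C" "\<And>w. \<bar>F w\<bar> \<le> C * (1 + (\<Sum>i\<in>I. (w i)\<^sup>2)) ^ k" using polybdE[OF assms(2)] by blast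
  show ?thesis
  proof (rule Bochner_Integration.integrable_bound)
    show "integrable (gaussM I) (\<lambda>w. C * (\<Prod>i\<in>I. (1 + (w i)\<^sup>2) ^ k))"
      by (intro integrable_mult_right gaussP.product_integrable_prod assms integrable_gauss_pow1)
    show "AE w in gaussM I. norm (F w) \<le> norm (C * (\<Prod>i\<in>I. (1 + (w i)\<^sup>2) ^ k))"
    proof (rule AE_I2)
      fix w :: "'a \<Rightarrow> real"
      have "1 + (\<Sum>i\<in>I. (w i)\<^sup>2) \<le> (\<Prod>i\<in>I. 1 + (w i)\<^sup>2)"
        using assms(1)
      proof (induction I rule: finite_induct)
        case (insert i I)
        have "(1 + (w i)\<^sup>2) * (1 + (\<Sum>i\<in>I. (w i)\<^sup>2)) \<ge> 1 + (w i)\<^sup>2 + (\<Sum>i\<in>I. (w i)\<^sup>2)"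
          by (simp add: algebra_simps sum_nonneg)
        moreover have "(1 + (w i)\<^sup>2) * (1 + (\<Sum>i\<in>I. (w i)\<^sup>2)) \<le> (1 + (w i)\<^sup>2) * (\<Prod>i\<in>I. 1 + (w i)\<^sup>2)"
          using insert by (intro mult_left_mono) auto
        ultimately show ?case using insert by simp
      qed simp
      then have "C * (1 + (\<Sum>i\<in>I. (w i)\<^sup>2)) ^ k \<le> C * (\<Prod>i\<in>I. (1 + (w i)\<^sup>2)) ^ k"
        using F(1) by (intro mult_left_mono power_mono) (auto intro!: add_nonneg_nonneg sum_nonneg)
      with F(2)[of w] show "norm (F w) \<le> norm (C * (\<Prod>i\<in>I. (1 + (w i)\<^sup>2) ^ k))"
        by (simp add: prod_power_distrib)
    qed
  qed fact
qed

text \<open>By Fubini the coordinate \<open>i\<close> is integrated first; with the others frozen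
  the claim is \<open>stein_1d\<close>.\<close>

lemma stein:
  assumes I: "finite I" "i \<in> I"
    and der: "\<And>w x. ((\<lambda>t. F (w(i := t))) has_real_derivative F' (w(i := x))) (at x)"
    and m: "F \<in> borel_measurable (\<Pi>\<^sub>M i\<in>I. borel)" "F' \<in> borel_measurable (\<Pi>\<^sub>M i\<in>I. borel)"
    and b: "polybd I F" "polybd I F'"
  shows "integral\<^sup>L (gaussM I) F' = integral\<^sup>L (gaussM I) (\<lambda>w. w i * F w)"
proof -
  have m' [measurable]: "F \<in> borel_measurable (gaussM I)" "F' \<in> borel_measurable (gaussM I)"
    using m by (simp_all cong: measurable_cong_sets add: sets_gaussM)
  have mi [measurable]: "(\<lambda>w. w i) \<in> borel_measurable (gaussM I)"
    using I by (simp cong: measurable_cong_sets add: sets_gaussM)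
  have i1: "integrable (gaussM I) F'" using I b m' by (intro polybd_integrable)
  have i2: "integrable (gaussM I) (\<lambda>w. w i * F w)"
    using I b m' mi by (intro polybd_integrable polybd_mult polybd_coord) auto
  obtain I' where I': "I = insert i I'" "i \<notin> I'" "finite I'"
    using I by (metis finite_insert mk_disjoint_insert)
  have "integral\<^sup>L (gaussM I) (\<lambda>w. F' w - w i * F w) =
    (LINT w|gaussM I'. LINT y|gauss. F' (w(i := y)) - y * F (w(i := y)))"
    using gaussP.product_integral_insert[OF I'(3,2), of "\<lambda>w. F' w - w i * F w"] i1 i2
    unfolding I'(1) by simp
  also have "\<dots> = (LINT w|gaussM I'. 0)"
  proof (rule Bochner_Integration.integral_cong, rule refl)
    fix w assume w: "w \<in> space (gaussM I')"
    obtain C k where F: "0 \<le> C" "\<And>w. \<bar>F w\<bar> \<le> C * (1 + (\<Sum>i\<in>I. (w i)\<^sup>2)) ^ k" using polybdE[OF b(1)] by blast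
    obtain D l where G: "0 \<le> D" "\<And>w. \<bar>F' w\<bar> \<le> D * (1 + (\<Sum>i\<in>I. (w i)\<^sup>2)) ^ l" using polybdE[OF b(2)] by blast
    define s where "s = 1 + (\<Sum>j\<in>I'. (w j)\<^sup>2)"
    have s1: "1 \<le> s" unfolding s_def by (auto intro!: sum_nonneg)
    have sx: "1 + (\<Sum>j\<in>I. ((w(i := x)) j)\<^sup>2) \<le> s * (1 + x\<^sup>2)" for x
    proof -
      have "(\<Sum>j\<in>I. ((w(i := x)) j)\<^sup>2) = x\<^sup>2 + (\<Sum>j\<in>I'. (w j)\<^sup>2)"
        unfolding I'(1) using I'(2,3) by (auto intro!: sum.cong)
      then have "1 + (\<Sum>j\<in>I. ((w(i := x)) j)\<^sup>2) = s + 1 * x\<^sup>2" by (simp add: s_def)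
      also have "\<dots> \<le> s + s * x\<^sup>2" using s1 by (intro add_left_mono mult_right_mono) auto
      finally show ?thesis by (simp add: algebra_simps)
    qed
    have pw: "(1 + (\<Sum>j\<in>I. ((w(i := x)) j)\<^sup>2)) ^ q \<le> s ^ (k + l) * (1 + x\<^sup>2) ^ (k + l)" if "q \<le> k + l" for x q
    proof -
      have "(1 + (\<Sum>j\<in>I. ((w(i := x)) j)\<^sup>2)) ^ q \<le> (s * (1 + x\<^sup>2)) ^ q"
        by (intro power_mono sx) (auto intro!: add_nonneg_nonneg sum_nonneg)
      also have "\<dots> \<le> (s * (1 + x\<^sup>2)) ^ (k + l)"
      proof (rule power_increasing[OF that])
        show "1 \<le> s * (1 + x\<^sup>2)" using mult_mono[OF s1, of 1 "1 + x\<^sup>2"] s1 by simp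
      qed
      finally show ?thesis by (simp add: power_mult_distrib)
    qed
    show "(LINT y|gauss. F' (w(i := y)) - y * F (w(i := y))) = 0"
    proof (rule stein_1d[where C="(C + D) * s ^ (k + l)" and k="k + l"])
      show "((\<lambda>y. F (w(i := y))) has_real_derivative F' (w(i := x))) (at x)" for x by (rule der)
      have "(\<lambda>y. w(i := y)) \<in> measurable borel (\<Pi>\<^sub>M i\<in>I. borel)"
        unfolding I'(1) by (rule measurable_fun_upd[where J=I']) (use w in \<open>auto simp: space_PiM\<close>)
      then show "(\<lambda>y. F' (w(i := y))) \<in> borel_measurable borel"
        using m(2) by (rule measurable_compose)
      fix x
      have "\<bar>F (w(i := x))\<bar> \<le> C * (s ^ (k + l) * (1 + x\<^sup>2) ^ (k + l))"
        by (rule order_trans[OF F(2)]) (intro mult_left_mono pw F, simp)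
      also have "\<dots> \<le> (C + D) * s ^ (k + l) * (1 + x\<^sup>2) ^ (k + l)"
        using G(1) s1 by (simp add: algebra_simps)
      finally show "\<bar>F (w(i := x))\<bar> \<le> (C + D) * s ^ (k + l) * (1 + x\<^sup>2) ^ (k + l)" .
      have "\<bar>F' (w(i := x))\<bar> \<le> D * (s ^ (k + l) * (1 + x\<^sup>2) ^ (k + l))"
        by (rule order_trans[OF G(2)]) (intro mult_left_mono pw G, simp)
      also have "\<dots> \<le> (C + D) * s ^ (k + l) * (1 + x\<^sup>2) ^ (k + l)"
        using F(1) s1 by (simp add: algebra_simps)
      finally show "\<bar>F' (w(i := x))\<bar> \<le> (C + D) * s ^ (k + l) * (1 + x\<^sup>2) ^ (k + l)" .
    qed
  qed
  finally have "integral\<^sup>L (gaussM I) (\<lambda>w. F' w - w i * F w) = 0" by simp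
  then show ?thesis using i1 i2 by simp
qed

subsection \<open>Inverse matrices\<close>

lemma inv_mat_carrier [simp]:
  assumes A: "A \<in> carrier_mat n n" shows "inv_mat A \<in> carrier_mat n n"
proof (cases "mat_inverse A")
  case None
  then show ?thesis using carrier_matD(1)[OF A] carrier_matD(2)[OF A] by (simp add: inv_mat_def)
next
  case (Some B)
  show ?thesis using mat_inverse(2)[OF A Some] unfolding inv_mat_def Some option.case by blast
qed

lemma inv_mat_right:
  assumes "A \<in> carrier_mat n n" "Determinant.det A \<noteq> 0"
  shows "A * inv_mat A = 1\<^sub>m n" "inv_mat A * A = 1\<^sub>m n"
proof -
  have "A \<in> Units (ring_mat TYPE(real) n (undefined::unit))"
    by (rule det_non_zero_imp_unit[OF assms])
  then obtain B where B: "mat_inverse A = Some B"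
    using mat_inverse(1)[OF assms(1), of "undefined::unit"] by (cases "mat_inverse A") simp_all
  show "A * inv_mat A = 1\<^sub>m n" "inv_mat A * A = 1\<^sub>m n"
    using mat_inverse(2)[OF assms(1) B] unfolding inv_mat_def B option.case by blast+
qed

lemma inv_mat_singular:
  assumes "A \<in> carrier_mat n n" "Determinant.det A = 0"
  shows "inv_mat A = 0\<^sub>m n n"
proof (cases "mat_inverse A")
  case (Some B)
  then have "A * B = 1\<^sub>m n" "B \<in> carrier_mat n n" using mat_inverse(2)[OF assms(1) Some] by blast+
  then have "Determinant.det A * Determinant.det B = 1" using assms(1) by (metis det_mult det_one)
  then show ?thesis using assms(2) by simp
qed (use assms in \<open>simp add: inv_mat_def\<close>)

lemma inv_mat_unique:
  assumes "A \<in> carrier_mat n n" "B \<in> carrier_mat n n" "A * B = 1\<^sub>m n"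
  shows "inv_mat A = B" "Determinant.det A \<noteq> 0"
proof -
  have "Determinant.det A * Determinant.det B = 1" using det_mult[OF assms(1,2)] assms(3) by simp
  then show d: "Determinant.det A \<noteq> 0" by auto
  have "inv_mat A = inv_mat A * (A * B)"
    unfolding assms(3) using right_mult_one_mat[OF inv_mat_carrier[OF assms(1)]] by simp
  also have "\<dots> = (inv_mat A * A) * B"
    by (rule assoc_mult_mat[OF inv_mat_carrier[OF assms(1)] assms(1,2), symmetric])
  also have "\<dots> = B" using inv_mat_right[OF assms(1) d] assms(2) by simp
  finally show "inv_mat A = B" .
qed

text \<open>Cramer's rule extends to singular \<open>A\<close>, where \<open>1 / 0 = 0\<close> and
  \<open>inv_mat A\<close> is zero as well. The entries of the inverse are thus everywhere quotients
  of polynomials in the entries of the matrix, which makes them measurable.\<close>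

lemma inv_mat_adj:
  assumes A: "A \<in> carrier_mat n n"
  shows "inv_mat A = (1 / Determinant.det A) \<cdot>\<^sub>m adj_mat A"
proof (cases "Determinant.det A = 0")
  case True
  then show ?thesis using inv_mat_singular[OF A] adj_mat(1)[OF A] by (intro eq_matI) auto
next
  case False
  show ?thesis
  proof (rule inv_mat_unique(1)[OF A])
    show "(1 / Determinant.det A) \<cdot>\<^sub>m adj_mat A \<in> carrier_mat n n" using adj_mat(1)[OF A] by simp
    show "A * ((1 / Determinant.det A) \<cdot>\<^sub>m adj_mat A) = 1\<^sub>m n"
      using mult_smult_distrib[OF A adj_mat(1)[OF A], of "1 / Determinant.det A"] adj_mat(2)[OF A] False
      by (auto intro!: eq_matI)
  qed
qed

lemma det_pos_quad:
  assumes A: "(A :: real mat) \<in> carrier_mat n n"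
    and pos: "\<And>v. v \<in> carrier_vec n \<Longrightarrow> v \<noteq> 0\<^sub>v n \<Longrightarrow> v \<bullet> (A *\<^sub>v v) \<noteq> 0"
  shows "Determinant.det A \<noteq> 0"
proof
  assume "Determinant.det A = 0"
  then obtain v where "v \<in> carrier_vec n" "v \<noteq> 0\<^sub>v n" "A *\<^sub>v v = 0\<^sub>v n"
    using det_0_iff_vec_prod_zero_field[OF A] by auto
  with pos[of v] show False by simp
qed

lemma inv_mat_sym:
  assumes A: "A \<in> carrier_mat n n" and s: "transpose_mat A = A" and d: "Determinant.det A \<noteq> 0"
  shows "transpose_mat (inv_mat A) = inv_mat A"
proof (rule inv_mat_unique(1)[OF A, symmetric])
  show "transpose_mat (inv_mat A) \<in> carrier_mat n n" using A by simp
  have "A * transpose_mat (inv_mat A) = transpose_mat (inv_mat A * A)"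
    using transpose_mult[OF inv_mat_carrier[OF A] A] s by simp
  then show "A * transpose_mat (inv_mat A) = 1\<^sub>m n" using inv_mat_right(2)[OF A d] by simp
qed

subsection \<open>Regularised inverses of Gram matrices\<close>

text \<open>The case \<open>\<epsilon> = 0\<close> is the genuine inverse of \<open>W\<^sup>T W\<close>. All bounds come from the representation
  of \<open>r\<close> as a Gram matrix, lemma \<open>quad\<close>.\<close>

definition rV :: "nat \<Rightarrow> (nat \<Rightarrow> nat \<Rightarrow> real) \<Rightarrow> (nat \<Rightarrow> nat \<Rightarrow> real) \<Rightarrow> nat \<Rightarrow> nat \<Rightarrow> real" where
  "rV p W r a l = (\<Sum>j<p. W a j * r j l)"

definition rg :: "nat \<Rightarrow> (nat \<Rightarrow> nat \<Rightarrow> real) \<Rightarrow> (nat \<Rightarrow> real) \<Rightarrow> nat \<Rightarrow> real" where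
  "rg p r y j = (\<Sum>m<p. r j m * y m)"

definition rh :: "nat \<Rightarrow> (nat \<Rightarrow> nat \<Rightarrow> real) \<Rightarrow> (nat \<Rightarrow> nat \<Rightarrow> real) \<Rightarrow> (nat \<Rightarrow> real) \<Rightarrow> nat \<Rightarrow> real" where
  "rh p W r y a = (\<Sum>j<p. rV p W r a j * y j)"

definition ru :: "nat \<Rightarrow> (nat \<Rightarrow> nat \<Rightarrow> real) \<Rightarrow> real" where "ru p r = (\<Sum>j<p. r j j)"

text \<open>\<open>r\<close> is the inverse of W^T W + \<open>\<epsilon>\<close>, given by equations
  between entries; \<open>V\<close>, \<open>g\<close>, \<open>h\<close>, \<open>u\<close> are then W
  r, r y, W r y and tr r. Functions of indices let finite sums be rearranged free of carrier
  conditions.\<close>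

locale reginv =
  fixes n p :: nat and W r :: "nat \<Rightarrow> nat \<Rightarrow> real" and \<epsilon> :: real
  assumes eps: "0 \<le> \<epsilon>"
    and inv: "\<And>j m. j < p \<Longrightarrow> m < p \<Longrightarrow>
      (\<Sum>l<p. (\<Sum>a<n. W a j * W a l) * r l m) + \<epsilon> * r j m = (if j = m then 1 else 0)"
    and sym: "\<And>j m. j < p \<Longrightarrow> m < p \<Longrightarrow> r j m = r m j"
begin

abbreviation "V \<equiv> rV p W r"
abbreviation "g \<equiv> rg p r"
abbreviation "h \<equiv> rh p W r"
abbreviation "u \<equiv> ru p r"
lemmas V_def = rV_def and g_def = rg_def and h_def = rh_def and u_def = ru_def

text \<open>V^T W is r W^T W, which the defining equation turns into 1 - \<open>\<epsilon>\<close>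
  r. One more multiplication by r gives \<open>VV\<close>, hence r = V^T V +
  \<open>\<epsilon>\<close> r^2.\<close>

lemma VW:
  assumes "j < p" "l < p"
  shows "(\<Sum>a<n. V a j * W a l) = (if j = l then 1 else 0) - \<epsilon> * r j l"
proof -
  have "(\<Sum>a<n. V a j * W a l) = (\<Sum>a<n. \<Sum>i<p. W a l * W a i * r i j)"
    unfolding V_def sum_distrib_right by (intro sum.cong refl) simp
  also have "\<dots> = (\<Sum>i<p. (\<Sum>a<n. W a l * W a i) * r i j)"
    unfolding sum_distrib_right by (rule sum.swap)
  also have "\<dots> = (if j = l then 1 else 0) - \<epsilon> * r j l"
    using inv[OF assms(2,1)] sym[OF assms] by (auto simp: algebra_simps)
  finally show ?thesis .
qed

lemma VV:
  assumes "j < p" "l < p"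
  shows "(\<Sum>a<n. V a j * V a l) = r j l - \<epsilon> * (\<Sum>m<p. r j m * r m l)"
proof -
  have "(\<Sum>a<n. V a j * V a l) = (\<Sum>a<n. \<Sum>i<p. V a j * W a i * r i l)"
    unfolding V_def[of _ _ _ _ l] sum_distrib_left by (intro sum.cong refl) simp
  also have "\<dots> = (\<Sum>i<p. (\<Sum>a<n. V a j * W a i) * r i l)"
    unfolding sum_distrib_right by (rule sum.swap)
  also have "\<dots> = (\<Sum>i<p. ((if j = i then 1 else 0) - \<epsilon> * r j i) * r i l)"
    by (intro sum.cong refl) (simp add: VW assms)
  also have "\<dots> = (\<Sum>i<p. (if j = i then r i l else 0)) - \<epsilon> * (\<Sum>m<p. r j m * r m l)"
    unfolding sum_distrib_left sum_subtractf[symmetric] by (intro sum.cong refl) (auto simp: algebra_simps)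
  finally show ?thesis using assms by simp
qed

lemma quad:
  "(\<Sum>j<p. x j * g y j) = (\<Sum>a<n. h x a * h y a) + \<epsilon> * (\<Sum>j<p. g x j * g y j)"
proof -
  have "(\<Sum>a<n. h x a * h y a) = (\<Sum>a<n. \<Sum>j<p. \<Sum>l<p. x j * y l * (V a j * V a l))"
    unfolding h_def sum_product by (intro sum.cong refl) simp
  also have "\<dots> = (\<Sum>j<p. \<Sum>a<n. \<Sum>l<p. x j * y l * (V a j * V a l))" by (rule sum.swap)
  also have "\<dots> = (\<Sum>j<p. \<Sum>l<p. \<Sum>a<n. x j * y l * (V a j * V a l))"
    by (intro sum.cong refl sum.swap)
  also have "\<dots> = (\<Sum>j<p. \<Sum>l<p. x j * y l * (r j l - \<epsilon> * (\<Sum>m<p. r j m * r m l)))"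
    unfolding sum_distrib_left[symmetric] by (intro sum.cong refl) (simp add: VV)
  also have "\<dots> = (\<Sum>j<p. \<Sum>l<p. x j * (r j l * y l)) - (\<Sum>j<p. \<Sum>l<p. \<epsilon> * (\<Sum>m<p. (x j * r j m) * (r m l * y l)))"
    unfolding sum_subtractf[symmetric] by (intro sum.cong refl) (simp add: algebra_simps sum_distrib_left)
  also have "(\<Sum>j<p. \<Sum>l<p. x j * (r j l * y l)) = (\<Sum>j<p. x j * g y j)"
    unfolding g_def sum_distrib_left ..
  also have "(\<Sum>j<p. \<Sum>l<p. \<epsilon> * (\<Sum>m<p. (x j * r j m) * (r m l * y l))) = \<epsilon> * (\<Sum>j<p. g x j * g y j)"
  proof -
    have "(\<Sum>j<p. \<Sum>l<p. \<Sum>m<p. (x j * r j m) * (r m l * y l))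
        = (\<Sum>j<p. \<Sum>m<p. \<Sum>l<p. (x j * r j m) * (r m l * y l))"
      by (intro sum.cong refl sum.swap)
    also have "\<dots> = (\<Sum>m<p. \<Sum>j<p. \<Sum>l<p. (x j * r j m) * (r m l * y l))" by (rule sum.swap)
    also have "\<dots> = (\<Sum>m<p. (\<Sum>j<p. x j * r j m) * (\<Sum>l<p. r m l * y l))"
      by (simp add: sum_product)
    also have "\<dots> = (\<Sum>j<p. g x j * g y j)"
    proof (rule sum.cong[OF refl])
      fix m assume m: "m \<in> {..<p}"
      then have "(\<Sum>j<p. x j * r j m) = g x m"
        unfolding g_def by (intro sum.cong refl) (simp add: sym)
      then show "(\<Sum>j<p. x j * r j m) * (\<Sum>l<p. r m l * y l) = g x m * g y m" by (simp add: g_def)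
    qed
    finally have E: "(\<Sum>j<p. \<Sum>l<p. \<Sum>m<p. (x j * r j m) * (r m l * y l)) = (\<Sum>j<p. g x j * g y j)" .
    have "(\<Sum>j<p. \<Sum>l<p. \<epsilon> * f j l) = \<epsilon> * (\<Sum>j<p. \<Sum>l<p. f j l)" for f
      by (simp add: sum_distrib_left)
    then show ?thesis by (simp only: E)
  qed
  finally show ?thesis by simp
qed

lemma g_swap: "(\<Sum>j<p. x j * g y j) = (\<Sum>j<p. y j * g x j)"
  using quad[of x y] quad[of y x] by (simp add: mult.commute)

lemma quad_self: "(\<Sum>j<p. y j * g y j) = (\<Sum>a<n. (h y a)\<^sup>2) + \<epsilon> * (\<Sum>j<p. (g y j)\<^sup>2)"
  using quad[of y y] by (simp add: power2_eq_square)

lemma quad_nonneg: "0 \<le> (\<Sum>j<p. y j * g y j)"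
  unfolding quad_self using eps by (simp add: sum_nonneg)

lemma g_bound: "\<epsilon> * (\<Sum>j<p. (g y j)\<^sup>2) \<le> (\<Sum>j<p. y j * g y j)"
  and h_bound: "(\<Sum>a<n. (h y a)\<^sup>2) \<le> (\<Sum>j<p. y j * g y j)"
  unfolding quad_self using eps by (simp_all add: sum_nonneg)

lemma g_scale: "g (\<lambda>j. c * y j) m = c * g y m"
  and g_add: "g (\<lambda>j. x j + y j) m = g x m + g y m"
  unfolding g_def by (simp_all add: sum_distrib_left sum.distrib algebra_simps)

text \<open>The form is nonnegative at x + d y; expand with d = c and d = -c. The free weight
  \<open>c\<close> makes this a form of Cauchy-Schwarz that is linear in the two quadratic
  terms.\<close>

lemma quad_amgm:
  "2 * \<bar>c * (\<Sum>j<p. x j * g y j)\<bar> \<le> (\<Sum>j<p. x j * g x j) + c\<^sup>2 * (\<Sum>j<p. y j * g y j)"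
proof -
  have *: "0 \<le> (\<Sum>j<p. x j * g x j) + 2 * d * (\<Sum>j<p. x j * g y j) + d\<^sup>2 * (\<Sum>j<p. y j * g y j)" for d
  proof -
    have "(\<Sum>j<p. (x j + d * y j) * g (\<lambda>j. x j + d * y j) j) =
      (\<Sum>j<p. x j * g x j) + d * (\<Sum>j<p. x j * g y j) + d * (\<Sum>j<p. y j * g x j) + d\<^sup>2 * (\<Sum>j<p. y j * g y j)"
      unfolding g_add g_scale by (simp add: sum.distrib sum_distrib_left algebra_simps power2_eq_square)
    then show ?thesis using quad_nonneg[of "\<lambda>j. x j + d * y j"] g_swap[of x y] by simp
  qed
  show ?thesis using *[of c] *[of "- c"] by (auto simp: abs_if)
qed

lemma r_eq_g: "m < p \<Longrightarrow> g (\<lambda>j. if j = m then 1 else 0) j = r j m"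
  unfolding g_def by (simp add: if_distrib cong: if_cong)

lemma quad_unit: "m < p \<Longrightarrow> (\<Sum>j<p. (if j = m then 1 else 0) * f j) = f m" for f :: "nat \<Rightarrow> real"
  by (simp add: if_distrib[where f="\<lambda>t. t * _"] cong: if_cong)

lemma r_diag_nonneg: "j < p \<Longrightarrow> 0 \<le> r j j"
  using quad_nonneg[of "\<lambda>i. if i = j then 1 else 0"] by (simp add: quad_unit r_eq_g)

lemma u_nonneg: "0 \<le> u"
  unfolding u_def by (auto intro!: sum_nonneg r_diag_nonneg)

lemma r_diag_le_u: "j < p \<Longrightarrow> r j j \<le> u"
  unfolding u_def by (rule member_le_sum) (auto intro: r_diag_nonneg)

lemma r_le_u: assumes "j < p" "m < p" shows "\<bar>r j m\<bar> \<le> u"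
proof -
  have "2 * \<bar>r j m\<bar> \<le> r j j + r m m"
    using quad_amgm[of 1 "\<lambda>i. if i = j then 1 else 0" "\<lambda>i. if i = m then 1 else 0"] assms
    by (simp add: quad_unit r_eq_g)
  then show ?thesis using r_diag_le_u[OF assms(1)] r_diag_le_u[OF assms(2)] by simp
qed

text \<open>The j-th column of r satisfies \<open>\<epsilon>\<close> |r e_j|^2 <= r_jj by
  \<open>g_bound\<close>, and r_jj^2 is one term of that norm.\<close>

lemma r_diag_bound: assumes "j < p" shows "\<epsilon> * r j j \<le> 1"
proof -
  have "\<epsilon> * (r j j)\<^sup>2 \<le> \<epsilon> * (\<Sum>m<p. (r m j)\<^sup>2)"
    using assms eps by (intro mult_left_mono member_le_sum[of j "{..<p}" "\<lambda>m. (r m j)\<^sup>2"]) auto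
  also have "\<dots> \<le> r j j"
    using g_bound[of "\<lambda>i. if i = j then 1 else 0"] assms by (simp add: quad_unit r_eq_g)
  finally have "r j j * (\<epsilon> * r j j) \<le> r j j * 1" by (simp add: power2_eq_square algebra_simps)
  then show ?thesis using r_diag_nonneg[OF assms] by (cases "r j j = 0") auto
qed

lemma eps_u_le: "\<epsilon> * u \<le> real p"
  unfolding u_def sum_distrib_left using sum_bounded_above[of "{..<p}" "\<lambda>j. \<epsilon> * r j j" 1] r_diag_bound by simp

lemma y_eq_g:
  assumes "m < p"
  shows "y m = (\<Sum>a<n. W a m * (\<Sum>l<p. W a l * g y l)) + \<epsilon> * g y m"
proof -
  have "(\<Sum>a<n. W a m * (\<Sum>l<p. W a l * g y l)) = (\<Sum>a<n. \<Sum>l<p. \<Sum>i<p. W a m * W a l * r l i * y i)"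
    unfolding g_def sum_distrib_left by (intro sum.cong refl) (simp add: algebra_simps)
  also have "\<dots> = (\<Sum>l<p. \<Sum>a<n. \<Sum>i<p. W a m * W a l * r l i * y i)" by (rule sum.swap)
  also have "\<dots> = (\<Sum>l<p. \<Sum>i<p. \<Sum>a<n. W a m * W a l * r l i * y i)" by (intro sum.cong refl sum.swap)
  also have "\<dots> = (\<Sum>i<p. \<Sum>l<p. \<Sum>a<n. W a m * W a l * r l i * y i)" by (rule sum.swap)
  also have "\<dots> = (\<Sum>i<p. (\<Sum>l<p. (\<Sum>a<n. W a m * W a l) * r l i) * y i)"
    by (simp add: sum_distrib_right)
  also have "\<dots> = (\<Sum>i<p. ((if m = i then 1 else 0) - \<epsilon> * r m i) * y i)"
  proof (rule sum.cong[OF refl])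
    fix i assume "i \<in> {..<p}"
    then have "(\<Sum>l<p. (\<Sum>a<n. W a m * W a l) * r l i) = (if m = i then 1 else 0) - \<epsilon> * r m i"
      using inv[OF assms, of i] by simp
    then show "(\<Sum>l<p. (\<Sum>a<n. W a m * W a l) * r l i) * y i = ((if m = i then 1 else 0) - \<epsilon> * r m i) * y i"
      by simp
  qed
  also have "\<dots> = (\<Sum>i<p. (if m = i then y i else 0)) - \<epsilon> * g y m"
    unfolding g_def sum_distrib_left sum_subtractf[symmetric] by (intro sum.cong refl) (auto simp: algebra_simps)
  finally show ?thesis using assms by simp
qed

text \<open>Replacing y by (W^T W + \<open>\<epsilon>\<close>) g y turns the Euclidean product into
  the form of W^T W + \<open>\<epsilon>\<close>, in which \<open>norm_le_zeta\<close> is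
  proved.\<close>

lemma dot_eq_g:
  "(\<Sum>m<p. x m * y m) = (\<Sum>a<n. (\<Sum>m<p. W a m * x m) * (\<Sum>l<p. W a l * g y l)) + \<epsilon> * (\<Sum>m<p. x m * g y m)"
proof -
  have "(\<Sum>m<p. x m * y m) = (\<Sum>m<p. x m * ((\<Sum>a<n. W a m * (\<Sum>l<p. W a l * g y l)) + \<epsilon> * g y m))"
    using y_eq_g[of _ y] by (intro sum.cong refl) auto
  also have "\<dots> = (\<Sum>m<p. \<Sum>a<n. (W a m * x m) * (\<Sum>l<p. W a l * g y l)) + \<epsilon> * (\<Sum>m<p. x m * g y m)"
    by (simp add: sum_distrib_left sum.distrib algebra_simps)
  also have "(\<Sum>m<p. \<Sum>a<n. (W a m * x m) * (\<Sum>l<p. W a l * g y l)) = (\<Sum>a<n. (\<Sum>m<p. W a m * x m) * (\<Sum>l<p. W a l * g y l))"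
    by (subst sum.swap) (simp add: sum_distrib_right)
  finally show ?thesis .
qed

lemma zeta_g: "(\<Sum>m<p. y m * g y m) = (\<Sum>a<n. (\<Sum>l<p. W a l * g y l)\<^sup>2) + \<epsilon> * (\<Sum>m<p. (g y m)\<^sup>2)"
  using dot_eq_g[of "g y" y] by (simp add: power2_eq_square mult.commute)

text \<open>Cauchy-Schwarz for the form of \<open>W\<^sup>T W + \<epsilon>\<close>, applied to \<open>y\<close> and \<open>g y\<close>.\<close>
lemma norm_le_zeta:
  "(\<Sum>m<p. (y m)\<^sup>2) \<le> ((\<Sum>a<n. \<Sum>j<p. (W a j)\<^sup>2) + \<epsilon>) * (\<Sum>m<p. y m * g y m)"
proof -
  define N where "N = (\<Sum>m<p. (y m)\<^sup>2)"
  define T where "T = (\<Sum>a<n. \<Sum>j<p. (W a j)\<^sup>2)"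
  define z where "z = (\<Sum>m<p. y m * g y m)"
  define Wy where "Wy a = (\<Sum>m<p. W a m * y m)" for a
  define Wg where "Wg a = (\<Sum>l<p. W a l * g y l)" for a
  have N0: "0 \<le> N" unfolding N_def by (auto intro: sum_nonneg)
  have T0: "0 \<le> T" unfolding T_def by (auto intro!: sum_nonneg)
  have z0: "0 \<le> z" unfolding z_def by (rule quad_nonneg)
  have yg: "N = (\<Sum>a<n. Wy a * Wg a) + \<epsilon> * z"
    using dot_eq_g[of y y] by (simp add: N_def z_def Wy_def Wg_def power2_eq_square)
  have zz: "z = (\<Sum>a<n. (Wg a)\<^sup>2) + \<epsilon> * (\<Sum>m<p. (g y m)\<^sup>2)"
    using zeta_g[of y] by (simp add: z_def Wg_def)
  have Wy: "(\<Sum>a<n. (Wy a)\<^sup>2) \<le> T * N"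
  proof -
    have "(Wy a)\<^sup>2 \<le> (\<Sum>j<p. (W a j)\<^sup>2) * N" for a
      unfolding Wy_def N_def by (rule Cauchy_Schwarz_ineq_sum)
    then show ?thesis unfolding T_def sum_distrib_right by (intro sum_mono)
  qed
  have cs: "(d * (\<Sum>a<n. Wy a * Wg a)) * 2 \<le> (\<Sum>a<n. (Wg a)\<^sup>2) + d\<^sup>2 * (\<Sum>a<n. (Wy a)\<^sup>2)" for d
  proof -
    have "0 \<le> (\<Sum>a<n. (Wg a - d * Wy a)\<^sup>2)" by (intro sum_nonneg) auto
    also have "\<dots> = (\<Sum>a<n. (Wg a)\<^sup>2) - (d * (\<Sum>a<n. Wy a * Wg a)) * 2 + d\<^sup>2 * (\<Sum>a<n. (Wy a)\<^sup>2)"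
      by (simp add: power2_diff sum.distrib sum_subtractf sum_distrib_left sum_distrib_right power_mult_distrib algebra_simps)
    finally show ?thesis by simp
  qed
  have cs2: "(d * z) * 2 \<le> (\<Sum>m<p. (g y m)\<^sup>2) + d\<^sup>2 * N" for d
  proof -
    have "0 \<le> (\<Sum>a<p. (g y a - d * y a)\<^sup>2)" by (intro sum_nonneg) auto
    also have "\<dots> = (\<Sum>a<p. (g y a)\<^sup>2) - (d * z) * 2 + d\<^sup>2 * N"
      by (simp add: N_def z_def power2_diff sum.distrib sum_subtractf sum_distrib_left sum_distrib_right power_mult_distrib algebra_simps)
    finally show ?thesis by simp
  qed
  \<comment> \<open>\<open>d\<close> is a common weight in both squares; its best value 1 / (T +
    \<open>\<epsilon>\<close>) is inserted at the end.\<close>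
  have main: "2 * d * N \<le> z + d\<^sup>2 * ((T + \<epsilon>) * N)" for d
  proof -
    have "2 * d * N = (d * (\<Sum>a<n. Wy a * Wg a)) * 2 + \<epsilon> * ((d * z) * 2)"
      unfolding yg by (simp add: algebra_simps)
    also have "\<dots> \<le> ((\<Sum>a<n. (Wg a)\<^sup>2) + d\<^sup>2 * (T * N)) + \<epsilon> * ((\<Sum>m<p. (g y m)\<^sup>2) + d\<^sup>2 * N)"
      using cs[of d] mult_left_mono[OF Wy, of "d\<^sup>2"] mult_left_mono[OF cs2[of d] eps] by simp
    also have "\<dots> = z + d\<^sup>2 * ((T + \<epsilon>) * N)" unfolding zz by (simp add: algebra_simps)
    finally show ?thesis .
  qed
  show ?thesis
  proof (cases "T + \<epsilon> = 0 \<or> N = 0")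
    case True
    then show ?thesis
    proof
      \<comment> \<open>The inequality now reads 2 d N <= z for every \<open>d\<close>, so a large
        \<open>d\<close> forces N = 0.\<close>
      assume 0: "T + \<epsilon> = 0"
      have "N = 0"
      proof (rule ccontr)
        assume "N \<noteq> 0"
        then have "2 * ((z + 1) / (2 * N)) * N = z + 1" by simp
        with main[of "(z + 1) / (2 * N)"] show False unfolding 0 by simp
      qed
      then show ?thesis using 0 N0 by (simp add: N_def T_def)
    qed (use T0 eps z0 in \<open>simp add: N_def[symmetric] T_def[symmetric] z_def[symmetric]\<close>)
  next
    case False
    then have pos: "T + \<epsilon> > 0" using T0 eps by linarith
    have "2 * (1 / (T + \<epsilon>)) * N \<le> z + (1 / (T + \<epsilon>))\<^sup>2 * ((T + \<epsilon>) * N)" by (rule main)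
    then have "2 * (1 / (T + \<epsilon>)) * N \<le> z + (1 / (T + \<epsilon>)) * N" using pos by (simp add: power2_eq_square)
    then have "N / (T + \<epsilon>) \<le> z" by simp
    then have "N \<le> (T + \<epsilon>) * z" using pos by (simp add: pos_divide_le_eq mult.commute)
    then show ?thesis by (simp add: N_def T_def z_def)
  qed
qed

text \<open>This trace, \<open>trace_VV\<close>, \<open>hW\<close> and \<open>hV\<close> are the
  contractions to which the divergences in Haff's identity reduce. Each consists of a leading term
  and a correction with the factor \<open>\<epsilon>\<close>.\<close>

lemma trace_rS: "(\<Sum>a<n. \<Sum>l<p. V a l * W a l) = real p - \<epsilon> * u"
proof -
  have "(\<Sum>a<n. \<Sum>l<p. V a l * W a l) = (\<Sum>l<p. \<Sum>a<n. V a l * W a l)" by (rule sum.swap)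
  then show ?thesis by (simp add: VW u_def sum_subtractf sum_distrib_left)
qed

lemma trace_VV: "(\<Sum>a<n. \<Sum>l<p. V a l * V a l) = u - \<epsilon> * (\<Sum>j<p. \<Sum>m<p. (r j m)\<^sup>2)"
proof -
  have "(\<Sum>a<n. \<Sum>l<p. V a l * V a l) = (\<Sum>l<p. \<Sum>a<n. V a l * V a l)" by (rule sum.swap)
  also have "\<dots> = (\<Sum>l<p. r l l - \<epsilon> * (\<Sum>m<p. (r l m)\<^sup>2))"
    by (intro sum.cong refl) (auto simp: VV power2_eq_square sym intro!: sum.cong)
  finally show ?thesis by (simp add: u_def sum_subtractf sum_distrib_left)
qed

lemma hW: "l < p \<Longrightarrow> (\<Sum>a<n. h y a * W a l) = y l - \<epsilon> * g y l"
proof -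
  assume l: "l < p"
  have "(\<Sum>a<n. h y a * W a l) = (\<Sum>a<n. \<Sum>j<p. y j * (V a j * W a l))"
    unfolding h_def sum_distrib_right by (intro sum.cong refl) simp
  also have "\<dots> = (\<Sum>j<p. y j * (\<Sum>a<n. V a j * W a l))"
    by (subst sum.swap) (simp add: sum_distrib_left)
  also have "\<dots> = (\<Sum>j<p. (if l = j then y j else 0) - \<epsilon> * (r l j * y j))"
    by (intro sum.cong refl, subst VW) (use l in \<open>auto simp: sym algebra_simps\<close>)
  also have "\<dots> = (\<Sum>j<p. (if l = j then y j else 0)) - \<epsilon> * g y l"
    unfolding g_def by (simp add: sum_subtractf sum_distrib_left)
  finally show ?thesis using l by simp
qed

lemma hV: "l < p \<Longrightarrow> (\<Sum>a<n. h y a * V a l) = g y l - \<epsilon> * (\<Sum>m<p. r l m * g y m)"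
proof -
  assume l: "l < p"
  have "(\<Sum>a<n. h y a * V a l) = (\<Sum>j<p. (\<Sum>a<n. h y a * W a j) * r j l)"
    unfolding V_def[of _ _ _ _ l] sum_distrib_left sum_distrib_right by (subst sum.swap) (simp add: algebra_simps)
  also have "\<dots> = (\<Sum>j<p. (y j - \<epsilon> * g y j) * r j l)" by (intro sum.cong refl) (simp add: hW)
  also have "\<dots> = g y l - \<epsilon> * (\<Sum>m<p. r l m * g y m)"
    unfolding g_def[of _ _ y l] sum_distrib_left sum_subtractf[symmetric] using l
    by (intro sum.cong refl) (simp add: algebra_simps sym)
  finally show ?thesis .
qed

end

text \<open>Expand the square of W r0 v - W r v. The first vector has squared length v^T r0 v, the
  scalar product is v^T r v, and the second vector has squared length at most v^T r v.\<close>

lemma reginv_mono: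
  assumes R: "reginv n p W r \<epsilon>" and R0: "reginv n p W r0 0"
  shows "(\<Sum>j<p. v j * rg p r v j) \<le> (\<Sum>j<p. v j * rg p r0 v j)"
proof -
  interpret R: reginv n p W r \<epsilon> by fact
  interpret R0: reginv n p W r0 0 by fact
  define x where "x = R.g v"
  define q where "q = (\<Sum>j<p. v j * x j)"
  have q: "q = (\<Sum>a<n. (\<Sum>l<p. W a l * R0.g v l) * (\<Sum>m<p. W a m * x m))"
    unfolding q_def using R0.dot_eq_g[of x v] by (simp add: mult.commute)
  have A: "(\<Sum>m<p. v m * R0.g v m) = (\<Sum>a<n. (\<Sum>l<p. W a l * R0.g v l)\<^sup>2)"
    using R0.zeta_g[of v] by simp
  have B: "(\<Sum>a<n. (\<Sum>m<p. W a m * x m)\<^sup>2) \<le> q"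
    unfolding q_def x_def R.zeta_g using R.eps by (auto intro!: mult_nonneg_nonneg sum_nonneg)
  have sq: "(\<Sum>a<n. (f a - k a)\<^sup>2) = (\<Sum>a<n. (f a)\<^sup>2) - 2 * (\<Sum>a<n. f a * k a) + (\<Sum>a<n. (k a)\<^sup>2)"
    for f k :: "nat \<Rightarrow> real"
    by (simp add: power2_diff sum.distrib sum_subtractf sum_distrib_left mult.assoc)
  have "0 \<le> (\<Sum>a<n. ((\<Sum>l<p. W a l * R0.g v l) - (\<Sum>m<p. W a m * x m))\<^sup>2)" by (intro sum_nonneg) auto
  also have "\<dots> = (\<Sum>m<p. v m * R0.g v m) - 2 * q + (\<Sum>a<n. (\<Sum>m<p. W a m * x m)\<^sup>2)"
    unfolding A q by (rule sq)
  finally show ?thesis using B by (simp add: q_def x_def)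
qed

section \<open>Partial derivatives and Stein's identity for vector fields\<close>

text \<open>The derivative is a function on the whole space, taken at every point, so the derivative
  of a composite field is again an object to which the growth and measurability rules apply.\<close>

definition pd :: "'i \<Rightarrow> (('i \<Rightarrow> real) \<Rightarrow> real) \<Rightarrow> (('i \<Rightarrow> real) \<Rightarrow> real) \<Rightarrow> bool" where
  "pd i F F' \<longleftrightarrow> (\<forall>w. ((\<lambda>t. F (w(i := t))) has_real_derivative F' w) (at (w i)))"

lemma pd_cong: "pd i F F' \<Longrightarrow> (\<And>w. F' w = F'' w) \<Longrightarrow> pd i F F''"
  unfolding pd_def by simp

lemma pd_const: "pd i (\<lambda>w. c) (\<lambda>w. 0)"
  unfolding pd_def by simp

lemma pd_add: "pd i F F' \<Longrightarrow> pd i G G' \<Longrightarrow> pd i (\<lambda>w. F w + G w) (\<lambda>w. F' w + G' w)"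
  unfolding pd_def by (auto intro!: derivative_intros)

lemma pd_diff: "pd i F F' \<Longrightarrow> pd i G G' \<Longrightarrow> pd i (\<lambda>w. F w - G w) (\<lambda>w. F' w - G' w)"
  unfolding pd_def by (auto intro!: derivative_intros)

lemma pd_mult: "pd i F F' \<Longrightarrow> pd i G G' \<Longrightarrow> pd i (\<lambda>w. F w * G w) (\<lambda>w. F' w * G w + F w * G' w)"
  unfolding pd_def by (auto intro!: derivative_eq_intros)

lemma pd_cmult: "pd i F F' \<Longrightarrow> pd i (\<lambda>w. c * F w) (\<lambda>w. c * F' w)"
  using pd_mult[OF pd_const, of i F F' c] by simp

lemma pd_sum: "(\<And>j. j \<in> A \<Longrightarrow> pd i (F j) (F' j)) \<Longrightarrow> pd i (\<lambda>w. \<Sum>j\<in>A. F j w) (\<lambda>w. \<Sum>j\<in>A. F' j w)"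
  unfolding pd_def by (auto intro!: derivative_intros)

lemma pd_inverse:
  assumes "pd i F F'" "\<And>w. F w \<noteq> 0"
  shows "pd i (\<lambda>w. 1 / F w) (\<lambda>w. - (1 / F w)\<^sup>2 * F' w)"
  unfolding pd_def
proof
  fix w
  have d: "((\<lambda>t. F (w(i := t))) has_real_derivative F' w) (at (w i))" using assms unfolding pd_def by blast
  have "F (w(i := w i)) \<noteq> 0" using assms(2) by blast
  from DERIV_inverse_fun[OF d this]
  show "((\<lambda>t. 1 / F (w(i := t))) has_real_derivative - (1 / F w)\<^sup>2 * F' w) (at (w i))"
    by (simp add: fun_upd_def inverse_eq_divide power2_eq_square)
qed

lemma pd_coord: "pd i (\<lambda>w. w j) (\<lambda>w. if i = j then 1 else 0)"
  unfolding pd_def by (auto simp: fun_upd_def intro!: derivative_eq_intros)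

lemma stein_field:
  fixes F F' :: "'i \<Rightarrow> ('i \<Rightarrow> real) \<Rightarrow> real"
  assumes I: "finite I"
    and pd: "\<And>i. i \<in> I \<Longrightarrow> pd i (F i) (F' i)"
    and m: "\<And>i. i \<in> I \<Longrightarrow> F i \<in> borel_measurable (gaussM I)"
      "\<And>i. i \<in> I \<Longrightarrow> F' i \<in> borel_measurable (gaussM I)"
    and b: "\<And>i. i \<in> I \<Longrightarrow> polybd I (F i)" "\<And>i. i \<in> I \<Longrightarrow> polybd I (F' i)"
  shows "integral\<^sup>L (gaussM I) (\<lambda>w. \<Sum>i\<in>I. F' i w) = integral\<^sup>L (gaussM I) (\<lambda>w. \<Sum>i\<in>I. w i * F i w)"
proof -
  have i1: "integrable (gaussM I) (F' i)" if "i \<in> I" for i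
    using that I m b by (intro polybd_integrable) auto
  have i2: "integrable (gaussM I) (\<lambda>w. w i * F i w)" if "i \<in> I" for i
  proof (intro polybd_integrable polybd_mult polybd_coord borel_measurable_times)
    show "(\<lambda>w. w i) \<in> borel_measurable (gaussM I)" using that by measurable
  qed (use that I m b in auto)
  have "integral\<^sup>L (gaussM I) (F' i) = integral\<^sup>L (gaussM I) (\<lambda>w. w i * F i w)" if i: "i \<in> I" for i
  proof (rule stein[OF I i])
    show "((\<lambda>t. F i (w(i := t))) has_real_derivative F' i (w(i := x))) (at x)" for w x
      using pd[OF i] unfolding pd_def by (drule_tac spec[of _ "w(i := x)"]) simp
    show "F i \<in> borel_measurable (\<Pi>\<^sub>M i\<in>I. borel)" "F' i \<in> borel_measurable (\<Pi>\<^sub>M i\<in>I. borel)"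
      using m[OF i] by (simp_all cong: measurable_cong_sets add: sets_gaussM)
  qed (use b i in auto)
  then show ?thesis using i1 i2 by (simp add: Bochner_Integration.integral_sum)
qed

section \<open>Existence, differentiability and measurability of the regularised inverse\<close>

lemma inv_gram_reginv:
  fixes W :: "nat \<Rightarrow> nat \<Rightarrow> real" and n p \<epsilon>
  defines "S \<equiv> Matrix.mat p p (\<lambda>(j, l). (\<Sum>a<n. W a j * W a l) + (if j = l then \<epsilon> else 0))"
  assumes eps: "0 \<le> \<epsilon>" and d: "Determinant.det S \<noteq> 0"
    and r: "\<And>j l. j < p \<Longrightarrow> l < p \<Longrightarrow> r j l = inv_mat S $$ (j, l)"
  shows "reginv n p W r \<epsilon>"
proof
  have S: "S \<in> carrier_mat p p" unfolding S_def by simp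
  note iS = inv_mat_carrier[OF S]
  show "0 \<le> \<epsilon>" by fact
  fix j m assume jm: "j < p" "m < p"
  have "transpose_mat S = S" unfolding S_def by (rule eq_matI) (auto simp: mult.commute)
  from inv_mat_sym[OF S this d] have "transpose_mat (inv_mat S) $$ (j, m) = inv_mat S $$ (j, m)" by simp
  then show "r j m = r m j" using jm iS r by simp
  have "(S * inv_mat S) $$ (j, m) = (if j = m then 1 else 0)"
    using inv_mat_right(1)[OF S d] jm by simp
  moreover have "(S * inv_mat S) $$ (j, m) = (\<Sum>l<p. S $$ (j, l) * inv_mat S $$ (l, m))"
    using jm carrier_matD[OF iS] carrier_matD[OF S] by (simp add: scalar_prod_def atLeast0LessThan)
  moreover have "\<dots> = (\<Sum>l<p. ((\<Sum>a<n. W a j * W a l) + (if j = l then \<epsilon> else 0)) * r l m)"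
    using jm r by (intro sum.cong refl) (simp add: S_def)
  moreover have "\<dots> = (\<Sum>l<p. (\<Sum>a<n. W a j * W a l) * r l m) + (\<Sum>l<p. (if j = l then \<epsilon> * r l m else 0))"
    by (simp add: distrib_right sum.distrib if_distrib[where f="\<lambda>t. t * _"] cong: if_cong)
  ultimately show "(\<Sum>l<p. (\<Sum>a<n. W a j * W a l) * r l m) + \<epsilon> * r j m = (if j = m then 1 else 0)"
    using jm by simp
qed

text \<open>The quadratic form of \<open>S\<close> is |W v|^2 + \<open>\<epsilon>\<close>
  |v|^2.\<close>

lemma gram_det_nonzero:
  fixes W :: "nat \<Rightarrow> nat \<Rightarrow> real" and n p \<epsilon>
  defines "S \<equiv> Matrix.mat p p (\<lambda>(j, l). (\<Sum>a<n. W a j * W a l) + (if j = l then \<epsilon> else 0))"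
  assumes eps: "0 < \<epsilon>"
  shows "Determinant.det S \<noteq> 0"
proof (rule det_pos_quad)
  show S: "S \<in> carrier_mat p p" unfolding S_def by simp
  fix v :: "real Matrix.vec" assume v: "v \<in> carrier_vec p" "v \<noteq> 0\<^sub>v p"
  have "v \<bullet> (S *\<^sub>v v) = (\<Sum>j<p. \<Sum>l<p. v $ j * (((\<Sum>a<n. W a j * W a l) + (if j = l then \<epsilon> else 0)) * v $ l))"
    using v S by (simp add: scalar_prod_def S_def atLeast0LessThan sum_distrib_left)
  also have "\<dots> = (\<Sum>j<p. \<Sum>l<p. \<Sum>a<n. (W a j * v $ j) * (W a l * v $ l)) + (\<Sum>j<p. \<Sum>l<p. (if j = l then \<epsilon> * (v $ j * v $ j) else 0))"
    unfolding sum.distrib[symmetric]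
    by (intro sum.cong refl) (auto simp: algebra_simps sum_distrib_left sum_distrib_right)
  also have "(\<Sum>j<p. \<Sum>l<p. \<Sum>a<n. (W a j * v $ j) * (W a l * v $ l)) = (\<Sum>a<n. (\<Sum>j<p. W a j * v $ j)\<^sup>2)"
  proof -
    have "(\<Sum>j<p. \<Sum>l<p. \<Sum>a<n. (W a j * v $ j) * (W a l * v $ l)) = (\<Sum>j<p. \<Sum>a<n. \<Sum>l<p. (W a j * v $ j) * (W a l * v $ l))"
      by (intro sum.cong refl sum.swap)
    also have "\<dots> = (\<Sum>a<n. \<Sum>j<p. \<Sum>l<p. (W a j * v $ j) * (W a l * v $ l))" by (rule sum.swap)
    finally show ?thesis by (simp add: power2_eq_square sum_product)
  qed
  also have "(\<Sum>j<p. \<Sum>l<p. (if j = l then \<epsilon> * (v $ j * v $ j) else 0)) = \<epsilon> * (\<Sum>j<p. (v $ j)\<^sup>2)"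
    by (simp add: sum_distrib_left power2_eq_square)
  finally have e: "v \<bullet> (S *\<^sub>v v) = (\<Sum>a<n. (\<Sum>j<p. W a j * v $ j)\<^sup>2) + \<epsilon> * (\<Sum>j<p. (v $ j)\<^sup>2)" .
  obtain i where i: "i < p" "v $ i \<noteq> 0"
    using v by (metis carrier_vecD eq_vecI index_zero_vec(1) index_zero_vec(2))
  have "0 < (v $ i)\<^sup>2" using i by simp
  also have "\<dots> \<le> (\<Sum>j<p. (v $ j)\<^sup>2)" using i by (intro member_le_sum) auto
  finally have "0 < (\<Sum>j<p. (v $ j)\<^sup>2)" .
  then have "0 < \<epsilon> * (\<Sum>j<p. (v $ j)\<^sup>2)" using eps by simp
  moreover have "0 \<le> (\<Sum>a<n. (\<Sum>j<p. W a j * v $ j)\<^sup>2)" by (intro sum_nonneg) auto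
  ultimately show "v \<bullet> (S *\<^sub>v v) \<noteq> 0" unfolding e by linarith
qed

text \<open>The resolvent identity; it yields continuity and then differentiability of the inverse.\<close>
lemma reginv_diff:
  assumes R1: "reginv n p W1 r1 \<epsilon>" and R2: "reginv n p W2 r2 \<epsilon>" and jm: "j < p" "m < p"
  shows "r2 j m - r1 j m =
    - (\<Sum>s<p. \<Sum>t<p. r2 j s * ((\<Sum>a<n. W2 a s * W2 a t) - (\<Sum>a<n. W1 a s * W1 a t)) * r1 t m)"
proof -
  interpret R1: reginv n p W1 r1 \<epsilon> by fact
  interpret R2: reginv n p W2 r2 \<epsilon> by fact
  define S1 where "S1 s t = (\<Sum>a<n. W1 a s * W1 a t)" for s t
  define S2 where "S2 s t = (\<Sum>a<n. W2 a s * W2 a t)" for s t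
  have A: "(\<Sum>t<p. S1 s t * r1 t m) = (if s = m then 1 else 0) - \<epsilon> * r1 s m" if "s < p" for s
    using R1.inv[OF that jm(2)] unfolding S1_def by linarith
  have S2s: "S2 s t = S2 t s" for s t unfolding S2_def by (simp add: mult.commute)
  have B: "(\<Sum>s<p. r2 j s * S2 s t) = (if j = t then 1 else 0) - \<epsilon> * r2 j t" if t: "t < p" for t
  proof -
    have "(\<Sum>s<p. r2 j s * S2 s t) = (\<Sum>s<p. S2 t s * r2 s j)"
      using jm by (intro sum.cong refl) (auto simp: S2s[of t] R2.sym mult.commute)
    also have "\<dots> = (if t = j then 1 else 0) - \<epsilon> * r2 t j"
      using R2.inv[OF t jm(1)] unfolding S2_def by linarith
    finally show ?thesis using R2.sym[OF t jm(1)] by auto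
  qed
  have "(\<Sum>s<p. \<Sum>t<p. r2 j s * (S2 s t - S1 s t) * r1 t m)
      = (\<Sum>s<p. \<Sum>t<p. r2 j s * S2 s t * r1 t m) - (\<Sum>s<p. \<Sum>t<p. r2 j s * (S1 s t * r1 t m))"
    unfolding sum_subtractf[symmetric] by (intro sum.cong refl) (simp add: algebra_simps)
  also have "(\<Sum>s<p. \<Sum>t<p. r2 j s * S2 s t * r1 t m) = (\<Sum>t<p. (\<Sum>s<p. r2 j s * S2 s t) * r1 t m)"
    by (subst sum.swap) (simp add: sum_distrib_right)
  also have "\<dots> = (\<Sum>t<p. (if j = t then r1 t m else 0) - \<epsilon> * (r2 j t * r1 t m))"
    by (intro sum.cong refl, subst B) (auto simp: algebra_simps)
  also have "\<dots> = r1 j m - \<epsilon> * (\<Sum>t<p. r2 j t * r1 t m)"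
    using jm by (simp add: sum_subtractf sum_distrib_left)
  also have "(\<Sum>s<p. \<Sum>t<p. r2 j s * (S1 s t * r1 t m)) = (\<Sum>s<p. r2 j s * (\<Sum>t<p. S1 s t * r1 t m))"
    by (simp add: sum_distrib_left)
  also have "\<dots> = (\<Sum>s<p. (if s = m then r2 j s else 0) - \<epsilon> * (r2 j s * r1 s m))"
    by (intro sum.cong refl) (auto simp: A algebra_simps)
  also have "\<dots> = r2 j m - \<epsilon> * (\<Sum>t<p. r2 j t * r1 t m)"
    using jm by (simp add: sum_subtractf sum_distrib_left)
  finally show ?thesis unfolding S1_def S2_def by simp
qed

lemma has_real_derivative_reginv:
  fixes W W' :: "real \<Rightarrow> nat \<Rightarrow> nat \<Rightarrow> real" and r :: "real \<Rightarrow> nat \<Rightarrow> nat \<Rightarrow> real"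
  assumes pos: "0 < \<epsilon>" and R: "\<And>t. reginv n p (W t) (r t) \<epsilon>"
    and S': "\<And>s q. s < p \<Longrightarrow> q < p \<Longrightarrow>
      ((\<lambda>t. \<Sum>a<n. W t a s * W t a q) has_real_derivative S' s q) (at x)"
    and jm: "j < p" "m < p"
  shows "((\<lambda>t. r t j m) has_real_derivative - (\<Sum>s<p. \<Sum>q<p. r x j s * S' s q * r x q m)) (at x)"
proof -
  define S where "S t s q = (\<Sum>a<n. W t a s * W t a q)" for t s q
  have dif: "r t i k - r x i k = - (\<Sum>s<p. \<Sum>q<p. r t i s * (S t s q - S x s q) * r x q k)" if "i < p" "k < p" for t i k
    using reginv_diff[OF R R that] unfolding S_def .
  \<comment> \<open>This bound is uniform in \<open>t\<close>. In the resolvent identity it first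
    gives continuity of the inverse, which is then used in the limit of the difference
    quotients.\<close>
  have bd: "\<bar>r t i k\<bar> \<le> real p / \<epsilon>" if "i < p" "k < p" for t i k
  proof -
    interpret reginv n p "W t" "r t" \<epsilon> by (rule R)
    have "\<bar>r t i k\<bar> \<le> u" using that by (rule r_le_u)
    also have "u \<le> real p / \<epsilon>" using eps_u_le pos by (simp add: field_simps)
    finally show ?thesis .
  qed
  have St: "((\<lambda>t. S t s q) \<longlongrightarrow> S x s q) (at x)" if "s < p" "q < p" for s q
    using DERIV_isCont[OF S'[OF that]] unfolding S_def isCont_def .
  have rt: "((\<lambda>t. r t j s) \<longlongrightarrow> r x j s) (at x)" if s: "s < p" for s
  proof -
    have "((\<lambda>t. r t j s - r x j s) \<longlongrightarrow> 0) (at x)"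
    proof (rule Lim_null_comparison)
      show "\<forall>\<^sub>F t in at x. norm (r t j s - r x j s)
          \<le> (\<Sum>s'<p. \<Sum>q<p. real p / \<epsilon> * \<bar>S t s' q - S x s' q\<bar> * \<bar>r x q s\<bar>)"
      proof (rule always_eventually, rule allI)
        fix t
        have "norm (r t j s - r x j s) \<le> (\<Sum>s'<p. \<Sum>q<p. \<bar>r t j s' * (S t s' q - S x s' q) * r x q s\<bar>)"
          unfolding dif[OF jm(1) s] real_norm_def abs_minus_cancel
          by (rule order_trans[OF sum_abs], intro sum_mono sum_abs)
        also have "\<dots> \<le> (\<Sum>s'<p. \<Sum>q<p. real p / \<epsilon> * \<bar>S t s' q - S x s' q\<bar> * \<bar>r x q s\<bar>)"
          unfolding abs_mult by (intro sum_mono mult_right_mono bd jm) auto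
        finally show "norm (r t j s - r x j s) \<le> (\<Sum>s'<p. \<Sum>q<p. real p / \<epsilon> * \<bar>S t s' q - S x s' q\<bar> * \<bar>r x q s\<bar>)" .
      qed
      have "((\<lambda>t. (\<Sum>s'<p. \<Sum>q<p. real p / \<epsilon> * \<bar>S t s' q - S x s' q\<bar> * \<bar>r x q s\<bar>)) \<longlongrightarrow>
         (\<Sum>s'<p. \<Sum>q<p. real p / \<epsilon> * \<bar>S x s' q - S x s' q\<bar> * \<bar>r x q s\<bar>)) (at x)"
        by (intro tendsto_intros St) auto
      then show "((\<lambda>t. (\<Sum>s'<p. \<Sum>q<p. real p / \<epsilon> * \<bar>S t s' q - S x s' q\<bar> * \<bar>r x q s\<bar>)) \<longlongrightarrow> 0) (at x)"
        by simp
    qed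
    then show ?thesis by (simp add: LIM_zero_iff)
  qed
  have "((\<lambda>t. - (\<Sum>s<p. \<Sum>q<p. r t j s * ((S t s q - S x s q) / (t - x)) * r x q m)) \<longlongrightarrow>
       - (\<Sum>s<p. \<Sum>q<p. r x j s * S' s q * r x q m)) (at x)"
    using S' unfolding has_field_derivative_iff S_def[symmetric]
    by (intro tendsto_intros rt) auto
  moreover have "- (\<Sum>s<p. \<Sum>q<p. r t j s * ((S t s q - S x s q) / (t - x)) * r x q m) = (r t j m - r x j m) / (t - x)" for t
    unfolding dif[OF jm] by (simp add: sum_divide_distrib)
  ultimately show ?thesis unfolding has_field_derivative_iff by simp
qed

lemma measurable_det:
  assumes "\<And>i j. i < n \<Longrightarrow> j < n \<Longrightarrow> (\<lambda>w. F w $$ (i, j)) \<in> borel_measurable M"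
    and "\<And>w. F w \<in> carrier_mat n n"
  shows "(\<lambda>w. Determinant.det (F w) :: real) \<in> borel_measurable M"
proof -
  have "Determinant.det (F w) = (\<Sum>q\<in>{q. q permutes {0..<n}}. signof q * (\<Prod>i = 0..<n. F w $$ (i, q i)))" for w
    using det_def'[OF assms(2)] by simp
  moreover have "(\<lambda>w. \<Sum>q\<in>{q. q permutes {0..<n}}. signof q * (\<Prod>i = 0..<n. F w $$ (i, q i))) \<in> borel_measurable M"
    by (intro borel_measurable_sum borel_measurable_times borel_measurable_const borel_measurable_prod assms)
      (auto dest: permutes_in_image)
  ultimately show ?thesis by simp
qed

lemma measurable_inv_mat:
  assumes m: "\<And>i j. i < n \<Longrightarrow> j < n \<Longrightarrow> (\<lambda>w. F w $$ (i, j)) \<in> borel_measurable M"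
    and c: "\<And>w. F w \<in> carrier_mat n n" and ij: "i < n" "j < n"
  shows "(\<lambda>w. inv_mat (F w) $$ (i, j)) \<in> borel_measurable M"
proof -
  have d: "dim_row (F w) = n" "dim_col (F w) = n" for w using c[of w] by auto
  have eq: "inv_mat (F w) $$ (i, j) = (1 / Determinant.det (F w)) * ((-1) ^ (j + i) * Determinant.det (mat_delete (F w) j i))" for w
    unfolding inv_mat_adj[OF c] using ij d by (simp add: adj_mat_def Determinant.cofactor_def)
  have "(\<lambda>w. Determinant.det (mat_delete (F w) j i)) \<in> borel_measurable M"
  proof (rule measurable_det[where n="n - 1"])
    show "mat_delete (F w) j i \<in> carrier_mat (n - 1) (n - 1)" for w using mat_delete_dim[of "F w" j i] d by auto
    fix i' j' assume ij': "i' < n - 1" "j' < n - 1"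
    then have "mat_delete (F w) j i $$ (i', j') = F w $$ (if i' < j then i' else Suc i', if j' < i then j' else Suc j')" for w
      unfolding mat_delete_def using d by simp
    then show "(\<lambda>w. mat_delete (F w) j i $$ (i', j')) \<in> borel_measurable M"
      using ij' by (auto intro!: m)
  qed
  moreover have "(\<lambda>w. Determinant.det (F w)) \<in> borel_measurable M" by (rule measurable_det[OF m c])
  ultimately show ?thesis unfolding eq by measurable
qed

subsection \<open>Haff's identity\<close>

text \<open>Below, \<open>w\<close> is a standard normal \<open>n \<times> p\<close> matrix, \<open>Q\<close> a projection of rank \<open>N\<close>, \<open>W = Q w\<close>, and
  \<open>R \<epsilon>\<close> is the inverse of \<open>S \<epsilon> = W\<^sup>T W + \<epsilon>\<close>, extended by zero. For \<open>\<epsilon> > 0\<close> it is bounded, which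
  makes Stein's identity applicable without any moment condition; \<open>\<epsilon> = 0\<close> is reached as a limit.\<close>

locale sdesign =
  fixes n p :: nat and Q :: "nat \<Rightarrow> nat \<Rightarrow> real"
  assumes Qsym: "\<And>a b. a < n \<Longrightarrow> b < n \<Longrightarrow> Q a b = Q b a"
    and Qidem: "\<And>a b. a < n \<Longrightarrow> b < n \<Longrightarrow> (\<Sum>c<n. Q a c * Q c b) = Q a b"
begin

definition I :: "(nat \<times> nat) set" where "I = {..<n} \<times> {..<p}"

lemma finite_I [simp]: "finite I" by (simp add: I_def)

definition N :: real where "N = (\<Sum>a<n. Q a a)"

definition W :: "(nat \<times> nat \<Rightarrow> real) \<Rightarrow> nat \<Rightarrow> nat \<Rightarrow> real" where
  "W w a l = (if l < p then \<Sum>b<n. Q a b * w (b, l) else 0)"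

definition S :: "real \<Rightarrow> (nat \<times> nat \<Rightarrow> real) \<Rightarrow> real mat" where
  "S \<epsilon> w = Matrix.mat p p (\<lambda>(j, l). (\<Sum>a<n. W w a j * W w a l) + (if j = l then \<epsilon> else 0))"

definition R :: "real \<Rightarrow> (nat \<times> nat \<Rightarrow> real) \<Rightarrow> nat \<Rightarrow> nat \<Rightarrow> real" where
  "R \<epsilon> w j l = (if j < p \<and> l < p then inv_mat (S \<epsilon> w) $$ (j, l) else 0)"

definition V :: "real \<Rightarrow> (nat \<times> nat \<Rightarrow> real) \<Rightarrow> nat \<Rightarrow> nat \<Rightarrow> real" where
  "V \<epsilon> w = rV p (W w) (R \<epsilon> w)"

definition u :: "real \<Rightarrow> (nat \<times> nat \<Rightarrow> real) \<Rightarrow> real" where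
  "u \<epsilon> w = ru p (R \<epsilon> w)"

text \<open>The squared Frobenius norm of the regularised inverse; \<open>tau\<close> is that of
  \<open>W\<close>, in other words the trace of W^T W.\<close>

definition rr :: "real \<Rightarrow> (nat \<times> nat \<Rightarrow> real) \<Rightarrow> real" where
  "rr \<epsilon> w = (\<Sum>j<p. \<Sum>m<p. (R \<epsilon> w j m)\<^sup>2)"

definition tau :: "(nat \<times> nat \<Rightarrow> real) \<Rightarrow> real" where
  "tau w = (\<Sum>a<n. \<Sum>j<p. (W w a j)\<^sup>2)"

lemma S_carrier [simp]: "S \<epsilon> w \<in> carrier_mat p p" by (simp add: S_def)

lemma reginv_R:
  assumes "0 \<le> \<epsilon>" "Determinant.det (S \<epsilon> w) \<noteq> 0" shows "reginv n p (W w) (R \<epsilon> w) \<epsilon>"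
  using assms unfolding S_def by (intro inv_gram_reginv) (auto simp: R_def S_def)

lemma reginv_R_pos: "0 < \<epsilon> \<Longrightarrow> reginv n p (W w) (R \<epsilon> w) \<epsilon>"
  using gram_det_nonzero[where W="W w" and n=n and p=p] by (intro reginv_R) (auto simp: S_def)

lemma R_bound: assumes e: "0 < \<epsilon>" shows "\<bar>R \<epsilon> w j l\<bar> \<le> real p / \<epsilon>"
proof (cases "j < p \<and> l < p")
  case True
  interpret r: reginv n p "W w" "R \<epsilon> w" \<epsilon> by (rule reginv_R_pos[OF e])
  have "\<bar>R \<epsilon> w j l\<bar> \<le> ru p (R \<epsilon> w)" using True by (intro r.r_le_u) auto
  also have "\<dots> \<le> real p / \<epsilon>" using r.eps_u_le e by (simp add: field_simps)
  finally show ?thesis .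
qed (use e in \<open>auto simp: R_def\<close>)

lemma measurable_w [measurable]: "a < n \<Longrightarrow> l < p \<Longrightarrow> (\<lambda>w. w (a, l)) \<in> borel_measurable (\<Pi>\<^sub>M i\<in>I. borel)"
  by (rule measurable_component_singleton) (simp add: I_def)

lemma measurable_W [measurable]: "(\<lambda>w. W w a l) \<in> borel_measurable (\<Pi>\<^sub>M i\<in>I. borel)"
  unfolding W_def by (cases "l < p") (auto intro!: borel_measurable_sum borel_measurable_times measurable_w)

lemma measurable_R [measurable]: "(\<lambda>w. R \<epsilon> w j l) \<in> borel_measurable (\<Pi>\<^sub>M i\<in>I. borel)"
proof (cases "j < p \<and> l < p")
  case True
  have "(\<lambda>w. inv_mat (S \<epsilon> w) $$ (j, l)) \<in> borel_measurable (\<Pi>\<^sub>M i\<in>I. borel)"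
    using True by (intro measurable_inv_mat[where n=p]) (auto simp: S_def)
  then show ?thesis using True by (simp add: R_def)
qed (auto simp: R_def)

lemma measurable_det_S [measurable]: "(\<lambda>w. Determinant.det (S \<epsilon> w)) \<in> borel_measurable (\<Pi>\<^sub>M i\<in>I. borel)"
  by (rule measurable_det[where n=p]) (auto simp: S_def)

lemma measurable_VuT [measurable]:
  "(\<lambda>w. V \<epsilon> w a l) \<in> borel_measurable (\<Pi>\<^sub>M i\<in>I. borel)"
  "u \<epsilon> \<in> borel_measurable (\<Pi>\<^sub>M i\<in>I. borel)"
  "rr \<epsilon> \<in> borel_measurable (\<Pi>\<^sub>M i\<in>I. borel)"
  "tau \<in> borel_measurable (\<Pi>\<^sub>M i\<in>I. borel)"
  unfolding V_def rV_def u_def[abs_def] ru_def rr_def[abs_def] tau_def[abs_def]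
  by measurable

lemma polybd_W [intro]: "polybd I (\<lambda>w. W w a l)"
  unfolding W_def by (cases "l < p") (auto intro!: polybd_sum polybd_mult polybd_coord simp: I_def)

lemma polybd_R [intro]: "0 < \<epsilon> \<Longrightarrow> polybd I (\<lambda>w. R \<epsilon> w j l)"
  by (rule polybd_bounded, rule R_bound)

lemma polybd_VuT [intro]:
  "0 < \<epsilon> \<Longrightarrow> polybd I (\<lambda>w. V \<epsilon> w a l)"
  "0 < \<epsilon> \<Longrightarrow> polybd I (u \<epsilon>)"
  "0 < \<epsilon> \<Longrightarrow> polybd I (rr \<epsilon>)"
  "polybd I tau"
  unfolding V_def rV_def u_def[abs_def] ru_def rr_def[abs_def] tau_def[abs_def]
  by (auto intro!: polybd_sum polybd_mult polybd_power polybd_W polybd_R)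

lemma QW: "a < n \<Longrightarrow> (\<Sum>b<n. Q a b * W w b l) = W w a l"
proof (cases "l < p")
  case True
  assume a: "a < n"
  have "(\<Sum>b<n. Q a b * W w b l) = (\<Sum>c<n. (\<Sum>b<n. Q a b * Q b c) * w (c, l))"
  proof -
    have "(\<Sum>b<n. Q a b * W w b l) = (\<Sum>b<n. \<Sum>c<n. Q a b * Q b c * w (c, l))"
      using True by (simp add: W_def sum_distrib_left mult.assoc)
    also have "\<dots> = (\<Sum>c<n. \<Sum>b<n. Q a b * Q b c * w (c, l))" by (rule sum.swap)
    finally show ?thesis by (simp add: sum_distrib_right)
  qed
  also have "\<dots> = W w a l" using True a by (simp add: Qidem W_def)
  finally show ?thesis .
qed (simp add: W_def)

lemma QV: "a < n \<Longrightarrow> (\<Sum>b<n. Q a b * V \<epsilon> w b l) = V \<epsilon> w a l"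
proof -
  assume a: "a < n"
  have "(\<Sum>b<n. Q a b * V \<epsilon> w b l) = (\<Sum>j<p. (\<Sum>b<n. Q a b * W w b j) * R \<epsilon> w j l)"
  proof -
    have "(\<Sum>b<n. Q a b * V \<epsilon> w b l) = (\<Sum>b<n. \<Sum>j<p. Q a b * W w b j * R \<epsilon> w j l)"
      by (simp add: V_def rV_def sum_distrib_left mult.assoc)
    also have "\<dots> = (\<Sum>j<p. \<Sum>b<n. Q a b * W w b j * R \<epsilon> w j l)" by (rule sum.swap)
    finally show ?thesis by (simp add: sum_distrib_right)
  qed
  then show ?thesis using a by (simp add: QW V_def rV_def)
qed

text \<open>The columns of V lie in the range of the symmetric projection \<open>Q\<close>, so the
  projection can be moved onto w.\<close>

lemma sum_wV:
  assumes "l < p" shows "(\<Sum>a<n. w (a, l) * V \<epsilon> w a m) = (\<Sum>a<n. W w a l * V \<epsilon> w a m)"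
proof -
  have "(\<Sum>a<n. w (a, l) * V \<epsilon> w a m) = (\<Sum>a<n. \<Sum>b<n. w (a, l) * (Q a b * V \<epsilon> w b m))"
    by (intro sum.cong refl) (simp only: sum_distrib_left[symmetric], simp add: QV)
  also have "\<dots> = (\<Sum>b<n. \<Sum>a<n. w (a, l) * (Q a b * V \<epsilon> w b m))" by (rule sum.swap)
  also have "\<dots> = (\<Sum>b<n. W w b l * V \<epsilon> w b m)"
    unfolding W_def sum_distrib_right using assms by (intro sum.cong refl) (auto simp: Qsym sum_distrib_right intro!: sum.cong)
  finally show ?thesis .
qed

lemma pd_W:
  assumes "a < n" "j < p"
  shows "pd (a, l) (\<lambda>w. W w b j) (\<lambda>w. if j = l then Q b a else 0)"
proof -
  have "pd (a, l) (\<lambda>w. \<Sum>c<n. Q b c * w (c, j)) (\<lambda>w. \<Sum>c<n. Q b c * (if (a, l) = (c, j) then 1 else 0))"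
    by (intro pd_sum pd_cmult pd_coord)
  moreover have "(\<Sum>c<n. Q b c * (if (a, l) = (c, j) then 1 else 0)) = (if j = l then Q b a else 0)"
    using assms by (auto simp: if_distrib[where f="\<lambda>t. _ * t"] cong: if_cong)
  ultimately show ?thesis using assms by (simp add: W_def)
qed

text \<open>This is dR = - R dS R. In the direction (a, l) the derivative of W^T W lives on row l
  and column l, filled with row a of W, because Q W = W.\<close>

lemma pd_R:
  assumes e: "0 < \<epsilon>" and a: "a < n" "l < p" and jm: "j < p" "m < p"
  shows "pd (a, l) (\<lambda>w. R \<epsilon> w j m) (\<lambda>w. - (R \<epsilon> w j l * V \<epsilon> w a m + V \<epsilon> w a j * R \<epsilon> w l m))"
  unfolding pd_def
proof
  fix w
  let ?w = "\<lambda>t::real. w((a, l) := t)"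
  have W': "((\<lambda>t. W (?w t) b s) has_real_derivative (if s = l then Q b a else 0)) (at (w (a, l)))" if "s < p" for b s
    using pd_W[OF a(1) that, of l b] unfolding pd_def by blast
  define S' where "S' s q = (if s = l then W w a q else 0) + (if q = l then W w a s else 0)" for s q
  have QW': "(\<Sum>b<n. Q b a * W w b q) = W w a q" for q
  proof -
    have "(\<Sum>b<n. Q b a * W w b q) = (\<Sum>b<n. Q a b * W w b q)"
      using a by (intro sum.cong refl) (simp add: Qsym)
    then show ?thesis using QW[OF a(1), of w q] by simp
  qed
  have "((\<lambda>t. \<Sum>b<n. W (?w t) b s * W (?w t) b q) has_real_derivative S' s q) (at (w (a, l)))"
    if "s < p" "q < p" for s q
  proof -
    have "((\<lambda>t. \<Sum>b<n. W (?w t) b s * W (?w t) b q) has_real_derivative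
      (\<Sum>b<n. (if s = l then Q b a else 0) * W (?w (w (a, l))) b q + (if q = l then Q b a else 0) * W (?w (w (a, l))) b s)) (at (w (a, l)))"
      by (intro DERIV_sum DERIV_mult W' that)
    moreover have "(\<Sum>b<n. (if s = l then Q b a else 0) * W (?w (w (a, l))) b q + (if q = l then Q b a else 0) * W (?w (w (a, l))) b s) = S' s q"
      unfolding S'_def by (auto simp: sum.distrib QW')
    ultimately show ?thesis by simp
  qed
  from has_real_derivative_reginv[OF e reginv_R_pos[OF e] this jm]
  have "((\<lambda>t. R \<epsilon> (?w t) j m) has_real_derivative
      - (\<Sum>s<p. \<Sum>q<p. R \<epsilon> w j s * S' s q * R \<epsilon> w q m)) (at (w (a, l)))" by simp
  moreover have "(\<Sum>s<p. \<Sum>q<p. R \<epsilon> w j s * S' s q * R \<epsilon> w q m) = R \<epsilon> w j l * V \<epsilon> w a m + V \<epsilon> w a j * R \<epsilon> w l m"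
  proof -
    have "(\<Sum>s<p. \<Sum>q<p. R \<epsilon> w j s * S' s q * R \<epsilon> w q m) =
       (\<Sum>s<p. \<Sum>q<p. if s = l then R \<epsilon> w j s * (W w a q * R \<epsilon> w q m) else 0)
       + (\<Sum>s<p. \<Sum>q<p. if q = l then (W w a s * R \<epsilon> w j s) * R \<epsilon> w q m else 0)"
      unfolding S'_def sum.distrib[symmetric] by (intro sum.cong refl) (auto simp: algebra_simps)
    also have "(\<Sum>s<p. \<Sum>q<p. if s = l then R \<epsilon> w j s * (W w a q * R \<epsilon> w q m) else 0) =
        (\<Sum>s<p. if s = l then \<Sum>q<p. R \<epsilon> w j s * (W w a q * R \<epsilon> w q m) else 0)"
      by (intro sum.cong refl) auto
    also have "\<dots> = R \<epsilon> w j l * V \<epsilon> w a m" using a by (simp add: V_def rV_def sum_distrib_left)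
    also have "(\<Sum>s<p. \<Sum>q<p. if q = l then (W w a s * R \<epsilon> w j s) * R \<epsilon> w q m else 0) = (\<Sum>s<p. W w a s * R \<epsilon> w j s) * R \<epsilon> w l m"
      using a by (simp add: sum_distrib_right)
    also have "(\<Sum>s<p. W w a s * R \<epsilon> w j s) = V \<epsilon> w a j"
      unfolding V_def rV_def using reginv.sym[OF reginv_R_pos[OF e]] jm by (intro sum.cong refl) simp
    finally show ?thesis .
  qed
  ultimately show "((\<lambda>t. R \<epsilon> (w((a, l) := t)) j m) has_real_derivative - (R \<epsilon> w j l * V \<epsilon> w a m + V \<epsilon> w a j * R \<epsilon> w l m)) (at (w (a, l)))"
    by simp
qed

text \<open>The entries of W R W^T, which at \<open>\<epsilon> = 0\<close> and for nonsingular
  \<open>S\<close> is the projection onto the column space of \<open>W\<close>.\<close>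

definition c :: "real \<Rightarrow> (nat \<times> nat \<Rightarrow> real) \<Rightarrow> nat \<Rightarrow> nat \<Rightarrow> real" where
  "c \<epsilon> w a b = (\<Sum>j<p. V \<epsilon> w a j * W w b j)"

lemma V_eq: "V \<epsilon> w a l = (\<Sum>j<p. W w a j * R \<epsilon> w j l)"
  by (simp add: V_def rV_def)

lemma pd_V:
  assumes e: "0 < \<epsilon>" and a: "a < n" "l < p" and m: "m < p"
  shows "pd (a, l) (\<lambda>w. V \<epsilon> w b m) (\<lambda>w. Q b a * R \<epsilon> w l m - V \<epsilon> w b l * V \<epsilon> w a m - c \<epsilon> w a b * R \<epsilon> w l m)"
proof (rule pd_cong)
  show "pd (a, l) (\<lambda>w. V \<epsilon> w b m) (\<lambda>w. \<Sum>j<p. (if j = l then Q b a else 0) * R \<epsilon> w j m +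
       W w b j * - (R \<epsilon> w j l * V \<epsilon> w a m + V \<epsilon> w a j * R \<epsilon> w l m))"
    unfolding V_eq[of _ _ b]
    by (intro pd_sum pd_mult pd_W pd_R e a m) auto
  fix w
  have "(\<Sum>j<p. (if j = l then Q b a else 0) * R \<epsilon> w j m + W w b j * - (R \<epsilon> w j l * V \<epsilon> w a m + V \<epsilon> w a j * R \<epsilon> w l m))
    = (\<Sum>j<p. (if j = l then Q b a * R \<epsilon> w j m else 0)) - (\<Sum>j<p. W w b j * R \<epsilon> w j l) * V \<epsilon> w a m - c \<epsilon> w a b * R \<epsilon> w l m"
    unfolding c_def sum_distrib_right sum_subtractf[symmetric] by (intro sum.cong refl) (auto simp: algebra_simps)
  then show "(\<Sum>j<p. (if j = l then Q b a else 0) * R \<epsilon> w j m + W w b j * - (R \<epsilon> w j l * V \<epsilon> w a m + V \<epsilon> w a j * R \<epsilon> w l m))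
    = Q b a * R \<epsilon> w l m - V \<epsilon> w b l * V \<epsilon> w a m - c \<epsilon> w a b * R \<epsilon> w l m"
    using a by (simp add: V_def rV_def)
qed

abbreviation \<nu> :: "(nat \<times> nat \<Rightarrow> real) measure" where "\<nu> \<equiv> gaussM I"

lemma stein_grid:
  fixes F F' :: "nat \<Rightarrow> nat \<Rightarrow> (nat \<times> nat \<Rightarrow> real) \<Rightarrow> real"
  assumes "\<And>a l. a < n \<Longrightarrow> l < p \<Longrightarrow> pd (a, l) (F a l) (F' a l)"
    and "\<And>a l. a < n \<Longrightarrow> l < p \<Longrightarrow> F a l \<in> borel_measurable (\<Pi>\<^sub>M i\<in>I. borel)"
      "\<And>a l. a < n \<Longrightarrow> l < p \<Longrightarrow> F' a l \<in> borel_measurable (\<Pi>\<^sub>M i\<in>I. borel)"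
    and "\<And>a l. a < n \<Longrightarrow> l < p \<Longrightarrow> polybd I (F a l)" "\<And>a l. a < n \<Longrightarrow> l < p \<Longrightarrow> polybd I (F' a l)"
  shows "integral\<^sup>L \<nu> (\<lambda>w. \<Sum>a<n. \<Sum>l<p. F' a l w) = integral\<^sup>L \<nu> (\<lambda>w. \<Sum>a<n. \<Sum>l<p. w (a, l) * F a l w)"
proof -
  have "integral\<^sup>L \<nu> (\<lambda>w. \<Sum>i\<in>I. (\<lambda>(a, l). F' a l) i w) = integral\<^sup>L \<nu> (\<lambda>w. \<Sum>i\<in>I. w i * (\<lambda>(a, l). F a l) i w)"
    using assms by (intro stein_field)
      (auto simp: I_def measurable_cong_sets[OF sets_gaussM refl])
  then show ?thesis unfolding I_def by (simp add: sum.cartesian_product case_prod_beta)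
qed

lemma integrable_poly: "polybd I f \<Longrightarrow> f \<in> borel_measurable (\<Pi>\<^sub>M i\<in>I. borel) \<Longrightarrow> integrable \<nu> f"
  by (intro polybd_integrable) (auto simp: measurable_cong_sets[OF sets_gaussM refl])

text \<open>Stein's identity for the vector field \<open>f V\<close>, where \<open>V = W R\<close>.\<close>
lemma haff_identity:
  assumes e: "0 < \<epsilon>"
    and f: "\<And>a l. a < n \<Longrightarrow> l < p \<Longrightarrow> pd (a, l) f (f' a l)"
      "f \<in> borel_measurable (\<Pi>\<^sub>M i\<in>I. borel)" "\<And>a l. f' a l \<in> borel_measurable (\<Pi>\<^sub>M i\<in>I. borel)"
      "polybd I f" "\<And>a l. polybd I (f' a l)"
  shows "integral\<^sup>L \<nu> (\<lambda>w. f w * (N * u \<epsilon> w - (u \<epsilon> w - \<epsilon> * rr \<epsilon> w) - (real p - \<epsilon> * u \<epsilon> w) * u \<epsilon> w)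
      + (\<Sum>a<n. \<Sum>l<p. V \<epsilon> w a l * f' a l w)) = integral\<^sup>L \<nu> (\<lambda>w. f w * (real p - \<epsilon> * u \<epsilon> w))"
proof -
  note [measurable] = f(2,3)
  have cm [measurable]: "(\<lambda>w. c \<epsilon> w a b) \<in> borel_measurable (\<Pi>\<^sub>M i\<in>I. borel)" for a b
    unfolding c_def by measurable
  have cp: "polybd I (\<lambda>w. c \<epsilon> w a b)" for a b
    unfolding c_def using e by (auto intro!: polybd_sum polybd_mult)
  have eq: "integral\<^sup>L \<nu> (\<lambda>w. \<Sum>a<n. \<Sum>l<p. (Q a a * R \<epsilon> w l l - V \<epsilon> w a l * V \<epsilon> w a l - c \<epsilon> w a a * R \<epsilon> w l l) * f w + V \<epsilon> w a l * f' a l w)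
     = integral\<^sup>L \<nu> (\<lambda>w. \<Sum>a<n. \<Sum>l<p. w (a, l) * (V \<epsilon> w a l * f w))"
  proof (rule stein_grid)
    fix a l assume al: "a < n" "l < p"
    show "pd (a, l) (\<lambda>w. V \<epsilon> w a l * f w) (\<lambda>w. (Q a a * R \<epsilon> w l l - V \<epsilon> w a l * V \<epsilon> w a l - c \<epsilon> w a a * R \<epsilon> w l l) * f w + V \<epsilon> w a l * f' a l w)"
      by (intro pd_mult pd_V e al f)
  qed (use e f in \<open>measurable, auto intro!: polybd_mult polybd_add polybd_diff cp\<close>)
  \<comment> \<open>Summation over all entries turns Q, V^T V and W R W^T into the traces N, u -
    \<open>\<epsilon>\<close> rr and p - \<open>\<epsilon>\<close> u.\<close>
  have A: "(\<Sum>a<n. \<Sum>l<p. (Q a a * R \<epsilon> w l l - V \<epsilon> w a l * V \<epsilon> w a l - c \<epsilon> w a a * R \<epsilon> w l l) * f w + V \<epsilon> w a l * f' a l w)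
    = f w * (N * u \<epsilon> w - (u \<epsilon> w - \<epsilon> * rr \<epsilon> w) - (real p - \<epsilon> * u \<epsilon> w) * u \<epsilon> w) + (\<Sum>a<n. \<Sum>l<p. V \<epsilon> w a l * f' a l w)" for w
  proof -
    interpret r: reginv n p "W w" "R \<epsilon> w" \<epsilon> by (rule reginv_R_pos[OF e])
    have 1: "(\<Sum>a<n. \<Sum>l<p. Q a a * R \<epsilon> w l l) = N * u \<epsilon> w"
      by (simp add: N_def u_def ru_def sum_product)
    have 2: "(\<Sum>a<n. \<Sum>l<p. V \<epsilon> w a l * V \<epsilon> w a l) = u \<epsilon> w - \<epsilon> * rr \<epsilon> w"
      using r.trace_VV by (simp add: V_def u_def rr_def)
    have "(\<Sum>a<n. c \<epsilon> w a a) = real p - \<epsilon> * u \<epsilon> w"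
      using r.trace_rS by (simp add: c_def V_def u_def)
    then have 3: "(\<Sum>a<n. \<Sum>l<p. c \<epsilon> w a a * R \<epsilon> w l l) = (real p - \<epsilon> * u \<epsilon> w) * u \<epsilon> w"
      unfolding u_def ru_def by (simp add: sum_product[symmetric])
    have "(\<Sum>a<n. \<Sum>l<p. (Q a a * R \<epsilon> w l l - V \<epsilon> w a l * V \<epsilon> w a l - c \<epsilon> w a a * R \<epsilon> w l l) * f w + V \<epsilon> w a l * f' a l w)
     = ((\<Sum>a<n. \<Sum>l<p. Q a a * R \<epsilon> w l l) - (\<Sum>a<n. \<Sum>l<p. V \<epsilon> w a l * V \<epsilon> w a l) - (\<Sum>a<n. \<Sum>l<p. c \<epsilon> w a a * R \<epsilon> w l l)) * f w
       + (\<Sum>a<n. \<Sum>l<p. V \<epsilon> w a l * f' a l w)"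
      by (simp only: sum.distrib sum_subtractf left_diff_distrib sum_distrib_right)
    then show ?thesis unfolding 1 2 3 by simp
  qed
  have B: "(\<Sum>a<n. \<Sum>l<p. w (a, l) * (V \<epsilon> w a l * f w)) = f w * (real p - \<epsilon> * u \<epsilon> w)" for w
  proof -
    interpret r: reginv n p "W w" "R \<epsilon> w" \<epsilon> by (rule reginv_R_pos[OF e])
    have "(\<Sum>a<n. \<Sum>l<p. w (a, l) * (V \<epsilon> w a l * f w)) = (\<Sum>l<p. (\<Sum>a<n. w (a, l) * V \<epsilon> w a l) * f w)"
      by (subst sum.swap) (simp add: sum_distrib_right mult.assoc)
    also have "\<dots> = (\<Sum>l<p. (\<Sum>a<n. W w a l * V \<epsilon> w a l) * f w)"
      by (intro sum.cong refl) (simp add: sum_wV)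
    also have "\<dots> = (\<Sum>a<n. \<Sum>l<p. V \<epsilon> w a l * W w a l) * f w"
      by (subst sum.swap[of "\<lambda>a l. V \<epsilon> w a l * W w a l"]) (simp add: sum_distrib_right sum_distrib_left mult_ac)
    also have "(\<Sum>a<n. \<Sum>l<p. V \<epsilon> w a l * W w a l) = real p - \<epsilon> * u \<epsilon> w"
      using r.trace_rS by (simp add: V_def u_def)
    finally show ?thesis by simp
  qed
  show ?thesis using eq unfolding A B .
qed

end

text \<open>Since \<open>e\<close> is orthogonal to the range of \<open>Q\<close>, derivatives in the direction \<open>e\<close> do not see \<open>S\<close>.\<close>

locale sdesign_dir = sdesign +
  fixes e :: "nat \<Rightarrow> real"
  assumes e_unit: "(\<Sum>a<n. (e a)\<^sup>2) = 1"
    and Qe: "\<And>a. a < n \<Longrightarrow> (\<Sum>b<n. Q a b * e b) = 0"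
begin

definition x :: "(nat \<times> nat \<Rightarrow> real) \<Rightarrow> nat \<Rightarrow> real" where
  "x w l = (if l < p then \<Sum>a<n. e a * w (a, l) else 0)"

definition y :: "(nat \<Rightarrow> real) \<Rightarrow> (nat \<times> nat \<Rightarrow> real) \<Rightarrow> nat \<Rightarrow> real" where
  "y m w l = x w l + m l"

definition g :: "real \<Rightarrow> (nat \<Rightarrow> real) \<Rightarrow> (nat \<times> nat \<Rightarrow> real) \<Rightarrow> nat \<Rightarrow> real" where
  "g \<epsilon> m w = rg p (R \<epsilon> w) (y m w)"

definition h :: "real \<Rightarrow> (nat \<Rightarrow> real) \<Rightarrow> (nat \<times> nat \<Rightarrow> real) \<Rightarrow> nat \<Rightarrow> real" where
  "h \<epsilon> m w = rh p (W w) (R \<epsilon> w) (y m w)"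

definition zeta :: "real \<Rightarrow> (nat \<Rightarrow> real) \<Rightarrow> (nat \<times> nat \<Rightarrow> real) \<Rightarrow> real" where
  "zeta \<epsilon> m w = (\<Sum>j<p. y m w j * g \<epsilon> m w j)"

definition y2 :: "(nat \<Rightarrow> real) \<Rightarrow> (nat \<times> nat \<Rightarrow> real) \<Rightarrow> real" where
  "y2 m w = (\<Sum>j<p. (y m w j)\<^sup>2)"

text \<open>1 / zeta, kept below 1 / \<open>\<epsilon>\<close>: the summand here is separate from
  the regularisation inside \<open>R\<close> and takes care of the points where \<open>y\<close>
  vanishes.\<close>

definition phi :: "real \<Rightarrow> (nat \<Rightarrow> real) \<Rightarrow> (nat \<times> nat \<Rightarrow> real) \<Rightarrow> real" where
  "phi \<epsilon> m w = 1 / (zeta \<epsilon> m w + \<epsilon>)"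

section \<open>Growth and derivatives of the statistics in the direction e\<close>

lemma measurable_x [measurable]: "(\<lambda>w. x w l) \<in> borel_measurable (\<Pi>\<^sub>M i\<in>I. borel)"
  unfolding x_def by (cases "l < p") (auto intro!: borel_measurable_sum borel_measurable_times measurable_w)

lemma measurable_dir [measurable]:
  "(\<lambda>w. y m w l) \<in> borel_measurable (\<Pi>\<^sub>M i\<in>I. borel)"
  "(\<lambda>w. g \<epsilon> m w l) \<in> borel_measurable (\<Pi>\<^sub>M i\<in>I. borel)"
  "(\<lambda>w. h \<epsilon> m w a) \<in> borel_measurable (\<Pi>\<^sub>M i\<in>I. borel)"
  "zeta \<epsilon> m \<in> borel_measurable (\<Pi>\<^sub>M i\<in>I. borel)"
  "y2 m \<in> borel_measurable (\<Pi>\<^sub>M i\<in>I. borel)"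
  "phi \<epsilon> m \<in> borel_measurable (\<Pi>\<^sub>M i\<in>I. borel)"
  unfolding y_def g_def h_def zeta_def[abs_def] y2_def[abs_def] phi_def[abs_def] rg_def rh_def V_def[symmetric]
  by measurable

lemma polybd_x [intro]: "polybd I (\<lambda>w. x w l)"
  unfolding x_def by (cases "l < p") (auto intro!: polybd_sum polybd_mult polybd_coord simp: I_def)

lemma polybd_dir [intro]:
  "polybd I (\<lambda>w. y m w l)"
  "0 < \<epsilon> \<Longrightarrow> polybd I (\<lambda>w. g \<epsilon> m w l)"
  "0 < \<epsilon> \<Longrightarrow> polybd I (\<lambda>w. h \<epsilon> m w a)"
  "0 < \<epsilon> \<Longrightarrow> polybd I (zeta \<epsilon> m)"
  "polybd I (y2 m)"
  unfolding y_def g_def h_def zeta_def[abs_def] y2_def[abs_def] rg_def rh_def V_def[symmetric]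
  by (auto intro!: polybd_sum polybd_mult polybd_add polybd_power polybd_x polybd_R polybd_VuT)

lemma zeta_nonneg: "0 < \<epsilon> \<Longrightarrow> 0 \<le> zeta \<epsilon> m w"
  using reginv.quad_nonneg[OF reginv_R_pos] by (simp add: zeta_def g_def)

lemma phi_pos: "0 < \<epsilon> \<Longrightarrow> 0 < phi \<epsilon> m w"
  using zeta_nonneg[of \<epsilon> m w] by (simp add: phi_def)

lemma phi_zeta: "0 < \<epsilon> \<Longrightarrow> phi \<epsilon> m w * zeta \<epsilon> m w = 1 - \<epsilon> * phi \<epsilon> m w"
  using zeta_nonneg[of \<epsilon> m w] by (simp add: phi_def field_simps)

lemma polybd_phi [intro]: "0 < \<epsilon> \<Longrightarrow> polybd I (phi \<epsilon> m)"
proof (rule polybd_bounded)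
  fix w assume "0 < \<epsilon>"
  with zeta_nonneg[OF this, of m w] show "\<bar>phi \<epsilon> m w\<bar> \<le> 1 / \<epsilon>" by (simp add: phi_def frac_le)
qed

lemma eW: "(\<Sum>a<n. e a * W w a l) = 0"
proof (cases "l < p")
  case True
  have "(\<Sum>a<n. e a * W w a l) = (\<Sum>a<n. \<Sum>b<n. e a * Q a b * w (b, l))"
    using True by (simp add: W_def sum_distrib_left mult.assoc)
  also have "\<dots> = (\<Sum>b<n. \<Sum>a<n. e a * Q a b * w (b, l))" by (rule sum.swap)
  also have "\<dots> = (\<Sum>b<n. (\<Sum>a<n. Q b a * e a) * w (b, l))"
    unfolding sum_distrib_right by (intro sum.cong refl) (simp add: Qsym mult.commute)
  finally show ?thesis by (simp add: Qe)
qed (simp add: W_def)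

lemma eV: "(\<Sum>a<n. e a * V \<epsilon> w a l) = 0"
proof -
  have "(\<Sum>a<n. e a * V \<epsilon> w a l) = (\<Sum>a<n. \<Sum>j<p. e a * W w a j * R \<epsilon> w j l)"
    by (simp add: V_eq sum_distrib_left mult.assoc)
  also have "\<dots> = (\<Sum>j<p. \<Sum>a<n. e a * W w a j * R \<epsilon> w j l)" by (rule sum.swap)
  finally show ?thesis by (simp add: sum_distrib_right[symmetric] eW)
qed

lemma h_eq: "h \<epsilon> m w a = (\<Sum>j<p. V \<epsilon> w a j * y m w j)"
  by (simp add: h_def rh_def V_def)

lemma g_eq: "g \<epsilon> m w j = (\<Sum>l<p. R \<epsilon> w j l * y m w l)"
  by (simp add: g_def rg_def)

lemma eh: "(\<Sum>a<n. e a * h \<epsilon> m w a) = 0"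
proof -
  have "(\<Sum>a<n. e a * h \<epsilon> m w a) = (\<Sum>a<n. \<Sum>j<p. e a * V \<epsilon> w a j * y m w j)"
    by (simp add: h_eq sum_distrib_left mult.assoc)
  also have "\<dots> = (\<Sum>j<p. \<Sum>a<n. e a * V \<epsilon> w a j * y m w j)" by (rule sum.swap)
  finally show ?thesis by (simp add: sum_distrib_right[symmetric] eV)
qed

lemma pd_y:
  assumes "a < n" "j < p"
  shows "pd (a, l) (\<lambda>w. y m w j) (\<lambda>w. if j = l then e a else 0)"
proof -
  have "pd (a, l) (\<lambda>w. (\<Sum>c<n. e c * w (c, j)) + m j) (\<lambda>w. (\<Sum>c<n. e c * (if (a, l) = (c, j) then 1 else 0)) + 0)"
    by (intro pd_add pd_sum pd_cmult pd_coord pd_const)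
  moreover have "(\<Sum>c<n. e c * (if (a, l) = (c, j) then 1 else 0)) = (if j = l then e a else 0)"
    using assms by (auto simp: if_distrib[where f="\<lambda>t. _ * t"] cong: if_cong)
  ultimately show ?thesis using assms by (simp add: x_def y_def)
qed

lemma pd_g:
  assumes \<epsilon>: "0 < \<epsilon>" and a: "a < n" "l < p" "j < p"
  shows "pd (a, l) (\<lambda>w. g \<epsilon> m w j)
    (\<lambda>w. R \<epsilon> w j l * e a - R \<epsilon> w j l * h \<epsilon> m w a - V \<epsilon> w a j * g \<epsilon> m w l)"
proof (rule pd_cong)
  show "pd (a, l) (\<lambda>w. g \<epsilon> m w j) (\<lambda>w. \<Sum>i<p. - (R \<epsilon> w j l * V \<epsilon> w a i + V \<epsilon> w a j * R \<epsilon> w l i) * y m w i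
       + R \<epsilon> w j i * (if i = l then e a else 0))"
    unfolding g_eq by (intro pd_sum pd_mult pd_R pd_y \<epsilon> a) auto
  fix w
  have "(\<Sum>i<p. - (R \<epsilon> w j l * V \<epsilon> w a i + V \<epsilon> w a j * R \<epsilon> w l i) * y m w i + R \<epsilon> w j i * (if i = l then e a else 0))
    = (\<Sum>i<p. (if i = l then R \<epsilon> w j i * e a else 0)) - R \<epsilon> w j l * h \<epsilon> m w a - V \<epsilon> w a j * g \<epsilon> m w l"
    unfolding h_eq g_eq sum_distrib_left sum_subtractf[symmetric]
    by (intro sum.cong refl) (auto simp: algebra_simps)
  then show "(\<Sum>i<p. - (R \<epsilon> w j l * V \<epsilon> w a i + V \<epsilon> w a j * R \<epsilon> w l i) * y m w i + R \<epsilon> w j i * (if i = l then e a else 0))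
    = R \<epsilon> w j l * e a - R \<epsilon> w j l * h \<epsilon> m w a - V \<epsilon> w a j * g \<epsilon> m w l"
    using a by simp
qed

text \<open>There are two sources: y moves by e, which gives 2 e_a g_l, and R moves by - R dS R,
  which gives - g^T dS g = - 2 h_a g_l.\<close>

lemma pd_zeta:
  assumes \<epsilon>: "0 < \<epsilon>" and a: "a < n" "l < p"
  shows "pd (a, l) (zeta \<epsilon> m) (\<lambda>w. 2 * (e a - h \<epsilon> m w a) * g \<epsilon> m w l)"
proof (rule pd_cong)
  show "pd (a, l) (zeta \<epsilon> m) (\<lambda>w. \<Sum>j<p. (if j = l then e a else 0) * g \<epsilon> m w j
     + y m w j * (R \<epsilon> w j l * e a - R \<epsilon> w j l * h \<epsilon> m w a - V \<epsilon> w a j * g \<epsilon> m w l))"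
    unfolding zeta_def[abs_def] by (intro pd_sum pd_mult pd_g pd_y \<epsilon> a) auto
  fix w
  interpret r: reginv n p "W w" "R \<epsilon> w" \<epsilon> by (rule reginv_R_pos[OF \<epsilon>])
  have g': "(\<Sum>j<p. y m w j * R \<epsilon> w j l) = g \<epsilon> m w l"
    unfolding g_eq using a by (intro sum.cong refl) (simp add: r.sym)
  have "(\<Sum>j<p. (if j = l then e a else 0) * g \<epsilon> m w j
     + y m w j * (R \<epsilon> w j l * e a - R \<epsilon> w j l * h \<epsilon> m w a - V \<epsilon> w a j * g \<epsilon> m w l))
    = (\<Sum>j<p. (if j = l then e a * g \<epsilon> m w j else 0)) + (\<Sum>j<p. y m w j * R \<epsilon> w j l) * e a
      - (\<Sum>j<p. y m w j * R \<epsilon> w j l) * h \<epsilon> m w a - h \<epsilon> m w a * g \<epsilon> m w l"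
    unfolding h_eq[of _ _ _ a] sum_distrib_right sum.distrib[symmetric] sum_subtractf[symmetric]
    by (intro sum.cong refl) (auto simp: algebra_simps)
  also have "\<dots> = 2 * (e a - h \<epsilon> m w a) * g \<epsilon> m w l"
    unfolding g' using a by (simp add: algebra_simps)
  finally show "(\<Sum>j<p. (if j = l then e a else 0) * g \<epsilon> m w j
     + y m w j * (R \<epsilon> w j l * e a - R \<epsilon> w j l * h \<epsilon> m w a - V \<epsilon> w a j * g \<epsilon> m w l))
     = 2 * (e a - h \<epsilon> m w a) * g \<epsilon> m w l" .
qed

lemma pd_phi:
  assumes \<epsilon>: "0 < \<epsilon>" and a: "a < n" "l < p"
  shows "pd (a, l) (phi \<epsilon> m) (\<lambda>w. 2 * (phi \<epsilon> m w)\<^sup>2 * (h \<epsilon> m w a - e a) * g \<epsilon> m w l)"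
proof (rule pd_cong)
  have nz: "zeta \<epsilon> m w + \<epsilon> \<noteq> 0" for w using zeta_nonneg[OF \<epsilon>, of m w] \<epsilon> by linarith
  show "pd (a, l) (phi \<epsilon> m) (\<lambda>w. - (1 / (zeta \<epsilon> m w + \<epsilon>))\<^sup>2 * (2 * (e a - h \<epsilon> m w a) * g \<epsilon> m w l + 0))"
    unfolding phi_def[abs_def] by (intro pd_inverse pd_add pd_zeta pd_const \<epsilon> a nz)
  show "- (1 / (zeta \<epsilon> m w + \<epsilon>))\<^sup>2 * (2 * (e a - h \<epsilon> m w a) * g \<epsilon> m w l + 0)
    = 2 * (phi \<epsilon> m w)\<^sup>2 * (h \<epsilon> m w a - e a) * g \<epsilon> m w l" for w
    by (simp add: phi_def algebra_simps)
qed

lemma pd_h: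
  assumes \<epsilon>: "0 < \<epsilon>" and a: "a < n" "l < p"
  shows "pd (a, l) (\<lambda>w. h \<epsilon> m w b)
    (\<lambda>w. Q b a * g \<epsilon> m w l - V \<epsilon> w b l * h \<epsilon> m w a - c \<epsilon> w a b * g \<epsilon> m w l + V \<epsilon> w b l * e a)"
proof (rule pd_cong)
  show "pd (a, l) (\<lambda>w. h \<epsilon> m w b) (\<lambda>w. \<Sum>j<p. (Q b a * R \<epsilon> w l j - V \<epsilon> w b l * V \<epsilon> w a j - c \<epsilon> w a b * R \<epsilon> w l j) * y m w j
     + V \<epsilon> w b j * (if j = l then e a else 0))"
    unfolding h_eq by (intro pd_sum pd_mult pd_V pd_y \<epsilon> a) auto
  fix w
  have "(\<Sum>j<p. (Q b a * R \<epsilon> w l j - V \<epsilon> w b l * V \<epsilon> w a j - c \<epsilon> w a b * R \<epsilon> w l j) * y m w j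
     + V \<epsilon> w b j * (if j = l then e a else 0))
    = Q b a * g \<epsilon> m w l - V \<epsilon> w b l * h \<epsilon> m w a - c \<epsilon> w a b * g \<epsilon> m w l + (\<Sum>j<p. if j = l then V \<epsilon> w b j * e a else 0)"
    unfolding h_eq g_eq sum_distrib_left sum_subtractf[symmetric] sum.distrib[symmetric]
    by (intro sum.cong refl) (auto simp: algebra_simps)
  then show "(\<Sum>j<p. (Q b a * R \<epsilon> w l j - V \<epsilon> w b l * V \<epsilon> w a j - c \<epsilon> w a b * R \<epsilon> w l j) * y m w j
     + V \<epsilon> w b j * (if j = l then e a else 0))
    = Q b a * g \<epsilon> m w l - V \<epsilon> w b l * h \<epsilon> m w a - c \<epsilon> w a b * g \<epsilon> m w l + V \<epsilon> w b l * e a"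
    using a by simp
qed

end

section \<open>Further bounds for the regularised inverse\<close>

context reginv
begin

lemma quad_le_u: "(\<Sum>j<p. y j * g y j) \<le> real p * u * (\<Sum>j<p. (y j)\<^sup>2)"
proof -
  have "(\<Sum>j<p. y j * g y j) \<le> (\<Sum>j<p. \<Sum>m<p. \<bar>y j\<bar> * \<bar>y m\<bar> * u)"
    unfolding g_def sum_distrib_left
  proof (intro sum_mono)
    fix j m assume jm: "j \<in> {..<p}" "m \<in> {..<p}"
    have "y j * (r j m * y m) \<le> \<bar>y j\<bar> * \<bar>y m\<bar> * \<bar>r j m\<bar>"
      by (metis abs_ge_self abs_mult mult.assoc mult.commute)
    also have "\<dots> \<le> \<bar>y j\<bar> * \<bar>y m\<bar> * u"
      using jm by (intro mult_left_mono r_le_u) auto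
    finally show "y j * (r j m * y m) \<le> \<bar>y j\<bar> * \<bar>y m\<bar> * u" .
  qed
  also have "\<dots> = (\<Sum>j<p. \<bar>y j\<bar>)\<^sup>2 * u"
    unfolding power2_eq_square sum_product by (simp add: sum_distrib_right)
  also have "\<dots> \<le> (real p * (\<Sum>j<p. (y j)\<^sup>2)) * u"
    using Cauchy_Schwarz_ineq_sum[of "\<lambda>_. 1" "\<lambda>j. \<bar>y j\<bar>" "{..<p}"]
    by (intro mult_right_mono u_nonneg) simp
  finally show ?thesis by (simp add: algebra_simps)
qed

text \<open>Each (g y j)^2 is at most r_jj times y^T r y, by Cauchy-Schwarz for r against a unit
  vector; then sum over j.\<close>

lemma g_sq_le: "(\<Sum>j<p. (g y j)\<^sup>2) \<le> u * (\<Sum>j<p. y j * g y j)"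
proof -
  define z where "z = (\<Sum>j<p. y j * g y j)"
  have z0: "0 \<le> z" unfolding z_def by (rule quad_nonneg)
  have "(g y j)\<^sup>2 \<le> r j j * z" if j: "j < p" for j
  proof -
    have am: "2 * \<bar>c * g y j\<bar> \<le> r j j + c\<^sup>2 * z" for c
      using quad_amgm[of c "\<lambda>i. if i = j then 1 else 0" y] j by (simp add: quad_unit r_eq_g z_def)
    show ?thesis
    proof (cases "z = 0")
      case True
      have "g y j = 0"
      proof (rule ccontr)
        assume nz: "g y j \<noteq> 0"
        \<comment> \<open>With z = 0 the weight costs nothing; this one would make 2 (r_jj + 1) at
          most r_jj.\<close>
        have "2 * \<bar>(r j j + 1) / g y j * g y j\<bar> \<le> r j j" using am[of "(r j j + 1) / g y j"] True by simp
        then show False using nz r_diag_nonneg[OF j] by simp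
      qed
      then show ?thesis using True by simp
    next
      case False
      then have zp: "0 < z" using z0 by simp
      have "2 * \<bar>g y j / z * g y j\<bar> \<le> r j j + (g y j / z)\<^sup>2 * z" by (rule am)
      moreover have "\<bar>g y j / z * g y j\<bar> = (g y j)\<^sup>2 / z" using zp by (simp add: power2_eq_square)
      moreover have "(g y j / z)\<^sup>2 * z = (g y j)\<^sup>2 / z" using zp by (simp add: power2_eq_square)
      ultimately have "(g y j)\<^sup>2 / z \<le> r j j" by linarith
      then show ?thesis using zp by (simp add: pos_divide_le_eq)
    qed
  qed
  then have "(\<Sum>j<p. (g y j)\<^sup>2) \<le> (\<Sum>j<p. r j j * z)" by (intro sum_mono) simp
  then show ?thesis by (simp add: u_def z_def sum_distrib_right)
qed

lemma eps_rr_le: "\<epsilon> * (\<Sum>j<p. \<Sum>m<p. (r j m)\<^sup>2) \<le> u"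
proof -
  have "(\<Sum>a<n. \<Sum>l<p. V a l * V a l) \<ge> 0" by (intro sum_nonneg) simp
  then show ?thesis using trace_VV by simp
qed

end

text \<open>Meant for limits for which no majorant is known yet: uniformly bounded integrals already
  make the limit integrable. In the monotone cases the limit then serves as majorant for convergence
  of the integrals.\<close>

lemma fatou_integrable:
  fixes F :: "nat \<Rightarrow> 'a \<Rightarrow> real"
  assumes F: "\<And>k. integrable M (F k)" "\<And>k w. 0 \<le> F k w" "\<And>k. integral\<^sup>L M (F k) \<le> C"
    and f: "f \<in> borel_measurable M" "AE w in M. (\<lambda>k. F k w) \<longlonglongrightarrow> f w"
  shows "integrable M f"
proof -
  have nn: "AE w in M. 0 \<le> f w"
    using f(2) by eventually_elim (use F(2) in \<open>auto intro: LIMSEQ_le_const\<close>)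
  have "(\<integral>\<^sup>+w. ennreal (f w) \<partial>M) = (\<integral>\<^sup>+w. liminf (\<lambda>k. ennreal (F k w)) \<partial>M)"
    using f(2) by (intro nn_integral_cong_AE) (auto elim!: eventually_mono intro!: lim_imp_Liminf[symmetric] tendsto_ennrealI)
  also have "\<dots> \<le> liminf (\<lambda>k. \<integral>\<^sup>+w. ennreal (F k w) \<partial>M)"
    using F(1) by (intro nn_integral_liminf) auto
  also have "\<dots> \<le> liminf (\<lambda>k::nat. ennreal C)"
    using F by (intro Liminf_mono always_eventually) (auto simp: nn_integral_eq_integral ennreal_leI)
  also have "\<dots> = ennreal C" by (simp add: Liminf_const)
  finally have "(\<integral>\<^sup>+w. ennreal (f w) \<partial>M) < \<infinity>" by (simp add: le_less_trans)
  then show ?thesis by (rule integrableI_nonneg[OF f(1) nn])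
qed

section \<open>Stein's identity along e and a majorant for the reciprocal form\<close>

context sdesign_dir
begin

text \<open>Stein's identity for the field with entries e_a K_l: summed over a, its pairing with w
  contains w only through x = e^T w and K.\<close>

lemma stein_dir:
  assumes "\<And>a l. a < n \<Longrightarrow> l < p \<Longrightarrow> pd (a, l) (K l) (K' a l)"
    and "\<And>l. l < p \<Longrightarrow> K l \<in> borel_measurable (\<Pi>\<^sub>M i\<in>I. borel)"
      "\<And>a l. a < n \<Longrightarrow> l < p \<Longrightarrow> K' a l \<in> borel_measurable (\<Pi>\<^sub>M i\<in>I. borel)"
    and "\<And>l. l < p \<Longrightarrow> polybd I (K l)" "\<And>a l. a < n \<Longrightarrow> l < p \<Longrightarrow> polybd I (K' a l)"
  shows "integral\<^sup>L \<nu> (\<lambda>w. \<Sum>l<p. \<Sum>a<n. e a * K' a l w) = integral\<^sup>L \<nu> (\<lambda>w. \<Sum>l<p. x w l * K l w)"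
proof -
  have "integral\<^sup>L \<nu> (\<lambda>w. \<Sum>a<n. \<Sum>l<p. e a * K' a l w) = integral\<^sup>L \<nu> (\<lambda>w. \<Sum>a<n. \<Sum>l<p. w (a, l) * (e a * K l w))"
    using assms by (intro stein_grid pd_cmult polybd_mult borel_measurable_times) auto
  moreover have "(\<Sum>a<n. \<Sum>l<p. e a * K' a l w) = (\<Sum>l<p. \<Sum>a<n. e a * K' a l w)" for w by (rule sum.swap)
  moreover have "(\<Sum>a<n. \<Sum>l<p. w (a, l) * (e a * K l w)) = (\<Sum>l<p. x w l * K l w)" for w
    unfolding x_def by (subst sum.swap) (auto simp: sum_distrib_right sum_distrib_left mult_ac intro!: sum.cong)
  ultimately show ?thesis by simp
qed

lemma e_sq: "(\<Sum>a<n. e a * e a) = 1" using e_unit by (simp add: power2_eq_square)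

text \<open>This expresses that x has identity covariance given W. Stein's identity along e, applied
  to the field R x, produces tr R; the derivatives of R drop out because V and h are orthogonal to
  e.\<close>

lemma dir_identity:
  assumes \<epsilon>: "0 < \<epsilon>"
  shows "integral\<^sup>L \<nu> (\<lambda>w. u \<epsilon> w) = integral\<^sup>L \<nu> (\<lambda>w. \<Sum>l<p. x w l * g \<epsilon> (\<lambda>_. 0) w l)"
proof -
  have "integral\<^sup>L \<nu> (\<lambda>w. \<Sum>l<p. \<Sum>a<n. e a * (R \<epsilon> w l l * e a - R \<epsilon> w l l * h \<epsilon> (\<lambda>_. 0) w a - V \<epsilon> w a l * g \<epsilon> (\<lambda>_. 0) w l))
     = integral\<^sup>L \<nu> (\<lambda>w. \<Sum>l<p. x w l * g \<epsilon> (\<lambda>_. 0) w l)"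
    using \<epsilon> by (intro stein_dir pd_g polybd_diff polybd_mult) auto
  moreover have "(\<Sum>a<n. e a * (R \<epsilon> w l l * e a - R \<epsilon> w l l * h \<epsilon> (\<lambda>_. 0) w a - V \<epsilon> w a l * g \<epsilon> (\<lambda>_. 0) w l)) = R \<epsilon> w l l" for w l
  proof -
    have "(\<Sum>a<n. e a * (R \<epsilon> w l l * e a - R \<epsilon> w l l * h \<epsilon> (\<lambda>_. 0) w a - V \<epsilon> w a l * g \<epsilon> (\<lambda>_. 0) w l))
      = R \<epsilon> w l l * (\<Sum>a<n. e a * e a) - R \<epsilon> w l l * (\<Sum>a<n. e a * h \<epsilon> (\<lambda>_. 0) w a) - (\<Sum>a<n. e a * V \<epsilon> w a l) * g \<epsilon> (\<lambda>_. 0) w l"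
      unfolding sum_distrib_left sum_distrib_right sum_subtractf[symmetric] by (intro sum.cong refl) (simp add: algebra_simps)
    then show ?thesis by (simp add: e_sq eh eV)
  qed
  ultimately show ?thesis by (simp add: u_def ru_def)
qed

text \<open>The field is phi g, a regularised S^{-1} y / (y^T S^{-1} y), and the left side
  integrates its divergence in y.\<close>

lemma shrink_identity:
  assumes \<epsilon>: "0 < \<epsilon>"
  shows "integral\<^sup>L \<nu> (\<lambda>w. phi \<epsilon> m w * u \<epsilon> w - 2 * (phi \<epsilon> m w)\<^sup>2 * (\<Sum>l<p. (g \<epsilon> m w l)\<^sup>2))
    = integral\<^sup>L \<nu> (\<lambda>w. \<Sum>l<p. x w l * (g \<epsilon> m w l * phi \<epsilon> m w))"
proof -
  have "integral\<^sup>L \<nu> (\<lambda>w. \<Sum>l<p. \<Sum>a<n. e a * ((R \<epsilon> w l l * e a - R \<epsilon> w l l * h \<epsilon> m w a - V \<epsilon> w a l * g \<epsilon> m w l) * phi \<epsilon> m w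
        + g \<epsilon> m w l * (2 * (phi \<epsilon> m w)\<^sup>2 * (h \<epsilon> m w a - e a) * g \<epsilon> m w l)))
     = integral\<^sup>L \<nu> (\<lambda>w. \<Sum>l<p. x w l * (g \<epsilon> m w l * phi \<epsilon> m w))"
    using \<epsilon> by (intro stein_dir pd_mult pd_g pd_phi polybd_diff polybd_add polybd_mult polybd_dir polybd_const polybd_phi polybd_R polybd_VuT polybd_power) (auto, measurable)
  moreover have "(\<Sum>a<n. e a * ((R \<epsilon> w l l * e a - R \<epsilon> w l l * h \<epsilon> m w a - V \<epsilon> w a l * g \<epsilon> m w l) * phi \<epsilon> m w
        + g \<epsilon> m w l * (2 * (phi \<epsilon> m w)\<^sup>2 * (h \<epsilon> m w a - e a) * g \<epsilon> m w l)))
      = phi \<epsilon> m w * R \<epsilon> w l l - 2 * (phi \<epsilon> m w)\<^sup>2 * (g \<epsilon> m w l)\<^sup>2" for w l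
  proof -
    have "(\<Sum>a<n. e a * ((R \<epsilon> w l l * e a - R \<epsilon> w l l * h \<epsilon> m w a - V \<epsilon> w a l * g \<epsilon> m w l) * phi \<epsilon> m w
        + g \<epsilon> m w l * (2 * (phi \<epsilon> m w)\<^sup>2 * (h \<epsilon> m w a - e a) * g \<epsilon> m w l)))
      = (R \<epsilon> w l l * phi \<epsilon> m w) * (\<Sum>a<n. e a * e a) - R \<epsilon> w l l * phi \<epsilon> m w * (\<Sum>a<n. e a * h \<epsilon> m w a)
       - g \<epsilon> m w l * phi \<epsilon> m w * (\<Sum>a<n. e a * V \<epsilon> w a l)
       + (2 * (phi \<epsilon> m w)\<^sup>2 * (g \<epsilon> m w l)\<^sup>2) * (\<Sum>a<n. e a * h \<epsilon> m w a)
       - (2 * (phi \<epsilon> m w)\<^sup>2 * (g \<epsilon> m w l)\<^sup>2) * (\<Sum>a<n. e a * e a)"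
      unfolding sum_distrib_left sum_subtractf[symmetric] sum.distrib[symmetric]
      by (intro sum.cong refl) (simp add: algebra_simps power2_eq_square)
    then show ?thesis by (simp add: e_sq eh eV)
  qed
  ultimately show ?thesis by (simp add: u_def ru_def sum_subtractf sum_distrib_left)
qed

lemma pd_tau:
  assumes a: "a < n" "l < p" shows "pd (a, l) tau (\<lambda>w. 2 * W w a l)"
proof (rule pd_cong)
  show "pd (a, l) tau (\<lambda>w. \<Sum>b<n. \<Sum>j<p. (if j = l then Q b a else 0) * W w b j + W w b j * (if j = l then Q b a else 0))"
    unfolding tau_def[abs_def] power2_eq_square by (intro pd_sum pd_mult pd_W a) auto
  fix w
  have "(\<Sum>b<n. \<Sum>j<p. (if j = l then Q b a else 0) * W w b j + W w b j * (if j = l then Q b a else 0))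
    = (\<Sum>b<n. \<Sum>j<p. if j = l then 2 * (Q a b * W w b j) else 0)"
    using a by (intro sum.cong refl) (auto simp: Qsym)
  also have "\<dots> = 2 * W w a l" using a by (simp add: sum_distrib_left[symmetric] QW)
  finally show "(\<Sum>b<n. \<Sum>j<p. (if j = l then Q b a else 0) * W w b j + W w b j * (if j = l then Q b a else 0)) = 2 * W w a l" .
qed

definition rho :: "real \<Rightarrow> (nat \<Rightarrow> real) \<Rightarrow> (nat \<times> nat \<Rightarrow> real) \<Rightarrow> real" where
  "rho \<epsilon> m w = 1 / (y2 m w + \<epsilon>)"

lemma y2_nonneg: "0 \<le> y2 m w" unfolding y2_def by (intro sum_nonneg) simp

lemma rho_pos: "0 < \<epsilon> \<Longrightarrow> 0 < rho \<epsilon> m w"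
  using y2_nonneg[of m w] by (simp add: rho_def)

lemma measurable_rho [measurable]: "rho \<epsilon> m \<in> borel_measurable (\<Pi>\<^sub>M i\<in>I. borel)"
  unfolding rho_def[abs_def] by measurable

lemma polybd_rho: "0 < \<epsilon> \<Longrightarrow> polybd I (rho \<epsilon> m)"
proof (rule polybd_bounded)
  fix w assume "0 < \<epsilon>"
  with y2_nonneg[of m w] show "\<bar>rho \<epsilon> m w\<bar> \<le> 1 / \<epsilon>" by (simp add: rho_def frac_le)
qed

lemma pd_rho:
  assumes \<epsilon>: "0 < \<epsilon>" and a: "a < n" "l < p"
  shows "pd (a, l) (rho \<epsilon> m) (\<lambda>w. - (2 * (rho \<epsilon> m w)\<^sup>2 * e a * y m w l))"
proof (rule pd_cong)
  have nz: "y2 m w + \<epsilon> \<noteq> 0" for w using y2_nonneg[of m w] \<epsilon> by linarith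
  have y2: "pd (a, l) (y2 m) (\<lambda>w. \<Sum>j<p. (if j = l then e a else 0) * y m w j + y m w j * (if j = l then e a else 0))"
    unfolding y2_def[abs_def] power2_eq_square by (intro pd_sum pd_mult pd_y a) auto
  show "pd (a, l) (rho \<epsilon> m) (\<lambda>w. - (1 / (y2 m w + \<epsilon>))\<^sup>2 *
      ((\<Sum>j<p. (if j = l then e a else 0) * y m w j + y m w j * (if j = l then e a else 0)) + 0))"
    unfolding rho_def[abs_def] by (intro pd_inverse pd_add y2 pd_const nz)
  have "(\<Sum>j<p. (if j = l then e a else 0) * y m w j + y m w j * (if j = l then e a else 0)) =
     (\<Sum>j<p. if j = l then 2 * e a * y m w j else 0)" for w
    by (intro sum.cong refl) auto
  also have "\<dots> w = 2 * e a * y m w l" for w using a by simp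
  finally show "- (1 / (y2 m w + \<epsilon>))\<^sup>2 * ((\<Sum>j<p. (if j = l then e a else 0) * y m w j + y m w j * (if j = l then e a else 0)) + 0)
     = - (2 * (rho \<epsilon> m w)\<^sup>2 * e a * y m w l)" for w
    by (simp add: rho_def)
qed

text \<open>The factor tau + 1 comes from |y|^2 <= (tau + \<open>\<epsilon>\<close>) zeta with
  \<open>\<epsilon> \<le> 1\<close>; the limit of F as \<open>\<epsilon>\<close> tends to 0 is the
  majorant \<open>D1\<close>.\<close>

definition F :: "real \<Rightarrow> (nat \<Rightarrow> real) \<Rightarrow> (nat \<times> nat \<Rightarrow> real) \<Rightarrow> real" where
  "F \<epsilon> m w = (tau w + 1) * rho \<epsilon> m w"

lemma pd_F:
  assumes "0 < \<epsilon>" "a < n" "l < p"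
  shows "pd (a, l) (F \<epsilon> m) (\<lambda>w. 2 * W w a l * rho \<epsilon> m w + (tau w + 1) * - (2 * (rho \<epsilon> m w)\<^sup>2 * e a * y m w l))"
proof (rule pd_cong)
  show "pd (a, l) (F \<epsilon> m) (\<lambda>w. (2 * W w a l + 0) * rho \<epsilon> m w + (tau w + 1) * - (2 * (rho \<epsilon> m w)\<^sup>2 * e a * y m w l))"
    unfolding F_def[abs_def] by (intro pd_mult pd_add pd_tau pd_const pd_rho assms)
qed simp

lemma tau_nonneg: "0 \<le> tau w" unfolding tau_def by (intro sum_nonneg) simp

lemma F_pos: "0 < \<epsilon> \<Longrightarrow> 0 < F \<epsilon> m w"
  using rho_pos[of \<epsilon> m w] tau_nonneg[of w] by (simp add: F_def)

lemma measurable_F [measurable]: "F \<epsilon> m \<in> borel_measurable (\<Pi>\<^sub>M i\<in>I. borel)"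
  unfolding F_def[abs_def] by measurable

lemma polybd_F: "0 < \<epsilon> \<Longrightarrow> polybd I (F \<epsilon> m)"
  unfolding F_def[abs_def] by (intro polybd_mult polybd_add polybd_VuT polybd_const polybd_rho)

text \<open>\<open>F\<close> dominates \<open>phi\<close> uniformly in \<open>\<epsilon>\<close>. Stein's identity for \<open>y / \<bar>y\<bar>\<^sup>2\<close> has divergence \<open>(p - 2) / \<bar>y\<bar>\<^sup>2\<close>,
  which bounds its expectation when \<open>p \<ge> 3\<close>.\<close>
lemma E_F_bound:
  assumes \<epsilon>: "0 < \<epsilon>" and p: "3 \<le> p"
  shows "integral\<^sup>L \<nu> (\<lambda>w. F \<epsilon> m w) \<le> integral\<^sup>L \<nu> (\<lambda>w. (tau w + 1) * (\<Sum>l<p. (x w l)\<^sup>2))"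
proof -
  have id: "integral\<^sup>L \<nu> (\<lambda>w. \<Sum>l<p. \<Sum>a<n. e a * ((if l = l then e a else 0) * F \<epsilon> m w
        + y m w l * (2 * W w a l * rho \<epsilon> m w + (tau w + 1) * - (2 * (rho \<epsilon> m w)\<^sup>2 * e a * y m w l))))
     = integral\<^sup>L \<nu> (\<lambda>w. \<Sum>l<p. x w l * (y m w l * F \<epsilon> m w))"
    using \<epsilon> by (intro stein_dir pd_mult pd_F pd_y polybd_diff polybd_add polybd_mult polybd_minus polybd_dir polybd_const polybd_rho polybd_F polybd_W polybd_VuT polybd_power) (auto, measurable)
  have A: "(\<Sum>l<p. \<Sum>a<n. e a * ((if l = l then e a else 0) * F \<epsilon> m w
        + y m w l * (2 * W w a l * rho \<epsilon> m w + (tau w + 1) * - (2 * (rho \<epsilon> m w)\<^sup>2 * e a * y m w l))))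
      = F \<epsilon> m w * (real p - 2 * (y2 m w * rho \<epsilon> m w))" for w
  proof -
    have "(\<Sum>a<n. e a * ((if l = l then e a else 0) * F \<epsilon> m w
        + y m w l * (2 * W w a l * rho \<epsilon> m w + (tau w + 1) * - (2 * (rho \<epsilon> m w)\<^sup>2 * e a * y m w l))))
       = F \<epsilon> m w * (\<Sum>a<n. e a * e a) + 2 * y m w l * rho \<epsilon> m w * (\<Sum>a<n. e a * W w a l)
        - 2 * F \<epsilon> m w * rho \<epsilon> m w * (y m w l)\<^sup>2 * (\<Sum>a<n. e a * e a)" for l
      unfolding sum_distrib_left sum_subtractf[symmetric] sum.distrib[symmetric]
      by (intro sum.cong refl) (simp add: algebra_simps power2_eq_square F_def)
    then have "(\<Sum>l<p. \<Sum>a<n. e a * ((if l = l then e a else 0) * F \<epsilon> m w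
        + y m w l * (2 * W w a l * rho \<epsilon> m w + (tau w + 1) * - (2 * (rho \<epsilon> m w)\<^sup>2 * e a * y m w l))))
      = (\<Sum>l<p. F \<epsilon> m w - 2 * F \<epsilon> m w * rho \<epsilon> m w * (y m w l)\<^sup>2)"
      by (simp add: e_sq eW)
    also have "\<dots> = real p * F \<epsilon> m w - 2 * F \<epsilon> m w * rho \<epsilon> m w * y2 m w"
      by (simp add: sum_subtractf sum_distrib_left y2_def)
    finally show ?thesis by (simp add: algebra_simps)
  qed
  have intF: "integrable \<nu> (F \<epsilon> m)" using \<epsilon> by (intro integrable_poly polybd_F) auto
  have intX: "integrable \<nu> (\<lambda>w. (tau w + 1) * (\<Sum>l<p. (x w l)\<^sup>2))"
    by (intro integrable_poly polybd_mult polybd_add polybd_sum polybd_power polybd_x polybd_VuT) auto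
  \<comment> \<open>The divergence factor p - 2 y2 rho is therefore at least p - 2, hence at least
    1.\<close>
  have yr: "y2 m w * rho \<epsilon> m w \<le> 1" for w
    using y2_nonneg[of m w] \<epsilon> by (simp add: rho_def)
  have "integral\<^sup>L \<nu> (\<lambda>w. F \<epsilon> m w) \<le> integral\<^sup>L \<nu> (\<lambda>w. F \<epsilon> m w * (real p - 2 * (y2 m w * rho \<epsilon> m w)))"
  proof (rule integral_mono[OF intF])
    show "integrable \<nu> (\<lambda>w. F \<epsilon> m w * (real p - 2 * (y2 m w * rho \<epsilon> m w)))"
      using \<epsilon> by (intro integrable_poly polybd_mult polybd_diff polybd_F polybd_rho polybd_dir) auto
    fix w
    have "F \<epsilon> m w * 1 \<le> F \<epsilon> m w * (real p - 2 * (y2 m w * rho \<epsilon> m w))"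
      using yr[of w] p F_pos[OF \<epsilon>, of m w] by (intro mult_left_mono) auto
    then show "F \<epsilon> m w \<le> F \<epsilon> m w * (real p - 2 * (y2 m w * rho \<epsilon> m w))" by simp
  qed
  also have "\<dots> = integral\<^sup>L \<nu> (\<lambda>w. \<Sum>l<p. x w l * (y m w l * F \<epsilon> m w))" using id unfolding A .
  also have "\<dots> \<le> integral\<^sup>L \<nu> (\<lambda>w. 1/2 * ((tau w + 1) * (\<Sum>l<p. (x w l)\<^sup>2)) + 1/2 * F \<epsilon> m w)"
  proof (rule integral_mono)
    show "integrable \<nu> (\<lambda>w. \<Sum>l<p. x w l * (y m w l * F \<epsilon> m w))"
      using \<epsilon> by (intro integrable_poly polybd_mult polybd_sum polybd_F polybd_x polybd_dir) auto
    show "integrable \<nu> (\<lambda>w. 1/2 * ((tau w + 1) * (\<Sum>l<p. (x w l)\<^sup>2)) + 1/2 * F \<epsilon> m w)"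
      using intF intX by simp
    fix w
    have r: "0 < rho \<epsilon> m w" by (rule rho_pos[OF \<epsilon>])
    \<comment> \<open>The weights 1/2 leave half of the expectation of F on the right, where it is
      absorbed into the left side at the end.\<close>
    have "x w l * (y m w l * rho \<epsilon> m w) \<le> 1/2 * (x w l)\<^sup>2 + 1/2 * (y m w l)\<^sup>2 * (rho \<epsilon> m w)\<^sup>2" for l
      using zero_le_power2[of "x w l - y m w l * rho \<epsilon> m w"] by (simp add: power2_diff power_mult_distrib)
    then have "(\<Sum>l<p. x w l * (y m w l * rho \<epsilon> m w)) \<le> (\<Sum>l<p. 1/2 * (x w l)\<^sup>2 + 1/2 * (y m w l)\<^sup>2 * (rho \<epsilon> m w)\<^sup>2)"
      by (intro sum_mono)
    also have "\<dots> = 1/2 * (\<Sum>l<p. (x w l)\<^sup>2) + 1/2 * (y2 m w * rho \<epsilon> m w) * rho \<epsilon> m w"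
      by (simp add: sum.distrib sum_distrib_left sum_distrib_right y2_def power2_eq_square algebra_simps)
    also have "\<dots> \<le> 1/2 * (\<Sum>l<p. (x w l)\<^sup>2) + 1/2 * 1 * rho \<epsilon> m w"
      using yr[of w] r by (intro add_left_mono mult_right_mono mult_left_mono) auto
    finally have "(tau w + 1) * (\<Sum>l<p. x w l * (y m w l * rho \<epsilon> m w)) \<le> (tau w + 1) * (1/2 * (\<Sum>l<p. (x w l)\<^sup>2) + 1/2 * 1 * rho \<epsilon> m w)"
      using tau_nonneg[of w] by (intro mult_left_mono) auto
    also have "\<dots> = 1/2 * ((tau w + 1) * (\<Sum>l<p. (x w l)\<^sup>2)) + 1/2 * F \<epsilon> m w"
      by (simp add: F_def field_simps)
    also have "(tau w + 1) * (\<Sum>l<p. x w l * (y m w l * rho \<epsilon> m w)) = (\<Sum>l<p. x w l * (y m w l * F \<epsilon> m w))"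
      unfolding sum_distrib_left F_def by (intro sum.cong refl) (simp add: algebra_simps)
    finally show "(\<Sum>l<p. x w l * (y m w l * F \<epsilon> m w)) \<le> 1/2 * ((tau w + 1) * (\<Sum>l<p. (x w l)\<^sup>2)) + 1/2 * F \<epsilon> m w" .
  qed
  also have "\<dots> = 1/2 * integral\<^sup>L \<nu> (\<lambda>w. (tau w + 1) * (\<Sum>l<p. (x w l)\<^sup>2)) + 1/2 * integral\<^sup>L \<nu> (\<lambda>w. F \<epsilon> m w)"
    using intF intX by simp
  finally show ?thesis by simp
qed

end

text \<open>Evaluate r (W^T W) r0 in two ways; this is the resolvent identity for fixed W and two
  values of the regularisation.\<close>

lemma reginv_diff0:
  assumes R: "reginv n p W r \<epsilon>" and R0: "reginv n p W r0 0" and jm: "j < p" "m < p"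
  shows "r j m - r0 j m = - (\<epsilon> * (\<Sum>t<p. r j t * r0 t m))"
proof -
  interpret R: reginv n p W r \<epsilon> by fact
  interpret R0: reginv n p W r0 0 by fact
  define S where "S s t = (\<Sum>a<n. W a s * W a t)" for s t
  have A: "(\<Sum>t<p. S s t * r0 t m) = (if s = m then 1 else 0)" if "s < p" for s
    using R0.inv[OF that jm(2)] unfolding S_def by simp
  have Ss: "S s t = S t s" for s t unfolding S_def by (simp add: mult.commute)
  have B: "(\<Sum>s<p. r j s * S s t) = (if j = t then 1 else 0) - \<epsilon> * r j t" if t: "t < p" for t
  proof -
    have "(\<Sum>s<p. r j s * S s t) = (\<Sum>s<p. S t s * r s j)"
      using jm by (intro sum.cong refl) (auto simp: Ss[of t] R.sym mult.commute)
    also have "\<dots> = (if t = j then 1 else 0) - \<epsilon> * r t j"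
      using R.inv[OF t jm(1)] unfolding S_def by linarith
    finally show ?thesis using R.sym[OF t jm(1)] by auto
  qed
  have "r j m = (\<Sum>s<p. if s = m then r j s else 0)" using jm by simp
  also have "\<dots> = (\<Sum>s<p. r j s * (\<Sum>t<p. S s t * r0 t m))"
    by (intro sum.cong refl) (auto simp: A)
  also have "\<dots> = (\<Sum>s<p. \<Sum>t<p. r j s * S s t * r0 t m)" by (simp add: sum_distrib_left mult.assoc)
  also have "\<dots> = (\<Sum>t<p. \<Sum>s<p. r j s * S s t * r0 t m)" by (rule sum.swap)
  also have "\<dots> = (\<Sum>t<p. (if j = t then r0 t m else 0) - \<epsilon> * (r j t * r0 t m))"
    unfolding sum_distrib_right[symmetric] by (intro sum.cong refl, subst B) (auto simp: algebra_simps)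
  also have "\<dots> = r0 j m - \<epsilon> * (\<Sum>t<p. r j t * r0 t m)"
    using jm by (simp add: sum_subtractf sum_distrib_left)
  finally show ?thesis by simp
qed

subsection \<open>Vanishing regularisation\<close>

definition ek :: "nat \<Rightarrow> real" where "ek k = 1 / real (Suc k)"

lemma ek_pos: "0 < ek k" and ek_le1: "ek k \<le> 1" by (simp_all add: ek_def)

lemma ek_tendsto: "ek \<longlonglongrightarrow> 0"
  unfolding ek_def[abs_def] by (rule LIMSEQ_Suc[OF lim_1_over_n])

context sdesign
begin

sublocale nu: prob_space "\<nu>" by (rule prob_space_gaussM)

lemma u_nonneg: "0 < \<epsilon> \<Longrightarrow> 0 \<le> u \<epsilon> w"
  using reginv.u_nonneg[OF reginv_R_pos] by (simp add: u_def)

lemma eps_u_le: "0 < \<epsilon> \<Longrightarrow> \<epsilon> * u \<epsilon> w \<le> real p"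
  using reginv.eps_u_le[OF reginv_R_pos] by (simp add: u_def)

lemma eps_rr_le: "0 < \<epsilon> \<Longrightarrow> \<epsilon> * rr \<epsilon> w \<le> u \<epsilon> w"
  using reginv.eps_rr_le[OF reginv_R_pos] by (simp add: u_def rr_def)

lemma rr_nonneg: "0 \<le> rr \<epsilon> w"
  unfolding rr_def by (intro sum_nonneg) simp

lemma det_S0: "Determinant.det (S 0 w) \<noteq> 0 \<Longrightarrow> reginv n p (W w) (R 0 w) 0"
  by (rule reginv_R) simp

lemma u_le_u0:
  assumes "0 < \<epsilon>" "Determinant.det (S 0 w) \<noteq> 0" shows "u \<epsilon> w \<le> u 0 w"
proof -
  interpret r: reginv n p "W w" "R \<epsilon> w" \<epsilon> by (rule reginv_R_pos) fact
  interpret r0: reginv n p "W w" "R 0 w" 0 by (rule det_S0) fact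
  show ?thesis unfolding u_def ru_def
  proof (rule sum_mono)
    fix j assume "j \<in> {..<p}"
    then show "R \<epsilon> w j j \<le> R 0 w j j"
      using reginv_mono[OF r.reginv_axioms r0.reginv_axioms, of "\<lambda>i. if i = j then 1 else 0"]
      by (simp add: r.quad_unit r.r_eq_g r0.r_eq_g)
  qed
qed

lemma R_tendsto:
  assumes d: "Determinant.det (S 0 w) \<noteq> 0" shows "(\<lambda>k. R (ek k) w j l) \<longlonglongrightarrow> R 0 w j l"
proof (cases "j < p \<and> l < p")
  case True
  have "(\<lambda>k. R (ek k) w j l - R 0 w j l) \<longlonglongrightarrow> 0"
  proof (rule Lim_null_comparison)
    show "\<forall>\<^sub>F k in sequentially. norm (R (ek k) w j l - R 0 w j l) \<le> ek k * (\<Sum>t<p. u 0 w * \<bar>R 0 w t l\<bar>)"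
    proof (rule always_eventually, rule allI)
      fix k
      interpret r: reginv n p "W w" "R (ek k) w" "ek k" by (rule reginv_R_pos) (rule ek_pos)
      have "norm (R (ek k) w j l - R 0 w j l) = ek k * \<bar>\<Sum>t<p. R (ek k) w j t * R 0 w t l\<bar>"
        using reginv_diff0[OF r.reginv_axioms det_S0[OF d]] True ek_pos[of k] by (simp add: abs_mult)
      also have "\<dots> \<le> ek k * (\<Sum>t<p. u 0 w * \<bar>R 0 w t l\<bar>)"
      proof (intro mult_left_mono order_trans[OF sum_abs] sum_mono)
        fix t assume "t \<in> {..<p}"
        then have "\<bar>R (ek k) w j t\<bar> \<le> u 0 w"
          using r.r_le_u[of j t] True u_le_u0[OF ek_pos d, of k] by (simp add: u_def)
        then show "\<bar>R (ek k) w j t * R 0 w t l\<bar> \<le> u 0 w * \<bar>R 0 w t l\<bar>"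
          by (simp add: abs_mult mult_right_mono)
      qed (use ek_pos[of k] in simp)
      finally show "norm (R (ek k) w j l - R 0 w j l) \<le> ek k * (\<Sum>t<p. u 0 w * \<bar>R 0 w t l\<bar>)" .
    qed
    show "(\<lambda>k. ek k * (\<Sum>t<p. u 0 w * \<bar>R 0 w t l\<bar>)) \<longlonglongrightarrow> 0"
      using tendsto_mult_left_zero[OF ek_tendsto] .
  qed
  then show ?thesis by (simp add: LIM_zero_iff)
qed (auto simp: R_def)

lemma u_tendsto: "Determinant.det (S 0 w) \<noteq> 0 \<Longrightarrow> (\<lambda>k. u (ek k) w) \<longlonglongrightarrow> u 0 w"
  unfolding u_def ru_def by (intro tendsto_sum R_tendsto)

text \<open>Haff's identity with f = 1. The error terms are collected on the left, where they are
  nonnegative, so the identity bounds E u uniformly in \<open>\<epsilon>\<close> as soon as N > p +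
  1.\<close>

lemma haff_identity_const:
  assumes e: "0 < \<epsilon>"
  shows "integral\<^sup>L \<nu> (\<lambda>w. (N - real p - 1) * u \<epsilon> w + \<epsilon> * (rr \<epsilon> w + (u \<epsilon> w)\<^sup>2 + u \<epsilon> w)) = real p"
proof -
  have "integral\<^sup>L \<nu> (\<lambda>w. 1 * (N * u \<epsilon> w - (u \<epsilon> w - \<epsilon> * rr \<epsilon> w) - (real p - \<epsilon> * u \<epsilon> w) * u \<epsilon> w)
      + (\<Sum>a<n. \<Sum>l<p. V \<epsilon> w a l * 0)) = integral\<^sup>L \<nu> (\<lambda>w. 1 * (real p - \<epsilon> * u \<epsilon> w))"
    by (rule haff_identity[OF e]) (auto intro: pd_const)
  moreover have iu: "integrable \<nu> (u \<epsilon>)" using e by (intro integrable_poly) auto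
  moreover have "integrable \<nu> (\<lambda>w. (N - real p - 1) * u \<epsilon> w + \<epsilon> * (rr \<epsilon> w + (u \<epsilon> w)\<^sup>2 + u \<epsilon> w))"
    using e by (intro integrable_poly polybd_add polybd_mult polybd_power) auto
  ultimately have "integral\<^sup>L \<nu> (\<lambda>w. ((N - real p - 1) * u \<epsilon> w + \<epsilon> * (rr \<epsilon> w + (u \<epsilon> w)\<^sup>2 + u \<epsilon> w)) - \<epsilon> * u \<epsilon> w) = integral\<^sup>L \<nu> (\<lambda>w. real p - \<epsilon> * u \<epsilon> w)"
    by (simp add: algebra_simps power2_eq_square)
  moreover have "integral\<^sup>L \<nu> (\<lambda>w. real p) = real p" by (simp add: nu.prob_space)
  ultimately show ?thesis
    using iu \<open>integrable \<nu> (\<lambda>w. (N - real p - 1) * u \<epsilon> w + \<epsilon> * (rr \<epsilon> w + (u \<epsilon> w)\<^sup>2 + u \<epsilon> w))\<close>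
    by (simp only: Bochner_Integration.integral_diff integrable_mult_right integrable_const nu.integrable_const)
qed

context
  assumes Nb: "real p + 1 < N"
begin

lemma E_u_bound:
  assumes e: "0 < \<epsilon>" shows "integral\<^sup>L \<nu> (\<lambda>w. u \<epsilon> w) \<le> real p / (N - real p - 1)"
proof -
  have "(N - real p - 1) * integral\<^sup>L \<nu> (\<lambda>w. u \<epsilon> w) = integral\<^sup>L \<nu> (\<lambda>w. (N - real p - 1) * u \<epsilon> w)" by simp
  also have "\<dots> \<le> integral\<^sup>L \<nu> (\<lambda>w. (N - real p - 1) * u \<epsilon> w + \<epsilon> * (rr \<epsilon> w + (u \<epsilon> w)\<^sup>2 + u \<epsilon> w))"
  proof (rule integral_mono)
    show "integrable \<nu> (\<lambda>w. (N - real p - 1) * u \<epsilon> w)"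
      "integrable \<nu> (\<lambda>w. (N - real p - 1) * u \<epsilon> w + \<epsilon> * (rr \<epsilon> w + (u \<epsilon> w)\<^sup>2 + u \<epsilon> w))"
      using e by (intro integrable_poly polybd_add polybd_mult polybd_power; auto)+
  qed (use e rr_nonneg u_nonneg[OF e] in auto)
  also have "\<dots> = real p" by (rule haff_identity_const[OF e])
  finally show ?thesis using Nb by (simp add: field_simps)
qed

text \<open>On the event that \<open>S\<close> is singular the trace of the regularised inverse is at least of order
  \<open>1/\<epsilon>\<close>, so its bounded expectation makes the event null.\<close>
lemma AE_det_S0: "AE w in \<nu>. Determinant.det (S 0 w) \<noteq> 0"
proof -
  have big: "1 \<le> \<epsilon> * (real p * u \<epsilon> w)" if e: "0 < \<epsilon>" and d: "Determinant.det (S 0 w) = 0" for \<epsilon> w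
  proof -
    interpret r: reginv n p "W w" "R \<epsilon> w" \<epsilon> by (rule reginv_R_pos[OF e])
    obtain v where v: "v \<in> carrier_vec p" "v \<noteq> 0\<^sub>v p" "S 0 w *\<^sub>v v = 0\<^sub>v p"
      using d det_0_iff_vec_prod_zero_field[OF S_carrier] by auto
    define q where "q j = v $ j" for j
    have Sv: "(\<Sum>l<p. (\<Sum>a<n. W w a j * W w a l) * q l) = 0" if j: "j < p" for j
    proof -
      have "(S 0 w *\<^sub>v v) $ j = 0" using v(3) j by simp
      moreover have "(S 0 w *\<^sub>v v) $ j = (\<Sum>l<p. (\<Sum>a<n. W w a j * W w a l) * q l)"
        using j v(1) by (simp add: S_def scalar_prod_def atLeast0LessThan q_def)
      ultimately show ?thesis by simp
    qed
    \<comment> \<open>A kernel vector q of S satisfies (S + \<open>\<epsilon>\<close>) q =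
      \<open>\<epsilon>\<close> q, hence R q = q / \<open>\<epsilon>\<close>. Then |q|^2 =
      \<open>\<epsilon>\<close> q^T R q <= \<open>\<epsilon>\<close> p u |q|^2.\<close>
    have Rv: "q j = \<epsilon> * r.g q j" if j: "j < p" for j
    proof -
      define z where "z = r.g q"
      have "(\<Sum>l<p. (\<Sum>a<n. W w a j * W w a l) * q l) = (\<Sum>l<p. \<Sum>a<n. W w a j * W w a l * q l)"
        by (simp add: sum_distrib_right)
      have qj: "(\<Sum>i<p. R \<epsilon> w j i * (\<Sum>l<p. (\<Sum>a<n. W w a i * W w a l) * q l)) = q j - \<epsilon> * r.g q j"
      proof -
        have B: "(\<Sum>i<p. R \<epsilon> w j i * (\<Sum>a<n. W w a i * W w a l)) = (if j = l then 1 else 0) - \<epsilon> * R \<epsilon> w j l" if l: "l < p" for l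
        proof -
          have "(\<Sum>i<p. R \<epsilon> w j i * (\<Sum>a<n. W w a i * W w a l)) = (\<Sum>i<p. (\<Sum>a<n. W w a l * W w a i) * R \<epsilon> w i j)"
            using j by (intro sum.cong refl) (auto simp: r.sym[of j] mult.commute)
          then show ?thesis using r.inv[OF l j] r.sym[OF l j] by auto
        qed
        have "(\<Sum>i<p. R \<epsilon> w j i * (\<Sum>l<p. (\<Sum>a<n. W w a i * W w a l) * q l)) =
          (\<Sum>i<p. \<Sum>l<p. R \<epsilon> w j i * (\<Sum>a<n. W w a i * W w a l) * q l)"
          by (simp add: sum_distrib_left sum_distrib_right mult.assoc)
        also have "\<dots> = (\<Sum>l<p. \<Sum>i<p. R \<epsilon> w j i * (\<Sum>a<n. W w a i * W w a l) * q l)" by (rule sum.swap)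
        also have "\<dots> = (\<Sum>l<p. (if j = l then q l else 0) - \<epsilon> * (R \<epsilon> w j l * q l))"
          unfolding sum_distrib_right[symmetric] by (intro sum.cong refl, subst B) (auto simp: algebra_simps)
        also have "\<dots> = q j - \<epsilon> * r.g q j"
          using j by (simp add: sum_subtractf sum_distrib_left rg_def)
        finally show ?thesis .
      qed
      have "(\<Sum>i<p. R \<epsilon> w j i * (\<Sum>l<p. (\<Sum>a<n. W w a i * W w a l) * q l)) = 0"
        by (intro sum.neutral) (simp add: Sv)
      with qj show ?thesis by simp
    qed
    have "(\<Sum>j<p. (q j)\<^sup>2) = (\<Sum>j<p. \<epsilon> * (q j * r.g q j))"
      by (intro sum.cong refl) (use Rv in \<open>auto simp: power2_eq_square\<close>)
    also have "\<dots> = \<epsilon> * (\<Sum>j<p. q j * r.g q j)" by (simp add: sum_distrib_left)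
    also have "\<dots> \<le> \<epsilon> * (real p * u \<epsilon> w * (\<Sum>j<p. (q j)\<^sup>2))"
      using e r.quad_le_u[of q] by (intro mult_left_mono) (auto simp: u_def)
    finally have le: "1 * (\<Sum>j<p. (q j)\<^sup>2) \<le> (\<epsilon> * (real p * u \<epsilon> w)) * (\<Sum>j<p. (q j)\<^sup>2)" by (simp add: mult.assoc)
    obtain i where i: "i < p" "v $ i \<noteq> 0"
      using v by (metis carrier_vecD eq_vecI index_zero_vec(1) index_zero_vec(2))
    have "0 < (q i)\<^sup>2" using i by (simp add: q_def)
    also have "\<dots> \<le> (\<Sum>j<p. (q j)\<^sup>2)" using i by (intro member_le_sum) auto
    finally show ?thesis using le by (simp add: mult_le_cancel_right)
  qed
  define A where "A = {w \<in> space \<nu>. Determinant.det (S 0 w) = 0}"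
  have A: "A \<in> sets \<nu>" unfolding A_def by measurable
  have "measure \<nu> A \<le> \<epsilon> * (real p * (real p / (N - real p - 1)))" if e: "0 < \<epsilon>" for \<epsilon>
  proof -
    have iu: "integrable \<nu> (u \<epsilon>)" using e by (intro integrable_poly) auto
    have "measure \<nu> A = integral\<^sup>L \<nu> (\<lambda>w. indicator A w)" using A by simp
    also have "\<dots> \<le> integral\<^sup>L \<nu> (\<lambda>w. \<epsilon> * (real p * u \<epsilon> w))"
    proof (rule integral_mono)
      show "integrable \<nu> (\<lambda>w. \<epsilon> * (real p * u \<epsilon> w))" using iu by simp
      show "indicator A w \<le> \<epsilon> * (real p * u \<epsilon> w)" for w
        using big[OF e, of w] e u_nonneg[OF e, of w] by (auto simp: A_def indicator_def)
      show "integrable \<nu> (\<lambda>w. indicator A w :: real)"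
        using A by (intro integrable_real_indicator) (auto simp: nu.emeasure_eq_measure)
    qed
    also have "\<dots> = \<epsilon> * (real p * integral\<^sup>L \<nu> (\<lambda>w. u \<epsilon> w))" by simp
    also have "\<dots> \<le> \<epsilon> * (real p * (real p / (N - real p - 1)))"
      using E_u_bound[OF e] e by (intro mult_left_mono) auto
    finally show ?thesis .
  qed
  then have "measure \<nu> A \<le> ek k * (real p * (real p / (N - real p - 1)))" for k using ek_pos by blast
  moreover have "(\<lambda>k. ek k * (real p * (real p / (N - real p - 1)))) \<longlonglongrightarrow> 0"
    using tendsto_mult_left_zero[OF ek_tendsto] .
  ultimately have "measure \<nu> A \<le> 0" by (meson LIMSEQ_le_const)
  then have "A \<in> null_sets \<nu>" using A by (intro null_setsI) (simp_all add: nu.emeasure_eq_measure measure_le_0_iff)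
  then show ?thesis by (rule AE_I'[rotated 0]) (auto simp: A_def)
qed

lemma u0_integrable: "integrable \<nu> (u 0)"
proof (rule fatou_integrable[where F="\<lambda>k. u (ek k)" and C="real p / (N - real p - 1)"])
  show "integrable \<nu> (u (ek k))" for k using ek_pos by (intro integrable_poly) auto
  show "0 \<le> u (ek k) w" for k w by (rule u_nonneg[OF ek_pos])
  show "integral\<^sup>L \<nu> (\<lambda>w. u (ek k) w) \<le> real p / (N - real p - 1)" for k by (rule E_u_bound[OF ek_pos])
  show "AE w in \<nu>. (\<lambda>k. u (ek k) w) \<longlonglongrightarrow> u 0 w" using AE_det_S0 by eventually_elim (rule u_tendsto)
qed measurable

lemma E_u0_lim: "(\<lambda>k. LINT w|\<nu>. u (ek k) w) \<longlonglongrightarrow> integral\<^sup>L \<nu> (\<lambda>w. u 0 w)"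
proof (rule integral_dominated_convergence[OF _ _ u0_integrable])
  show "AE w in \<nu>. (\<lambda>k. u (ek k) w) \<longlonglongrightarrow> u 0 w" using AE_det_S0 by eventually_elim (rule u_tendsto)
  show "AE w in \<nu>. norm (u (ek k) w) \<le> u 0 w" for k
    using AE_det_S0 by eventually_elim (use u_le_u0[OF ek_pos, of _ k] u_nonneg[OF ek_pos, of k] in auto)
qed measurable

text \<open>The mean of tr S^{-1}, known from the inverse Wishart law, arises as the limit of
  \<open>haff_identity_const\<close>.\<close>

lemma E_u0: "integral\<^sup>L \<nu> (\<lambda>w. u 0 w) = real p / (N - real p - 1)"
proof -
  have "(\<lambda>k. LINT w|\<nu>. (N - real p - 1) * u (ek k) w + ek k * (rr (ek k) w + (u (ek k) w)\<^sup>2 + u (ek k) w))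
     \<longlonglongrightarrow> integral\<^sup>L \<nu> (\<lambda>w. (N - real p - 1) * u 0 w)"
  proof (rule integral_dominated_convergence)
    \<comment> \<open>N + 1 = (N - p - 1) + 1 + p + 1, where the last three summands stem from
      \<open>\<epsilon>\<close> rr <= u, \<open>\<epsilon>\<close> u <= p and
      \<open>\<epsilon> \<le> 1\<close>.\<close>
    show "integrable \<nu> (\<lambda>w. (N + 1) * u 0 w)" using u0_integrable by simp
    show "AE w in \<nu>. (\<lambda>k. (N - real p - 1) * u (ek k) w + ek k * (rr (ek k) w + (u (ek k) w)\<^sup>2 + u (ek k) w)) \<longlonglongrightarrow> (N - real p - 1) * u 0 w"
      using AE_det_S0
    proof eventually_elim
      fix w assume d: "Determinant.det (S 0 w) \<noteq> 0"
      have "(\<lambda>k. (N - real p - 1) * u (ek k) w + ek k * (rr (ek k) w + (u (ek k) w)\<^sup>2 + u (ek k) w)) \<longlonglongrightarrow>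
         (N - real p - 1) * u 0 w + 0 * (rr 0 w + (u 0 w)\<^sup>2 + u 0 w)"
        unfolding rr_def by (intro tendsto_intros u_tendsto R_tendsto d ek_tendsto)
      then show "(\<lambda>k. (N - real p - 1) * u (ek k) w + ek k * (rr (ek k) w + (u (ek k) w)\<^sup>2 + u (ek k) w)) \<longlonglongrightarrow> (N - real p - 1) * u 0 w"
        by simp
    qed
    fix k
    show "AE w in \<nu>. norm ((N - real p - 1) * u (ek k) w + ek k * (rr (ek k) w + (u (ek k) w)\<^sup>2 + u (ek k) w)) \<le> (N + 1) * u 0 w"
      using AE_det_S0
    proof eventually_elim
      fix w assume d: "Determinant.det (S 0 w) \<noteq> 0"
      let ?u = "u (ek k) w"
      have u: "0 \<le> ?u" by (rule u_nonneg[OF ek_pos])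
      have "ek k * (rr (ek k) w + ?u\<^sup>2 + ?u) = ek k * rr (ek k) w + (ek k * ?u) * ?u + ek k * ?u"
        by (simp add: algebra_simps power2_eq_square)
      also have "\<dots> \<le> ?u + real p * ?u + 1 * ?u"
        using u by (intro add_mono eps_rr_le mult_right_mono eps_u_le ek_pos ek_le1)
      finally have "(N - real p - 1) * ?u + ek k * (rr (ek k) w + ?u\<^sup>2 + ?u) \<le> (N + 1) * ?u" by (simp add: algebra_simps)
      also have "\<dots> \<le> (N + 1) * u 0 w"
        using Nb u_le_u0[OF ek_pos d] by (intro mult_left_mono) auto
      moreover have "0 \<le> (N - real p - 1) * ?u + ek k * (rr (ek k) w + ?u\<^sup>2 + ?u)"
        using Nb u ek_pos[of k] rr_nonneg[of "ek k" w] by simp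
      ultimately show "norm ((N - real p - 1) * ?u + ek k * (rr (ek k) w + ?u\<^sup>2 + ?u)) \<le> (N + 1) * u 0 w" by simp
    qed
  qed measurable
  moreover have "integral\<^sup>L \<nu> (\<lambda>w. (N - real p - 1) * u (ek k) w + ek k * (rr (ek k) w + (u (ek k) w)\<^sup>2 + u (ek k) w)) = real p" for k
    by (rule haff_identity_const[OF ek_pos])
  ultimately have "(\<lambda>k. real p) \<longlonglongrightarrow> (N - real p - 1) * integral\<^sup>L \<nu> (\<lambda>w. u 0 w)" by simp
  then have "real p = (N - real p - 1) * integral\<^sup>L \<nu> (\<lambda>w. u 0 w)" using LIMSEQ_const_iff by blast
  then show ?thesis using Nb by (simp add: field_simps)
qed

end

end

section \<open>Limits, majorants and Haff's identity for the reciprocal form\<close>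

context sdesign_dir
begin

lemma V_tendsto: "Determinant.det (S 0 w) \<noteq> 0 \<Longrightarrow> (\<lambda>k. V (ek k) w a l) \<longlonglongrightarrow> V 0 w a l"
  unfolding V_eq by (intro tendsto_intros R_tendsto)

lemma g_tendsto: "Determinant.det (S 0 w) \<noteq> 0 \<Longrightarrow> (\<lambda>k. g (ek k) m w j) \<longlonglongrightarrow> g 0 m w j"
  unfolding g_eq by (intro tendsto_intros R_tendsto)

lemma h_tendsto: "Determinant.det (S 0 w) \<noteq> 0 \<Longrightarrow> (\<lambda>k. h (ek k) m w a) \<longlonglongrightarrow> h 0 m w a"
  unfolding h_eq by (intro tendsto_intros V_tendsto)

lemma zeta_tendsto: "Determinant.det (S 0 w) \<noteq> 0 \<Longrightarrow> (\<lambda>k. zeta (ek k) m w) \<longlonglongrightarrow> zeta 0 m w"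
  unfolding zeta_def by (intro tendsto_intros g_tendsto)

lemma zeta_le_zeta0:
  assumes "0 < \<epsilon>" "Determinant.det (S 0 w) \<noteq> 0" shows "zeta \<epsilon> m w \<le> zeta 0 m w"
  unfolding zeta_def g_def by (intro reginv_mono[OF reginv_R_pos det_S0] assms)

lemma y2_le_zeta:
  assumes "reginv n p (W w) (R \<epsilon> w) \<epsilon>"
  shows "y2 m w \<le> (tau w + \<epsilon>) * zeta \<epsilon> m w"
  using reginv.norm_le_zeta[OF assms, of "y m w"] by (simp add: y2_def tau_def zeta_def g_def)

text \<open>\<open>norm_le_zeta\<close> gives |y|^2 <= (tau + \<open>\<epsilon>\<close>) zeta, and
  \<open>\<epsilon> \<le> 1\<close> makes the resulting bound the same for all
  \<open>\<epsilon>\<close>.\<close>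

lemma phi_le:
  assumes "0 < \<epsilon>" "\<epsilon> \<le> 1" "0 < y2 m w"
  shows "phi \<epsilon> m w \<le> (tau w + 1) / y2 m w"
proof -
  have z: "0 \<le> zeta \<epsilon> m w" by (rule zeta_nonneg[OF assms(1)])
  have "y2 m w \<le> (tau w + \<epsilon>) * zeta \<epsilon> m w" by (rule y2_le_zeta[OF reginv_R_pos[OF assms(1)]])
  also have "\<dots> \<le> (tau w + 1) * (zeta \<epsilon> m w + \<epsilon>)"
    using assms z tau_nonneg[of w] by (intro mult_mono) auto
  finally show ?thesis using assms z by (simp add: phi_def field_simps)
qed

definition G2 :: "real \<Rightarrow> (nat \<Rightarrow> real) \<Rightarrow> (nat \<times> nat \<Rightarrow> real) \<Rightarrow> real" where
  "G2 \<epsilon> m w = (\<Sum>l<p. (g \<epsilon> m w l)\<^sup>2)"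

definition H2 :: "real \<Rightarrow> (nat \<Rightarrow> real) \<Rightarrow> (nat \<times> nat \<Rightarrow> real) \<Rightarrow> real" where
  "H2 \<epsilon> m w = (\<Sum>a<n. (h \<epsilon> m w a)\<^sup>2)"

text \<open>The product g^T V^T h; at \<open>\<epsilon> = 0\<close> and for nonsingular
  \<open>S\<close> it equals \<open>G2\<close>.\<close>

definition kap :: "real \<Rightarrow> (nat \<Rightarrow> real) \<Rightarrow> (nat \<times> nat \<Rightarrow> real) \<Rightarrow> real" where
  "kap \<epsilon> m w = (\<Sum>l<p. g \<epsilon> m w l * (\<Sum>a<n. V \<epsilon> w a l * h \<epsilon> m w a))"

lemma measurable_G2H2 [measurable]:
  "G2 \<epsilon> m \<in> borel_measurable (\<Pi>\<^sub>M i\<in>I. borel)"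
  "H2 \<epsilon> m \<in> borel_measurable (\<Pi>\<^sub>M i\<in>I. borel)"
  "kap \<epsilon> m \<in> borel_measurable (\<Pi>\<^sub>M i\<in>I. borel)"
  unfolding G2_def[abs_def] H2_def[abs_def] kap_def[abs_def] by measurable

text \<open>The divergence of the field of \<open>haff_identity_phi\<close>, expressed by scalar
  statistics; \<open>haff_rhs\<close> is the pairing of that field with w.\<close>

definition haff_lhs :: "real \<Rightarrow> (nat \<Rightarrow> real) \<Rightarrow> (nat \<times> nat \<Rightarrow> real) \<Rightarrow> real" where
  "haff_lhs \<epsilon> m w = phi \<epsilon> m w * (N * u \<epsilon> w - (u \<epsilon> w - \<epsilon> * rr \<epsilon> w) - (real p - \<epsilon> * u \<epsilon> w) * u \<epsilon> w)
     + 2 * (phi \<epsilon> m w)\<^sup>2 * kap \<epsilon> m w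
     - 2 * (phi \<epsilon> m w)\<^sup>2 * (N * G2 \<epsilon> m w - 2 * kap \<epsilon> m w - (real p - \<epsilon> * u \<epsilon> w) * G2 \<epsilon> m w - u \<epsilon> w * H2 \<epsilon> m w)
     - 8 * (phi \<epsilon> m w)^3 * G2 \<epsilon> m w * H2 \<epsilon> m w"

definition haff_rhs :: "real \<Rightarrow> (nat \<Rightarrow> real) \<Rightarrow> (nat \<times> nat \<Rightarrow> real) \<Rightarrow> real" where
  "haff_rhs \<epsilon> m w = phi \<epsilon> m w * (real p - \<epsilon> * u \<epsilon> w) - 2 * (phi \<epsilon> m w)\<^sup>2 * (zeta \<epsilon> m w - \<epsilon> * G2 \<epsilon> m w)"

lemma measurable_haff_lhs [measurable]: "haff_lhs \<epsilon> m \<in> borel_measurable (\<Pi>\<^sub>M i\<in>I. borel)"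
  "haff_rhs \<epsilon> m \<in> borel_measurable (\<Pi>\<^sub>M i\<in>I. borel)"
  unfolding haff_lhs_def[abs_def] haff_rhs_def[abs_def] by measurable

text \<open>The field is W (phi R - 2 phi^2 g g^T), that is, W times the Jacobian in y of the vector
  phi g. The trace of this Jacobian is the divergence in \<open>shrink_identity\<close>, and its
  product with W^T W has at \<open>\<epsilon> = 0\<close> the trace (p - 2) phi. Stein's identity
  for the field thus links these two quantities.\<close>

lemma haff_identity_phi:
  assumes \<epsilon>: "0 < \<epsilon>"
  shows "integral\<^sup>L \<nu> (\<lambda>w. haff_lhs \<epsilon> m w) = integral\<^sup>L \<nu> (\<lambda>w. haff_rhs \<epsilon> m w)"
proof -
  have cm [measurable]: "(\<lambda>w. c \<epsilon> w a b) \<in> borel_measurable (\<Pi>\<^sub>M i\<in>I. borel)" for a b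
    unfolding c_def by measurable
  have cp: "polybd I (\<lambda>w. c \<epsilon> w a b)" for a b
    unfolding c_def using \<epsilon> by (intro polybd_sum polybd_mult polybd_VuT polybd_W)
  define K where "K a l w = V \<epsilon> w a l * phi \<epsilon> m w - 2 * ((h \<epsilon> m w a * g \<epsilon> m w l) * (phi \<epsilon> m w * phi \<epsilon> m w))" for a l w
  define P' where "P' a l w = 2 * (phi \<epsilon> m w)\<^sup>2 * (h \<epsilon> m w a - e a) * g \<epsilon> m w l" for a l w
  define K' where "K' a l w = ((Q a a * R \<epsilon> w l l - V \<epsilon> w a l * V \<epsilon> w a l - c \<epsilon> w a a * R \<epsilon> w l l) * phi \<epsilon> m w + V \<epsilon> w a l * P' a l w)
    - 2 * (((Q a a * g \<epsilon> m w l - V \<epsilon> w a l * h \<epsilon> m w a - c \<epsilon> w a a * g \<epsilon> m w l + V \<epsilon> w a l * e a) * g \<epsilon> m w l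
           + h \<epsilon> m w a * (R \<epsilon> w l l * e a - R \<epsilon> w l l * h \<epsilon> m w a - V \<epsilon> w a l * g \<epsilon> m w l)) * (phi \<epsilon> m w * phi \<epsilon> m w)
         + (h \<epsilon> m w a * g \<epsilon> m w l) * (P' a l w * phi \<epsilon> m w + phi \<epsilon> m w * P' a l w))" for a l w
  have main: "integral\<^sup>L \<nu> (\<lambda>w. \<Sum>a<n. \<Sum>l<p. K' a l w) = integral\<^sup>L \<nu> (\<lambda>w. \<Sum>a<n. \<Sum>l<p. w (a, l) * K a l w)"
  proof (rule stein_grid)
    fix a l assume al: "a < n" "l < p"
    show "pd (a, l) (K a l) (K' a l)"
      unfolding K_def[abs_def] K'_def[abs_def] P'_def
      by (intro pd_diff pd_cmult pd_mult pd_V pd_h pd_g pd_phi \<epsilon> al)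
    show "polybd I (K a l)" unfolding K_def[abs_def]
      using \<epsilon> by (intro polybd_diff polybd_mult polybd_const polybd_VuT polybd_dir polybd_phi)
    show "polybd I (K' a l)" unfolding K'_def[abs_def] P'_def
      using \<epsilon> by (intro polybd_diff polybd_add polybd_mult polybd_power polybd_const polybd_VuT polybd_dir polybd_phi polybd_R cp)
    show "K a l \<in> borel_measurable (\<Pi>\<^sub>M i\<in>I. borel)" unfolding K_def[abs_def] by measurable
    show "K' a l \<in> borel_measurable (\<Pi>\<^sub>M i\<in>I. borel)" unfolding K'_def[abs_def] P'_def by measurable
  qed
  have A: "(\<Sum>a<n. \<Sum>l<p. K' a l w) = haff_lhs \<epsilon> m w" for w
  proof -
    interpret r: reginv n p "W w" "R \<epsilon> w" \<epsilon> by (rule reginv_R_pos[OF \<epsilon>])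
    let ?f = "phi \<epsilon> m w"
    have C: "(\<Sum>a<n. c \<epsilon> w a a) = real p - \<epsilon> * u \<epsilon> w"
      using r.trace_rS by (simp add: c_def V_def u_def)
    have VV: "(\<Sum>l<p. \<Sum>a<n. V \<epsilon> w a l * V \<epsilon> w a l) = u \<epsilon> w - \<epsilon> * rr \<epsilon> w"
      using r.trace_VV by (subst sum.swap) (simp add: V_def u_def rr_def)
    have l: "(\<Sum>a<n. K' a l w) = ?f * (N * R \<epsilon> w l l - (\<Sum>a<n. V \<epsilon> w a l * V \<epsilon> w a l) - (\<Sum>a<n. c \<epsilon> w a a) * R \<epsilon> w l l)
       + 2 * ?f\<^sup>2 * (g \<epsilon> m w l * (\<Sum>a<n. V \<epsilon> w a l * h \<epsilon> m w a))
       - 2 * ?f\<^sup>2 * (N * (g \<epsilon> m w l)\<^sup>2 - 2 * (g \<epsilon> m w l * (\<Sum>a<n. V \<epsilon> w a l * h \<epsilon> m w a)) - (\<Sum>a<n. c \<epsilon> w a a) * (g \<epsilon> m w l)\<^sup>2 - R \<epsilon> w l l * H2 \<epsilon> m w)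
       - 8 * ?f^3 * (g \<epsilon> m w l)\<^sup>2 * H2 \<epsilon> m w" for l
    proof -
      have "(\<Sum>a<n. K' a l w) = ?f * (N * R \<epsilon> w l l - (\<Sum>a<n. V \<epsilon> w a l * V \<epsilon> w a l) - (\<Sum>a<n. c \<epsilon> w a a) * R \<epsilon> w l l)
       + 2 * ?f\<^sup>2 * (g \<epsilon> m w l * (\<Sum>a<n. V \<epsilon> w a l * h \<epsilon> m w a))
       - 2 * ?f\<^sup>2 * (N * (g \<epsilon> m w l)\<^sup>2 - 2 * (g \<epsilon> m w l * (\<Sum>a<n. V \<epsilon> w a l * h \<epsilon> m w a)) - (\<Sum>a<n. c \<epsilon> w a a) * (g \<epsilon> m w l)\<^sup>2 - R \<epsilon> w l l * H2 \<epsilon> m w)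
       - 8 * ?f^3 * (g \<epsilon> m w l)\<^sup>2 * H2 \<epsilon> m w
       - 4 * ?f\<^sup>2 * g \<epsilon> m w l * (\<Sum>a<n. e a * V \<epsilon> w a l) - 2 * ?f\<^sup>2 * R \<epsilon> w l l * (\<Sum>a<n. e a * h \<epsilon> m w a)
       + 8 * ?f^3 * (g \<epsilon> m w l)\<^sup>2 * (\<Sum>a<n. e a * h \<epsilon> m w a)"
        unfolding N_def H2_def sum_distrib_left sum_distrib_right sum_subtractf[symmetric] sum.distrib[symmetric]
        by (intro sum.cong refl) (simp add: K'_def P'_def algebra_simps power2_eq_square power3_eq_cube)
      \<comment> \<open>Derivatives of y carry the factor e_a; summed over a these terms vanish, as
        V and h are orthogonal to e.\<close>
      then show ?thesis by (simp add: eV eh)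
    qed
    have "(\<Sum>a<n. \<Sum>l<p. K' a l w) = (\<Sum>l<p. \<Sum>a<n. K' a l w)" by (rule sum.swap)
    also have "\<dots> = ?f * (N * (\<Sum>l<p. R \<epsilon> w l l) - (\<Sum>l<p. \<Sum>a<n. V \<epsilon> w a l * V \<epsilon> w a l) - (\<Sum>a<n. c \<epsilon> w a a) * (\<Sum>l<p. R \<epsilon> w l l))
       + 2 * ?f\<^sup>2 * (\<Sum>l<p. g \<epsilon> m w l * (\<Sum>a<n. V \<epsilon> w a l * h \<epsilon> m w a))
       - 2 * ?f\<^sup>2 * (N * (\<Sum>l<p. (g \<epsilon> m w l)\<^sup>2) - 2 * (\<Sum>l<p. g \<epsilon> m w l * (\<Sum>a<n. V \<epsilon> w a l * h \<epsilon> m w a)) - (\<Sum>a<n. c \<epsilon> w a a) * (\<Sum>l<p. (g \<epsilon> m w l)\<^sup>2) - (\<Sum>l<p. R \<epsilon> w l l) * H2 \<epsilon> m w)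
       - 8 * ?f^3 * (\<Sum>l<p. (g \<epsilon> m w l)\<^sup>2) * H2 \<epsilon> m w"
      unfolding l by (simp only: sum.distrib sum_subtractf sum_distrib_left[symmetric] sum_distrib_right[symmetric])
    also have "\<dots> = haff_lhs \<epsilon> m w"
      unfolding haff_lhs_def C VV by (simp add: u_def ru_def kap_def G2_def)
    finally show ?thesis .
  qed
  have B: "(\<Sum>a<n. \<Sum>l<p. w (a, l) * K a l w) = haff_rhs \<epsilon> m w" for w
  proof -
    interpret r: reginv n p "W w" "R \<epsilon> w" \<epsilon> by (rule reginv_R_pos[OF \<epsilon>])
    let ?f = "phi \<epsilon> m w"
    have wh: "(\<Sum>a<n. w (a, l) * h \<epsilon> m w a) = y m w l - \<epsilon> * g \<epsilon> m w l" if l: "l < p" for l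
    proof -
      have "(\<Sum>a<n. w (a, l) * h \<epsilon> m w a) = (\<Sum>a<n. \<Sum>j<p. w (a, l) * V \<epsilon> w a j * y m w j)"
        by (simp add: h_eq sum_distrib_left mult.assoc)
      also have "\<dots> = (\<Sum>j<p. (\<Sum>a<n. w (a, l) * V \<epsilon> w a j) * y m w j)"
        by (subst sum.swap) (simp add: sum_distrib_right)
      also have "\<dots> = (\<Sum>j<p. \<Sum>a<n. W w a l * V \<epsilon> w a j * y m w j)"
        by (simp add: sum_wV[OF l] sum_distrib_right)
      also have "\<dots> = (\<Sum>a<n. h \<epsilon> m w a * W w a l)"
        by (subst sum.swap) (simp add: h_eq sum_distrib_left sum_distrib_right mult_ac)
      also have "\<dots> = y m w l - \<epsilon> * g \<epsilon> m w l" using r.hW[OF l, of "y m w"] by (simp add: h_def g_def)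
      finally show ?thesis .
    qed
    have wV: "(\<Sum>l<p. \<Sum>a<n. w (a, l) * V \<epsilon> w a l) = real p - \<epsilon> * u \<epsilon> w"
    proof -
      have "(\<Sum>l<p. \<Sum>a<n. w (a, l) * V \<epsilon> w a l) = (\<Sum>l<p. \<Sum>a<n. V \<epsilon> w a l * W w a l)"
        by (rule sum.cong[OF refl]) (simp add: sum_wV mult.commute)
      also have "\<dots> = (\<Sum>a<n. \<Sum>l<p. V \<epsilon> w a l * W w a l)" by (rule sum.swap)
      finally show ?thesis using r.trace_rS by (simp add: V_def u_def)
    qed
    have "(\<Sum>a<n. \<Sum>l<p. w (a, l) * K a l w) = (\<Sum>l<p. \<Sum>a<n. w (a, l) * K a l w)" by (rule sum.swap)
    also have "\<dots> = (\<Sum>l<p. ?f * (\<Sum>a<n. w (a, l) * V \<epsilon> w a l) - 2 * ?f\<^sup>2 * (g \<epsilon> m w l * (\<Sum>a<n. w (a, l) * h \<epsilon> m w a)))"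
      unfolding sum_distrib_left sum_subtractf[symmetric]
      by (intro sum.cong refl) (simp add: K_def algebra_simps power2_eq_square)
    also have "\<dots> = (\<Sum>l<p. ?f * (\<Sum>a<n. w (a, l) * V \<epsilon> w a l) - 2 * ?f\<^sup>2 * (g \<epsilon> m w l * (y m w l - \<epsilon> * g \<epsilon> m w l)))"
      by (intro sum.cong refl) (simp add: wh)
    also have "\<dots> = ?f * (\<Sum>l<p. \<Sum>a<n. w (a, l) * V \<epsilon> w a l) - 2 * ?f\<^sup>2 * (\<Sum>l<p. g \<epsilon> m w l * (y m w l - \<epsilon> * g \<epsilon> m w l))"
      by (simp only: sum_subtractf sum_distrib_left[symmetric])
    also have "(\<Sum>l<p. g \<epsilon> m w l * (y m w l - \<epsilon> * g \<epsilon> m w l)) = zeta \<epsilon> m w - \<epsilon> * G2 \<epsilon> m w"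
      unfolding zeta_def G2_def sum_distrib_left sum_subtractf[symmetric]
      by (intro sum.cong refl) (simp add: algebra_simps power2_eq_square)
    finally show ?thesis unfolding wV haff_rhs_def .
  qed
  show ?thesis using main unfolding A B .
qed

definition CF :: real where "CF = integral\<^sup>L \<nu> (\<lambda>w. (tau w + 1) * (\<Sum>l<p. (x w l)\<^sup>2))"

definition D1 :: "(nat \<Rightarrow> real) \<Rightarrow> (nat \<times> nat \<Rightarrow> real) \<Rightarrow> real" where
  "D1 m w = (tau w + 1) / y2 m w"

lemma measurable_D1 [measurable]: "D1 m \<in> borel_measurable (\<Pi>\<^sub>M i\<in>I. borel)"
  unfolding D1_def[abs_def] by measurable

lemma F_tendsto: "0 < y2 m w \<Longrightarrow> (\<lambda>k. F (ek k) m w) \<longlonglongrightarrow> D1 m w"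
proof -
  assume y: "0 < y2 m w"
  have "(\<lambda>k. (tau w + 1) * (1 / (y2 m w + ek k))) \<longlonglongrightarrow> (tau w + 1) * (1 / (y2 m w + 0))"
    using y by (intro tendsto_intros ek_tendsto) auto
  then show ?thesis by (simp add: F_def rho_def D1_def)
qed

lemma zeta0_pos:
  assumes "Determinant.det (S 0 w) \<noteq> 0" "0 < y2 m w" shows "0 < zeta 0 m w"
proof -
  have "0 < (tau w + 0) * zeta 0 m w" using y2_le_zeta[OF det_S0[OF assms(1)], of m] assms(2) by simp
  then show ?thesis using tau_nonneg[of w] by (simp add: zero_less_mult_iff)
qed

text \<open>Everything follows from phi zeta <= 1, G2 <= u zeta and H2 <= zeta: each product in
  \<open>haff_lhs\<close> or \<open>haff_rhs\<close> is bounded by a constant times phi u or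
  phi.\<close>

lemma phi_bounds:
  assumes e: "0 < \<epsilon>"
  shows "(phi \<epsilon> m w)\<^sup>2 * zeta \<epsilon> m w \<le> phi \<epsilon> m w"
    and "0 \<le> G2 \<epsilon> m w" "0 \<le> H2 \<epsilon> m w"
    and "(phi \<epsilon> m w)\<^sup>2 * G2 \<epsilon> m w \<le> phi \<epsilon> m w * u \<epsilon> w"
    and "\<epsilon> * G2 \<epsilon> m w \<le> zeta \<epsilon> m w"
    and "(phi \<epsilon> m w)\<^sup>2 * H2 \<epsilon> m w \<le> phi \<epsilon> m w"
    and "(phi \<epsilon> m w)^3 * G2 \<epsilon> m w * H2 \<epsilon> m w \<le> phi \<epsilon> m w * u \<epsilon> w"
    and "\<bar>kap \<epsilon> m w\<bar> \<le> (1 + (real p)\<^sup>2) * G2 \<epsilon> m w"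
proof -
  interpret r: reginv n p "W w" "R \<epsilon> w" \<epsilon> by (rule reginv_R_pos[OF e])
  let ?f = "phi \<epsilon> m w" and ?z = "zeta \<epsilon> m w" and ?u = "u \<epsilon> w"
  have f: "0 < ?f" by (rule phi_pos[OF e])
  have u: "0 \<le> ?u" by (rule u_nonneg[OF e])
  have fz: "?f * ?z \<le> 1" using phi_zeta[OF e, of m w] f e by simp
  have "?f * (?f * ?z) \<le> ?f * 1" using fz f by (intro mult_left_mono) auto
  then show f2z: "?f\<^sup>2 * ?z \<le> ?f" by (simp add: power2_eq_square mult.assoc)
  show G0: "0 \<le> G2 \<epsilon> m w" unfolding G2_def by (intro sum_nonneg) simp
  show H0: "0 \<le> H2 \<epsilon> m w" unfolding H2_def by (intro sum_nonneg) simp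
  have Gz: "G2 \<epsilon> m w \<le> ?u * ?z" using r.g_sq_le[of "y m w"] by (simp add: G2_def g_def u_def zeta_def)
  have Hz: "H2 \<epsilon> m w \<le> ?z" using r.h_bound[of "y m w"] by (simp add: H2_def h_def g_def zeta_def)
  show "\<epsilon> * G2 \<epsilon> m w \<le> ?z" using r.g_bound[of "y m w"] by (simp add: G2_def g_def zeta_def)
  have "?f\<^sup>2 * G2 \<epsilon> m w \<le> ?f\<^sup>2 * (?u * ?z)" using Gz by (intro mult_left_mono) auto
  also have "\<dots> = ?u * (?f\<^sup>2 * ?z)" by simp
  also have "\<dots> \<le> ?u * ?f" using f2z u by (rule mult_left_mono)
  finally show f2G: "?f\<^sup>2 * G2 \<epsilon> m w \<le> ?f * ?u" by (simp add: mult.commute)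
  have "?f\<^sup>2 * H2 \<epsilon> m w \<le> ?f\<^sup>2 * ?z" using Hz by (intro mult_left_mono) auto
  then show f2H: "?f\<^sup>2 * H2 \<epsilon> m w \<le> ?f" using f2z by linarith
  have "?f * H2 \<epsilon> m w \<le> 1"
    using order_trans[OF mult_left_mono[OF Hz less_imp_le[OF f]] fz] .
  then have "(?f * H2 \<epsilon> m w) * (?f\<^sup>2 * G2 \<epsilon> m w) \<le> 1 * (?f * ?u)"

    by (rule mult_mono) (use f2G G0 H0 f u in auto)
  then show "?f^3 * G2 \<epsilon> m w * H2 \<epsilon> m w \<le> ?f * ?u"
    by (simp add: power2_eq_square power3_eq_cube mult_ac)
  have k: "kap \<epsilon> m w = G2 \<epsilon> m w - \<epsilon> * (\<Sum>l<p. g \<epsilon> m w l * r.g (g \<epsilon> m w) l)"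
  proof -
    have "kap \<epsilon> m w = (\<Sum>l<p. g \<epsilon> m w l * (g \<epsilon> m w l - \<epsilon> * r.g (g \<epsilon> m w) l))"
      unfolding kap_def
    proof (rule sum.cong[OF refl])
      fix l assume "l \<in> {..<p}"
      then have "(\<Sum>a<n. V \<epsilon> w a l * h \<epsilon> m w a) = g \<epsilon> m w l - \<epsilon> * r.g (g \<epsilon> m w) l"
        using r.hV[of l "y m w"] by (simp add: V_def h_def g_def rg_def[of _ _ "rg _ _ _"] mult.commute)
      then show "g \<epsilon> m w l * (\<Sum>a<n. V \<epsilon> w a l * h \<epsilon> m w a) = g \<epsilon> m w l * (g \<epsilon> m w l - \<epsilon> * r.g (g \<epsilon> m w) l)" by simp
    qed
    then show ?thesis by (simp add: G2_def right_diff_distrib sum_subtractf sum_distrib_left power2_eq_square mult_ac)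
  qed
  \<comment> \<open>\<open>kap\<close> differs from \<open>G2\<close> by \<open>\<epsilon>\<close>
    times the form of R at g, which is at most \<open>\<epsilon>\<close> p u G2 and hence at most
    p^2 G2.\<close>
  have "\<epsilon> * (\<Sum>l<p. g \<epsilon> m w l * r.g (g \<epsilon> m w) l) \<le> \<epsilon> * (real p * ?u * G2 \<epsilon> m w)"
    using r.quad_le_u[of "g \<epsilon> m w"] e by (intro mult_left_mono) (auto simp: G2_def u_def)
  also have "\<dots> = (real p * G2 \<epsilon> m w) * (\<epsilon> * ?u)" by simp
  also have "\<dots> \<le> (real p * G2 \<epsilon> m w) * real p" using eps_u_le[OF e] G0 by (intro mult_left_mono) auto
  finally have "\<epsilon> * (\<Sum>l<p. g \<epsilon> m w l * r.g (g \<epsilon> m w) l) \<le> (real p)\<^sup>2 * G2 \<epsilon> m w" by (simp add: power2_eq_square mult_ac)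
  moreover have "0 \<le> \<epsilon> * (\<Sum>l<p. g \<epsilon> m w l * r.g (g \<epsilon> m w) l)" using r.quad_nonneg e by simp
  moreover have "0 \<le> (real p)\<^sup>2 * G2 \<epsilon> m w" using G0 by simp
  ultimately show "\<bar>kap \<epsilon> m w\<bar> \<le> (1 + (real p)\<^sup>2) * G2 \<epsilon> m w"
    unfolding k using G0 by (auto simp: abs_if algebra_simps)
qed

lemma integrable_F: "0 < \<epsilon> \<Longrightarrow> integrable \<nu> (F \<epsilon> m)"
  by (intro integrable_poly polybd_F) auto

context
  assumes Nb: "real p + 1 < N"
begin

text \<open>For positive \<open>\<epsilon>\<close> the expectations agree with those of u by
  \<open>dir_identity\<close>. As zeta lies below its value at 0, Fatou's lemma comes first and
  domination by the limit second.\<close>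

lemma quad_integrable: "integrable \<nu> (zeta 0 (\<lambda>_. 0))"
  and E_quad: "integral\<^sup>L \<nu> (\<lambda>w. zeta 0 (\<lambda>_. 0) w) = real p / (N - real p - 1)"
proof -
  have z: "zeta \<epsilon> (\<lambda>_. 0) w = (\<Sum>l<p. x w l * g \<epsilon> (\<lambda>_. 0) w l)" for \<epsilon> w
    by (simp add: zeta_def y_def)
  have E: "integral\<^sup>L \<nu> (\<lambda>w. zeta (ek k) (\<lambda>_. 0) w) = integral\<^sup>L \<nu> (\<lambda>w. u (ek k) w)" for k
    unfolding z using dir_identity[OF ek_pos] by simp
  have lim: "AE w in \<nu>. (\<lambda>k. zeta (ek k) (\<lambda>_. 0) w) \<longlonglongrightarrow> zeta 0 (\<lambda>_. 0) w"
    using AE_det_S0[OF Nb] by eventually_elim (rule zeta_tendsto)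
  show int: "integrable \<nu> (zeta 0 (\<lambda>_. 0))"
  proof (rule fatou_integrable[where F="\<lambda>k. zeta (ek k) (\<lambda>_. 0)" and C="real p / (N - real p - 1)"])
    show "integrable \<nu> (zeta (ek k) (\<lambda>_. 0))" for k using ek_pos by (intro integrable_poly) auto
    show "0 \<le> zeta (ek k) (\<lambda>_. 0) w" for k w by (rule zeta_nonneg[OF ek_pos])
    show "integral\<^sup>L \<nu> (\<lambda>w. zeta (ek k) (\<lambda>_. 0) w) \<le> real p / (N - real p - 1)" for k
      unfolding E by (rule E_u_bound[OF Nb ek_pos])
  qed (use lim in measurable)
  have "(\<lambda>k. LINT w|\<nu>. zeta (ek k) (\<lambda>_. 0) w) \<longlonglongrightarrow> integral\<^sup>L \<nu> (\<lambda>w. zeta 0 (\<lambda>_. 0) w)"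
  proof (rule integral_dominated_convergence[OF _ _ int lim])
    show "AE w in \<nu>. norm (zeta (ek k) (\<lambda>_. 0) w) \<le> zeta 0 (\<lambda>_. 0) w" for k
      using AE_det_S0[OF Nb] by eventually_elim (use zeta_le_zeta0[OF ek_pos, of _ k] zeta_nonneg[OF ek_pos, of k] in auto)
  qed measurable
  moreover have "(\<lambda>k. LINT w|\<nu>. u (ek k) w) \<longlonglongrightarrow> real p / (N - real p - 1)"
    using E_u0_lim[OF Nb] unfolding E_u0[OF Nb] .
  ultimately show "integral\<^sup>L \<nu> (\<lambda>w. zeta 0 (\<lambda>_. 0) w) = real p / (N - real p - 1)"
    unfolding E by (rule LIMSEQ_unique)
qed

context
  assumes p3: "3 \<le> p"
begin

lemma E_F_le: "0 < \<epsilon> \<Longrightarrow> integral\<^sup>L \<nu> (\<lambda>w. F \<epsilon> m w) \<le> CF"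
  using E_F_bound[OF _ p3] by (simp add: CF_def)

text \<open>Where y vanishes F is at least 1 / \<open>\<epsilon>\<close>, so the bound on its
  expectation makes this event null.\<close>

lemma AE_y2: "AE w in \<nu>. 0 < y2 m w"
proof -
  define A where "A = {w \<in> space \<nu>. y2 m w = 0}"
  have A: "A \<in> sets \<nu>" unfolding A_def by measurable
  have "measure \<nu> A \<le> \<epsilon> * CF" if e: "0 < \<epsilon>" for \<epsilon>
  proof -
    have "measure \<nu> A = integral\<^sup>L \<nu> (\<lambda>w. indicator A w)" using A by simp
    also have "\<dots> \<le> integral\<^sup>L \<nu> (\<lambda>w. \<epsilon> * F \<epsilon> m w)"
    proof (rule integral_mono)
      show "integrable \<nu> (\<lambda>w. \<epsilon> * F \<epsilon> m w)" using integrable_F[OF e] by simp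
      show "integrable \<nu> (\<lambda>w. indicator A w :: real)"
        using A by (intro integrable_real_indicator) (auto simp: nu.emeasure_eq_measure)
      show "indicator A w \<le> \<epsilon> * F \<epsilon> m w" for w
        using e less_imp_le[OF F_pos[OF e, of m w]] tau_nonneg[of w] mult_nonneg_nonneg[OF less_imp_le[OF e] less_imp_le[OF F_pos[OF e, of m w]]]
        by (cases "w \<in> A") (auto simp: A_def F_def rho_def)
    qed
    also have "\<dots> = \<epsilon> * integral\<^sup>L \<nu> (\<lambda>w. F \<epsilon> m w)" by simp
    also have "\<dots> \<le> \<epsilon> * CF" using E_F_le[OF e] e by (intro mult_left_mono) auto
    finally show ?thesis .
  qed
  then have "measure \<nu> A \<le> ek k * CF" for k using ek_pos by blast
  moreover have "(\<lambda>k. ek k * CF) \<longlonglongrightarrow> 0" using tendsto_mult_left_zero[OF ek_tendsto] .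
  ultimately have "measure \<nu> A \<le> 0" by (meson LIMSEQ_le_const)
  then have "A \<in> null_sets \<nu>" using A by (intro null_setsI) (simp_all add: nu.emeasure_eq_measure measure_le_0_iff)
  then show ?thesis using y2_nonneg[of m] by (intro AE_I'[of A]) (auto simp: A_def less_le)
qed

lemma D1_integrable: "integrable \<nu> (D1 m)"
proof (rule fatou_integrable[where F="\<lambda>k. F (ek k) m" and C=CF])
  show "AE w in \<nu>. (\<lambda>k. F (ek k) m w) \<longlonglongrightarrow> D1 m w" using AE_y2 by eventually_elim (rule F_tendsto)
qed (auto intro: integrable_F E_F_le less_imp_le F_pos ek_pos simp: measurable_cong_sets[OF sets_gaussM refl])

text \<open>Haff's identity with f = F. The derivatives of F contribute 2 rho (p -
  \<open>\<epsilon>\<close> u), which is nonnegative, and what remains is (N - p - 1) E (F u) <= p E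
  F. In the limit this makes \<open>D1\<close> times tr S^{-1} integrable, the majorant for
  \<open>haff_lhs\<close>.\<close>

lemma E_Fu_le:
  assumes e: "0 < \<epsilon>" shows "integral\<^sup>L \<nu> (\<lambda>w. F \<epsilon> m w * u \<epsilon> w) \<le> real p * CF / (N - real p - 1)"
proof -
  define f' where "f' a l w = 2 * W w a l * rho \<epsilon> m w + (tau w + 1) * - (2 * (rho \<epsilon> m w)\<^sup>2 * e a * y m w l)" for a l w
  have mf' [measurable]: "f' a l \<in> borel_measurable (\<Pi>\<^sub>M i\<in>I. borel)" for a l
    unfolding f'_def[abs_def] by measurable
  have pf': "polybd I (f' a l)" for a l
    unfolding f'_def[abs_def] using e by (intro polybd_add polybd_mult polybd_minus polybd_const polybd_W polybd_rho polybd_dir polybd_power polybd_VuT)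
  have haff': "integral\<^sup>L \<nu> (\<lambda>w. F \<epsilon> m w * (N * u \<epsilon> w - (u \<epsilon> w - \<epsilon> * rr \<epsilon> w) - (real p - \<epsilon> * u \<epsilon> w) * u \<epsilon> w)
      + (\<Sum>a<n. \<Sum>l<p. V \<epsilon> w a l * f' a l w)) = integral\<^sup>L \<nu> (\<lambda>w. F \<epsilon> m w * (real p - \<epsilon> * u \<epsilon> w))"
  proof (rule haff_identity[OF e])
    show "pd (a, l) (F \<epsilon> m) (f' a l)" if "a < n" "l < p" for a l
      unfolding f'_def[abs_def] by (rule pd_F[OF e that])
  qed (rule measurable_F mf' polybd_F[OF e] pf')+
  have VF: "(\<Sum>a<n. \<Sum>l<p. V \<epsilon> w a l * f' a l w) \<ge> 0" for w
  proof -
    interpret r: reginv n p "W w" "R \<epsilon> w" \<epsilon> by (rule reginv_R_pos[OF e])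
    have "(\<Sum>a<n. \<Sum>l<p. V \<epsilon> w a l * f' a l w) = (\<Sum>l<p. \<Sum>a<n. V \<epsilon> w a l * f' a l w)" by (rule sum.swap)
    also have "\<dots> = (\<Sum>l<p. 2 * rho \<epsilon> m w * (\<Sum>a<n. V \<epsilon> w a l * W w a l)
        - (2 * (tau w + 1) * (rho \<epsilon> m w)\<^sup>2 * y m w l) * (\<Sum>a<n. e a * V \<epsilon> w a l))"
      unfolding sum_distrib_left sum_subtractf[symmetric] f'_def by (intro sum.cong refl) (simp add: algebra_simps)
    also have "\<dots> = 2 * rho \<epsilon> m w * (\<Sum>l<p. \<Sum>a<n. V \<epsilon> w a l * W w a l)"
      by (simp only: eV mult_zero_right diff_0_right sum_distrib_left[symmetric])
    also have "(\<Sum>l<p. \<Sum>a<n. V \<epsilon> w a l * W w a l) = real p - \<epsilon> * u \<epsilon> w"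
      using r.trace_rS by (subst sum.swap) (simp add: V_def u_def)
    finally show ?thesis using rho_pos[OF e, of m w] eps_u_le[OF e, of w] by simp
  qed
  have "(N - real p - 1) * integral\<^sup>L \<nu> (\<lambda>w. F \<epsilon> m w * u \<epsilon> w) = integral\<^sup>L \<nu> (\<lambda>w. (N - real p - 1) * (F \<epsilon> m w * u \<epsilon> w))" by simp
  also have "\<dots> \<le> integral\<^sup>L \<nu> (\<lambda>w. F \<epsilon> m w * (N * u \<epsilon> w - (u \<epsilon> w - \<epsilon> * rr \<epsilon> w) - (real p - \<epsilon> * u \<epsilon> w) * u \<epsilon> w)
      + (\<Sum>a<n. \<Sum>l<p. V \<epsilon> w a l * f' a l w))"
  proof (rule integral_mono)
    show "integrable \<nu> (\<lambda>w. (N - real p - 1) * (F \<epsilon> m w * u \<epsilon> w))"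
      using e by (intro integrable_poly polybd_mult polybd_const polybd_F polybd_VuT) auto
    show "integrable \<nu> (\<lambda>w. F \<epsilon> m w * (N * u \<epsilon> w - (u \<epsilon> w - \<epsilon> * rr \<epsilon> w) - (real p - \<epsilon> * u \<epsilon> w) * u \<epsilon> w)
      + (\<Sum>a<n. \<Sum>l<p. V \<epsilon> w a l * f' a l w))"
      using e by (intro integrable_poly polybd_mult polybd_const polybd_F polybd_VuT polybd_add polybd_diff polybd_sum pf') auto
    fix w
    have "(N - real p - 1) * u \<epsilon> w \<le> N * u \<epsilon> w - (u \<epsilon> w - \<epsilon> * rr \<epsilon> w) - (real p - \<epsilon> * u \<epsilon> w) * u \<epsilon> w"
      using e rr_nonneg[of \<epsilon> w] by (simp add: algebra_simps)
    then have "F \<epsilon> m w * ((N - real p - 1) * u \<epsilon> w) \<le> F \<epsilon> m w * (N * u \<epsilon> w - (u \<epsilon> w - \<epsilon> * rr \<epsilon> w) - (real p - \<epsilon> * u \<epsilon> w) * u \<epsilon> w)"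
      using F_pos[OF e, of m w] by (intro mult_left_mono) auto
    with VF[of w] show "(N - real p - 1) * (F \<epsilon> m w * u \<epsilon> w) \<le> F \<epsilon> m w * (N * u \<epsilon> w - (u \<epsilon> w - \<epsilon> * rr \<epsilon> w) - (real p - \<epsilon> * u \<epsilon> w) * u \<epsilon> w)
      + (\<Sum>a<n. \<Sum>l<p. V \<epsilon> w a l * f' a l w)" by (simp only: mult.left_commute[of "F \<epsilon> m w"])
  qed
  also have "\<dots> = integral\<^sup>L \<nu> (\<lambda>w. F \<epsilon> m w * (real p - \<epsilon> * u \<epsilon> w))" by (rule haff')
  also have "\<dots> \<le> integral\<^sup>L \<nu> (\<lambda>w. real p * F \<epsilon> m w)"
  proof (rule integral_mono)
    show "integrable \<nu> (\<lambda>w. F \<epsilon> m w * (real p - \<epsilon> * u \<epsilon> w))"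
      using e by (intro integrable_poly polybd_mult polybd_diff polybd_const polybd_F polybd_VuT) auto
    show "integrable \<nu> (\<lambda>w. real p * F \<epsilon> m w)" using integrable_F[OF e] by simp
    show "F \<epsilon> m w * (real p - \<epsilon> * u \<epsilon> w) \<le> real p * F \<epsilon> m w" for w
      using F_pos[OF e, of m w] u_nonneg[OF e, of w] e by (simp add: algebra_simps)
  qed
  also have "\<dots> \<le> real p * CF" using E_F_le[OF e, of m] by (simp add: mult_left_mono)
  finally show ?thesis using Nb by (simp add: field_simps)
qed

lemma D1u_integrable: "integrable \<nu> (\<lambda>w. D1 m w * u 0 w)"
proof (rule fatou_integrable[where F="\<lambda>k w. F (ek k) m w * u (ek k) w" and C="real p * CF / (N - real p - 1)"])
  show "integrable \<nu> (\<lambda>w. F (ek k) m w * u (ek k) w)" for k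
    using ek_pos by (intro integrable_poly polybd_mult polybd_F polybd_VuT) auto
  show "0 \<le> F (ek k) m w * u (ek k) w" for k w
    using F_pos[OF ek_pos, of k m w] u_nonneg[OF ek_pos, of k w] by simp
  show "integral\<^sup>L \<nu> (\<lambda>w. F (ek k) m w * u (ek k) w) \<le> real p * CF / (N - real p - 1)" for k by (rule E_Fu_le[OF ek_pos])
  show "AE w in \<nu>. (\<lambda>k. F (ek k) m w * u (ek k) w) \<longlonglongrightarrow> D1 m w * u 0 w"
    using AE_y2 AE_det_S0[OF Nb] by eventually_elim (intro tendsto_mult F_tendsto u_tendsto)
qed measurable

end

end

text \<open>The divergence in y of the field S^{-1} y / (y^T S^{-1} y).\<close>

definition A0 :: "(nat \<Rightarrow> real) \<Rightarrow> (nat \<times> nat \<Rightarrow> real) \<Rightarrow> real" where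
  "A0 m w = phi 0 m w * u 0 w - 2 * (phi 0 m w)\<^sup>2 * G2 0 m w"

lemma phi_dom: "0 < y2 m w \<Longrightarrow> phi (ek k) m w \<le> D1 m w"
  using phi_le[OF ek_pos ek_le1] by (simp add: D1_def)

lemma phi_tendsto:
  assumes "Determinant.det (S 0 w) \<noteq> 0" "0 < y2 m w"
  shows "(\<lambda>k. phi (ek k) m w) \<longlonglongrightarrow> phi 0 m w"
  unfolding phi_def using zeta0_pos[OF assms]
  by (intro tendsto_intros zeta_tendsto assms ek_tendsto) auto

lemma kap_tendsto:
  assumes "Determinant.det (S 0 w) \<noteq> 0"
  shows "(\<lambda>k. kap (ek k) m w) \<longlonglongrightarrow> kap 0 m w" "(\<lambda>k. G2 (ek k) m w) \<longlonglongrightarrow> G2 0 m w"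
    "(\<lambda>k. H2 (ek k) m w) \<longlonglongrightarrow> H2 0 m w" "(\<lambda>k. rr (ek k) w) \<longlonglongrightarrow> rr 0 w"
  unfolding kap_def G2_def H2_def rr_def
  by (intro tendsto_intros g_tendsto h_tendsto V_tendsto R_tendsto assms)+

text \<open>At \<open>\<epsilon> = 0\<close> Haff's identity for \<open>phi\<close> involves only two quantities; this is where the constant
  \<open>(p - 2) / (N - p + 1)\<close> of the shrinkage estimator comes from.\<close>
lemma haff_lhs_0:
  assumes d: "Determinant.det (S 0 w) \<noteq> 0" and y: "0 < y2 m w"
  shows "haff_lhs 0 m w = (N - real p + 1) * A0 m w" and "haff_rhs 0 m w = (real p - 2) * phi 0 m w"
proof -
  interpret r: reginv n p "W w" "R 0 w" 0 by (rule det_S0[OF d])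
  let ?f = "phi 0 m w"
  have z: "0 < zeta 0 m w" by (rule zeta0_pos[OF d y])
  have fz: "?f * zeta 0 m w = 1" using z by (simp add: phi_def)
  have H: "H2 0 m w = zeta 0 m w" using r.quad_self[of "y m w"] by (simp add: H2_def zeta_def h_def g_def)
  have K: "kap 0 m w = G2 0 m w"
    unfolding kap_def G2_def
  proof (rule sum.cong[OF refl])
    fix l assume "l \<in> {..<p}"
    then have "(\<Sum>a<n. V 0 w a l * h 0 m w a) = g 0 m w l"
      using r.hV[of l "y m w"] by (simp add: V_def h_def g_def mult.commute)
    then show "g 0 m w l * (\<Sum>a<n. V 0 w a l * h 0 m w a) = (g 0 m w l)\<^sup>2" by (simp add: power2_eq_square)
  qed
  have f2: "?f\<^sup>2 * zeta 0 m w = ?f" and f3: "?f^3 * zeta 0 m w = ?f\<^sup>2"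
    using fz by (simp_all add: power2_eq_square power3_eq_cube mult.assoc)
  have "haff_lhs 0 m w = ?f * u 0 w * (N - 1 - real p) + 2 * u 0 w * (?f\<^sup>2 * zeta 0 m w) + 6 * ?f\<^sup>2 * G2 0 m w
      - 2 * ?f\<^sup>2 * (N - real p) * G2 0 m w - 8 * G2 0 m w * (?f^3 * zeta 0 m w)"
    unfolding haff_lhs_def H K by (simp add: algebra_simps)
  \<comment> \<open>The coefficient of phi u is N - 1 - p + 2 and that of phi^2 G2 is 6 - 2 (N - p)
    - 8; both are N - p + 1 times those of \<open>A0\<close>.\<close>
  also have "\<dots> = (N - real p + 1) * A0 m w"
    unfolding f2 f3 A0_def by (simp add: algebra_simps)
  finally show "haff_lhs 0 m w = (N - real p + 1) * A0 m w" .
  have "haff_rhs 0 m w = ?f * real p - 2 * (?f\<^sup>2 * zeta 0 m w)" unfolding haff_rhs_def by simp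
  then show "haff_rhs 0 m w = (real p - 2) * phi 0 m w" unfolding f2 by (simp add: algebra_simps)
qed

context
  assumes Nb: "real p + 1 < N" and p3: "3 \<le> p"
begin

text \<open>Term by term from \<open>phi_bounds\<close>, followed by phi <= D1 and u <= u 0. The
  constants are crude but free of \<open>k\<close>.\<close>

lemma haff_lhs_bound:
  assumes d: "Determinant.det (S 0 w) \<noteq> 0" and y: "0 < y2 m w"
  shows "\<bar>haff_lhs (ek k) m w\<bar> \<le> (3 * N + 4 * real p + 6 * (1 + (real p)\<^sup>2) + 12) * (D1 m w * u 0 w)"
    and "\<bar>haff_rhs (ek k) m w\<bar> \<le> (real p + 4) * D1 m w"
    and "\<bar>phi (ek k) m w * u (ek k) w - 2 * (phi (ek k) m w)\<^sup>2 * G2 (ek k) m w\<bar> \<le> 3 * (D1 m w * u 0 w)"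
proof -
  note e = ek_pos[of k]
  let ?f = "phi (ek k) m w" and ?u = "u (ek k) w" and ?G = "G2 (ek k) m w" and ?H = "H2 (ek k) m w"
    and ?k = "kap (ek k) m w" and ?z = "zeta (ek k) m w"
  have f: "0 < ?f" by (rule phi_pos[OF e])
  have u: "0 \<le> ?u" by (rule u_nonneg[OF e])
  note b = phi_bounds[OF e, of m w]
  have fu: "?f * ?u \<le> D1 m w * u 0 w"
    using phi_dom[OF y, of k] u_le_u0[OF e d] f u by (intro mult_mono) auto
  have fu0: "0 \<le> ?f * ?u" using f u by simp
  define c where "c = real p - ek k * ?u"
  have c: "0 \<le> c" "c \<le> real p" using eps_u_le[OF e, of w] u e by (simp_all add: c_def)
  have err: "0 \<le> ek k * rr (ek k) w" "ek k * rr (ek k) w \<le> ?u" using eps_rr_le[OF e, of w] rr_nonneg[of "ek k" w] e by simp_all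
  have f2G0: "0 \<le> ?f\<^sup>2 * ?G" using b(2) by simp
  have N0: "0 \<le> N" using Nb by linarith
  have t1: "\<bar>?f * (N * ?u - (?u - ek k * rr (ek k) w) - c * ?u)\<bar> \<le> (N + 2 + real p) * (?f * ?u)"
  proof -
    have "c * ?u \<le> real p * ?u" "0 \<le> c * ?u" using c u by (auto intro: mult_right_mono)
    moreover have "0 \<le> N * ?u" using N0 u by simp
    ultimately have "\<bar>N * ?u - (?u - ek k * rr (ek k) w) - c * ?u\<bar> \<le> N * ?u + 2 * ?u + real p * ?u"
      using err u by linarith
    then have "?f * \<bar>N * ?u - (?u - ek k * rr (ek k) w) - c * ?u\<bar> \<le> ?f * (N * ?u + 2 * ?u + real p * ?u)"
      using f by (intro mult_left_mono) auto
    also have "\<dots> = (N + 2 + real p) * (?f * ?u)" by (simp add: algebra_simps)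
    finally show ?thesis using f by (simp only: abs_mult abs_of_pos)
  qed
  have t2: "\<bar>?f\<^sup>2 * ?k\<bar> \<le> (1 + (real p)\<^sup>2) * (?f * ?u)"
  proof -
    have "\<bar>?f\<^sup>2 * ?k\<bar> \<le> ?f\<^sup>2 * ((1 + (real p)\<^sup>2) * ?G)" using b(8) by (simp add: abs_mult mult_left_mono)
    also have "\<dots> = (1 + (real p)\<^sup>2) * (?f\<^sup>2 * ?G)" by simp
    also have "\<dots> \<le> (1 + (real p)\<^sup>2) * (?f * ?u)" using b(4) by (intro mult_left_mono) auto
    finally show ?thesis .
  qed
  have t3: "0 \<le> N * (?f\<^sup>2 * ?G)" "N * (?f\<^sup>2 * ?G) \<le> N * (?f * ?u)"
    using N0 b(4) f2G0 by (auto intro: mult_left_mono)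
  have t4: "0 \<le> c * (?f\<^sup>2 * ?G)" "c * (?f\<^sup>2 * ?G) \<le> real p * (?f * ?u)"
    using c b(4) f2G0 by (auto intro: mult_mono)
  have t5: "0 \<le> ?u * (?f\<^sup>2 * ?H)" "?u * (?f\<^sup>2 * ?H) \<le> ?f * ?u"
    using u b(6) b(3) mult_left_mono[OF b(6) u] by (auto simp: mult.commute)
  have t6: "0 \<le> ?f^3 * ?G * ?H" using f b(2,3) by simp
  have "haff_lhs (ek k) m w = ?f * (N * ?u - (?u - ek k * rr (ek k) w) - c * ?u) + 6 * (?f\<^sup>2 * ?k)
     - 2 * (N * (?f\<^sup>2 * ?G)) + 2 * (c * (?f\<^sup>2 * ?G)) + 2 * (?u * (?f\<^sup>2 * ?H)) - 8 * (?f^3 * ?G * ?H)"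
    unfolding haff_lhs_def c_def[symmetric] by (simp add: algebra_simps)
  then have "\<bar>haff_lhs (ek k) m w\<bar> \<le> (N + 2 + real p) * (?f * ?u) + 6 * ((1 + (real p)\<^sup>2) * (?f * ?u))
     + 2 * (N * (?f * ?u)) + 2 * (real p * (?f * ?u)) + 2 * (?f * ?u) + 8 * (?f * ?u)"
    using t1 t2 t3 t4 t5 t6 b(7) by linarith
  also have "\<dots> = (3 * N + 3 * real p + 6 * (1 + (real p)\<^sup>2) + 12) * (?f * ?u)" by (simp add: algebra_simps)
  also have "\<dots> \<le> (3 * N + 4 * real p + 6 * (1 + (real p)\<^sup>2) + 12) * (D1 m w * u 0 w)"
    by (rule mult_mono) (use fu fu0 N0 in auto)
  finally show "\<bar>haff_lhs (ek k) m w\<bar> \<le> (3 * N + 4 * real p + 6 * (1 + (real p)\<^sup>2) + 12) * (D1 m w * u 0 w)" .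
  have "?f\<^sup>2 * (ek k * ?G) \<le> ?f\<^sup>2 * ?z" using b(5) by (intro mult_left_mono) auto
  then have "?f\<^sup>2 * (ek k * ?G) \<le> ?f" using b(1) by linarith
  moreover have "0 \<le> ?f\<^sup>2 * (ek k * ?G)" using b(2) e by simp
  moreover have "0 \<le> ?f\<^sup>2 * ?z" using zeta_nonneg[OF e, of m w] by simp
  moreover have "0 \<le> ?f * c" "?f * c \<le> real p * ?f" using f c by simp_all
  moreover have "haff_rhs (ek k) m w = ?f * c - 2 * (?f\<^sup>2 * ?z) + 2 * (?f\<^sup>2 * (ek k * ?G))"
    unfolding haff_rhs_def c_def by (simp add: algebra_simps)
  ultimately have "\<bar>haff_rhs (ek k) m w\<bar> \<le> real p * ?f + 2 * ?f + 2 * ?f" using b(1) by linarith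
  also have "\<dots> = (real p + 4) * ?f" by (simp add: algebra_simps)
  also have "\<dots> \<le> (real p + 4) * D1 m w" using phi_dom[OF y, of k] by (intro mult_left_mono) auto
  finally show "\<bar>haff_rhs (ek k) m w\<bar> \<le> (real p + 4) * D1 m w" .
  show "\<bar>?f * ?u - 2 * ?f\<^sup>2 * ?G\<bar> \<le> 3 * (D1 m w * u 0 w)"
    using b(4) f2G0 fu0 fu by (simp only: mult.assoc)
qed

text \<open>Dominated convergence along \<open>ek\<close>, in \<open>shrink_identity\<close> and in
  \<open>haff_identity_phi\<close>. The two limits share the expectation of \<open>A0\<close>, so
  together they evaluate the cross term produced by the shrinkage.\<close>

lemma A0_integrable: "integrable \<nu> (A0 m)"
  and E_A0: "integral\<^sup>L \<nu> (\<lambda>w. A0 m w) = integral\<^sup>L \<nu> (\<lambda>w. phi 0 m w * (\<Sum>l<p. x w l * g 0 m w l))"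
  and dot_integrable: "integrable \<nu> (\<lambda>w. phi 0 m w * (\<Sum>l<p. x w l * g 0 m w l))"
  and phi0_integrable: "integrable \<nu> (phi 0 m)"
  and haff_limit: "(N - real p + 1) * integral\<^sup>L \<nu> (\<lambda>w. A0 m w) = (real p - 2) * integral\<^sup>L \<nu> (\<lambda>w. phi 0 m w)"
proof -
  have mA0 [measurable]: "A0 m \<in> borel_measurable (\<Pi>\<^sub>M i\<in>I. borel)" unfolding A0_def[abs_def] by measurable
  note AE = AE_conjI[OF AE_det_S0[OF Nb] AE_y2[OF Nb p3, of m]]
  have ID: "integrable \<nu> (\<lambda>w. D1 m w * u 0 w)" "integrable \<nu> (D1 m)"
    by (rule D1u_integrable[OF Nb p3] D1_integrable[OF Nb p3])+
  have limA: "AE w in \<nu>. (\<lambda>k. phi (ek k) m w * u (ek k) w - 2 * (phi (ek k) m w)\<^sup>2 * G2 (ek k) m w) \<longlonglongrightarrow> A0 m w"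
    using AE by eventually_elim (auto simp: A0_def intro!: tendsto_intros phi_tendsto u_tendsto kap_tendsto)
  have bA: "AE w in \<nu>. norm (phi (ek k) m w * u (ek k) w - 2 * (phi (ek k) m w)\<^sup>2 * G2 (ek k) m w) \<le> 3 * (D1 m w * u 0 w)" for k
    using AE by eventually_elim (simp only: real_norm_def, blast intro: haff_lhs_bound(3))
  have ID3: "integrable \<nu> (\<lambda>w. 3 * (D1 m w * u 0 w))" using ID by simp
  show iA: "integrable \<nu> (A0 m)"
    by (rule integrable_dominated_convergence[OF _ _ ID3 limA bA]; measurable)
  have EA: "(\<lambda>k. LINT w|\<nu>. phi (ek k) m w * u (ek k) w - 2 * (phi (ek k) m w)\<^sup>2 * G2 (ek k) m w) \<longlonglongrightarrow> integral\<^sup>L \<nu> (\<lambda>w. A0 m w)"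
    by (rule integral_dominated_convergence[OF _ _ ID3 limA bA]; measurable)
  have limp: "AE w in \<nu>. (\<lambda>k. phi (ek k) m w) \<longlonglongrightarrow> phi 0 m w"
    using AE by eventually_elim (blast intro: phi_tendsto)
  have bp: "AE w in \<nu>. norm (phi (ek k) m w) \<le> D1 m w" for k
    using AE by eventually_elim (use phi_dom phi_pos[OF ek_pos, of k m] in \<open>auto simp: less_imp_le\<close>)
  show ip: "integrable \<nu> (phi 0 m)"
    by (rule integrable_dominated_convergence[OF _ _ ID(2) limp bp]; measurable)
  define q where "q k w = (\<Sum>l<p. x w l * (g (ek k) m w l * phi (ek k) m w))" for k w
  define q0 where "q0 w = phi 0 m w * (\<Sum>l<p. x w l * g 0 m w l)" for w
  have mq [measurable]: "q k \<in> borel_measurable (\<Pi>\<^sub>M i\<in>I. borel)" "q0 \<in> borel_measurable (\<Pi>\<^sub>M i\<in>I. borel)" for k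
    unfolding q_def[abs_def] q0_def[abs_def] by measurable
  have limq: "AE w in \<nu>. (\<lambda>k. q k w) \<longlonglongrightarrow> q0 w"
    using AE
  proof eventually_elim
    fix w assume *: "Determinant.det (S 0 w) \<noteq> 0 \<and> 0 < y2 m w"
    have "(\<lambda>k. q k w) \<longlonglongrightarrow> (\<Sum>l<p. x w l * (g 0 m w l * phi 0 m w))"
      unfolding q_def using * by (intro tendsto_intros g_tendsto phi_tendsto) auto
    also have "(\<Sum>l<p. x w l * (g 0 m w l * phi 0 m w)) = q0 w"
      by (simp add: q0_def sum_distrib_left mult_ac)
    finally show "(\<lambda>k. q k w) \<longlonglongrightarrow> q0 w" .
  qed
  \<comment> \<open>\<open>quad_amgm\<close> with weight phi splits the cross term into the form at
    x, integrable by \<open>quad_integrable\<close>, and phi^2 zeta <= phi <= D1.\<close>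
  have bq: "AE w in \<nu>. norm (q k w) \<le> 1/2 * zeta 0 (\<lambda>_. 0) w + 1/2 * D1 m w" for k
    using AE
  proof eventually_elim
    fix w assume *: "Determinant.det (S 0 w) \<noteq> 0 \<and> 0 < y2 m w"
    interpret r: reginv n p "W w" "R (ek k) w" "ek k" by (rule reginv_R_pos[OF ek_pos])
    let ?f = "phi (ek k) m w"
    have y0: "y (\<lambda>_. 0) w = x w" by (auto simp: y_def)
    have "q k w = ?f * (\<Sum>l<p. x w l * r.g (y m w) l)"
      by (simp add: q_def g_def sum_distrib_left mult_ac)
    then have "2 * \<bar>q k w\<bar> \<le> zeta (ek k) (\<lambda>_. 0) w + ?f\<^sup>2 * zeta (ek k) m w"
      using r.quad_amgm[of ?f "x w" "y m w"] by (simp add: zeta_def g_def y0)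
    also have "\<dots> \<le> zeta 0 (\<lambda>_. 0) w + D1 m w"
      using zeta_le_zeta0[OF ek_pos, of w k] phi_bounds(1)[OF ek_pos, of k m w] phi_dom[of m w k] *
      by (intro add_mono) (auto intro: order_trans)
    finally show "norm (q k w) \<le> 1/2 * zeta 0 (\<lambda>_. 0) w + 1/2 * D1 m w" by simp
  qed
  have IDq: "integrable \<nu> (\<lambda>w. 1/2 * zeta 0 (\<lambda>_. 0) w + 1/2 * D1 m w)"
    using quad_integrable[OF Nb] ID(2) by simp
  have "integrable \<nu> q0"
    by (rule integrable_dominated_convergence[OF _ _ IDq limq bq]; measurable)
  then show "integrable \<nu> (\<lambda>w. phi 0 m w * (\<Sum>l<p. x w l * g 0 m w l))"
    by (simp only: q0_def[abs_def])
  have Eq: "(\<lambda>k. LINT w|\<nu>. q k w) \<longlonglongrightarrow> integral\<^sup>L \<nu> (\<lambda>w. q0 w)"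
    by (rule integral_dominated_convergence[OF _ _ IDq limq bq]; measurable)
  have "integral\<^sup>L \<nu> (\<lambda>w. phi (ek k) m w * u (ek k) w - 2 * (phi (ek k) m w)\<^sup>2 * G2 (ek k) m w) = integral\<^sup>L \<nu> (\<lambda>w. q k w)" for k
    unfolding G2_def q_def by (rule shrink_identity[OF ek_pos])
  with EA Eq show "integral\<^sup>L \<nu> (\<lambda>w. A0 m w) = integral\<^sup>L \<nu> (\<lambda>w. phi 0 m w * (\<Sum>l<p. x w l * g 0 m w l))"
    unfolding q0_def by (simp add: LIMSEQ_unique)
  have liml: "AE w in \<nu>. (\<lambda>k. haff_lhs (ek k) m w) \<longlonglongrightarrow> (N - real p + 1) * A0 m w"
    using AE
  proof eventually_elim
    fix w assume *: "Determinant.det (S 0 w) \<noteq> 0 \<and> 0 < y2 m w"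
    then have "(\<lambda>k. haff_lhs (ek k) m w) \<longlonglongrightarrow> haff_lhs 0 m w"
      unfolding haff_lhs_def by (intro tendsto_intros phi_tendsto u_tendsto kap_tendsto ek_tendsto) auto
    then show "(\<lambda>k. haff_lhs (ek k) m w) \<longlonglongrightarrow> (N - real p + 1) * A0 m w" using haff_lhs_0(1) * by simp
  qed
  have limr: "AE w in \<nu>. (\<lambda>k. haff_rhs (ek k) m w) \<longlonglongrightarrow> (real p - 2) * phi 0 m w"
    using AE
  proof eventually_elim
    fix w assume *: "Determinant.det (S 0 w) \<noteq> 0 \<and> 0 < y2 m w"
    then have "(\<lambda>k. haff_rhs (ek k) m w) \<longlonglongrightarrow> haff_rhs 0 m w"
      unfolding haff_rhs_def by (intro tendsto_intros phi_tendsto u_tendsto kap_tendsto zeta_tendsto ek_tendsto) auto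
    then show "(\<lambda>k. haff_rhs (ek k) m w) \<longlonglongrightarrow> (real p - 2) * phi 0 m w" using haff_lhs_0(2) * by simp
  qed
  have bl: "AE w in \<nu>. norm (haff_lhs (ek k) m w) \<le> (3 * N + 4 * real p + 6 * (1 + (real p)\<^sup>2) + 12) * (D1 m w * u 0 w)" for k
    using AE by eventually_elim (simp only: real_norm_def, blast intro: haff_lhs_bound(1))
  have br: "AE w in \<nu>. norm (haff_rhs (ek k) m w) \<le> (real p + 4) * D1 m w" for k
    using AE by eventually_elim (simp only: real_norm_def, blast intro: haff_lhs_bound(2))
  have IDl: "integrable \<nu> (\<lambda>w. (3 * N + 4 * real p + 6 * (1 + (real p)\<^sup>2) + 12) * (D1 m w * u 0 w))"
    and IDr: "integrable \<nu> (\<lambda>w. (real p + 4) * D1 m w)" by (intro integrable_mult_right ID)+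
  have "(\<lambda>k. LINT w|\<nu>. haff_lhs (ek k) m w) \<longlonglongrightarrow> integral\<^sup>L \<nu> (\<lambda>w. (N - real p + 1) * A0 m w)"
    by (rule integral_dominated_convergence[OF _ _ IDl liml bl]; measurable)
  moreover have "(\<lambda>k. LINT w|\<nu>. haff_rhs (ek k) m w) \<longlonglongrightarrow> integral\<^sup>L \<nu> (\<lambda>w. (real p - 2) * phi 0 m w)"
    by (rule integral_dominated_convergence[OF _ _ IDr limr br]; measurable)
  ultimately have "integral\<^sup>L \<nu> (\<lambda>w. (N - real p + 1) * A0 m w) = integral\<^sup>L \<nu> (\<lambda>w. (real p - 2) * phi 0 m w)"
    unfolding haff_identity_phi[OF ek_pos] by (rule LIMSEQ_unique)
  then show "(N - real p + 1) * integral\<^sup>L \<nu> (\<lambda>w. A0 m w) = (real p - 2) * integral\<^sup>L \<nu> (\<lambda>w. phi 0 m w)" by simp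
qed

lemma shrink_expectation:
  "(N - real p + 1) * integral\<^sup>L \<nu> (\<lambda>w. phi 0 m w * (\<Sum>l<p. x w l * g 0 m w l)) = (real p - 2) * integral\<^sup>L \<nu> (\<lambda>w. phi 0 m w)"
  using haff_limit E_A0 by simp

end

end

subsection \<open>Matrix normal laws as images of white noise\<close>

text \<open>Induction on the size: after the first row and column are split off, the remaining block
  is the Schur complement, which is again positive definite.\<close>

lemma cholesky:
  fixes s :: "nat \<Rightarrow> nat \<Rightarrow> real"
  assumes "\<And>i j. i < p \<Longrightarrow> j < p \<Longrightarrow> s i j = s j i"
    and "\<And>v i. i < p \<Longrightarrow> v i \<noteq> 0 \<Longrightarrow> 0 < (\<Sum>i<p. \<Sum>j<p. v i * s i j * v j)"
  shows "\<exists>L. (\<forall>i j. i < j \<longrightarrow> L i j = 0) \<and> (\<forall>i<p. 0 < L i i) \<and>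
    (\<forall>i<p. \<forall>j<p. s i j = (\<Sum>l<p. L i l * L j l))"
  using assms
proof (induction p arbitrary: s)
  case 0
  show ?case by (intro exI[of _ "\<lambda>_ _. 0"]) auto
next
  case (Suc p)
  define t where "t = s 0 0"
  have "0 < (\<Sum>i<Suc p. \<Sum>j<Suc p. (if i = 0 then 1 else 0) * s i j * (if j = 0 then 1 else 0))"
    by (rule Suc.prems(2)[of 0]) auto
  also have "(\<Sum>i<Suc p. \<Sum>j<Suc p. (if i = 0 then 1 else 0) * s i j * (if j = 0 then 1 else 0)) = t"
    by (simp add: sum.lessThan_Suc_shift t_def del: sum.lessThan_Suc)
  finally have t: "0 < t" .
  define s' where "s' i j = s (Suc i) (Suc j) - s (Suc i) 0 * s (Suc j) 0 / t" for i j
  have sym: "s 0 (Suc j) = s (Suc j) 0" if "j < p" for j using Suc.prems(1)[of 0 "Suc j"] that by simp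
  have "\<exists>L. (\<forall>i j. i < j \<longrightarrow> L i j = 0) \<and> (\<forall>i<p. 0 < L i i) \<and>
    (\<forall>i<p. \<forall>j<p. s' i j = (\<Sum>l<p. L i l * L j l))"
  proof (rule Suc.IH)
    show "s' i j = s' j i" if "i < p" "j < p" for i j
      using Suc.prems(1)[of "Suc i" "Suc j"] that by (simp add: s'_def mult.commute)
    fix v :: "nat \<Rightarrow> real" and i assume i: "i < p" "v i \<noteq> 0"
    define b where "b = (\<Sum>j<p. s (Suc j) 0 * v j)"
    \<comment> \<open>The first entry minimises the form for given v, and the minimum is the form of
      the Schur complement at v.\<close>
    define w where "w k = (case k of 0 \<Rightarrow> - b / t | Suc j \<Rightarrow> v j)" for k
    have "0 < (\<Sum>i<Suc p. \<Sum>j<Suc p. w i * s i j * w j)"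
      by (rule Suc.prems(2)[of "Suc i"]) (use i in \<open>auto simp: w_def\<close>)
    also have "(\<Sum>i<Suc p. \<Sum>j<Suc p. w i * s i j * w j) =
      (w 0 * t * w 0 + (\<Sum>j<p. w 0 * s 0 (Suc j) * v j)) + (\<Sum>i<p. v i * s (Suc i) 0 * w 0 + (\<Sum>j<p. v i * s (Suc i) (Suc j) * v j))"
      by (simp add: sum.lessThan_Suc_shift w_def t_def del: sum.lessThan_Suc)
    also have "(\<Sum>j<p. w 0 * s 0 (Suc j) * v j) = w 0 * b"
      unfolding b_def sum_distrib_left by (intro sum.cong refl) (simp add: sym)
    also have "(\<Sum>i<p. v i * s (Suc i) 0 * w 0 + (\<Sum>j<p. v i * s (Suc i) (Suc j) * v j))
       = w 0 * b + (\<Sum>i<p. \<Sum>j<p. v i * s (Suc i) (Suc j) * v j)"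
      unfolding sum.distrib b_def sum_distrib_left by (simp add: mult_ac)
    also have "(w 0 * t * w 0 + w 0 * b) + (w 0 * b + (\<Sum>i<p. \<Sum>j<p. v i * s (Suc i) (Suc j) * v j))
       = (\<Sum>i<p. \<Sum>j<p. v i * s (Suc i) (Suc j) * v j) - b * b / t"
      using t by (simp add: w_def field_simps)
    also have "b * b / t = (\<Sum>i<p. \<Sum>j<p. v i * (s (Suc i) 0 * s (Suc j) 0 / t) * v j)"
      unfolding b_def sum_product sum_divide_distrib by (intro sum.cong refl) simp
    also have "(\<Sum>i<p. \<Sum>j<p. v i * s (Suc i) (Suc j) * v j) - \<dots> = (\<Sum>i<p. \<Sum>j<p. v i * s' i j * v j)"
      unfolding sum_subtractf[symmetric] s'_def by (intro sum.cong refl) (simp add: algebra_simps)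
    finally show "0 < (\<Sum>i<p. \<Sum>j<p. v i * s' i j * v j)" .
  qed
  then obtain L where L: "\<And>i j. i < j \<Longrightarrow> L i j = 0" "\<And>i. i < p \<Longrightarrow> 0 < L i i"
    "\<And>i j. i < p \<Longrightarrow> j < p \<Longrightarrow> s' i j = (\<Sum>l<p. L i l * L j l)" by blast
  define K where "K i j = (case i of 0 \<Rightarrow> (case j of 0 \<Rightarrow> sqrt t | Suc _ \<Rightarrow> 0)
     | Suc i' \<Rightarrow> (case j of 0 \<Rightarrow> s i 0 / sqrt t | Suc j' \<Rightarrow> L i' j'))" for i j
  have rt: "sqrt t * sqrt t = t" "0 < sqrt t" using t by auto
  show ?case
  proof (intro exI[of _ K] conjI allI impI)
    show "K i j = 0" if "i < j" for i j using that L(1) by (auto simp: K_def split: nat.split)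
    show "0 < K i i" if "i < Suc p" for i using that L(2) rt by (auto simp: K_def split: nat.split)
    fix i j assume ij: "i < Suc p" "j < Suc p"
    have *: "(\<Sum>l<Suc p. K i l * K j l) = K i 0 * K j 0 + (\<Sum>l<p. K i (Suc l) * K j (Suc l))"
      by (simp add: sum.lessThan_Suc_shift del: sum.lessThan_Suc)
    show "s i j = (\<Sum>l<Suc p. K i l * K j l)"
    proof (cases i; cases j)
      assume "i = 0" "j = 0" then show ?thesis unfolding * using rt by (simp add: K_def t_def)
    next
      fix j' assume "i = 0" "j = Suc j'" then show ?thesis unfolding * using rt sym ij by (simp add: K_def)
    next
      fix i' assume "i = Suc i'" "j = 0" then show ?thesis unfolding * using rt by (simp add: K_def)
    next
      fix i' j' assume e: "i = Suc i'" "j = Suc j'"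
      then have "s' i' j' = (\<Sum>l<p. L i' l * L j' l)" using ij L(3) by simp
      then show ?thesis unfolding * using e rt by (simp add: K_def s'_def)
    qed
  qed
qed

interpretation lborelP: product_sigma_finite "\<lambda>_::'i. lborel :: real measure" by unfold_locales

text \<open>Change of variables for a triangular affine map. A coordinate of maximal rank influences
  no other one, so it is treated by a one-dimensional affine substitution with the others fixed, and
  induction does the rest. Ranks, rather than an order on the indices, allow unrelated coordinates
  to be tied.\<close>

lemma nn_integral_triangular:
  fixes K :: "'i \<Rightarrow> 'i \<Rightarrow> real" and r :: "'i \<Rightarrow> nat" and b c :: "'i \<Rightarrow> real"
  assumes "finite I" "\<And>i. i \<in> I \<Longrightarrow> 0 < c i"
    and "\<And>i j. i \<in> I \<Longrightarrow> j \<in> I \<Longrightarrow> \<not> r j < r i \<Longrightarrow> K i j = 0"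
    and "F \<in> borel_measurable (\<Pi>\<^sub>M i\<in>I. lborel)"
  shows "(\<integral>\<^sup>+w. F w \<partial>(\<Pi>\<^sub>M i\<in>I. lborel)) =
    (\<Prod>i\<in>I. ennreal (c i)) * (\<integral>\<^sup>+w. F (\<lambda>i\<in>I. b i + c i * w i + (\<Sum>j\<in>I. K i j * w j)) \<partial>(\<Pi>\<^sub>M i\<in>I. lborel))"
  using assms
proof (induction I arbitrary: F rule: finite_ranking_induct[where f=r])
  case empty
  then show ?case by (simp add: PiM_empty nn_integral_count_space_finite max.absorb2 restrict_def)
next
  case (insert x S)
  show ?case
  proof (cases "x \<in> S")
    case True
    then show ?thesis using insert by (simp add: insert_absorb)
  next
    case x: False
    have c: "0 < c x" using insert.prems by simp
    define T where "T A w = (\<lambda>i\<in>A. b i + c i * w i + (\<Sum>j\<in>A. K i j * w j))" for A w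
    have K0: "K i x = 0" if "i \<in> insert x S" for i
      using insert.prems(2)[OF that, of x] insert.hyps(2) that by (auto simp: not_less)
    define q where "q w = b x + (\<Sum>j\<in>S. K x j * w j)" for w
    have T: "T (insert x S) (w(x := y)) = (T S w)(x := q w + c x * y)" for w y
    proof
      fix i
      have "(\<Sum>j\<in>insert x S. K i j * (w(x := y)) j) = (\<Sum>j\<in>S. K i j * w j)" if "i \<in> insert x S"
        using insert.hyps(1) x K0[OF that] by (simp, intro sum.cong) auto
      then show "T (insert x S) (w(x := y)) i = ((T S w)(x := q w + c x * y)) i"
        using x by (auto simp: T_def q_def)
    qed
    have mT: "T A \<in> measurable (\<Pi>\<^sub>M i\<in>A. lborel) (\<Pi>\<^sub>M i\<in>A. lborel)" if "finite A" for A
      unfolding T_def by measurable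
    note [measurable] = insert.prems(3)
    have mq [measurable]: "q \<in> borel_measurable (\<Pi>\<^sub>M i\<in>S. lborel)" unfolding q_def[abs_def] by measurable
    have mF: "(\<lambda>(v, y). F (v(x := y))) \<in> borel_measurable ((\<Pi>\<^sub>M i\<in>S. lborel) \<Otimes>\<^sub>M lborel)"
      using measurable_compose[OF measurable_add_dim insert.prems(3)] by (simp add: split_beta')
    define G where "G v = (\<integral>\<^sup>+y. F (v(x := y)) \<partial>lborel)" for v
    have mG: "G \<in> borel_measurable (\<Pi>\<^sub>M i\<in>S. lborel)"
      unfolding G_def[abs_def] using mF by measurable
    have IH: "(\<integral>\<^sup>+w. G w \<partial>(\<Pi>\<^sub>M i\<in>S. lborel)) = (\<Prod>i\<in>S. ennreal (c i)) * (\<integral>\<^sup>+w. G (T S w) \<partial>(\<Pi>\<^sub>M i\<in>S. lborel))"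
      unfolding T_def by (rule insert.IH) (use insert.prems mG in auto)
    \<comment> \<open>The shift \<open>q w\<close> is computed from the old coordinates while v will
      be their image \<open>T S w\<close>; translation invariance permits any shift.\<close>
    have inner: "G v = ennreal (c x) * (\<integral>\<^sup>+y. F (v(x := q w + c x * y)) \<partial>lborel)"
      if v: "v \<in> space (\<Pi>\<^sub>M i\<in>S. lborel)" for v w
    proof -
      have "(\<lambda>y. F (v(x := y))) \<in> borel_measurable borel"
        using measurable_compose[OF measurable_Pair1'[OF v, of "lborel"] mF] by simp
      then show ?thesis unfolding G_def using c by (subst nn_integral_real_affine[where c="c x" and t="q w"]) auto
    qed
    have "(\<integral>\<^sup>+w. F w \<partial>(\<Pi>\<^sub>M i\<in>insert x S. lborel)) = (\<integral>\<^sup>+w. G w \<partial>(\<Pi>\<^sub>M i\<in>S. lborel))"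
      unfolding G_def by (rule lborelP.product_nn_integral_insert[OF insert.hyps(1) x insert.prems(3)])
    also have "\<dots> = (\<Prod>i\<in>S. ennreal (c i)) * (\<integral>\<^sup>+w. ennreal (c x) * (\<integral>\<^sup>+y. F ((T S w)(x := q w + c x * y)) \<partial>lborel) \<partial>(\<Pi>\<^sub>M i\<in>S. lborel))"
      unfolding IH
    proof (intro arg_cong2[where f="(*)"] refl nn_integral_cong)
      fix w assume "w \<in> space (\<Pi>\<^sub>M i\<in>S. lborel :: real measure)"
      then show "G (T S w) = ennreal (c x) * (\<integral>\<^sup>+y. F ((T S w)(x := q w + c x * y)) \<partial>lborel)"
        by (intro inner) (auto simp: T_def space_PiM)
    qed
    also have "\<dots> = (\<Prod>i\<in>S. ennreal (c i)) * (ennreal (c x) * (\<integral>\<^sup>+w. \<integral>\<^sup>+y. F (T (insert x S) (w(x := y))) \<partial>lborel \<partial>(\<Pi>\<^sub>M i\<in>S. lborel)))"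
      unfolding T[symmetric]
    proof (subst nn_integral_cmult)
      have "(\<lambda>(w, y). F (T (insert x S) (w(x := y)))) \<in> borel_measurable ((\<Pi>\<^sub>M i\<in>S. lborel) \<Otimes>\<^sub>M lborel)"
        using measurable_compose[OF measurable_add_dim measurable_compose[OF mT insert.prems(3)]] insert.hyps(1)
        by (simp add: split_beta')
      then show "(\<lambda>w. \<integral>\<^sup>+y. F (T (insert x S) (w(x := y))) \<partial>lborel) \<in> borel_measurable (\<Pi>\<^sub>M i\<in>S. lborel)"
        by measurable
    qed simp
    also have "(\<integral>\<^sup>+w. \<integral>\<^sup>+y. F (T (insert x S) (w(x := y))) \<partial>lborel \<partial>(\<Pi>\<^sub>M i\<in>S. lborel)) =
        (\<integral>\<^sup>+w. F (T (insert x S) w) \<partial>(\<Pi>\<^sub>M i\<in>insert x S. lborel))"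
      by (rule lborelP.product_nn_integral_insert[OF insert.hyps(1) x, symmetric])
        (use measurable_compose[OF mT insert.prems(3)] insert.hyps(1) in simp)
    finally show ?thesis unfolding T_def[symmetric] using insert.hyps(1) x by (simp add: mult_ac)
  qed
qed

section \<open>Lebesgue measure on matrices and the density of the matrix normal law\<close>

lemma gaussM_density:
  assumes "finite I"
  shows "gaussM I = density (\<Pi>\<^sub>M i\<in>I. lborel) (\<lambda>w. \<Prod>i\<in>I. ennreal (std_normal_density (w i)))"
proof (rule gaussP.PiM_eqI[symmetric])
  show "sets (density (\<Pi>\<^sub>M i\<in>I. lborel) (\<lambda>w. \<Prod>i\<in>I. ennreal (std_normal_density (w i)))) = sets (gaussM I)"
    by (simp add: sets_gaussM cong: sets_PiM_cong)
  fix A assume A: "\<And>i. i \<in> I \<Longrightarrow> A i \<in> sets gauss"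
  have "emeasure (density (\<Pi>\<^sub>M i\<in>I. lborel) (\<lambda>w. \<Prod>i\<in>I. ennreal (std_normal_density (w i)))) (Pi\<^sub>E I A)
     = (\<integral>\<^sup>+w. (\<Prod>i\<in>I. ennreal (std_normal_density (w i))) * indicator (Pi\<^sub>E I A) w \<partial>(\<Pi>\<^sub>M i\<in>I. lborel))"
    using A assms by (subst emeasure_density) (auto intro!: sets_PiM_I_finite)
  also have "\<dots> = (\<integral>\<^sup>+w. (\<Prod>i\<in>I. ennreal (std_normal_density (w i)) * indicator (A i) (w i)) \<partial>(\<Pi>\<^sub>M i\<in>I. lborel))"
  proof (rule nn_integral_cong)
    fix w assume "w \<in> space (\<Pi>\<^sub>M i\<in>I. lborel :: real measure)"
    then have "w \<in> extensional I" by (auto simp: space_PiM PiE_def)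
    then have "indicator (Pi\<^sub>E I A) w = (\<Prod>i\<in>I. indicator (A i) (w i) :: ennreal)"
      using assms by (auto simp: indicator_def PiE_iff prod_zero_iff)
    then show "(\<Prod>i\<in>I. ennreal (std_normal_density (w i))) * indicator (Pi\<^sub>E I A) w =
       (\<Prod>i\<in>I. ennreal (std_normal_density (w i)) * indicator (A i) (w i))" by (simp add: prod.distrib)
  qed
  also have "\<dots> = (\<Prod>i\<in>I. \<integral>\<^sup>+x. ennreal (std_normal_density x) * indicator (A i) x \<partial>lborel)"
    using A by (intro lborelP.product_nn_integral_prod assms) auto
  also have "\<dots> = (\<Prod>i\<in>I. emeasure gauss (A i))"
    using A by (intro prod.cong refl) (simp add: gauss_def emeasure_density)
  finally show "emeasure (density (\<Pi>\<^sub>M i\<in>I. lborel) (\<lambda>w. \<Prod>i\<in>I. ennreal (std_normal_density (w i)))) (Pi\<^sub>E I A)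
     = (\<Prod>i\<in>I. emeasure gauss (A i))" .
qed fact

lemma inj_on_mat: "inj_on (Matrix.mat n p) (Pi\<^sub>E ({..<n} \<times> {..<p}) (\<lambda>_. UNIV))"
proof (rule inj_onI)
  fix f g :: "nat \<times> nat \<Rightarrow> 'a"
  assume fg: "f \<in> Pi\<^sub>E ({..<n} \<times> {..<p}) (\<lambda>_. UNIV)" "g \<in> Pi\<^sub>E ({..<n} \<times> {..<p}) (\<lambda>_. UNIV)"
    and eq: "Matrix.mat n p f = Matrix.mat n p g"
  have "f ij = g ij" if "ij \<in> {..<n} \<times> {..<p}" for ij
  proof -
    have "Matrix.mat n p f $$ ij = Matrix.mat n p g $$ ij" using eq by simp
    then show ?thesis using that by (cases ij) auto
  qed
  then show "f = g" using fg by (intro PiE_ext) auto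
qed

lemma space_lborel_mat: "space (lborel_mat n p) = carrier_mat n p"
proof -
  have "Matrix.mat n p ` Pi\<^sub>E ({..<n} \<times> {..<p}) (\<lambda>_. UNIV) = (carrier_mat n p :: real mat set)"
  proof safe
    fix Y :: "real mat" assume Y: "Y \<in> carrier_mat n p"
    then have Y: "Y = Matrix.mat n p (restrict (\<lambda>ij. Y $$ ij) ({..<n} \<times> {..<p}))"
      by (intro eq_matI) auto
    show "Y \<in> Matrix.mat n p ` Pi\<^sub>E ({..<n} \<times> {..<p}) (\<lambda>_. UNIV)"
      by (rule image_eqI[where f="Matrix.mat n p", OF Y]) auto
  qed auto
  then show ?thesis by (simp add: lborel_mat_def space_embed_measure space_PiM)
qed

lemma measurable_mat_entry [measurable]:
  assumes "i < n" "j < p" shows "(\<lambda>Y. Y $$ (i, j)) \<in> borel_measurable (lborel_mat n p)"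
  unfolding lborel_mat_def using assms
  by (intro measurable_embed_measure1) (simp add: measurable_component_singleton)

lemma measurable_lborel_matI:
  assumes "\<And>x. x \<in> space M \<Longrightarrow> F x \<in> carrier_mat n p"
    and "\<And>i j. i < n \<Longrightarrow> j < p \<Longrightarrow> (\<lambda>x. F x $$ (i, j)) \<in> borel_measurable M"
  shows "F \<in> measurable M (lborel_mat n p)"
proof -
  let ?I = "{..<n} \<times> {..<p}"
  have "Matrix.mat n p \<in> measurable (\<Pi>\<^sub>M ij\<in>?I. lborel) (lborel_mat n p)"
    unfolding lborel_mat_def by (rule measurable_embed_measure2') (simp add: space_PiM inj_on_mat)
  moreover have "(\<lambda>x. restrict (\<lambda>ij. F x $$ ij) ?I) \<in> measurable M (\<Pi>\<^sub>M ij\<in>?I. lborel)"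
    using assms(2) by (intro measurable_restrict) auto
  ultimately have "(\<lambda>x. Matrix.mat n p (restrict (\<lambda>ij. F x $$ ij) ?I)) \<in> measurable M (lborel_mat n p)"
    by (rule measurable_compose[rotated])
  moreover have "Matrix.mat n p (restrict (\<lambda>ij. F x $$ ij) ?I) = F x" if "x \<in> space M" for x
    using assms(1)[OF that] by (intro eq_matI) auto
  ultimately show ?thesis by (simp cong: measurable_cong)
qed

lemma nn_integral_lborel_mat:
  assumes "F \<in> borel_measurable (lborel_mat n p)"
  shows "integral\<^sup>N (lborel_mat n p) F = (\<integral>\<^sup>+w. F (Matrix.mat n p w) \<partial>(\<Pi>\<^sub>M ij\<in>{..<n} \<times> {..<p}. lborel))"
  using assms unfolding lborel_mat_def
  by (intro nn_integral_embed_measure') (simp_all add: space_PiM inj_on_mat)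

lemma mvnormal_pdf_eq:
  assumes "dim_vec m = p" "dim_vec x = p" "S \<in> carrier_mat p p"
  shows "mvnormal_pdf m S x = exp (- (\<Sum>j<p. \<Sum>l<p. (x $ j - m $ j) * inv_mat S $$ (j, l) * (x $ l - m $ l)) / 2)
      / sqrt ((2 * pi) ^ p * Determinant.det S)"
proof -
  have iS: "dim_row (inv_mat S) = p" "dim_col (inv_mat S) = p" using inv_mat_carrier[OF assms(3)] by auto
  have "(x - m) \<bullet> (inv_mat S *\<^sub>v (x - m)) = (\<Sum>j<p. \<Sum>l<p. (x $ j - m $ j) * inv_mat S $$ (j, l) * (x $ l - m $ l))"
    using assms iS by (simp add: scalar_prod_def atLeast0LessThan sum_distrib_left mult.assoc)
  then show ?thesis using assms by (simp add: mvnormal_pdf_def)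
qed

lemma matnormal_pdf_eq:
  assumes "M \<in> carrier_mat n p" "Y \<in> carrier_mat n p" "S \<in> carrier_mat p p"
  shows "matnormal_pdf M S Y = (\<Prod>i<n. exp (- (\<Sum>j<p. \<Sum>l<p. (Y $$ (i, j) - M $$ (i, j)) * inv_mat S $$ (j, l) * (Y $$ (i, l) - M $$ (i, l))) / 2)
      / sqrt ((2 * pi) ^ p * Determinant.det S))"
proof -
  have "mvnormal_pdf (Matrix.row M i) S (Matrix.row Y i) = exp (- (\<Sum>j<p. \<Sum>l<p. (Y $$ (i, j) - M $$ (i, j)) * inv_mat S $$ (j, l) * (Y $$ (i, l) - M $$ (i, l))) / 2)
      / sqrt ((2 * pi) ^ p * Determinant.det S)" if "i < n" for i
    using that assms by (subst mvnormal_pdf_eq[where p=p]) auto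
  then show ?thesis using assms by (simp add: matnormal_pdf_def)
qed

lemma measurable_matnormal_pdf:
  assumes "M \<in> carrier_mat n p" "S \<in> carrier_mat p p"
  shows "matnormal_pdf M S \<in> borel_measurable (lborel_mat n p)"
proof -
  have "(\<lambda>Y. \<Prod>i<n. exp (- (\<Sum>j<p. \<Sum>l<p. (Y $$ (i, j) - M $$ (i, j)) * inv_mat S $$ (j, l) * (Y $$ (i, l) - M $$ (i, l))) / 2)
      / sqrt ((2 * pi) ^ p * Determinant.det S)) \<in> borel_measurable (lborel_mat n p)"
    by (intro borel_measurable_prod borel_measurable_divide borel_measurable_exp[THEN measurable_compose[rotated]]
        borel_measurable_uminus borel_measurable_sum borel_measurable_times borel_measurable_diff borel_measurable_const measurable_mat_entry) auto
  then show ?thesis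
    by (rule measurable_cong[THEN iffD1, rotated], subst matnormal_pdf_eq[OF assms(1) _ assms(2)])
      (simp_all only: space_lborel_mat)
qed

section \<open>Whitening by a lower triangular factor\<close>

text \<open>This is M + w L^T: each row of the white noise is multiplied by L and shifted by the
  mean.\<close>

definition transform :: "nat \<Rightarrow> nat \<Rightarrow> real mat \<Rightarrow> (nat \<Rightarrow> nat \<Rightarrow> real) \<Rightarrow> (nat \<times> nat \<Rightarrow> real) \<Rightarrow> real mat" where
  "transform n p M L w = Matrix.mat n p (\<lambda>(a, j). M $$ (a, j) + (\<Sum>l<p. L j l * w (a, l)))"

definition lower_factor :: "nat \<Rightarrow> real mat \<Rightarrow> (nat \<Rightarrow> nat \<Rightarrow> real) \<Rightarrow> bool" where
  "lower_factor p S L \<longleftrightarrow> (\<forall>i j. i < j \<longrightarrow> L i j = 0) \<and> (\<forall>i<p. 0 < L i i) \<and>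
    S = Matrix.mat p p (\<lambda>(i, j). L i j) * transpose_mat (Matrix.mat p p (\<lambda>(i, j). L i j))"

lemma pos_def_lower_factor:
  assumes "pos_def_mat p S" obtains L where "lower_factor p S L"
proof -
  have S: "S \<in> carrier_mat p p" "transpose_mat S = S" and pos: "\<And>v. v \<in> carrier_vec p \<Longrightarrow> v \<noteq> 0\<^sub>v p \<Longrightarrow> v \<bullet> (S *\<^sub>v v) > 0"
    using assms unfolding pos_def_mat_def by blast+
  have "\<exists>L. (\<forall>i j. i < j \<longrightarrow> L i j = 0) \<and> (\<forall>i<p. 0 < L i i) \<and>
    (\<forall>i<p. \<forall>j<p. S $$ (i, j) = (\<Sum>l<p. L i l * L j l))"
  proof (rule cholesky)
    fix i j assume "i < p" "j < p"
    then show "S $$ (i, j) = S $$ (j, i)" using S(2) S(1) by (metis carrier_matD index_transpose_mat(1))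
  next
    fix v :: "nat \<Rightarrow> real" and i assume i: "i < p" "v i \<noteq> 0"
    have "0 < Matrix.vec p v \<bullet> (S *\<^sub>v Matrix.vec p v)"
    proof (rule pos)
      show "Matrix.vec p v \<noteq> 0\<^sub>v p"
      proof
        assume "Matrix.vec p v = 0\<^sub>v p"
        then have "Matrix.vec p v $ i = 0\<^sub>v p $ i" by simp
        then show False using i by simp
      qed
    qed simp
    also have "Matrix.vec p v \<bullet> (S *\<^sub>v Matrix.vec p v) = (\<Sum>i<p. \<Sum>j<p. v i * S $$ (i, j) * v j)"
      using S(1) by (simp add: scalar_prod_def atLeast0LessThan sum_distrib_left mult.assoc)
    finally show "0 < (\<Sum>i<p. \<Sum>j<p. v i * S $$ (i, j) * v j)" .
  qed
  then obtain L where L: "\<forall>i j. i < j \<longrightarrow> L i j = 0" "\<forall>i<p. 0 < L i i" "\<forall>i<p. \<forall>j<p. S $$ (i, j) = (\<Sum>l<p. L i l * L j l)" by blast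
  have "S = Matrix.mat p p (\<lambda>(i, j). L i j) * transpose_mat (Matrix.mat p p (\<lambda>(i, j). L i j))"
    using S(1) L(3) by (intro eq_matI) (auto simp: scalar_prod_def atLeast0LessThan)
  with L have "lower_factor p S L" unfolding lower_factor_def by blast
  then show ?thesis by (rule that)
qed

definition lower_mat :: "nat \<Rightarrow> (nat \<Rightarrow> nat \<Rightarrow> real) \<Rightarrow> real mat" where
  "lower_mat p L = Matrix.mat p p (\<lambda>(i, j). L i j)"

context
  fixes p :: nat and S :: "real mat" and L :: "nat \<Rightarrow> nat \<Rightarrow> real"
  assumes L: "lower_factor p S L"
begin

abbreviation "Lm \<equiv> lower_mat p L"

lemma Lm: "Lm \<in> carrier_mat p p" "S = Lm * transpose_mat Lm" "S \<in> carrier_mat p p"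
proof -
  show a: "Lm \<in> carrier_mat p p" by (simp add: lower_mat_def)
  show b: "S = Lm * transpose_mat Lm" using L by (simp add: lower_factor_def lower_mat_def)
  show "S \<in> carrier_mat p p" unfolding b using a by simp
qed

lemma det_Lm: "Determinant.det Lm = (\<Prod>i<p. L i i)" "0 < Determinant.det Lm" "Determinant.det S = (Determinant.det Lm)\<^sup>2"
proof -
  have "Determinant.det Lm = prod_list (diag_mat Lm)"
    by (rule det_lower_triangular[of p]) (use L in \<open>auto simp: lower_mat_def lower_factor_def\<close>)
  also have "\<dots> = (\<Prod>i<p. L i i)"
    by (simp add: diag_mat_def lower_mat_def prod.list_conv_set_nth atLeast0LessThan)
  finally show d: "Determinant.det Lm = (\<Prod>i<p. L i i)" .
  show "0 < Determinant.det Lm" unfolding d using L by (intro prod_pos) (auto simp: lower_factor_def)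
  show "Determinant.det S = (Determinant.det Lm)\<^sup>2"
    using det_mult[OF Lm(1), of "transpose_mat Lm"] det_transpose[OF Lm(1)] Lm(1,2) by (simp add: power2_eq_square)
qed

lemma det_S_pos: "0 < Determinant.det S"
  unfolding det_Lm(3) by (rule zero_less_power[OF det_Lm(2)])

text \<open>With T = L K L^T, the equation T T^{-1} = 1 exhibits K L^T T^{-1} as a right inverse of
  L. Read as a left inverse it says K (L^T T^{-1} L) = 1.\<close>

lemma inv_congruence:
  assumes K: "K \<in> carrier_mat p p" "Determinant.det K \<noteq> 0"
  shows "transpose_mat Lm * inv_mat (Lm * K * transpose_mat Lm) * Lm = inv_mat K"
    and "Determinant.det (Lm * K * transpose_mat Lm) = (Determinant.det Lm)\<^sup>2 * Determinant.det K"
proof -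
  define T where "T = Lm * K * transpose_mat Lm"
  note Lm1 = Lm(1)
  have c: "transpose_mat Lm \<in> carrier_mat p p" using Lm1 by simp
  have LK: "Lm * K \<in> carrier_mat p p" using Lm1 K by simp
  have T: "T \<in> carrier_mat p p" unfolding T_def using LK c by simp
  show det: "Determinant.det (Lm * K * transpose_mat Lm) = (Determinant.det Lm)\<^sup>2 * Determinant.det K"
    using det_mult[OF LK c] det_mult[OF Lm1 K(1)] det_transpose[OF Lm1] by (simp add: power2_eq_square)
  then have "Determinant.det T \<noteq> 0" unfolding T_def using det_Lm(2) K(2) by simp
  note iT = inv_mat_right(1)[OF T this] inv_mat_carrier[OF T]
  have X: "K * (transpose_mat Lm * inv_mat T) \<in> carrier_mat p p" using K(1) c iT(2) by simp
  have "Lm * (K * (transpose_mat Lm * inv_mat T)) = T * inv_mat T"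
    unfolding T_def using Lm1 K(1) c iT(2) by (simp add: assoc_mult_mat[of _ p p _ p _ p])
  then have "Lm * (K * (transpose_mat Lm * inv_mat T)) = 1\<^sub>m p" using iT(1) by simp
  then have "K * (transpose_mat Lm * inv_mat T) * Lm = 1\<^sub>m p"
    by (rule mat_mult_left_right_inverse[OF Lm1 X])
  then have "K * (transpose_mat Lm * inv_mat T * Lm) = 1\<^sub>m p"
    using Lm1 K(1) c iT(2) by (simp add: assoc_mult_mat[of _ p p _ p _ p])
  from inv_mat_unique(1)[OF K(1) _ this] show "transpose_mat Lm * inv_mat (Lm * K * transpose_mat Lm) * Lm = inv_mat K"
    using Lm1 c iT(2) by (simp add: T_def)
qed

text \<open>This is how the unknown covariance cancels: vectors multiplied by L, measured in the
  inverse of a matrix transformed by congruence, give a form in white noise alone.\<close>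

lemma quad_congruence:
  assumes K: "K \<in> carrier_mat p p" "Determinant.det K \<noteq> 0"
  shows "(\<Sum>j<p. \<Sum>l<p. (\<Sum>q<p. L j q * v q) * inv_mat (Lm * K * transpose_mat Lm) $$ (j, l) * (\<Sum>q<p. L l q * z q))
    = (\<Sum>j<p. \<Sum>l<p. v j * inv_mat K $$ (j, l) * z l)"
proof -
  define T where "T = Lm * K * transpose_mat Lm"
  note Lm1 = Lm(1)
  have c: "transpose_mat Lm \<in> carrier_mat p p" using Lm1 by simp
  have iT: "inv_mat T \<in> carrier_mat p p" unfolding T_def using Lm1 K c by simp
  define v' where "v' = Matrix.vec p v"
  define z' where "z' = Matrix.vec p z"
  have Lv: "(Lm *\<^sub>v v') $ j = (\<Sum>q<p. L j q * v q)" "(Lm *\<^sub>v z') $ j = (\<Sum>q<p. L j q * z q)" if "j < p" for j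
    using that by (simp_all add: lower_mat_def v'_def z'_def scalar_prod_def atLeast0LessThan)
  have vz: "v' \<in> carrier_vec p" "z' \<in> carrier_vec p" "Lm *\<^sub>v v' \<in> carrier_vec p" "Lm *\<^sub>v z' \<in> carrier_vec p"
    using Lm1 by (auto simp: v'_def z'_def)
  have w: "inv_mat T *\<^sub>v (Lm *\<^sub>v z') \<in> carrier_vec p" using iT vz by simp
  have bil: "(\<Sum>j<p. \<Sum>l<p. a $ j * B $$ (j, l) * b $ l) = a \<bullet> (B *\<^sub>v b)"
    if "a \<in> carrier_vec p" "b \<in> carrier_vec p" "B \<in> carrier_mat p p" for a b and B :: "real mat"
    using that carrier_matD[OF that(3)] by (simp add: scalar_prod_def atLeast0LessThan sum_distrib_left mult.assoc)
  have "(\<Sum>j<p. \<Sum>l<p. (\<Sum>q<p. L j q * v q) * inv_mat T $$ (j, l) * (\<Sum>q<p. L l q * z q)) =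
      (\<Sum>j<p. \<Sum>l<p. (Lm *\<^sub>v v') $ j * inv_mat T $$ (j, l) * (Lm *\<^sub>v z') $ l)"
    by (intro sum.cong refl) (simp add: Lv)
  also have "\<dots> = (Lm *\<^sub>v v') \<bullet> (inv_mat T *\<^sub>v (Lm *\<^sub>v z'))"
    by (rule bil[OF vz(3,4) iT])
  also have "\<dots> = v' \<bullet> (transpose_mat Lm *\<^sub>v (inv_mat T *\<^sub>v (Lm *\<^sub>v z')))"
    using transpose_vec_mult_scalar[of "transpose_mat Lm" p p "inv_mat T *\<^sub>v (Lm *\<^sub>v z')" v'] Lm1 w vz by simp
  also have "transpose_mat Lm *\<^sub>v (inv_mat T *\<^sub>v (Lm *\<^sub>v z')) = (transpose_mat Lm * inv_mat T * Lm) *\<^sub>v z'"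
    using Lm1 iT vz by (simp add: assoc_mult_mat_vec[of _ p p _ p])
  also have "\<dots> = inv_mat K *\<^sub>v z'" unfolding T_def inv_congruence(1)[OF K] ..
  also have "v' \<bullet> (inv_mat K *\<^sub>v z') = (\<Sum>j<p. \<Sum>l<p. v' $ j * inv_mat K $$ (j, l) * z' $ l)"
    by (rule bil[symmetric]) (use vz K in auto)
  also have "\<dots> = (\<Sum>j<p. \<Sum>l<p. v j * inv_mat K $$ (j, l) * z l)"
    by (intro sum.cong refl) (simp add: v'_def z'_def)
  finally show ?thesis by (simp add: T_def)
qed

lemma quad_transform:
  "(\<Sum>j<p. \<Sum>l<p. (\<Sum>q<p. L j q * v q) * inv_mat S $$ (j, l) * (\<Sum>q<p. L l q * z q)) = (\<Sum>q<p. v q * z q)"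
proof -
  have i1: "inv_mat (1\<^sub>m p) = 1\<^sub>m p" by (rule inv_mat_unique(1)) auto
  have "Lm * 1\<^sub>m p * transpose_mat Lm = S" using Lm(1,2) by simp
  then have "(\<Sum>j<p. \<Sum>l<p. (\<Sum>q<p. L j q * v q) * inv_mat S $$ (j, l) * (\<Sum>q<p. L l q * z q))
     = (\<Sum>j<p. \<Sum>l<p. v j * inv_mat (1\<^sub>m p) $$ (j, l) * z l)"
    using quad_congruence[of "1\<^sub>m p" v z] by simp
  also have "\<dots> = (\<Sum>j<p. \<Sum>l<p. if l = j then v j * z l else 0)"
    unfolding i1 by (intro sum.cong refl) auto
  finally show ?thesis by simp
qed

end

context
  fixes n p :: nat and M S :: "real mat" and L :: "nat \<Rightarrow> nat \<Rightarrow> real"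
  assumes M: "M \<in> carrier_mat n p" and L: "lower_factor p S L"
begin

lemma transform_carrier [simp]: "transform n p M L w \<in> carrier_mat n p" by (simp add: transform_def)

lemma pdf_transform:
  "(\<Prod>i\<in>{..<n} \<times> {..<p}. ennreal (L (snd i) (snd i))) * ennreal (matnormal_pdf M S (transform n p M L w))
     = (\<Prod>i\<in>{..<n} \<times> {..<p}. ennreal (std_normal_density (w i)))"
proof -
  have Lpos: "0 < L j j" if "j < p" for j using L that by (simp add: lower_factor_def)
  have sq: "sqrt ((2 * pi) ^ p * Determinant.det S) = sqrt (2 * pi) ^ p * (\<Prod>j<p. L j j)"
    unfolding det_Lm(3)[OF L] real_sqrt_mult[of "(2 * pi) ^ p"] real_sqrt_power[of "2 * pi"] real_sqrt_abs abs_of_pos[OF det_Lm(2)[OF L]]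
    by (simp only: det_Lm(1)[OF L])
  have row: "(\<Prod>j<p. L j j) * (exp (- (\<Sum>j<p. \<Sum>l<p. (transform n p M L w $$ (i, j) - M $$ (i, j)) * inv_mat S $$ (j, l) * (transform n p M L w $$ (i, l) - M $$ (i, l))) / 2)
      / sqrt ((2 * pi) ^ p * Determinant.det S)) = (\<Prod>j<p. std_normal_density (w (i, j)))" if i: "i < n" for i
  proof -
    have "(\<Sum>j<p. \<Sum>l<p. (transform n p M L w $$ (i, j) - M $$ (i, j)) * inv_mat S $$ (j, l) * (transform n p M L w $$ (i, l) - M $$ (i, l)))
       = (\<Sum>j<p. \<Sum>l<p. (\<Sum>q<p. L j q * w (i, q)) * inv_mat S $$ (j, l) * (\<Sum>q<p. L l q * w (i, q)))"
      using i by (intro sum.cong refl) (simp add: transform_def)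
    also have "\<dots> = (\<Sum>q<p. (w (i, q))\<^sup>2)" by (simp add: quad_transform[OF L] power2_eq_square)
    finally have q: "(\<Sum>j<p. \<Sum>l<p. (transform n p M L w $$ (i, j) - M $$ (i, j)) * inv_mat S $$ (j, l) * (transform n p M L w $$ (i, l) - M $$ (i, l)))
       = (\<Sum>q<p. (w (i, q))\<^sup>2)" .
    have "(\<Prod>j<p. std_normal_density (w (i, j))) = (\<Prod>j<p. exp (- (w (i, j))\<^sup>2 / 2)) / sqrt (2 * pi) ^ p"
    proof -
      have "std_normal_density z = exp (- z\<^sup>2 / 2) / sqrt (2 * pi)" for z by (simp add: std_normal_density_def)
      then show ?thesis by (simp only: prod_dividef prod_constant card_lessThan)
    qed
    also have "(\<Prod>j<p. exp (- (w (i, j))\<^sup>2 / 2)) = exp (- (\<Sum>q<p. (w (i, q))\<^sup>2) / 2)"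
    proof -
      have "- (\<Sum>q<p. (w (i, q))\<^sup>2) / 2 = (\<Sum>q<p. - (w (i, q))\<^sup>2 / 2)"
        by (simp add: sum_negf sum_divide_distrib)
      then show ?thesis by (simp only: exp_sum finite_lessThan)
    qed
    finally have d: "(\<Prod>j<p. std_normal_density (w (i, j))) = exp (- (\<Sum>q<p. (w (i, q))\<^sup>2) / 2) / sqrt (2 * pi) ^ p" .
    have "0 < (\<Prod>j<p. L j j)" using Lpos by (intro prod_pos) auto
    then have nz: "(\<Prod>j<p. L j j) \<noteq> 0" by linarith
    have cancel: "C * (E / (s * C)) = E / s" if "C \<noteq> 0" for C E s :: real using that by simp
    show ?thesis unfolding q sq d by (rule cancel[OF nz])
  qed
  have "(\<Prod>i\<in>{..<n} \<times> {..<p}. L (snd i) (snd i)) * matnormal_pdf M S (transform n p M L w)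
     = (\<Prod>i<n. \<Prod>j<p. std_normal_density (w (i, j)))"
    unfolding matnormal_pdf_eq[OF M transform_carrier Lm(3)[OF L]]
  proof -
    have "(\<Prod>i\<in>{..<n} \<times> {..<p}. L (snd i) (snd i)) = (\<Prod>i<n. \<Prod>j<p. L j j)"
      by (simp only: prod.cartesian_product split_beta')
    then show "(\<Prod>i\<in>{..<n} \<times> {..<p}. L (snd i) (snd i)) * (\<Prod>i<n. exp (- (\<Sum>j<p. \<Sum>l<p. (transform n p M L w $$ (i, j) - M $$ (i, j)) * inv_mat S $$ (j, l) * (transform n p M L w $$ (i, l) - M $$ (i, l))) / 2)
      / sqrt ((2 * pi) ^ p * Determinant.det S)) = (\<Prod>i<n. \<Prod>j<p. std_normal_density (w (i, j)))"
      by (simp only: prod.distrib[symmetric]) (intro prod.cong refl row, simp)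
  qed
  also have "\<dots> = (\<Prod>i\<in>{..<n} \<times> {..<p}. std_normal_density (w i))" by (simp add: prod.cartesian_product)
  finally have eq: "(\<Prod>i\<in>{..<n} \<times> {..<p}. L (snd i) (snd i)) * matnormal_pdf M S (transform n p M L w) = \<dots>" .
  have nn: "0 \<le> L (snd i) (snd i)" if "i \<in> {..<n} \<times> {..<p}" for i using Lpos[of "snd i"] that by auto
  have 1: "(\<Prod>i\<in>{..<n} \<times> {..<p}. ennreal (L (snd i) (snd i))) = ennreal (\<Prod>i\<in>{..<n} \<times> {..<p}. L (snd i) (snd i))"
    by (rule prod_ennreal) (rule nn)
  have 2: "(\<Prod>i\<in>{..<n} \<times> {..<p}. ennreal (std_normal_density (w i))) = ennreal (\<Prod>i\<in>{..<n} \<times> {..<p}. std_normal_density (w i))"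
    by (rule prod_ennreal) simp
  have "0 \<le> (\<Prod>i\<in>{..<n} \<times> {..<p}. L (snd i) (snd i))" by (rule prod_nonneg) (use nn in blast)
  then show ?thesis unfolding 1 2 by (simp only: ennreal_mult'[symmetric] eq)
qed

lemma measurable_transform [measurable]: "transform n p M L \<in> measurable (\<Pi>\<^sub>M ij\<in>{..<n} \<times> {..<p}. borel) (lborel_mat n p)"
  by (rule measurable_lborel_matI) (auto simp: transform_def intro!: borel_measurable_add borel_measurable_sum borel_measurable_times measurable_component_singleton)

lemma matnormal_eq_distr:
  "matnormal M S = distr (gaussM ({..<n} \<times> {..<p})) (lborel_mat n p) (transform n p M L)"
proof (rule measure_eqI)
  let ?I = "{..<n} \<times> {..<p}"
  have mn: "matnormal M S = density (lborel_mat n p) (\<lambda>Y. ennreal (matnormal_pdf M S Y))"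
    using M by (simp add: matnormal_def)
  show "sets (matnormal M S) = sets (distr (gaussM ?I) (lborel_mat n p) (transform n p M L))" by (simp add: mn)
  note [measurable] = measurable_matnormal_pdf[OF M Lm(3)[OF L]]
  fix X assume "X \<in> sets (matnormal M S)"
  then have X [measurable]: "X \<in> sets (lborel_mat n p)" by (simp add: mn)
  define F where "F w = ennreal (matnormal_pdf M S (Matrix.mat n p w)) * indicator X (Matrix.mat n p w)" for w
  have mmat: "Matrix.mat n p \<in> measurable (\<Pi>\<^sub>M ij\<in>?I. lborel) (lborel_mat n p)"
    by (rule measurable_lborel_matI) (auto intro: measurable_component_singleton)
  have mF: "F \<in> borel_measurable (\<Pi>\<^sub>M ij\<in>?I. lborel)"
    unfolding F_def[abs_def] using mmat by measurable
  have "emeasure (matnormal M S) X = (\<integral>\<^sup>+Y. ennreal (matnormal_pdf M S Y) * indicator X Y \<partial>lborel_mat n p)"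
    unfolding mn by (subst emeasure_density) auto
  also have "\<dots> = (\<integral>\<^sup>+w. F w \<partial>(\<Pi>\<^sub>M ij\<in>?I. lborel))"
    unfolding F_def by (rule nn_integral_lborel_mat) measurable
  also have "\<dots> = (\<Prod>i\<in>?I. ennreal (L (snd i) (snd i))) * (\<integral>\<^sup>+w. F (\<lambda>i\<in>?I. M $$ i + L (snd i) (snd i) * w i +
      (\<Sum>j\<in>?I. (if fst i = fst j \<and> snd j < snd i then L (snd i) (snd j) else 0) * w j)) \<partial>(\<Pi>\<^sub>M i\<in>?I. lborel))"
    \<comment> \<open>The rank is the column: as L is lower triangular, entry (a, j) involves,
      besides w (a, j), only entries of the same row in smaller columns.\<close>
    by (rule nn_integral_triangular[where r=snd]) (use mF L in \<open>auto simp: lower_factor_def\<close>)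
  also have "\<dots> = (\<Prod>i\<in>?I. ennreal (L (snd i) (snd i))) *
     (\<integral>\<^sup>+w. ennreal (matnormal_pdf M S (transform n p M L w)) * indicator X (transform n p M L w) \<partial>(\<Pi>\<^sub>M i\<in>?I. lborel))"
  proof (intro arg_cong2[where f="(*)"] refl nn_integral_cong)
    fix w :: "nat \<times> nat \<Rightarrow> real"
    have "Matrix.mat n p (\<lambda>i\<in>?I. M $$ i + L (snd i) (snd i) * w i +
      (\<Sum>j\<in>?I. (if fst i = fst j \<and> snd j < snd i then L (snd i) (snd j) else 0) * w j)) = transform n p M L w"
    proof (rule eq_matI)
      fix a j assume "a < dim_row (transform n p M L w)" "j < dim_col (transform n p M L w)"
      then have aj: "a < n" "j < p" by (simp_all add: transform_def)
      have "(\<Sum>i\<in>?I. (if a = fst i \<and> snd i < j then L j (snd i) else 0) * w i) =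
         (\<Sum>b<n. if b = a then (\<Sum>l<p. (if l < j then L j l else 0) * w (b, l)) else 0)"
      proof -
        have "(\<Sum>i\<in>?I. (if a = fst i \<and> snd i < j then L j (snd i) else 0) * w i) =
          (\<Sum>b<n. \<Sum>l<p. (if a = b \<and> l < j then L j l else 0) * w (b, l))"
          by (simp add: sum.cartesian_product split_beta')
        also have "\<dots> = (\<Sum>b<n. if b = a then (\<Sum>l<p. (if l < j then L j l else 0) * w (b, l)) else 0)"
          by (intro sum.cong refl) (auto intro!: sum.neutral)
        finally show ?thesis .
      qed
      also have "\<dots> = (\<Sum>l<p. (if l < j then L j l else 0) * w (a, l))" using aj by simp
      also have "L j j * w (a, j) + \<dots> = (\<Sum>l<p. (if l = j then L j l * w (a, l) else 0) + (if l < j then L j l else 0) * w (a, l))"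
        using aj by (simp add: sum.distrib)
      also have "\<dots> = (\<Sum>l<p. L j l * w (a, l))"
        using L by (intro sum.cong refl) (auto simp: lower_factor_def not_less)
      finally have "L j j * w (a, j) + (\<Sum>i\<in>?I. (if a = fst i \<and> snd i < j then L j (snd i) else 0) * w i) = (\<Sum>l<p. L j l * w (a, l))" by simp
      then show "Matrix.mat n p (\<lambda>i\<in>?I. M $$ i + L (snd i) (snd i) * w i +
         (\<Sum>j\<in>?I. (if fst i = fst j \<and> snd j < snd i then L (snd i) (snd j) else 0) * w j)) $$ (a, j) = transform n p M L w $$ (a, j)"
        using aj by (simp add: transform_def cong: if_cong)
    qed (simp_all add: transform_def)
    then show "F (\<lambda>i\<in>?I. M $$ i + L (snd i) (snd i) * w i +
      (\<Sum>j\<in>?I. (if fst i = fst j \<and> snd j < snd i then L (snd i) (snd j) else 0) * w j)) =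
      ennreal (matnormal_pdf M S (transform n p M L w)) * indicator X (transform n p M L w)" by (simp add: F_def)
  qed
  also have "\<dots> = (\<integral>\<^sup>+w. (\<Prod>i\<in>?I. ennreal (std_normal_density (w i))) * indicator X (transform n p M L w) \<partial>(\<Pi>\<^sub>M i\<in>?I. lborel))"
  proof (subst nn_integral_cmult[symmetric])
    have "transform n p M L \<in> measurable (\<Pi>\<^sub>M i\<in>?I. lborel) (lborel_mat n p)"
      using measurable_transform by (simp cong: measurable_cong_sets sets_PiM_cong)
    then show "(\<lambda>w. ennreal (matnormal_pdf M S (transform n p M L w)) * indicator X (transform n p M L w)) \<in> borel_measurable (\<Pi>\<^sub>M i\<in>?I. lborel)"
      by measurable
  qed (simp add: mult.assoc[symmetric] pdf_transform)
  also have "\<dots> = (\<integral>\<^sup>+w. indicator X (transform n p M L w) \<partial>gaussM ?I)"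
  proof (subst gaussM_density, simp, subst nn_integral_density)
    have "transform n p M L \<in> measurable (\<Pi>\<^sub>M i\<in>?I. lborel) (lborel_mat n p)"
      using measurable_transform by (simp cong: measurable_cong_sets sets_PiM_cong)
    then show "(\<lambda>w. indicator X (transform n p M L w)) \<in> borel_measurable (\<Pi>\<^sub>M i\<in>?I. lborel)" by measurable
  qed auto
  also have "\<dots> = emeasure (distr (gaussM ?I) (lborel_mat n p) (transform n p M L)) X"
  proof -
    have mT: "transform n p M L \<in> measurable (gaussM ?I) (lborel_mat n p)"
      using measurable_transform by (simp cong: measurable_cong_sets add: sets_gaussM)
    have "emeasure (distr (gaussM ?I) (lborel_mat n p) (transform n p M L)) X =
        (\<integral>\<^sup>+Y. indicator X Y \<partial>distr (gaussM ?I) (lborel_mat n p) (transform n p M L))"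
      using X by simp
    also have "\<dots> = (\<integral>\<^sup>+w. indicator X (transform n p M L w) \<partial>gaussM ?I)"
      by (rule nn_integral_distr[OF mT]) (use X in simp)
    finally show ?thesis by simp
  qed
  finally show "emeasure (matnormal M S) X = emeasure (distr (gaussM ?I) (lborel_mat n p) (transform n p M L)) X" .
qed

end

subsection \<open>The expected loss\<close>

lemma det_bound:
  assumes A: "(A :: real mat) \<in> carrier_mat n n"
  shows "\<bar>Determinant.det A\<bar> \<le> fact n * (1 + (\<Sum>i<n. \<Sum>j<n. \<bar>A $$ (i, j)\<bar>)) ^ n"
proof -
  define s where "s = 1 + (\<Sum>i<n. \<Sum>j<n. \<bar>A $$ (i, j)\<bar>)"
  have "\<bar>A $$ (i, j)\<bar> \<le> s" if "i < n" "j < n" for i j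
  proof -
    have "\<bar>A $$ (i, j)\<bar> \<le> (\<Sum>j<n. \<bar>A $$ (i, j)\<bar>)" using that by (intro member_le_sum) auto
    also have "\<dots> \<le> (\<Sum>i<n. \<Sum>j<n. \<bar>A $$ (i, j)\<bar>)"
      using that by (intro member_le_sum[of i "{..<n}" "\<lambda>i. \<Sum>j<n. \<bar>A $$ (i, j)\<bar>"]) (auto intro: sum_nonneg)
    finally show ?thesis by (simp add: s_def)
  qed
  note entry = this
  have "\<bar>Determinant.det A\<bar> \<le> (\<Sum>q\<in>{q. q permutes {0..<n}}. \<bar>signof q * (\<Prod>i = 0..<n. A $$ (i, q i))\<bar>)"
    unfolding det_def'[OF A] by (rule sum_abs)
  also have "\<dots> \<le> (\<Sum>q\<in>{q. q permutes {0..<n}}. s ^ n)"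
  proof (rule sum_mono)
    fix q assume "q \<in> {q. q permutes {0..<n}}"
    then have q: "q i < n" if "i < n" for i using permutes_in_image[of q "{0..<n}" i] that by auto
    have "\<bar>signof q * (\<Prod>i = 0..<n. A $$ (i, q i))\<bar> = (\<Prod>i = 0..<n. \<bar>A $$ (i, q i)\<bar>)"
      by (simp add: abs_mult abs_prod sign_def)
    also have "\<dots> \<le> (\<Prod>i = 0..<n. s)" using q entry by (intro prod_mono) auto
    finally show "\<bar>signof q * (\<Prod>i = 0..<n. A $$ (i, q i))\<bar> \<le> s ^ n" by simp
  qed
  also have "\<dots> = fact n * s ^ n" by (simp add: card_permutations[of _ n])
  finally show ?thesis by (simp add: s_def)
qed

text \<open>A bound linear in the entries is the aim: applied to S it bounds ln det S from above,
  applied to S^{-1} it bounds it from below, and both kinds of entries are integrable.\<close>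

lemma ln_det_bound:
  assumes A: "(A :: real mat) \<in> carrier_mat n n" and d: "Determinant.det A > 0"
  shows "ln (Determinant.det A) \<le> ln (fact n) + real n * (\<Sum>i<n. \<Sum>j<n. \<bar>A $$ (i, j)\<bar>)"
proof -
  define t where "t = (\<Sum>i<n. \<Sum>j<n. \<bar>A $$ (i, j)\<bar>)"
  have t: "0 \<le> t" unfolding t_def by (intro sum_nonneg) simp
  have "ln (Determinant.det A) \<le> ln (fact n * (1 + t) ^ n)"
    using det_bound[OF A] d by (simp add: t_def)
  also have "\<dots> = ln (fact n) + real n * ln (1 + t)" using t by (simp add: ln_mult ln_realpow)
  also have "\<dots> \<le> ln (fact n) + real n * t" using t by (intro add_left_mono mult_left_mono ln_add_one_self_le_self) auto
  finally show ?thesis by (simp add: t_def)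
qed

lemma integral_sum3:
  fixes f :: "'i \<Rightarrow> 'j \<Rightarrow> 'k \<Rightarrow> 'a \<Rightarrow> real"
  assumes "\<And>a j l. a \<in> X \<Longrightarrow> j \<in> Y \<Longrightarrow> l \<in> Z \<Longrightarrow> integrable M (f a j l)"
  shows "integrable M (\<lambda>z. \<Sum>a\<in>X. \<Sum>j\<in>Y. \<Sum>l\<in>Z. f a j l z)"
    "(\<integral>z. (\<Sum>a\<in>X. \<Sum>j\<in>Y. \<Sum>l\<in>Z. f a j l z) \<partial>M) = (\<Sum>a\<in>X. \<Sum>j\<in>Y. \<Sum>l\<in>Z. \<integral>z. f a j l z \<partial>M)"
  using assms by (simp_all add: Bochner_Integration.integral_sum Bochner_Integration.integrable_sum)

lemma pair_integrable_mult:
  fixes f :: "'a \<Rightarrow> real" and g :: "'b \<Rightarrow> real"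
  assumes "prob_space M" "prob_space N" and f: "integrable M f" and g: "integrable N g"
  shows "integrable (M \<Otimes>\<^sub>M N) (\<lambda>z. f (fst z) * g (snd z))"
    and "(\<integral>z. f (fst z) * g (snd z) \<partial>(M \<Otimes>\<^sub>M N)) = integral\<^sup>L M f * integral\<^sup>L N g"
proof -
  interpret M: prob_space M by fact
  interpret N: prob_space N by fact
  interpret pair_prob_space M N ..
  note [measurable] = borel_measurable_integrable[OF f] borel_measurable_integrable[OF g]
  show int: "integrable (M \<Otimes>\<^sub>M N) (\<lambda>z. f (fst z) * g (snd z))"
  proof (rule Fubini_integrable)
    show "integrable M (\<lambda>x. \<integral>y. norm (f (fst (x, y)) * g (snd (x, y))) \<partial>N)"
      using f g by (simp add: abs_mult)
    show "AE x in M. integrable N (\<lambda>y. f (fst (x, y)) * g (snd (x, y)))" using g by simp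
  qed measurable
  show "(\<integral>z. f (fst z) * g (snd z) \<partial>(M \<Otimes>\<^sub>M N)) = integral\<^sup>L M f * integral\<^sup>L N g"
    using integral_fst'[OF int] by simp
qed

context sdesign
begin

lemma gauss_first_moment: "i \<in> I \<Longrightarrow> (\<integral>w. w i \<partial>\<nu>) = 0"
  using stein[of I i "\<lambda>_. 1" "\<lambda>_. 0"] by simp

lemma gauss_second_moment:
  assumes "i \<in> I" "j \<in> I" shows "(\<integral>w. w i * w j \<partial>\<nu>) = (if i = j then 1 else 0)"
proof -
  have "(\<integral>w. (if i = j then 1 else 0 :: real) \<partial>\<nu>) = (\<integral>w. w i * w j \<partial>\<nu>)"
  proof (rule stein[OF finite_I assms(1)])
    show "((\<lambda>t. (w(i := t)) j) has_real_derivative (if i = j then 1 else 0)) (at x)" for w x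
      by (auto intro!: derivative_eq_intros)
  qed (use assms in \<open>auto intro: measurable_component_singleton\<close>)
  then show ?thesis by (simp add: nu.prob_space)
qed

text \<open>A nonsingular Gram matrix is positive definite, so it has a triangular factor, and its
  determinant is the square of that of the factor.\<close>

lemma det_S0_pos:
  assumes d: "Determinant.det (S 0 w) \<noteq> 0" shows "0 < Determinant.det (S 0 w)"
proof -
  have "pos_def_mat p (S 0 w)"
    unfolding pos_def_mat_def
  proof (intro conjI ballI impI)
    show "transpose_mat (S 0 w) = S 0 w" unfolding S_def by (rule eq_matI) (auto simp: mult.commute)
    fix v :: "real Matrix.vec" assume v: "v \<in> carrier_vec p" "v \<noteq> 0\<^sub>v p"
    define Wv where "Wv a = (\<Sum>j<p. W w a j * v $ j)" for a
    have Sv: "(S 0 w *\<^sub>v v) $ j = (\<Sum>a<n. W w a j * Wv a)" if "j < p" for j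
    proof -
      have "(S 0 w *\<^sub>v v) $ j = (\<Sum>l<p. \<Sum>a<n. W w a j * (W w a l * v $ l))"
        using that v by (simp add: S_def scalar_prod_def atLeast0LessThan sum_distrib_right mult.assoc)
      also have "\<dots> = (\<Sum>a<n. \<Sum>l<p. W w a j * (W w a l * v $ l))" by (rule sum.swap)
      finally show ?thesis by (simp add: Wv_def sum_distrib_left)
    qed
    have q: "v \<bullet> (S 0 w *\<^sub>v v) = (\<Sum>a<n. (Wv a)\<^sup>2)"
    proof -
      have "v \<bullet> (S 0 w *\<^sub>v v) = (\<Sum>j<p. v $ j * (S 0 w *\<^sub>v v) $ j)"
        using carrier_matD[OF S_carrier] by (simp add: scalar_prod_def[of v] atLeast0LessThan)
      also have "\<dots> = (\<Sum>j<p. \<Sum>a<n. (W w a j * v $ j) * Wv a)"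
        by (simp add: Sv sum_distrib_left mult_ac)
      also have "\<dots> = (\<Sum>a<n. \<Sum>j<p. (W w a j * v $ j) * Wv a)" by (rule sum.swap)
      finally show ?thesis by (simp add: Wv_def sum_distrib_right[symmetric] power2_eq_square)
    qed
    have "(\<Sum>a<n. (Wv a)\<^sup>2) \<noteq> 0"
    proof
      assume "(\<Sum>a<n. (Wv a)\<^sup>2) = 0"
      then have "Wv a = 0" if "a < n" for a using that by (simp add: sum_nonneg_eq_0_iff)
      then have "S 0 w *\<^sub>v v = 0\<^sub>v p" using Sv by (intro eq_vecI) (auto simp: S_def)
      then show False using d v det_0_iff_vec_prod_zero_field[OF S_carrier] by blast
    qed
    moreover have "0 \<le> (\<Sum>a<n. (Wv a)\<^sup>2)" by (intro sum_nonneg) simp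
    ultimately show "0 < v \<bullet> (S 0 w *\<^sub>v v)" unfolding q by simp
  qed simp
  then obtain L where "lower_factor p (S 0 w) L" by (rule pos_def_lower_factor)
  then show ?thesis by (rule det_S_pos)
qed

lemma R_le_u0: "Determinant.det (S 0 w) \<noteq> 0 \<Longrightarrow> \<bar>R 0 w j l\<bar> \<le> u 0 w"
proof -
  assume d: "Determinant.det (S 0 w) \<noteq> 0"
  interpret r: reginv n p "W w" "R 0 w" 0 by (rule det_S0[OF d])
  show ?thesis using r.r_le_u[of j l] r.u_nonneg by (cases "j < p \<and> l < p") (auto simp: u_def R_def)
qed

context
  assumes Nb: "real p + 1 < N"
begin

lemma R0_integrable: "integrable \<nu> (\<lambda>w. R 0 w j l)"
proof (rule Bochner_Integration.integrable_bound[OF u0_integrable[OF Nb]])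
  show "AE w in \<nu>. norm (R 0 w j l) \<le> norm (u 0 w)"
    using AE_det_S0[OF Nb] by eventually_elim (use R_le_u0 in \<open>auto intro: order_trans[OF _ abs_ge_self]\<close>)
qed measurable

lemma ln_det_integrable: "integrable \<nu> (\<lambda>w. ln (Determinant.det (S 0 w)))"
proof (rule Bochner_Integration.integrable_bound)
  define B where "B w = ln (fact p) + real p * (\<Sum>i<p. \<Sum>j<p. \<bar>S 0 w $$ (i, j)\<bar>) + real p * (\<Sum>i<p. \<Sum>j<p. u 0 w)" for w
  have "integrable \<nu> (\<lambda>w. S 0 w $$ (i, j))" if "i < p" "j < p" for i j
    using that by (intro integrable_poly) (auto simp: S_def intro!: polybd_sum polybd_mult polybd_add)
  then show "integrable \<nu> B"
    unfolding B_def by (intro Bochner_Integration.integrable_add integrable_mult_right Bochner_Integration.integrable_sum integrable_abs u0_integrable Nb) auto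
  show "AE w in \<nu>. norm (ln (Determinant.det (S 0 w))) \<le> norm (B w)"
    using AE_det_S0[OF Nb]
  proof eventually_elim
    fix w assume d: "Determinant.det (S 0 w) \<noteq> 0"
    have iS: "inv_mat (S 0 w) \<in> carrier_mat p p" by simp
    have dp: "0 < Determinant.det (S 0 w)" by (rule det_S0_pos[OF d])
    have "Determinant.det (S 0 w) * Determinant.det (inv_mat (S 0 w)) = 1"
      using det_mult[OF S_carrier[of 0 w] iS] inv_mat_right(1)[OF S_carrier d] by simp
    then have di: "Determinant.det (inv_mat (S 0 w)) = 1 / Determinant.det (S 0 w)" using d by (simp add: field_simps)
    have u0: "0 \<le> u 0 w" using reginv.u_nonneg[OF det_S0[OF d]] by (simp add: u_def)
    have "ln (Determinant.det (inv_mat (S 0 w))) \<le> ln (fact p) + real p * (\<Sum>i<p. \<Sum>j<p. \<bar>inv_mat (S 0 w) $$ (i, j)\<bar>)"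
      by (rule ln_det_bound[OF iS]) (simp add: di dp)
    also have "(\<Sum>i<p. \<Sum>j<p. \<bar>inv_mat (S 0 w) $$ (i, j)\<bar>) \<le> (\<Sum>i<p. \<Sum>j<p. u 0 w)"
    proof (intro sum_mono)
      fix i j assume "i \<in> {..<p}" "j \<in> {..<p}"
      then show "\<bar>inv_mat (S 0 w) $$ (i, j)\<bar> \<le> u 0 w" using R_le_u0[OF d, of i j] by (simp add: R_def)
    qed
    finally have 1: "- ln (Determinant.det (S 0 w)) \<le> ln (fact p) + real p * (\<Sum>i<p. \<Sum>j<p. u 0 w)"
      using dp by (simp add: di ln_div mult_left_mono)
    have 2: "ln (Determinant.det (S 0 w)) \<le> ln (fact p) + real p * (\<Sum>i<p. \<Sum>j<p. \<bar>S 0 w $$ (i, j)\<bar>)"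
      by (rule ln_det_bound[OF S_carrier dp])
    have 3: "0 \<le> real p * (\<Sum>i<p. \<Sum>j<p. u 0 w)" using u0 by simp
    have 4: "0 \<le> real p * (\<Sum>i<p. \<Sum>j<p. \<bar>S 0 w $$ (i, j)\<bar>)" by (intro mult_nonneg_nonneg sum_nonneg) auto
    have "\<bar>ln (Determinant.det (S 0 w))\<bar> \<le> B w" using 1 2 3 4 unfolding B_def by linarith
    then show "norm (ln (Determinant.det (S 0 w))) \<le> norm (B w)" by simp
  qed
qed measurable

end

end

text \<open>\<open>e\<close> is an orthonormal basis of the column space of the design, \<open>Qf\<close> the projection onto the
  orthogonal complement.\<close>

locale frame =
  fixes n p m :: nat and e :: "nat \<Rightarrow> nat \<Rightarrow> real"
  assumes orth: "\<And>i j. i < m \<Longrightarrow> j < m \<Longrightarrow> (\<Sum>a<n. e i a * e j a) = (if i = j then 1 else 0)"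
begin

definition Qf :: "nat \<Rightarrow> nat \<Rightarrow> real" where
  "Qf a b = (if a = b then 1 else 0) - (\<Sum>i<m. e i a * e i b)"

lemma Qf_e: assumes "i < m" "a < n" shows "(\<Sum>b<n. Qf a b * e i b) = 0"
proof -
  have "(\<Sum>b<n. Qf a b * e i b) = (\<Sum>b<n. (if a = b then e i b else 0) - (\<Sum>k<m. e k a * (e k b * e i b)))"
    unfolding Qf_def by (intro sum.cong refl) (auto simp: left_diff_distrib sum_distrib_right mult.assoc)
  also have "\<dots> = e i a - (\<Sum>b<n. \<Sum>k<m. e k a * (e k b * e i b))"
    using assms by (simp add: sum_subtractf)
  also have "(\<Sum>b<n. \<Sum>k<m. e k a * (e k b * e i b)) = (\<Sum>k<m. e k a * (\<Sum>b<n. e k b * e i b))"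
    by (subst sum.swap) (simp add: sum_distrib_left)
  also have "\<dots> = (\<Sum>k<m. if k = i then e k a else 0)" using assms by (intro sum.cong refl) (auto simp: orth)
  finally show ?thesis using assms by simp
qed

lemma Qf_sym: "Qf a b = Qf b a"
  by (simp add: Qf_def mult.commute)

sublocale D: sdesign n p Qf
proof
  fix a b assume ab: "a < n" "b < n"
  show "Qf a b = Qf b a" by (rule Qf_sym)
  have "(\<Sum>c<n. Qf a c * Qf c b) = (\<Sum>c<n. (if c = b then Qf a c else 0) - (\<Sum>i<m. Qf a c * e i c * e i b))"
    unfolding Qf_def[of _ b] by (intro sum.cong refl) (auto simp: right_diff_distrib sum_distrib_left mult.assoc)
  also have "\<dots> = Qf a b - (\<Sum>c<n. \<Sum>i<m. Qf a c * e i c * e i b)" using ab by (simp add: sum_subtractf)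
  also have "(\<Sum>c<n. \<Sum>i<m. Qf a c * e i c * e i b) = (\<Sum>i<m. (\<Sum>c<n. Qf a c * e i c) * e i b)"
    by (subst sum.swap) (simp add: sum_distrib_right)
  also have "\<dots> = 0" using ab by (simp add: Qf_e)
  finally show "(\<Sum>c<n. Qf a c * Qf c b) = Qf a b" by simp
qed

lemma N_eq: "D.N = real n - real m"
proof -
  have "D.N = real n - (\<Sum>a<n. \<Sum>i<m. e i a * e i a)"
    unfolding D.N_def Qf_def by (simp add: sum_subtractf)
  also have "(\<Sum>a<n. \<Sum>i<m. e i a * e i a) = (\<Sum>i<m. \<Sum>a<n. e i a * e i a)" by (rule sum.swap)
  finally show ?thesis by (simp add: orth)
qed

lemma dir: "i < m \<Longrightarrow> sdesign_dir n Qf (e i)"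
  by unfold_locales (auto simp: orth power2_eq_square Qf_e)

abbreviation xx :: "nat \<Rightarrow> (nat \<times> nat \<Rightarrow> real) \<Rightarrow> nat \<Rightarrow> real" where
  "xx i \<equiv> sdesign_dir.x n p (e i)"

definition yy :: "(nat \<Rightarrow> nat \<Rightarrow> real) \<Rightarrow> nat \<Rightarrow> (nat \<times> nat \<Rightarrow> real) \<Rightarrow> nat \<Rightarrow> real" where
  "yy v i w l = xx i w l + v i l"

text \<open>With \<open>v\<close> the whitened mean, \<open>zz v i\<close> is \<open>x\<^sub>i\<^sup>T S\<^sup>-\<^sup>1 x\<^sub>i / d\<^sub>i\<close> and \<open>Del\<close> the whitened error of the fitted mean.\<close>

definition zz :: "(nat \<Rightarrow> nat \<Rightarrow> real) \<Rightarrow> nat \<Rightarrow> (nat \<times> nat \<Rightarrow> real) \<Rightarrow> real" where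
  "zz v i w = (\<Sum>j<p. \<Sum>l<p. yy v i w j * D.R 0 w j l * yy v i w l)"

definition beta :: real where "beta = (real p - 2) / (real n - real m - real p + 1)"

definition del :: "(nat \<Rightarrow> nat \<Rightarrow> real) \<Rightarrow> nat \<Rightarrow> (nat \<times> nat \<Rightarrow> real) \<Rightarrow> nat \<Rightarrow> real" where
  "del v i w j = xx i w j - beta / zz v i w * yy v i w j"

definition Del :: "(nat \<Rightarrow> nat \<Rightarrow> real) \<Rightarrow> (nat \<times> nat \<Rightarrow> real) \<Rightarrow> nat \<Rightarrow> nat \<Rightarrow> real" where
  "Del v w a j = (\<Sum>i<m. e i a * del v i w j)"

text \<open>The whitened prediction error for new data \<open>wt\<close>, measured in the inverse
  residual matrix. On almost all data, n times it is the part of minus twice the log plug-in density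
  that depends on \<open>wt\<close>.\<close>

definition loss :: "(nat \<Rightarrow> nat \<Rightarrow> real) \<Rightarrow> (nat \<times> nat \<Rightarrow> real) \<Rightarrow> (nat \<times> nat \<Rightarrow> real) \<Rightarrow> real" where
  "loss v wt w = (\<Sum>a<n. \<Sum>j<p. \<Sum>l<p. (wt (a, j) - Del v w a j) * D.R 0 w j l * (wt (a, l) - Del v w a l))"

lemma R0_sym: "D.R 0 w j l = D.R 0 w l j"
proof (cases "j < p \<and> l < p")
  case True
  show ?thesis
  proof (cases "Determinant.det (D.S 0 w) = 0")
    case d: True
    then show ?thesis using True inv_mat_singular[OF D.S_carrier d] by (simp add: D.R_def)
  next
    case False
    then show ?thesis using reginv.sym[OF D.det_S0[OF False]] True by blast
  qed
qed (auto simp: D.R_def)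

definition rdel :: "(nat \<Rightarrow> nat \<Rightarrow> real) \<Rightarrow> nat \<Rightarrow> (nat \<times> nat \<Rightarrow> real) \<Rightarrow> nat \<Rightarrow> real" where
  "rdel v i w j = (\<Sum>l<p. D.R 0 w j l * del v i w l)"

definition qdel :: "(nat \<Rightarrow> nat \<Rightarrow> real) \<Rightarrow> nat \<Rightarrow> (nat \<times> nat \<Rightarrow> real) \<Rightarrow> real" where
  "qdel v i w = (\<Sum>j<p. del v i w j * rdel v i w j)"

lemma measurable_yy [measurable]:
  assumes "i < m" shows "(\<lambda>w. yy v i w l) \<in> borel_measurable (\<Pi>\<^sub>M i\<in>D.I. borel)"
  unfolding yy_def using sdesign_dir.measurable_x[OF dir[OF assms]] by measurable

lemma measurable_del [measurable]:
  assumes i: "i < m"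
  shows "zz v i \<in> borel_measurable (\<Pi>\<^sub>M i\<in>D.I. borel)"
    "(\<lambda>w. del v i w l) \<in> borel_measurable (\<Pi>\<^sub>M i\<in>D.I. borel)"
    "(\<lambda>w. rdel v i w l) \<in> borel_measurable (\<Pi>\<^sub>M i\<in>D.I. borel)"
    "qdel v i \<in> borel_measurable (\<Pi>\<^sub>M i\<in>D.I. borel)"
proof -
  note [measurable] = measurable_yy[OF i] sdesign_dir.measurable_x[OF dir[OF i]]
  show [measurable]: "zz v i \<in> borel_measurable (\<Pi>\<^sub>M i\<in>D.I. borel)" unfolding zz_def[abs_def] by measurable
  show [measurable]: "(\<lambda>w. del v i w l) \<in> borel_measurable (\<Pi>\<^sub>M i\<in>D.I. borel)" for l unfolding del_def by measurable
  show [measurable]: "(\<lambda>w. rdel v i w l) \<in> borel_measurable (\<Pi>\<^sub>M i\<in>D.I. borel)" for l unfolding rdel_def by measurable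
  show "qdel v i \<in> borel_measurable (\<Pi>\<^sub>M i\<in>D.I. borel)" unfolding qdel_def[abs_def] by measurable
qed

section \<open>Expectation of the loss\<close>

context
  assumes dims: "m + p + 1 < n"
begin

lemma Nb: "real p + 1 < D.N"
proof -
  have "real (m + p + 1) < real n" using dims by (simp only: of_nat_less_iff)
  then show ?thesis by (simp add: N_eq)
qed

lemma zz_pos:
  assumes i: "i < m" and p: "3 \<le> p"
  shows "AE w in D.\<nu>. 0 < zz v i w"
proof -
  interpret d: sdesign_dir n p Qf "e i" by (rule dir[OF i])
  have "zz v i w = d.zeta 0 (v i) w" for w
    by (simp add: zz_def d.zeta_def d.g_eq d.y_def yy_def sum_distrib_left mult.assoc)
  moreover have "AE w in D.\<nu>. 0 < d.zeta 0 (v i) w"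
    using D.AE_det_S0[OF Nb] d.AE_y2[OF Nb p, of "v i"] by eventually_elim (rule d.zeta0_pos)
  ultimately show ?thesis by simp
qed

text \<open>Expand the form at x - k y with k = beta / zz. The square of x contributes p / (N - p -
  1); by \<open>shrink_expectation\<close> the cross term contributes -2 beta^2 E (1 / zz); the
  square of k y contributes beta^2 E (1 / zz).\<close>

lemma qdel_expectation:
  assumes i: "i < m" and p: "2 \<le> p"
  shows "integrable D.\<nu> (qdel v i)" "integrable D.\<nu> (\<lambda>w. beta / zz v i w)"
    "(\<integral>w. qdel v i w \<partial>D.\<nu>) = real p / (D.N - real p - 1) - beta * (\<integral>w. beta / zz v i w \<partial>D.\<nu>)"
proof -
  interpret d: sdesign_dir n p Qf "e i" by (rule dir[OF i])
  have z: "zz v i w = d.zeta 0 (v i) w" for w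
    by (simp add: zz_def d.zeta_def d.g_eq d.y_def yy_def sum_distrib_left mult.assoc)
  define f1 where "f1 w = d.zeta 0 (\<lambda>_. 0) w" for w
  define f2 where "f2 w = d.phi 0 (v i) w * (\<Sum>l<p. xx i w l * d.g 0 (v i) w l)" for w
  have phi: "d.phi 0 (v i) w = 1 / zz v i w" for w by (simp add: d.phi_def z)
  have f1: "integrable D.\<nu> f1" "integral\<^sup>L D.\<nu> f1 = real p / (D.N - real p - 1)"
    unfolding f1_def using d.quad_integrable[OF Nb] d.E_quad[OF Nb] by auto
  have expand: "qdel v i w = f1 w - 2 * beta * f2 w + beta * (beta / zz v i w)" if "beta = 0 \<or> zz v i w \<noteq> 0" for w
  proof -
    define k where "k = beta / zz v i w"
    have "qdel v i w = (\<Sum>j<p. \<Sum>l<p. (xx i w j - k * yy v i w j) * D.R 0 w j l * (xx i w l - k * yy v i w l))"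
      by (simp add: qdel_def rdel_def del_def k_def sum_distrib_left mult.assoc)
    also have "\<dots> = (\<Sum>j<p. \<Sum>l<p. xx i w j * D.R 0 w j l * xx i w l) - k * (\<Sum>j<p. \<Sum>l<p. xx i w j * D.R 0 w j l * yy v i w l)
        - k * (\<Sum>j<p. \<Sum>l<p. yy v i w j * D.R 0 w j l * xx i w l) + k\<^sup>2 * zz v i w"
      unfolding zz_def sum_distrib_left sum_subtractf[symmetric] sum.distrib[symmetric]
      by (intro sum.cong refl) (simp add: algebra_simps power2_eq_square)
    also have "(\<Sum>j<p. \<Sum>l<p. yy v i w j * D.R 0 w j l * xx i w l) = (\<Sum>j<p. \<Sum>l<p. xx i w j * D.R 0 w j l * yy v i w l)"
      by (subst sum.swap) (intro sum.cong refl, simp add: R0_sym mult.commute)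
    also have "(\<Sum>j<p. \<Sum>l<p. xx i w j * D.R 0 w j l * xx i w l) = f1 w"
      by (simp add: f1_def d.zeta_def d.g_eq d.y_def sum_distrib_left mult.assoc)
    also have "(\<Sum>j<p. \<Sum>l<p. xx i w j * D.R 0 w j l * yy v i w l) = (\<Sum>l<p. xx i w l * d.g 0 (v i) w l)"
      by (simp add: d.g_eq d.y_def yy_def sum_distrib_left mult.assoc)
    also have "k\<^sup>2 * zz v i w = beta * k" using that by (auto simp: k_def power2_eq_square)
    finally show ?thesis by (simp add: f2_def phi k_def)
  qed
  \<comment> \<open>For p = 2 the expectation of 1 / zz is infinite, but beta = 0. The facts are
    therefore stated for products with beta, uniformly in both cases.\<close>
  have c: "integrable D.\<nu> (\<lambda>w. beta / zz v i w) \<and> (beta \<noteq> 0 \<longrightarrow> integrable D.\<nu> f2) \<and>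
     2 * beta * integral\<^sup>L D.\<nu> f2 = 2 * beta * (\<integral>w. beta / zz v i w \<partial>D.\<nu>) \<and> (AE w in D.\<nu>. beta = 0 \<or> zz v i w \<noteq> 0)"
  proof (cases "p = 2")
    case True
    then have "beta = 0" unfolding beta_def by simp
    then show ?thesis by simp
  next
    case False
    then have p3: "3 \<le> p" using p by simp
    have i1: "integrable D.\<nu> (\<lambda>w. 1 / zz v i w)" using d.phi0_integrable[OF Nb p3, of "v i"] by (simp add: phi[symmetric])
    have i2: "integrable D.\<nu> f2" unfolding f2_def by (rule d.dot_integrable[OF Nb p3])
    have "(D.N - real p + 1) * integral\<^sup>L D.\<nu> f2 = (real p - 2) * (\<integral>w. 1 / zz v i w \<partial>D.\<nu>)"
      unfolding f2_def using d.shrink_expectation[OF Nb p3, of "v i"] by (simp only: phi)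
    moreover have "D.N - real p + 1 \<noteq> 0" using Nb by linarith
    ultimately have "integral\<^sup>L D.\<nu> f2 = beta * (\<integral>w. 1 / zz v i w \<partial>D.\<nu>)"
      unfolding beta_def N_eq by (simp add: field_simps)
    also have "\<dots> = (\<integral>w. beta * (1 / zz v i w) \<partial>D.\<nu>)" by (rule integral_mult_right_zero[symmetric])
    finally have E: "integral\<^sup>L D.\<nu> f2 = (\<integral>w. beta / zz v i w \<partial>D.\<nu>)" by simp
    have "integrable D.\<nu> (\<lambda>w. beta * (1 / zz v i w))" using i1 by (rule integrable_mult_right)
    moreover have "AE w in D.\<nu>. beta = 0 \<or> zz v i w \<noteq> 0"
      using zz_pos[OF i p3, of v] by eventually_elim auto
    ultimately show ?thesis using i2 E by simp
  qed
  show ib: "integrable D.\<nu> (\<lambda>w. beta / zz v i w)" using c by blast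
  define F where "F w = f1 w - 2 * beta * f2 w + beta * (beta / zz v i w)" for w
  have if2: "integrable D.\<nu> (\<lambda>w. 2 * beta * f2 w)" using c by (cases "beta = 0") auto
  have ib2: "integrable D.\<nu> (\<lambda>w. beta * (beta / zz v i w))" using ib by (rule integrable_mult_right)
  have iF: "integrable D.\<nu> F" unfolding F_def[abs_def]
    by (intro Bochner_Integration.integrable_add Bochner_Integration.integrable_diff f1(1) if2 ib2)
  have AE: "AE w in D.\<nu>. qdel v i w = F w" using c expand unfolding F_def by (auto elim!: eventually_mono)
  have mq: "qdel v i \<in> borel_measurable D.\<nu>"
    using measurable_del(4)[OF i] by (simp add: measurable_cong_sets[OF sets_gaussM refl])
  show "integrable D.\<nu> (qdel v i)"
    using integrable_cong_AE[OF mq borel_measurable_integrable[OF iF] AE] iF by blast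
  have "(\<integral>w. qdel v i w \<partial>D.\<nu>) = integral\<^sup>L D.\<nu> F"
    by (rule integral_cong_AE[OF mq borel_measurable_integrable[OF iF] AE])
  also have "\<dots> = integral\<^sup>L D.\<nu> f1 - (\<integral>w. 2 * beta * f2 w \<partial>D.\<nu>) + (\<integral>w. beta * (beta / zz v i w) \<partial>D.\<nu>)"
    unfolding F_def
    by (simp only: Bochner_Integration.integral_add Bochner_Integration.integral_diff f1(1) if2 ib2 Bochner_Integration.integrable_diff)
  also have "(\<integral>w. 2 * beta * f2 w \<partial>D.\<nu>) = 2 * beta * integral\<^sup>L D.\<nu> f2" by (rule integral_mult_right_zero)
  also have "\<dots> = 2 * beta * (\<integral>w. beta / zz v i w \<partial>D.\<nu>)" using c by blast
  also have "(\<integral>w. beta * (beta / zz v i w) \<partial>D.\<nu>) = beta * (\<integral>w. beta / zz v i w \<partial>D.\<nu>)" by (rule integral_mult_right_zero)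
  finally show "(\<integral>w. qdel v i w \<partial>D.\<nu>) = real p / (D.N - real p - 1) - beta * (\<integral>w. beta / zz v i w \<partial>D.\<nu>)"
    unfolding f1 by simp
qed

text \<open>By \<open>quad_amgm\<close> with a unit vector, twice the absolute value is at most R_jj
  plus the form at \<open>del\<close>. This gives the cross term between new data and fit an
  expectation.\<close>

lemma rdel_integrable:
  assumes i: "i < m" and p: "2 \<le> p" and j: "j < p"
  shows "integrable D.\<nu> (\<lambda>w. rdel v i w j)"
proof (rule Bochner_Integration.integrable_bound)
  show "integrable D.\<nu> (\<lambda>w. D.R 0 w j j + qdel v i w)"
    using D.R0_integrable[OF Nb] qdel_expectation(1)[OF i p] by simp
  show "AE w in D.\<nu>. norm (rdel v i w j) \<le> norm (D.R 0 w j j + qdel v i w)"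
    using D.AE_det_S0[OF Nb]
  proof eventually_elim
    fix w assume d: "Determinant.det (D.S 0 w) \<noteq> 0"
    interpret r: reginv n p "D.W w" "D.R 0 w" 0 by (rule D.det_S0[OF d])
    have rd: "rdel v i w k = r.g (del v i w) k" for k by (simp add: rdel_def rg_def)
    have "2 * \<bar>rdel v i w j\<bar> \<le> D.R 0 w j j + qdel v i w"
      using r.quad_amgm[of 1 "\<lambda>k. if k = j then 1 else 0" "del v i w"] j
      by (simp add: r.quad_unit r.r_eq_g qdel_def rd)
    then show "norm (rdel v i w j) \<le> norm (D.R 0 w j j + qdel v i w)" by simp
  qed
  show "(\<lambda>w. rdel v i w j) \<in> borel_measurable D.\<nu>"
    using measurable_del(3)[OF i] by (simp add: measurable_cong_sets[OF sets_gaussM refl])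
qed

text \<open>Sorted by degree in \<open>wt\<close>, every summand is a function of the new data times
  one of the old data, ready for Fubini's theorem. Orthonormality of e reduces the part free of
  \<open>wt\<close> to one form for each basis vector.\<close>

lemma loss_expand:
  "loss v wt w = (\<Sum>a<n. \<Sum>j<p. \<Sum>l<p. (wt (a, j) * wt (a, l)) * D.R 0 w j l)
     - 2 * (\<Sum>a<n. \<Sum>j<p. \<Sum>i<m. wt (a, j) * (e i a * rdel v i w j)) + (\<Sum>i<m. qdel v i w)"
proof -
  define rD where "rD a j = (\<Sum>l<p. D.R 0 w j l * Del v w a l)" for a j
  have rD: "rD a j = (\<Sum>i<m. e i a * rdel v i w j)" for a j
    unfolding rD_def Del_def rdel_def sum_distrib_left by (subst sum.swap) (simp add: mult_ac)
  have 1: "(\<Sum>j<p. \<Sum>l<p. (wt (a, j) - Del v w a j) * D.R 0 w j l * (wt (a, l) - Del v w a l))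
     = (\<Sum>j<p. \<Sum>l<p. (wt (a, j) * wt (a, l)) * D.R 0 w j l) - 2 * (\<Sum>j<p. wt (a, j) * rD a j) + (\<Sum>j<p. Del v w a j * rD a j)" for a
  proof -
    have "(\<Sum>j<p. \<Sum>l<p. (wt (a, j) - Del v w a j) * D.R 0 w j l * (wt (a, l) - Del v w a l))
     = (\<Sum>j<p. \<Sum>l<p. (wt (a, j) * wt (a, l)) * D.R 0 w j l) - (\<Sum>j<p. wt (a, j) * rD a j)
       - (\<Sum>j<p. \<Sum>l<p. Del v w a j * D.R 0 w j l * wt (a, l)) + (\<Sum>j<p. Del v w a j * rD a j)"
      unfolding rD_def sum_distrib_left sum_subtractf[symmetric] sum.distrib[symmetric]
      by (intro sum.cong refl) (simp add: algebra_simps)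
    also have "(\<Sum>j<p. \<Sum>l<p. Del v w a j * D.R 0 w j l * wt (a, l)) = (\<Sum>j<p. wt (a, j) * rD a j)"
      unfolding rD_def sum_distrib_left by (subst sum.swap) (intro sum.cong refl, simp add: R0_sym mult_ac)
    finally show ?thesis by simp
  qed
  have 3: "(\<Sum>a<n. \<Sum>j<p. Del v w a j * rD a j) = (\<Sum>i<m. qdel v i w)"
  proof -
    have "(\<Sum>a<n. \<Sum>j<p. Del v w a j * rD a j) = (\<Sum>j<p. \<Sum>a<n. \<Sum>i<m. \<Sum>k<m. (e i a * e k a) * (del v i w j * rdel v k w j))"
      unfolding rD Del_def sum_product by (subst sum.swap) (intro sum.cong refl, simp add: mult_ac)
    also have "\<dots> = (\<Sum>j<p. \<Sum>i<m. \<Sum>a<n. \<Sum>k<m. (e i a * e k a) * (del v i w j * rdel v k w j))"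
      by (intro sum.cong refl sum.swap)
    also have "\<dots> = (\<Sum>j<p. \<Sum>i<m. \<Sum>k<m. \<Sum>a<n. (e i a * e k a) * (del v i w j * rdel v k w j))"
      by (intro sum.cong refl sum.swap)
    also have "\<dots> = (\<Sum>j<p. \<Sum>i<m. \<Sum>k<m. if k = i then del v i w j * rdel v k w j else 0)"
      unfolding sum_distrib_right[symmetric] by (intro sum.cong refl) (auto simp: orth)
    also have "\<dots> = (\<Sum>j<p. \<Sum>i<m. del v i w j * rdel v i w j)" by (intro sum.cong refl) simp
    also have "\<dots> = (\<Sum>i<m. qdel v i w)" unfolding qdel_def by (rule sum.swap)
    finally show ?thesis .
  qed
  show ?thesis
    unfolding loss_def 1 sum.distrib sum_subtractf 3 unfolding rD by (simp add: sum_distrib_left)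
qed

text \<open>The quadratic part contributes n E tr S^{-1} and the linear part 0; each of the m
  estimated directions adds p / (N - p - 1) less the gain from shrinkage. This is the source of the
  factor n + m.\<close>

lemma loss_expectation:
  assumes p: "2 \<le> p \<or> m = 0"
  shows "integrable (D.\<nu> \<Otimes>\<^sub>M D.\<nu>) (\<lambda>z. loss v (fst z) (snd z))"
    and "(\<integral>z. loss v (fst z) (snd z) \<partial>(D.\<nu> \<Otimes>\<^sub>M D.\<nu>)) =
      real p * (real n + real m) / (real n - real m - real p - 1) - beta * (\<Sum>i<m. \<integral>w. beta / zz v i w \<partial>D.\<nu>)"
    and "i < m \<Longrightarrow> integrable D.\<nu> (\<lambda>w. beta / zz v i w)"
proof -
  have pm: "2 \<le> p" if "i < m" for i using p that by auto
  note pr = D.nu.prob_space_axioms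
  interpret PP: pair_prob_space D.\<nu> D.\<nu> ..
  have iw: "integrable D.\<nu> (\<lambda>w. w (a, j))" "integrable D.\<nu> (\<lambda>w. w (a, j) * w (a, l))" if "a < n" "j < p" "l < p" for a j l
    using that by (intro D.integrable_poly polybd_mult polybd_coord borel_measurable_times measurable_component_singleton; simp add: D.I_def)+
  have A: "integrable (D.\<nu> \<Otimes>\<^sub>M D.\<nu>) (\<lambda>z. (fst z (a, j) * fst z (a, l)) * D.R 0 (snd z) j l)"
    "(\<integral>z. (fst z (a, j) * fst z (a, l)) * D.R 0 (snd z) j l \<partial>(D.\<nu> \<Otimes>\<^sub>M D.\<nu>)) = (if j = l then \<integral>w. D.R 0 w j j \<partial>D.\<nu> else 0)"
    if "a < n" "j < p" "l < p" for a j l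
    using pair_integrable_mult[OF pr pr iw(2)[OF that] D.R0_integrable[OF Nb, of j l]] D.gauss_second_moment[of "(a, j)" "(a, l)"] that
    by (auto simp: D.I_def)
  have B: "integrable (D.\<nu> \<Otimes>\<^sub>M D.\<nu>) (\<lambda>z. fst z (a, j) * (e i a * rdel v i (snd z) j))"
    "(\<integral>z. fst z (a, j) * (e i a * rdel v i (snd z) j) \<partial>(D.\<nu> \<Otimes>\<^sub>M D.\<nu>)) = 0"
    if "a < n" "j < p" "i < m" for a j i
    using pair_integrable_mult[OF pr pr iw(1)[OF that(1,2,2)] integrable_mult_right[OF rdel_integrable[OF that(3) pm[OF that(3)] that(2), of v], of "e i a"]]
      D.gauss_first_moment[of "(a, j)"] that
    by (auto simp: D.I_def)
  have C: "integrable (D.\<nu> \<Otimes>\<^sub>M D.\<nu>) (\<lambda>z. qdel v i (snd z))"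
    "(\<integral>z. qdel v i (snd z) \<partial>(D.\<nu> \<Otimes>\<^sub>M D.\<nu>)) = (\<integral>w. qdel v i w \<partial>D.\<nu>)" if "i < m" for i
    using pair_integrable_mult[OF pr pr _ qdel_expectation(1)[OF that pm[OF that], of v], of "\<lambda>_. 1"]
    by (auto simp: D.nu.prob_space)
  show "integrable (D.\<nu> \<Otimes>\<^sub>M D.\<nu>) (\<lambda>z. loss v (fst z) (snd z))"
    unfolding loss_expand
    by (intro Bochner_Integration.integrable_add Bochner_Integration.integrable_diff integrable_mult_right Bochner_Integration.integrable_sum A B C) auto
  have "(\<integral>z. loss v (fst z) (snd z) \<partial>(D.\<nu> \<Otimes>\<^sub>M D.\<nu>)) =
     (\<Sum>a<n. \<Sum>j<p. \<Sum>l<p. if j = l then \<integral>w. D.R 0 w j j \<partial>D.\<nu> else 0) + (\<Sum>i<m. \<integral>w. qdel v i w \<partial>D.\<nu>)"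
  proof -
    define T1 where "T1 z = (\<Sum>a<n. \<Sum>j<p. \<Sum>l<p. (fst z (a, j) * fst z (a, l)) * D.R 0 (snd z) j l)" for z
    define T2 where "T2 z = (\<Sum>a<n. \<Sum>j<p. \<Sum>i<m. fst z (a, j) * (e i a * rdel v i (snd z) j))" for z
    define T3 where "T3 z = (\<Sum>i<m. qdel v i (snd z))" for z :: "(nat \<times> nat \<Rightarrow> real) \<times> (nat \<times> nat \<Rightarrow> real)"
    have 1: "integrable (D.\<nu> \<Otimes>\<^sub>M D.\<nu>) T1" "integral\<^sup>L (D.\<nu> \<Otimes>\<^sub>M D.\<nu>) T1 = (\<Sum>a<n. \<Sum>j<p. \<Sum>l<p. if j = l then \<integral>w. D.R 0 w j j \<partial>D.\<nu> else 0)"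
      unfolding T1_def[abs_def] by (subst integral_sum3; simp add: A)+
    have 2: "integrable (D.\<nu> \<Otimes>\<^sub>M D.\<nu>) T2" "integral\<^sup>L (D.\<nu> \<Otimes>\<^sub>M D.\<nu>) T2 = 0"
      unfolding T2_def[abs_def] by (subst integral_sum3; simp add: B)+
    have 3: "integrable (D.\<nu> \<Otimes>\<^sub>M D.\<nu>) T3" "integral\<^sup>L (D.\<nu> \<Otimes>\<^sub>M D.\<nu>) T3 = (\<Sum>i<m. \<integral>w. qdel v i w \<partial>D.\<nu>)"
    proof -
      show "integrable (D.\<nu> \<Otimes>\<^sub>M D.\<nu>) T3"
        unfolding T3_def[abs_def] by (intro Bochner_Integration.integrable_sum C) auto
      show "integral\<^sup>L (D.\<nu> \<Otimes>\<^sub>M D.\<nu>) T3 = (\<Sum>i<m. \<integral>w. qdel v i w \<partial>D.\<nu>)"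
        unfolding T3_def[abs_def] by (subst Bochner_Integration.integral_sum) (simp_all add: C)
    qed
    show ?thesis unfolding loss_expand T1_def[symmetric] T2_def[symmetric] T3_def[symmetric]
      using 1 2 3 by simp
  qed
  also have "(\<Sum>a<n. \<Sum>j<p. \<Sum>l<p. if j = l then \<integral>w. D.R 0 w j j \<partial>D.\<nu> else 0) = real n * (\<integral>w. D.u 0 w \<partial>D.\<nu>)"
    unfolding D.u_def ru_def using D.R0_integrable[OF Nb] by simp
  also have "\<dots> = real n * (real p / (D.N - real p - 1))" by (simp add: D.E_u0[OF Nb])
  also have "(\<Sum>i<m. \<integral>w. qdel v i w \<partial>D.\<nu>) = (\<Sum>i<m. real p / (D.N - real p - 1) - beta * (\<integral>w. beta / zz v i w \<partial>D.\<nu>))"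
    by (intro sum.cong refl qdel_expectation(3)) (auto intro: pm)
  also have "\<dots> = real m * (real p / (D.N - real p - 1)) - beta * (\<Sum>i<m. \<integral>w. beta / zz v i w \<partial>D.\<nu>)"
    by (simp add: sum_subtractf sum_distrib_left)
  also have "real n * (real p / (D.N - real p - 1)) + (real m * (real p / (D.N - real p - 1)) - beta * (\<Sum>i<m. \<integral>w. beta / zz v i w \<partial>D.\<nu>))
     = real p * (real n + real m) / (real n - real m - real p - 1) - beta * (\<Sum>i<m. \<integral>w. beta / zz v i w \<partial>D.\<nu>)"
    unfolding N_eq by (simp add: algebra_simps add_divide_distrib)
  finally show "(\<integral>z. loss v (fst z) (snd z) \<partial>(D.\<nu> \<Otimes>\<^sub>M D.\<nu>)) =
      real p * (real n + real m) / (real n - real m - real p - 1) - beta * (\<Sum>i<m. \<integral>w. beta / zz v i w \<partial>D.\<nu>)" .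
  show "integrable D.\<nu> (\<lambda>w. beta / zz v i w)" if "i < m" using qdel_expectation(2)[OF that pm[OF that]] .
qed

end

end

subsection \<open>Measurable matrix-valued functions\<close>

text \<open>Measurability is meant entrywise, since one type holds matrices of all sizes; the size
  is required on the space of the measure.\<close>

definition mat_meas :: "'a measure \<Rightarrow> nat \<Rightarrow> nat \<Rightarrow> ('a \<Rightarrow> real mat) \<Rightarrow> bool" where
  "mat_meas N r c F \<longleftrightarrow> (\<forall>x\<in>space N. F x \<in> carrier_mat r c) \<and>
     (\<forall>i<r. \<forall>j<c. (\<lambda>x. F x $$ (i, j)) \<in> borel_measurable N)"

lemma mat_measI:
  assumes "\<And>x. x \<in> space N \<Longrightarrow> F x \<in> carrier_mat r c"
    and "\<And>i j. i < r \<Longrightarrow> j < c \<Longrightarrow> (\<lambda>x. F x $$ (i, j)) \<in> borel_measurable N"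
  shows "mat_meas N r c F"
  using assms unfolding mat_meas_def by blast

lemma mat_meas_carrier: "mat_meas N r c F \<Longrightarrow> x \<in> space N \<Longrightarrow> F x \<in> carrier_mat r c"
  and mat_meas_entry: "mat_meas N r c F \<Longrightarrow> i < r \<Longrightarrow> j < c \<Longrightarrow> (\<lambda>x. F x $$ (i, j)) \<in> borel_measurable N"
  unfolding mat_meas_def by blast+

lemma mat_meas_cong:
  assumes "mat_meas N r c G" "\<And>x. x \<in> space N \<Longrightarrow> F x = G x" shows "mat_meas N r c F"
proof (rule mat_measI)
  show "F x \<in> carrier_mat r c" if "x \<in> space N" for x using mat_meas_carrier[OF assms(1) that] assms(2)[OF that] by simp
  fix i j assume "i < r" "j < c"
  from mat_meas_entry[OF assms(1) this] show "(\<lambda>x. F x $$ (i, j)) \<in> borel_measurable N"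
    by (rule measurable_cong[THEN iffD1, rotated]) (simp add: assms(2))
qed

lemma mat_meas_const: "C \<in> carrier_mat r c \<Longrightarrow> mat_meas N r c (\<lambda>x. C)"
  by (rule mat_measI) auto

lemma mat_meas_mult:
  assumes "mat_meas N r s F" "mat_meas N s c G" shows "mat_meas N r c (\<lambda>x. F x * G x)"
proof (rule mat_measI)
  show "F x * G x \<in> carrier_mat r c" if "x \<in> space N" for x
    using mat_meas_carrier[OF assms(1) that] mat_meas_carrier[OF assms(2) that] by simp
  fix i j assume ij: "i < r" "j < c"
  have "(\<lambda>x. \<Sum>l<s. F x $$ (i, l) * G x $$ (l, j)) \<in> borel_measurable N"
    using ij by (intro borel_measurable_sum borel_measurable_times mat_meas_entry[OF assms(1)] mat_meas_entry[OF assms(2)]) auto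
  then show "(\<lambda>x. (F x * G x) $$ (i, j)) \<in> borel_measurable N"
  proof (rule measurable_cong[THEN iffD1, rotated])
    fix x assume x: "x \<in> space N"
    show "(\<Sum>l<s. F x $$ (i, l) * G x $$ (l, j)) = (F x * G x) $$ (i, j)"
      using ij carrier_matD[OF mat_meas_carrier[OF assms(1) x]] carrier_matD[OF mat_meas_carrier[OF assms(2) x]]
      by (simp add: scalar_prod_def atLeast0LessThan)
  qed
qed

lemma mat_meas_transpose:
  assumes "mat_meas N r c F" shows "mat_meas N c r (\<lambda>x. transpose_mat (F x))"
proof (rule mat_measI)
  show "transpose_mat (F x) \<in> carrier_mat c r" if "x \<in> space N" for x
    using mat_meas_carrier[OF assms that] by simp
  fix i j assume ij: "i < c" "j < r"
  from mat_meas_entry[OF assms ij(2,1)] show "(\<lambda>x. transpose_mat (F x) $$ (i, j)) \<in> borel_measurable N"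
    by (rule measurable_cong[THEN iffD1, rotated]) (use ij in \<open>simp add: carrier_matD[OF mat_meas_carrier[OF assms]]\<close>)
qed

lemma mat_meas_minus:
  assumes "mat_meas N r c F" "mat_meas N r c G" shows "mat_meas N r c (\<lambda>x. F x - G x)"
proof (rule mat_measI)
  show "F x - G x \<in> carrier_mat r c" if "x \<in> space N" for x
    using mat_meas_carrier[OF assms(1) that] mat_meas_carrier[OF assms(2) that] by (intro minus_carrier_mat)
  fix i j assume ij: "i < r" "j < c"
  have "(\<lambda>x. F x $$ (i, j) - G x $$ (i, j)) \<in> borel_measurable N"
    using ij by (intro borel_measurable_diff mat_meas_entry[OF assms(1)] mat_meas_entry[OF assms(2)])
  then show "(\<lambda>x. (F x - G x) $$ (i, j)) \<in> borel_measurable N"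
    by (rule measurable_cong[THEN iffD1, rotated]) (use ij in \<open>simp add: carrier_matD[OF mat_meas_carrier[OF assms(2)]]\<close>)
qed

lemma mat_meas_smult:
  assumes "mat_meas N r c F" shows "mat_meas N r c (\<lambda>x. k \<cdot>\<^sub>m F x)"
proof (rule mat_measI)
  show "k \<cdot>\<^sub>m F x \<in> carrier_mat r c" if "x \<in> space N" for x
    using mat_meas_carrier[OF assms that] by simp
  fix i j assume ij: "i < r" "j < c"
  have "(\<lambda>x. k * F x $$ (i, j)) \<in> borel_measurable N"
    using ij by (intro borel_measurable_times borel_measurable_const mat_meas_entry[OF assms])
  then show "(\<lambda>x. (k \<cdot>\<^sub>m F x) $$ (i, j)) \<in> borel_measurable N"
    by (rule measurable_cong[THEN iffD1, rotated]) (use ij in \<open>simp add: carrier_matD[OF mat_meas_carrier[OF assms]]\<close>)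
qed

lemma mat_meas_mat_diag:
  assumes "\<And>i. i < r \<Longrightarrow> (\<lambda>x. f x i) \<in> borel_measurable N" shows "mat_meas N r r (\<lambda>x. mat_diag r (f x))"
proof (rule mat_measI)
  fix i j assume "i < r" "j < r"
  then show "(\<lambda>x. mat_diag r (f x) $$ (i, j)) \<in> borel_measurable N"
    using assms by (simp add: mat_diag_def)
qed simp

lemma mat_meas_det:
  assumes "mat_meas N r r F" shows "(\<lambda>x. Determinant.det (F x)) \<in> borel_measurable N"
proof -
  have "(\<lambda>x. Determinant.det (Matrix.mat r r (\<lambda>ij. F x $$ ij))) \<in> borel_measurable N"
    by (rule measurable_det[where n=r]) (auto intro: mat_meas_entry[OF assms])
  then show ?thesis
  proof (rule measurable_cong[THEN iffD1, rotated])
    fix x assume "x \<in> space N"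
    from mat_meas_carrier[OF assms this] have "Matrix.mat r r (\<lambda>ij. F x $$ ij) = F x" by (intro eq_matI) auto
    then show "Determinant.det (Matrix.mat r r (\<lambda>ij. F x $$ ij)) = Determinant.det (F x)" by simp
  qed
qed

lemma mat_meas_inv:
  assumes "mat_meas N r r F" shows "mat_meas N r r (\<lambda>x. inv_mat (F x))"
proof (rule mat_meas_cong)
  show "mat_meas N r r (\<lambda>x. inv_mat (Matrix.mat r r (\<lambda>ij. F x $$ ij)))"
    by (rule mat_measI) (auto intro!: measurable_inv_mat[where n=r] mat_meas_entry[OF assms])
  fix x assume "x \<in> space N"
  from mat_meas_carrier[OF assms this] have "Matrix.mat r r (\<lambda>ij. F x $$ ij) = F x" by (intro eq_matI) auto
  then show "inv_mat (F x) = inv_mat (Matrix.mat r r (\<lambda>ij. F x $$ ij))" by simp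
qed

lemma mat_meas_trace:
  assumes "mat_meas N r r F" shows "(\<lambda>x. trace_mat (F x)) \<in> borel_measurable N"
proof -
  have "(\<lambda>x. \<Sum>i<r. F x $$ (i, i)) \<in> borel_measurable N"
    by (intro borel_measurable_sum mat_meas_entry[OF assms]) auto
  then show ?thesis
    by (rule measurable_cong[THEN iffD1, rotated]) (simp add: trace_mat_def carrier_matD[OF mat_meas_carrier[OF assms]])
qed

lemma mat_meas_compose:
  assumes "mat_meas N r c F" "T \<in> measurable K N" shows "mat_meas K r c (\<lambda>x. F (T x))"
proof (rule mat_measI)
  show "F (T x) \<in> carrier_mat r c" if "x \<in> space K" for x
    using mat_meas_carrier[OF assms(1)] measurable_space[OF assms(2) that] .
  show "(\<lambda>x. F (T x) $$ (i, j)) \<in> borel_measurable K" if "i < r" "j < c" for i j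
    using measurable_compose[OF assms(2) mat_meas_entry[OF assms(1) that]] .
qed

lemma mat_meas_lborel_mat: "mat_meas (lborel_mat n p) n p (\<lambda>Y. Y)"
  by (rule mat_measI) (auto simp: space_lborel_mat)

subsection \<open>The design\<close>

text \<open>\<open>rank\<close> counts an independent subset of the set of columns, so repetitions
  have to be excluded: rank k among k columns makes them distinct, and a nonzero kernel vector is
  then a linear relation between them.\<close>

lemma full_rank_inj:
  fixes A :: "real mat"
  assumes A: "A \<in> carrier_mat n k" "vec_space.rank n A = k" and v: "v \<in> carrier_vec k" "A *\<^sub>v v = 0\<^sub>v n"
  shows "v = 0\<^sub>v k"
proof (rule ccontr)
  assume nz: "v \<noteq> 0\<^sub>v k"
  interpret vec_space "TYPE(real)" n .
  obtain T where T: "maximal T (\<lambda>T. T \<subseteq> set (cols A) \<and> lin_indpt T)"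
    using maximal_exists[of "(\<lambda>T. T \<subseteq> set (cols A) \<and> lin_indpt T)" "card (set (cols A))" "{}"]
    by (meson List.finite_set card_mono empty_iff empty_subsetI finite_lin_indpt2 rev_finite_subset)
  then have "k = card T" using rank_card_indpt[OF A(1)] A(2) by simp
  moreover have "card T \<le> card (set (cols A))" using T by (simp add: card_mono maximal_def)
  moreover have "length (cols A) = k" using A(1) by simp
  ultimately have "distinct (cols A)" using card_distinct[of "cols A"] card_length[of "cols A"] by linarith
  from lin_depI[OF A(1) v(1) nz v(2) this] full_rank_lin_indpt[OF A this] show False by blast
qed

lemma scalar_prod_self_eq_0:
  fixes v :: "real Matrix.vec"
  assumes "v \<in> carrier_vec n" "v \<bullet> v = 0" shows "v = 0\<^sub>v n"
proof (rule eq_vecI)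
  have "(\<Sum>i<n. v $ i * v $ i) = 0" using assms by (simp add: scalar_prod_def atLeast0LessThan)
  then have "v $ i = 0" if "i < n" for i using that by (simp add: sum_nonneg_eq_0_iff)
  then show "v $ i = 0\<^sub>v n $ i" if "i < dim_vec (0\<^sub>v n :: real Matrix.vec)" for i using that by simp
qed (use assms in simp)

locale design =
  fixes A P :: "real mat" and d :: "nat \<Rightarrow> real" and n p k :: nat and J :: "nat set"
  assumes A: "A \<in> carrier_mat n k" "vec_space.rank n A = k"
    and dims: "p + k + 1 < n" "0 < p" "p \<noteq> 1 \<or> J = {}"
    and J: "J \<subseteq> {..<k}"
    and P: "P \<in> carrier_mat (card J) (card J)" "transpose_mat P * P = 1\<^sub>m (card J)"
    and D: "transpose_mat P * gram_inv A J * P = mat_diag (card J) d"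
begin

definition m :: nat where "m = card J"

abbreviation AJ :: "real mat" where "AJ \<equiv> cols_of A J"

lemma finite_J: "finite J" using J finite_subset by blast

lemma m_le: "m \<le> k" using card_mono[OF _ J] by (simp add: m_def)

lemma dims': "m + p + 1 < n" using m_le dims by simp

lemma cols_of_carrier: "J0 \<subseteq> J \<Longrightarrow> cols_of A J0 \<in> carrier_mat n (card J0)"
proof -
  assume "J0 \<subseteq> J"
  then have eq: "{j. j < k \<and> j \<in> J0} = J0" using J by auto
  show ?thesis unfolding cols_of_def
    by (rule carrier_matI) (simp_all add: dim_submatrix carrier_matD[OF A(1)] eq)
qed

lemma AJ: "AJ \<in> carrier_mat n m" using cols_of_carrier[of J] by (simp add: m_def)

lemma cols_of_index:
  assumes "J0 \<subseteq> J" "a < n" "c < card J0"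
  shows "cols_of A J0 $$ (a, c) = A $$ (a, pick J0 c)" "pick J0 c \<in> J0"
proof -
  have eq: "{j. j < k \<and> j \<in> J0} = J0" using assms(1) J by auto
  show "cols_of A J0 $$ (a, c) = A $$ (a, pick J0 c)"
    unfolding cols_of_def using assms(2,3) carrier_matD[OF A(1)]
    by (subst submatrix_index) (simp_all add: pick_UNIV eq)
  show "pick J0 c \<in> J0" using assms(3) by (intro pick_in_set) simp
qed

lemma AJ_inj:
  assumes v: "v \<in> carrier_vec m" "AJ *\<^sub>v v = 0\<^sub>v n" shows "v = 0\<^sub>v m"
proof -
  have pk: "pick J c \<in> J" "pick J c < k" if "c < m" for c
    using cols_of_index(2)[of J 0 c] that dims J by (auto simp: m_def)
  have inj: "inj_on (pick J) {..<m}"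
  proof (rule inj_onI)
    fix c c' assume c: "c \<in> {..<m}" "c' \<in> {..<m}" "pick J c = pick J c'"
    have k1: "card {a\<in>J. a < pick J c} = c" by (rule card_pick) (use c(1) in \<open>simp add: m_def\<close>)
    have k2: "card {a\<in>J. a < pick J c'} = c'" by (rule card_pick) (use c(2) in \<open>simp add: m_def\<close>)
    show "c = c'" by (rule trans[OF sym[OF k1[unfolded c(3)]] k2])
  qed
  \<comment> \<open>\<open>z\<close> extends v by zeros from the columns in \<open>J\<close> to all
    k columns, so that A z = A_J v.\<close>
  define z where "z = Matrix.vec k (\<lambda>b. if b \<in> pick J ` {..<m} then v $ (inv_into {..<m} (pick J) b) else 0)"
  have zc: "z $ (pick J c) = v $ c" if c: "c < m" for c
  proof -
    have "inv_into {..<m} (pick J) (pick J c) = c" by (rule inv_into_f_f[OF inj]) (use c in simp)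
    moreover have "pick J c \<in> pick J ` {..<m}" using c by simp
    ultimately show ?thesis unfolding z_def index_vec[OF pk(2)[OF c]] by simp
  qed
  have "A *\<^sub>v z = 0\<^sub>v n"
  proof (rule eq_vecI)
    fix a assume "a < dim_vec (0\<^sub>v n :: real Matrix.vec)"
    then have a: "a < n" by simp
    have "(A *\<^sub>v z) $ a = (\<Sum>b<k. A $$ (a, b) * z $ b)"
      using a A(1) by (simp add: z_def scalar_prod_def atLeast0LessThan)
    also have "\<dots> = (\<Sum>b\<in>pick J ` {..<m}. A $$ (a, b) * z $ b)"
      using pk by (intro sum.mono_neutral_right) (auto simp: z_def)
    also have "\<dots> = (\<Sum>c<m. A $$ (a, pick J c) * z $ (pick J c))" by (rule sum.reindex[OF inj, simplified o_def])
    also have "\<dots> = (\<Sum>c<m. AJ $$ (a, c) * v $ c)"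
    proof (rule sum.cong[OF refl])
      fix c assume c: "c \<in> {..<m}"
      then have "AJ $$ (a, c) = A $$ (a, pick J c)" using cols_of_index(1)[OF subset_refl a, of c] by (simp add: m_def)
      then show "A $$ (a, pick J c) * z $ (pick J c) = AJ $$ (a, c) * v $ c" using zc c by simp
    qed
    also have "\<dots> = (AJ *\<^sub>v v) $ a" using a v(1) carrier_matD[OF AJ] by (simp add: scalar_prod_def atLeast0LessThan)
    finally show "(A *\<^sub>v z) $ a = 0\<^sub>v n $ a" using v(2) a by simp
  qed (use A in simp)
  then have z0: "z = 0\<^sub>v k" using full_rank_inj[OF A] by (simp add: z_def)
  show ?thesis
  proof (rule eq_vecI)
    fix c assume "c < dim_vec (0\<^sub>v m :: real Matrix.vec)"
    then have c: "c < m" by simp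
    have "v $ c = 0\<^sub>v k $ (pick J c)" using zc[OF c] z0 by simp
    then show "v $ c = 0\<^sub>v m $ c" using c pk(2)[OF c] by simp
  qed (use v in simp)
qed

definition Gr :: "real mat" where "Gr = transpose_mat AJ * AJ"
abbreviation G :: "real mat" where "G \<equiv> gram_inv A J"

lemma Gr: "Gr \<in> carrier_mat m m" using AJ by (simp add: Gr_def)

lemma G: "G = inv_mat Gr" "G \<in> carrier_mat m m"
  using Gr by (simp_all add: gram_inv_def Gr_def)

lemma det_Gr: "Determinant.det Gr \<noteq> 0"
proof (rule det_pos_quad[OF Gr])
  fix v :: "real Matrix.vec" assume v: "v \<in> carrier_vec m" "v \<noteq> 0\<^sub>v m"
  have Av: "AJ *\<^sub>v v \<in> carrier_vec n" using AJ v by simp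
  have "v \<bullet> (Gr *\<^sub>v v) = v \<bullet> (transpose_mat AJ *\<^sub>v (AJ *\<^sub>v v))"
    unfolding Gr_def using AJ v by (simp add: assoc_mult_mat_vec[of _ m n _ m])
  also have "\<dots> = (AJ *\<^sub>v v) \<bullet> (AJ *\<^sub>v v)"
    using transpose_vec_mult_scalar[OF AJ v(1) Av] AJ v Av by (simp add: comm_scalar_prod[of v m])
  finally have "v \<bullet> (Gr *\<^sub>v v) = (AJ *\<^sub>v v) \<bullet> (AJ *\<^sub>v v)" .
  moreover have "AJ *\<^sub>v v \<noteq> 0\<^sub>v n" using AJ_inj v by blast
  ultimately show "v \<bullet> (Gr *\<^sub>v v) \<noteq> 0"
    using scalar_prod_self_eq_0[OF Av] by auto
qed

lemma PPt: "P * transpose_mat P = 1\<^sub>m m"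
  using mat_mult_left_right_inverse[of "transpose_mat P" m P] P by (simp add: m_def)

lemma Pm: "P \<in> carrier_mat m m" "transpose_mat P \<in> carrier_mat m m" "transpose_mat P * P = 1\<^sub>m m"
  using P by (simp_all add: m_def)

lemma Dm: "transpose_mat P * G * P = mat_diag m d" using D by (simp add: m_def)

text \<open>Orthogonal columns that span the column space of A_J, the i-th of squared length 1 /
  d_i. Scaled by \<open>sqrt (d i)\<close> they become the orthonormal basis
  \<open>e\<close>.\<close>

definition U :: "real mat" where "U = AJ * P"

lemma U: "U \<in> carrier_mat n m" using AJ Pm by (simp add: U_def)

lemma D_UtU: "mat_diag m d * (transpose_mat U * U) = 1\<^sub>m m"
proof -
  have At: "transpose_mat AJ \<in> carrier_mat m n" using AJ by simp
  have UtU: "transpose_mat U * U = transpose_mat P * (Gr * P)"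
    unfolding U_def Gr_def transpose_mult[OF AJ Pm(1)]
    using AJ At Pm by (simp add: assoc_mult_mat[of _ m m _ n _ m] assoc_mult_mat[of _ m n _ m _ m])
  have GP: "Gr * P \<in> carrier_mat m m" using Gr Pm by simp
  have "mat_diag m d * (transpose_mat U * U) = transpose_mat P * G * P * (transpose_mat P * (Gr * P))"
    unfolding UtU Dm ..
  also have "\<dots> = transpose_mat P * G * (P * (transpose_mat P * (Gr * P)))"
    using Pm G GP by (simp add: assoc_mult_mat[of _ m m _ m _ m])
  also have "P * (transpose_mat P * (Gr * P)) = P * transpose_mat P * (Gr * P)"
    using Pm GP by (simp add: assoc_mult_mat[of _ m m _ m _ m])
  also have "\<dots> = Gr * P" unfolding PPt by (rule left_mult_one_mat[OF GP])
  also have "transpose_mat P * G * (Gr * P) = transpose_mat P * (G * Gr * P)"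
    using Pm G Gr by (simp add: assoc_mult_mat[of _ m m _ m _ m])
  also have "G * Gr = 1\<^sub>m m" unfolding G(1) by (rule inv_mat_right(2)[OF Gr det_Gr])
  also have "transpose_mat P * (1\<^sub>m m * P) = 1\<^sub>m m" using Pm by simp
  finally show ?thesis .
qed

lemma orthU: assumes "i < m" "j < m" shows "d i * (\<Sum>a<n. U $$ (a, i) * U $$ (a, j)) = (if i = j then 1 else 0)"
proof -
  have UtU: "transpose_mat U * U \<in> carrier_mat m m" using U by simp
  have "(mat_diag m d * (transpose_mat U * U)) $$ (i, j) = d i * (transpose_mat U * U) $$ (i, j)"
    unfolding mat_diag_mult_left[OF UtU] using assms by simp
  also have "(transpose_mat U * U) $$ (i, j) = (\<Sum>a<n. U $$ (a, i) * U $$ (a, j))"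
    using assms carrier_matD[OF U] by (simp add: scalar_prod_def atLeast0LessThan)
  finally show ?thesis unfolding D_UtU using assms by simp
qed

text \<open>By \<open>orthU\<close>, d_i times a sum of squares equals 1.\<close>

lemma d_pos: "i < m \<Longrightarrow> 0 < d i"
proof -
  assume i: "i < m"
  have "0 \<le> (\<Sum>a<n. U $$ (a, i) * U $$ (a, i))" by (intro sum_nonneg) simp
  then show ?thesis using orthU[OF i i] by (metis mult_nonpos_nonneg not_less not_one_le_zero)
qed

definition e :: "nat \<Rightarrow> nat \<Rightarrow> real" where "e i a = sqrt (d i) * U $$ (a, i)"

lemma frame_e: "frame n m e"
proof
  fix i j assume ij: "i < m" "j < m"
  have "(\<Sum>a<n. e i a * e j a) = sqrt (d i) * sqrt (d j) * (\<Sum>a<n. U $$ (a, i) * U $$ (a, j))"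
    unfolding e_def sum_distrib_left by (intro sum.cong refl) simp
  also have "\<dots> = (if i = j then 1 else 0)"
  proof (cases "i = j")
    case True
    then show ?thesis using orthU[OF ij] d_pos[OF ij(1)] by simp
  next
    case False
    then show ?thesis using orthU[OF ij] d_pos[OF ij(1)] by simp
  qed
  finally show "(\<Sum>a<n. e i a * e j a) = (if i = j then 1 else 0)" .
qed

sublocale frame n p m e by (rule frame_e)

definition H :: "real mat" where "H = AJ * G * transpose_mat AJ"

lemma H: "H \<in> carrier_mat n n" using AJ G by (simp add: H_def)

lemma H_eq: "H = U * mat_diag m d * transpose_mat U"
proof -
  have At: "transpose_mat AJ \<in> carrier_mat m n" using AJ by simp
  have "P * mat_diag m d * transpose_mat P = P * (transpose_mat P * G * P) * transpose_mat P" by (simp add: Dm)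
  also have "\<dots> = (P * transpose_mat P) * G * (P * transpose_mat P)"
    using Pm G by (simp add: assoc_mult_mat[of _ m m _ m _ m])
  also have "\<dots> = G" unfolding PPt using G by simp
  finally have Geq: "G = P * mat_diag m d * transpose_mat P" ..
  have "U * mat_diag m d * transpose_mat U = AJ * P * mat_diag m d * (transpose_mat P * transpose_mat AJ)"
    unfolding U_def transpose_mult[OF AJ Pm(1)] ..
  also have "\<dots> = AJ * (P * mat_diag m d * transpose_mat P) * transpose_mat AJ"
    using AJ At Pm mat_diag_dim[of m d]
    by (simp add: mult_carrier_mat[of _ m m _ m] assoc_mult_mat[of _ n m _ m _ m] assoc_mult_mat[of _ n m _ m _ n] assoc_mult_mat[of _ m m _ m _ m] assoc_mult_mat[of _ m m _ m _ n])
  finally show ?thesis unfolding H_def Geq[symmetric] ..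
qed

lemma H_index: assumes "a < n" "b < n" shows "H $$ (a, b) = (\<Sum>i<m. e i a * e i b)"
proof -
  have "H $$ (a, b) = (\<Sum>i<m. U $$ (a, i) * d i * U $$ (b, i))"
    unfolding H_eq mat_diag_mult_right[OF U] using assms carrier_matD[OF U]
    by (simp add: scalar_prod_def atLeast0LessThan)
  also have "\<dots> = (\<Sum>i<m. e i a * e i b)"
  proof (rule sum.cong[OF refl])
    fix i assume "i \<in> {..<m}"
    then have "sqrt (d i) * sqrt (d i) = d i" using d_pos[of i] by simp
    then show "U $$ (a, i) * d i * U $$ (b, i) = e i a * e i b" unfolding e_def by (simp add: mult_ac)
  qed
  finally show ?thesis .
qed

lemma Qf_index: "a < n \<Longrightarrow> b < n \<Longrightarrow> (1\<^sub>m n - H) $$ (a, b) = Qf a b"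
  using H by (simp add: Qf_def H_index)

lemma H_AJ: "H * AJ = AJ"
proof -
  have At: "transpose_mat AJ \<in> carrier_mat m n" using AJ by simp
  have "H * AJ = AJ * (G * Gr)"
    unfolding H_def Gr_def using AJ At G by (simp add: assoc_mult_mat[of _ n m _ n _ m] assoc_mult_mat[of _ n m _ m _ m] assoc_mult_mat[of _ n m _ m _ n] assoc_mult_mat[of _ m m _ n _ m])
  also have "G * Gr = 1\<^sub>m m" unfolding G(1) by (rule inv_mat_right(2)[OF Gr det_Gr])
  finally show ?thesis using AJ by simp
qed

lemma Qf_A: assumes "c \<in> J" "a < n" shows "(\<Sum>b<n. Qf a b * A $$ (b, c)) = 0"
proof -
  \<comment> \<open>The position of column c of A among the columns of A_J.\<close>
  define c' where "c' = card {x\<in>J. x < c}"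
  have pc: "pick J c' = c" unfolding c'_def by (rule pick_card_in_set[OF assms(1)])
  have c': "c' < m" unfolding c'_def m_def
    using assms(1) finite_J by (intro psubset_card_mono) auto
  have eq: "A $$ (b, c) = AJ $$ (b, c')" if "b < n" for b
    using cols_of_index(1)[of J b c'] that c' pc by (simp add: m_def)
  have "(\<Sum>b<n. Qf a b * A $$ (b, c)) = (\<Sum>b<n. (if a = b then AJ $$ (b, c') else 0) - H $$ (a, b) * AJ $$ (b, c'))"
    using assms by (intro sum.cong refl) (auto simp: eq Qf_def H_index left_diff_distrib)
  also have "\<dots> = AJ $$ (a, c') - (H * AJ) $$ (a, c')"
    using assms(2) c' carrier_matD[OF H] carrier_matD[OF AJ] by (simp add: sum_subtractf scalar_prod_def atLeast0LessThan)
  finally show ?thesis by (simp add: H_AJ)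
qed

text \<open>Here the inclusion of the true model in \<open>J\<close> enters: its mean lies in the
  column space of A_J, so the residuals contain noise only.\<close>

lemma Qf_mean:
  assumes J0: "J0 \<subseteq> J" and B: "B \<in> carrier_mat (card J0) p" and a: "a < n" and j: "j < p"
  shows "(\<Sum>b<n. Qf a b * (cols_of A J0 * B) $$ (b, j)) = 0"
proof -
  have C: "cols_of A J0 \<in> carrier_mat n (card J0)" by (rule cols_of_carrier[OF J0])
  have "(cols_of A J0 * B) $$ (b, j) = (\<Sum>c<card J0. A $$ (b, pick J0 c) * B $$ (c, j))" if "b < n" for b
    using that j C B cols_of_index(1)[OF J0 that] by (simp add: scalar_prod_def atLeast0LessThan)
  then have "(\<Sum>b<n. Qf a b * (cols_of A J0 * B) $$ (b, j)) = (\<Sum>b<n. \<Sum>c<card J0. Qf a b * A $$ (b, pick J0 c) * B $$ (c, j))"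
    by (simp add: sum_distrib_left mult.assoc)
  also have "\<dots> = (\<Sum>c<card J0. (\<Sum>b<n. Qf a b * A $$ (b, pick J0 c)) * B $$ (c, j))"
    by (subst sum.swap) (simp add: sum_distrib_right)
  also have "\<dots> = 0"
    using Qf_A[OF _ a] cols_of_index(2)[OF J0 a] J0 by (intro sum.neutral) auto
  finally show ?thesis .
qed

end

subsection \<open>The estimators under the model\<close>

lemma inv_mat_diag:
  assumes "\<And>i. i < r \<Longrightarrow> f i \<noteq> 0" shows "inv_mat (mat_diag r f) = mat_diag r (\<lambda>i. 1 / f i)"
proof (rule inv_mat_unique(1))
  show "mat_diag r f * mat_diag r (\<lambda>i. 1 / f i) = 1\<^sub>m r"
    unfolding mat_diag_diag by (rule eq_matI) (use assms in \<open>auto simp: mat_diag_def\<close>)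
qed simp_all

lemma inv_mat_smult:
  assumes A: "A \<in> carrier_mat r r" and d: "Determinant.det A \<noteq> 0" and c: "c \<noteq> 0"
  shows "inv_mat (c \<cdot>\<^sub>m A) = (1 / c) \<cdot>\<^sub>m inv_mat A"
proof (rule inv_mat_unique(1))
  have iA: "inv_mat A \<in> carrier_mat r r" using A by simp
  have "c \<cdot>\<^sub>m A * ((1 / c) \<cdot>\<^sub>m inv_mat A) = (c * (1 / c)) \<cdot>\<^sub>m (A * inv_mat A)"
    unfolding mult_smult_assoc_mat[OF A smult_carrier_mat[OF iA]] mult_smult_distrib[OF A iA]
    by (rule eq_matI) simp_all
  then show "c \<cdot>\<^sub>m A * ((1 / c) \<cdot>\<^sub>m inv_mat A) = 1\<^sub>m r"
    unfolding inv_mat_right(1)[OF A d] using c by (auto intro!: eq_matI)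
qed (use A in simp_all)

lemma transpose_mult_index:
  fixes X Y :: "real mat"
  assumes "X \<in> carrier_mat n p" "Y \<in> carrier_mat n q" "j < p" "l < q"
  shows "(transpose_mat X * Y) $$ (j, l) = (\<Sum>a<n. X $$ (a, j) * Y $$ (a, l))"
  using assms by (simp add: scalar_prod_def atLeast0LessThan)

lemma ln_matnormal_pdf:
  assumes "N \<in> carrier_mat n p" "Y \<in> carrier_mat n p" "C \<in> carrier_mat p p" and d: "0 < Determinant.det C"
  shows "0 < matnormal_pdf N C Y"
    "ln (matnormal_pdf N C Y) = - (\<Sum>i<n. \<Sum>j<p. \<Sum>l<p. (Y $$ (i, j) - N $$ (i, j)) * inv_mat C $$ (j, l) * (Y $$ (i, l) - N $$ (i, l))) / 2
      - (real n * real p * ln (2 * pi) + real n * ln (Determinant.det C)) / 2"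
proof -
  define q where "q i = (\<Sum>j<p. \<Sum>l<p. (Y $$ (i, j) - N $$ (i, j)) * inv_mat C $$ (j, l) * (Y $$ (i, l) - N $$ (i, l)))" for i
  have pos: "0 < (2 * pi) ^ p * Determinant.det C" using d by simp
  have f: "0 < exp (- q i / 2) / sqrt ((2 * pi) ^ p * Determinant.det C)" for i using pos by simp
  have eq: "matnormal_pdf N C Y = (\<Prod>i<n. exp (- q i / 2) / sqrt ((2 * pi) ^ p * Determinant.det C))"
    unfolding q_def by (rule matnormal_pdf_eq[OF assms(1,2,3)])
  show "0 < matnormal_pdf N C Y" unfolding eq using f by (intro prod_pos) auto
  have "ln (matnormal_pdf N C Y) = (\<Sum>i<n. ln (exp (- q i / 2) / sqrt ((2 * pi) ^ p * Determinant.det C)))"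
    unfolding eq using f by (intro ln_prod) auto
  also have "\<dots> = (\<Sum>i<n. - q i / 2 - (real p * ln (2 * pi) + ln (Determinant.det C)) / 2)"
  proof (rule sum.cong[OF refl])
    fix i
    have "ln (exp (- q i / 2) / sqrt ((2 * pi) ^ p * Determinant.det C)) = - q i / 2 - ln (sqrt ((2 * pi) ^ p * Determinant.det C))"
      using pos by (subst ln_div) auto
    also have "ln (sqrt ((2 * pi) ^ p * Determinant.det C)) = ln ((2 * pi) ^ p * Determinant.det C) / 2"
      using pos by (simp only: ln_sqrt)
    also have "ln ((2 * pi) ^ p * Determinant.det C) = ln ((2 * pi) ^ p) + ln (Determinant.det C)"
      using d by (intro ln_mult_pos) auto
    also have "ln ((2 * pi) ^ p) = real p * ln (2 * pi)" by (rule ln_realpow)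
    finally show "ln (exp (- q i / 2) / sqrt ((2 * pi) ^ p * Determinant.det C)) = - q i / 2 - (real p * ln (2 * pi) + ln (Determinant.det C)) / 2" .
  qed
  also have "\<dots> = - (\<Sum>i<n. q i) / 2 - (real n * real p * ln (2 * pi) + real n * ln (Determinant.det C)) / 2"
    by (simp add: sum_subtractf sum_negf sum_divide_distrib[symmetric] algebra_simps)
  finally show "ln (matnormal_pdf N C Y) = - (\<Sum>i<n. \<Sum>j<p. \<Sum>l<p. (Y $$ (i, j) - N $$ (i, j)) * inv_mat C $$ (j, l) * (Y $$ (i, l) - N $$ (i, l))) / 2
      - (real n * real p * ln (2 * pi) + real n * ln (Determinant.det C)) / 2" unfolding q_def .
qed

context design
begin

lemma S_of_eq: "S_of A J Y = transpose_mat Y * (1\<^sub>m n - H) * Y"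
  using carrier_matD[OF A(1)] by (simp add: S_of_def H_def)

text \<open>X is D U^T Y, and d_i times the i-th column of U is \<open>sqrt (d i)\<close> times the
  basis vector e_i.\<close>

lemma X_of_index:
  assumes Y: "Y \<in> carrier_mat n p" and ij: "i < m" "j < p"
  shows "X_of A J P d Y $$ (i, j) = sqrt (d i) * (\<Sum>a<n. e i a * Y $$ (a, j))"
proof -
  have At: "transpose_mat AJ \<in> carrier_mat m n" using AJ by simp
  have UY: "transpose_mat U * Y \<in> carrier_mat m p" using U Y by simp
  have "X_of A J P d Y = mat_diag m d * (transpose_mat P * transpose_mat AJ * Y)"
    unfolding X_of_def m_def[symmetric] using Pm At Y
    by (simp add: assoc_mult_mat[of _ m m _ m _ n] assoc_mult_mat[of _ m m _ n _ p] assoc_mult_mat[of _ m m _ m _ p] mult_carrier_mat[of _ m m _ n])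
  also have "transpose_mat P * transpose_mat AJ = transpose_mat U"
    unfolding U_def transpose_mult[OF AJ Pm(1)] ..
  finally have "X_of A J P d Y $$ (i, j) = d i * (transpose_mat U * Y) $$ (i, j)"
    unfolding mat_diag_mult_left[OF UY] using ij by simp
  also have "(transpose_mat U * Y) $$ (i, j) = (\<Sum>a<n. U $$ (a, i) * Y $$ (a, j))"
    using ij carrier_matD[OF U] carrier_matD[OF Y] by (simp add: scalar_prod_def atLeast0LessThan)
  also have "d i * \<dots> = sqrt (d i) * (\<Sum>a<n. e i a * Y $$ (a, j))"
    unfolding e_def sum_distrib_left using d_pos[OF ij(1)] by (intro sum.cong refl) simp
  finally show ?thesis .
qed

lemma X_of_carrier: "Y \<in> carrier_mat n p \<Longrightarrow> X_of A J P d Y \<in> carrier_mat m p"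
  unfolding X_of_def m_def[symmetric] using Pm AJ by (intro mult_carrier_mat[of _ m n _ p] mult_carrier_mat[of _ m m _ n] mult_carrier_mat[of _ m m _ m]) auto

lemma S_of_carrier: "Y \<in> carrier_mat n p \<Longrightarrow> S_of A J Y \<in> carrier_mat p p"
  unfolding S_of_eq using H by (intro mult_carrier_mat[of _ p n _ p] mult_carrier_mat[of _ p n _ n]) (auto intro: minus_carrier_mat)

lemma Bhat_eq:
  assumes Y: "Y \<in> carrier_mat n p"
  shows "Bhat A J P d Y = P * (1\<^sub>m m - Lambda_mat n p J d * inv_mat (C_of A J P d Y)) * X_of A J P d Y"
proof -
  have C: "C_of A J P d Y \<in> carrier_mat m m" by (simp add: C_of_def m_def)
  have W: "P * (1\<^sub>m m - Lambda_mat n p J d * inv_mat (C_of A J P d Y)) \<in> carrier_mat m m"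
    using C Pm by (auto simp: Lambda_mat_def m_def intro!: mult_carrier_mat[of _ "card J" "card J" _ "card J"] minus_carrier_mat)
  have At: "transpose_mat AJ \<in> carrier_mat m n" using AJ by simp
  show ?thesis
    unfolding Bhat_def X_of_def m_def[symmetric] carrier_matD[OF Y] using W Pm(1,2) At Y mat_diag_dim[of m d]
    by (simp add: assoc_mult_mat[of _ m m _ m _ n] assoc_mult_mat[of _ m m _ n _ p] assoc_mult_mat[of _ m m _ m _ p] assoc_mult_mat[of _ m m _ m _ m] mult_carrier_mat[of _ m m _ n] mult_carrier_mat[of _ m m _ m])
qed

lemma Bhat_carrier: "Y \<in> carrier_mat n p \<Longrightarrow> Bhat A J P d Y \<in> carrier_mat m p"
proof -
  assume Y: "Y \<in> carrier_mat n p"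
  have C: "C_of A J P d Y \<in> carrier_mat m m" by (simp add: C_of_def m_def)
  show ?thesis unfolding Bhat_eq[OF Y]
    using C Pm X_of_carrier[OF Y] by (auto simp: Lambda_mat_def m_def intro!: mult_carrier_mat[of _ "card J" "card J" _ "card J"] mult_carrier_mat[of _ "card J" "card J" _ p] minus_carrier_mat)
qed

end

section \<open>The estimators as functions of white noise\<close>

text \<open>What is asked of the mean is Q M = 0, so a single development serves every true model
  contained in \<open>J\<close>.\<close>

locale design_law = design +
  fixes M S :: "real mat" and L :: "nat \<Rightarrow> nat \<Rightarrow> real"
  assumes M: "M \<in> carrier_mat n p"
    and QM: "\<And>a j. a < n \<Longrightarrow> j < p \<Longrightarrow> (\<Sum>b<n. Qf a b * M $$ (b, j)) = 0"
    and L: "lower_factor p S L"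
begin

abbreviation T :: "(nat \<times> nat \<Rightarrow> real) \<Rightarrow> real mat" where "T \<equiv> transform n p M L"

lemma T_carrier: "T w \<in> carrier_mat n p" by (simp add: transform_def)

lemma T_index: "a < n \<Longrightarrow> j < p \<Longrightarrow> T w $$ (a, j) = M $$ (a, j) + (\<Sum>l<p. L j l * w (a, l))"
  by (simp add: transform_def)

lemma QT: assumes "a < n" "j < p" shows "(\<Sum>b<n. Qf a b * T w $$ (b, j)) = (\<Sum>l<p. L j l * D.W w a l)"
proof -
  have "(\<Sum>b<n. Qf a b * T w $$ (b, j)) = (\<Sum>b<n. Qf a b * M $$ (b, j)) + (\<Sum>b<n. \<Sum>l<p. L j l * (Qf a b * w (b, l)))"
    using assms unfolding sum.distrib[symmetric] by (intro sum.cong refl) (simp add: T_index distrib_left sum_distrib_left mult_ac)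
  also have "(\<Sum>b<n. \<Sum>l<p. L j l * (Qf a b * w (b, l))) = (\<Sum>l<p. \<Sum>b<n. L j l * (Qf a b * w (b, l)))" by (rule sum.swap)
  also have "\<dots> = (\<Sum>l<p. L j l * D.W w a l)" by (simp add: D.W_def sum_distrib_left)
  finally show ?thesis using assms by (simp add: QM)
qed

text \<open>The residual projection kills the mean and acts on rows, so it commutes with L, which
  acts on columns. Being symmetric and idempotent it can be applied to both factors.\<close>

lemma S_of_T: "S_of A J (T w) = lower_mat p L * D.S 0 w * transpose_mat (lower_mat p L)"
proof (rule eq_matI)
  note Lm1 = Lm(1)[OF L]
  have LS: "lower_mat p L * D.S 0 w \<in> carrier_mat p p" using Lm1 by simp
  fix j l assume "j < dim_row (lower_mat p L * D.S 0 w * transpose_mat (lower_mat p L))"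
    "l < dim_col (lower_mat p L * D.S 0 w * transpose_mat (lower_mat p L))"
  then have jl: "j < p" "l < p" using Lm1 by auto
  define QY where "QY a j = (\<Sum>q<p. L j q * D.W w a q)" for a j
  have QY: "(\<Sum>b<n. Qf a b * T w $$ (b, j)) = QY a j" if "a < n" "j < p" for a j
    using QT[OF that] by (simp add: QY_def)
  have QQY: "(\<Sum>b<n. Qf a b * QY b j) = QY a j" if "a < n" "j < p" for a j
  proof -
    have "(\<Sum>b<n. Qf a b * QY b j) = (\<Sum>b<n. \<Sum>q<p. L j q * (Qf a b * D.W w b q))"
      by (simp add: QY_def sum_distrib_left mult_ac)
    also have "\<dots> = (\<Sum>q<p. L j q * (\<Sum>b<n. Qf a b * D.W w b q))"
      by (subst sum.swap) (simp add: sum_distrib_left)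
    finally show ?thesis using that by (simp add: D.QW QY_def)
  qed
  have QT_mat: "((1\<^sub>m n - H) * T w) $$ (a, l) = QY a l" if a: "a < n" for a
  proof -
    have "((1\<^sub>m n - H) * T w) $$ (a, l) = (\<Sum>b<n. (1\<^sub>m n - H) $$ (a, b) * T w $$ (b, l))"
      using a jl carrier_matD[OF H] carrier_matD[OF T_carrier[of w]] by (simp add: scalar_prod_def atLeast0LessThan)
    then show ?thesis using a jl by (simp add: Qf_index QY)
  qed
  have IH: "1\<^sub>m n - H \<in> carrier_mat n n" using H by (intro minus_carrier_mat)
  have QTc: "(1\<^sub>m n - H) * T w \<in> carrier_mat n p" using IH T_carrier by simp
  have "S_of A J (T w) $$ (j, l) = (transpose_mat (T w) * ((1\<^sub>m n - H) * T w)) $$ (j, l)"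
    unfolding S_of_eq by (subst assoc_mult_mat[of _ p n _ n _ p]) (use IH T_carrier in auto)
  also have "\<dots> = (\<Sum>a<n. T w $$ (a, j) * ((1\<^sub>m n - H) * T w) $$ (a, l))"
    using transpose_mult_index[OF T_carrier QTc jl] .
  also have "\<dots> = (\<Sum>a<n. T w $$ (a, j) * QY a l)" by (intro sum.cong refl) (simp add: QT_mat)
  also have "\<dots> = (\<Sum>a<n. \<Sum>b<n. T w $$ (a, j) * (Qf a b * QY b l))"
    unfolding sum_distrib_left[symmetric] using jl by (simp add: QQY)
  also have "\<dots> = (\<Sum>b<n. \<Sum>a<n. T w $$ (a, j) * (Qf a b * QY b l))" by (rule sum.swap)
  also have "\<dots> = (\<Sum>b<n. (\<Sum>a<n. Qf b a * T w $$ (a, j)) * QY b l)"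
    unfolding sum_distrib_right by (intro sum.cong refl) (simp add: Qf_sym mult_ac)
  also have "\<dots> = (\<Sum>b<n. QY b j * QY b l)" using jl by (intro sum.cong refl) (simp add: QY)
  also have "\<dots> = (\<Sum>b<n. \<Sum>q<p. \<Sum>r<p. L j q * (D.W w b q * D.W w b r) * L l r)"
    unfolding QY_def sum_product by (intro sum.cong refl) (simp add: mult_ac)
  also have "\<dots> = (\<Sum>q<p. \<Sum>b<n. \<Sum>r<p. L j q * (D.W w b q * D.W w b r) * L l r)" by (rule sum.swap)
  also have "\<dots> = (\<Sum>q<p. \<Sum>r<p. \<Sum>b<n. L j q * (D.W w b q * D.W w b r) * L l r)" by (intro sum.cong refl sum.swap)
  also have "\<dots> = (\<Sum>q<p. \<Sum>r<p. L j q * D.S 0 w $$ (q, r) * L l r)"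
    by (intro sum.cong refl) (simp add: D.S_def sum_distrib_left sum_distrib_right)
  also have "\<dots> = (\<Sum>r<p. (\<Sum>q<p. L j q * D.S 0 w $$ (q, r)) * L l r)"
    by (subst sum.swap) (simp add: sum_distrib_right)
  also have "\<dots> = (lower_mat p L * D.S 0 w * transpose_mat (lower_mat p L)) $$ (j, l)"
  proof -
    have "(lower_mat p L * D.S 0 w) $$ (j, r) = (\<Sum>q<p. L j q * D.S 0 w $$ (q, r))" if "r < p" for r
      using that jl carrier_matD[OF D.S_carrier[of 0 w]] by (simp add: lower_mat_def scalar_prod_def atLeast0LessThan)
    then show ?thesis using jl carrier_matD[OF LS] carrier_matD[OF Lm1]
      by (simp add: scalar_prod_def[of "Matrix.row (lower_mat p L * D.S 0 w) _"] atLeast0LessThan) (simp add: lower_mat_def)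
  qed
  finally show "S_of A J (T w) $$ (j, l) = (lower_mat p L * D.S 0 w * transpose_mat (lower_mat p L)) $$ (j, l)" .
qed (use S_of_carrier[OF T_carrier[of w]] Lm(1)[OF L] in auto)

text \<open>The coordinate of the mean along e_i, whitened: L^{-1} M^T e_i.\<close>

definition vM :: "nat \<Rightarrow> nat \<Rightarrow> real" where
  "vM i l = (\<Sum>j<p. inv_mat (lower_mat p L) $$ (l, j) * (\<Sum>a<n. e i a * M $$ (a, j)))"

lemma L_vM: assumes "j < p" shows "(\<Sum>l<p. L j l * vM i l) = (\<Sum>a<n. e i a * M $$ (a, j))"
proof -
  note Lm1 = Lm(1)[OF L]
  have iL: "inv_mat (lower_mat p L) \<in> carrier_mat p p" using Lm1 by simp
  define q where "q j = (\<Sum>a<n. e i a * M $$ (a, j))" for j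
  have LI: "(\<Sum>l<p. L j l * inv_mat (lower_mat p L) $$ (l, j')) = (if j = j' then 1 else 0)" if "j' < p" for j'
  proof -
    have "(lower_mat p L * inv_mat (lower_mat p L)) $$ (j, j') = (if j = j' then 1 else 0)"
      using inv_mat_right(1)[OF Lm1] det_Lm(2)[OF L] that assms by simp
    then show ?thesis using that assms carrier_matD[OF iL] by (simp add: lower_mat_def scalar_prod_def atLeast0LessThan)
  qed
  have "(\<Sum>l<p. L j l * vM i l) = (\<Sum>l<p. \<Sum>j'<p. L j l * inv_mat (lower_mat p L) $$ (l, j') * q j')"
    by (simp add: vM_def q_def[symmetric] sum_distrib_left mult.assoc)
  also have "\<dots> = (\<Sum>j'<p. (\<Sum>l<p. L j l * inv_mat (lower_mat p L) $$ (l, j')) * q j')"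
    by (subst sum.swap) (simp add: sum_distrib_right)
  also have "\<dots> = (\<Sum>j'<p. if j' = j then q j' else 0)"
    by (rule sum.cong[OF refl]) (auto simp: LI)
  finally show ?thesis using assms by (simp add: q_def)
qed

lemma eT: assumes "i < m" "j < p" shows "(\<Sum>a<n. e i a * T w $$ (a, j)) = (\<Sum>l<p. L j l * yy vM i w l)"
proof -
  have "(\<Sum>a<n. e i a * T w $$ (a, j)) = (\<Sum>a<n. e i a * M $$ (a, j)) + (\<Sum>a<n. \<Sum>l<p. L j l * (e i a * w (a, l)))"
    using assms unfolding sum.distrib[symmetric] by (intro sum.cong refl) (simp add: T_index distrib_left sum_distrib_left mult_ac)
  also have "(\<Sum>a<n. \<Sum>l<p. L j l * (e i a * w (a, l))) = (\<Sum>l<p. L j l * xx i w l)"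
    by (subst sum.swap) (simp add: sdesign_dir.x_def[OF dir[OF assms(1)]] sum_distrib_left)
  also have "(\<Sum>a<n. e i a * M $$ (a, j)) = (\<Sum>l<p. L j l * vM i l)" using L_vM[OF assms(2)] by simp
  finally show ?thesis by (simp add: yy_def distrib_left sum.distrib)
qed

text \<open>Q M = 0 says that M is its own projection onto the span of the basis vectors.\<close>

lemma M_eq: assumes "a < n" "j < p" shows "M $$ (a, j) = (\<Sum>i<m. e i a * (\<Sum>l<p. L j l * vM i l))"
proof -
  have "0 = (\<Sum>b<n. (if a = b then M $$ (b, j) else 0) - (\<Sum>i<m. e i a * (e i b * M $$ (b, j))))"
    using QM[OF assms] by (simp add: Qf_def left_diff_distrib sum_distrib_right mult.assoc if_distrib[where f="\<lambda>t. t * _"] cong: if_cong)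
  also have "\<dots> = M $$ (a, j) - (\<Sum>b<n. \<Sum>i<m. e i a * (e i b * M $$ (b, j)))"
    using assms by (simp add: sum_subtractf)
  also have "(\<Sum>b<n. \<Sum>i<m. e i a * (e i b * M $$ (b, j))) = (\<Sum>i<m. e i a * (\<Sum>b<n. e i b * M $$ (b, j)))"
    by (subst sum.swap) (simp add: sum_distrib_left)
  finally show ?thesis by (simp add: L_vM[OF assms(2)])
qed

text \<open>For \<open>p = 2\<close> the constant \<open>beta\<close> vanishes, so that \<open>zz = 0\<close> does no harm there.\<close>

definition good :: "(nat \<times> nat \<Rightarrow> real) \<Rightarrow> bool" where
  "good w \<longleftrightarrow> Determinant.det (D.S 0 w) \<noteq> 0 \<and> (p = 2 \<or> (\<forall>i<m. zz vM i w \<noteq> 0))"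

lemma m0: "p = 1 \<Longrightarrow> m = 0" unfolding m_def using dims(3) by auto

lemma AE_good: "AE w in D.\<nu>. good w"
proof -
  have "AE w in D.\<nu>. p = 2 \<or> (\<forall>i<m. zz vM i w \<noteq> 0)"
  proof (cases "3 \<le> p")
    case True
    have "AE w in D.\<nu>. \<forall>i\<in>{..<m}. zz vM i w \<noteq> 0"
    proof (rule AE_finite_allI)
      fix i assume "i \<in> {..<m}"
      then have i: "i < m" by simp
      show "AE w in D.\<nu>. zz vM i w \<noteq> 0" using zz_pos[OF dims' i True, of vM] by eventually_elim simp
    qed simp
    then show ?thesis by eventually_elim auto
  next
    case False
    then have "p = 2 \<or> m = 0" using m0 dims(2) by (cases "p = 1") auto
    then show ?thesis by auto
  qed
  then show ?thesis using D.AE_det_S0[OF Nb[OF dims']] unfolding good_def by eventually_elim auto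
qed

lemma det_S_of_T: "Determinant.det (D.S 0 w) \<noteq> 0 \<Longrightarrow> 0 < Determinant.det (S_of A J (T w))"
  using D.det_S0_pos[of w] det_Lm(2)[OF L]
  by (simp add: S_of_T inv_congruence(2)[OF L D.S_carrier])

text \<open>The factor d_i is the square of the \<open>sqrt (d i)\<close> in X. It cancels against
  the one in Lambda, which leaves \<open>beta / zz\<close> in \<open>Lambda_C\<close>.\<close>

lemma C_of_T:
  assumes d: "Determinant.det (D.S 0 w) \<noteq> 0"
  shows "C_of A J P d (T w) = mat_diag m (\<lambda>i. d i * zz vM i w)"
proof -
  have iS: "inv_mat (S_of A J (T w)) \<in> carrier_mat p p" using S_of_carrier[OF T_carrier] by simp
  have "Matrix.row (X_of A J P d (T w)) i \<bullet> (inv_mat (S_of A J (T w)) *\<^sub>v Matrix.row (X_of A J P d (T w)) i)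
     = d i * zz vM i w" if i: "i < m" for i
  proof -
    note X = X_of_carrier[OF T_carrier[of w]]
    have "Matrix.row (X_of A J P d (T w)) i \<bullet> (inv_mat (S_of A J (T w)) *\<^sub>v Matrix.row (X_of A J P d (T w)) i)
      = (\<Sum>j<p. \<Sum>l<p. X_of A J P d (T w) $$ (i, j) * inv_mat (S_of A J (T w)) $$ (j, l) * X_of A J P d (T w) $$ (i, l))"
      using i carrier_matD[OF X] carrier_matD[OF iS] by (simp add: scalar_prod_def atLeast0LessThan sum_distrib_left mult.assoc)
    also have "\<dots> = (\<Sum>j<p. \<Sum>l<p. d i * ((\<Sum>q<p. L j q * yy vM i w q) * inv_mat (S_of A J (T w)) $$ (j, l) * (\<Sum>q<p. L l q * yy vM i w q)))"
    proof (intro sum.cong refl)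
      fix j l assume jl: "j \<in> {..<p}" "l \<in> {..<p}"
      have sd: "sqrt (d i) * sqrt (d i) = d i" using d_pos[OF i] by simp
      have "sqrt (d i) * r * s * (sqrt (d i) * t) = sqrt (d i) * sqrt (d i) * (r * s * t)" for r s t :: real by simp
      then show "X_of A J P d (T w) $$ (i, j) * inv_mat (S_of A J (T w)) $$ (j, l) * X_of A J P d (T w) $$ (i, l)
        = d i * ((\<Sum>q<p. L j q * yy vM i w q) * inv_mat (S_of A J (T w)) $$ (j, l) * (\<Sum>q<p. L l q * yy vM i w q))"
        using jl i by (simp only: X_of_index[OF T_carrier] eT lessThan_iff sd)
    qed
    also have "\<dots> = d i * (\<Sum>j<p. \<Sum>l<p. (\<Sum>q<p. L j q * yy vM i w q) * inv_mat (S_of A J (T w)) $$ (j, l) * (\<Sum>q<p. L l q * yy vM i w q))"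
      by (simp add: sum_distrib_left)
    also have "(\<Sum>j<p. \<Sum>l<p. (\<Sum>q<p. L j q * yy vM i w q) * inv_mat (S_of A J (T w)) $$ (j, l) * (\<Sum>q<p. L l q * yy vM i w q))
      = (\<Sum>j<p. \<Sum>l<p. yy vM i w j * inv_mat (D.S 0 w) $$ (j, l) * yy vM i w l)"
      unfolding S_of_T by (rule quad_congruence[OF L D.S_carrier d])
    also have "\<dots> = zz vM i w" unfolding zz_def by (intro sum.cong refl) (simp add: D.R_def)
    finally show ?thesis .
  qed
  then show ?thesis unfolding C_of_def m_def[symmetric] by (intro eq_matI) (auto simp: mat_diag_def)
qed

lemma Lambda_C:
  assumes "good w"
  shows "Lambda_mat n p J d * inv_mat (C_of A J P d (T w)) = mat_diag m (\<lambda>i. beta / zz vM i w)"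
proof -
  have d: "Determinant.det (D.S 0 w) \<noteq> 0" using assms by (simp add: good_def)
  have Lam: "Lambda_mat n p J d = mat_diag m (\<lambda>i. d i * beta)"
    unfolding Lambda_mat_def m_def[symmetric] beta_def by (simp add: mat_diag_def)
  show ?thesis
  proof (cases "\<forall>i<m. zz vM i w \<noteq> 0")
    case True
    have "inv_mat (C_of A J P d (T w)) = mat_diag m (\<lambda>i. 1 / (d i * zz vM i w))"
      unfolding C_of_T[OF d] by (rule inv_mat_diag) (use True d_pos in fastforce)
    then have "Lambda_mat n p J d * inv_mat (C_of A J P d (T w)) = mat_diag m (\<lambda>i. d i * beta * (1 / (d i * zz vM i w)))"
      unfolding Lam by simp
    also have "\<dots> = mat_diag m (\<lambda>i. beta / zz vM i w)"
      unfolding mat_diag_def using d_pos by (intro eq_matI) (auto simp: less_imp_neq[symmetric])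
    finally show ?thesis .
  next
    case False
    \<comment> \<open>By \<open>good\<close>, a vanishing \<open>zz\<close> is possible only for p =
      2. Then Lambda is zero, and the default value of the inverse of C does no harm.\<close>
    then have b: "beta = 0" using assms by (auto simp: good_def beta_def)
    have iC: "inv_mat (C_of A J P d (T w)) \<in> carrier_mat m m" by (rule inv_mat_carrier) (simp add: C_of_def m_def)
    show ?thesis unfolding Lam mat_diag_mult_left[OF iC] b by (intro eq_matI) (auto simp: mat_diag_def)
  qed
qed

text \<open>Since P diagonalises the design, each coordinate of the data along a basis vector
  receives its own shrinkage factor.\<close>

lemma ABhat_T:
  assumes g: "good w" and aj: "a < n" "j < p"
  shows "(AJ * Bhat A J P d (T w)) $$ (a, j) = (\<Sum>i<m. e i a * ((1 - beta / zz vM i w) * (\<Sum>l<p. L j l * yy vM i w l)))"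
proof -
  note X = X_of_carrier[OF T_carrier[of w]]
  let ?k = "\<lambda>i. 1 - beta / zz vM i w"
  have K: "1\<^sub>m m - mat_diag m (\<lambda>i. beta / zz vM i w) = mat_diag m ?k"
    by (intro eq_matI) (auto simp: mat_diag_def)
  have KX: "mat_diag m ?k * X_of A J P d (T w) \<in> carrier_mat m p" using X by (auto intro: mult_carrier_mat[of _ m m])
  have "AJ * Bhat A J P d (T w) = AJ * (P * mat_diag m ?k * X_of A J P d (T w))"
    unfolding Bhat_eq[OF T_carrier] Lambda_C[OF g] K ..
  also have "\<dots> = U * (mat_diag m ?k * X_of A J P d (T w))"
    unfolding U_def assoc_mult_mat[OF Pm(1) mat_diag_dim X] assoc_mult_mat[OF AJ Pm(1) KX] ..
  finally have "(AJ * Bhat A J P d (T w)) $$ (a, j) = (\<Sum>i<m. U $$ (a, i) * (?k i * X_of A J P d (T w) $$ (i, j)))"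
    using aj carrier_matD[OF U] carrier_matD[OF X] unfolding mat_diag_mult_left[OF X] by (simp add: scalar_prod_def atLeast0LessThan)
  also have "\<dots> = (\<Sum>i<m. e i a * (?k i * (\<Sum>l<p. L j l * yy vM i w l)))"
    using aj by (intro sum.cong refl, simp only: X_of_index[OF T_carrier] eT lessThan_iff) (simp add: e_def)
  finally show ?thesis .
qed

lemma zklic_T:
  assumes g: "good w"
  shows "zklic A J P d (T w) = real n * ln (Determinant.det (Sigma_hat A J (T w))) + real n * real p * ln (2 * pi)
    + real n * real p * (real n + real m) / (real n - real m - real p - 1) - real n * beta * (\<Sum>i<m. beta / zz vM i w)"
proof -
  have tr: "trace_mat (Lambda_mat n p J d * inv_mat (C_of A J P d (T w))) = (\<Sum>i<m. beta / zz vM i w)"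
    unfolding Lambda_C[OF g] by (simp add: trace_mat_def mat_diag_def)
  show ?thesis
    unfolding zklic_def Let_def Sigma_hat_def carrier_matD[OF T_carrier[of w]] tr m_def[symmetric]
    unfolding beta_def[symmetric] ..
qed

lemma Sigma_hat_T:
  assumes d: "Determinant.det (D.S 0 w) \<noteq> 0"
  shows "Sigma_hat A J (T w) \<in> carrier_mat p p" "0 < Determinant.det (Sigma_hat A J (T w))"
    "inv_mat (Sigma_hat A J (T w)) = real n \<cdot>\<^sub>m inv_mat (S_of A J (T w))"
    "ln (Determinant.det (Sigma_hat A J (T w))) = ln (Determinant.det (D.S 0 w)) + (2 * ln (Determinant.det (lower_mat p L)) - real p * ln (real n))"
proof -
  note S = S_of_carrier[OF T_carrier[of w]]
  note dS = det_S_of_T[OF d]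
  have n0: "0 < real n" using dims by simp
  have Sh: "Sigma_hat A J (T w) = (1 / real n) \<cdot>\<^sub>m S_of A J (T w)"
    using carrier_matD[OF T_carrier[of w]] by (simp add: Sigma_hat_def)
  show "Sigma_hat A J (T w) \<in> carrier_mat p p" unfolding Sh using S by simp
  have dSh: "Determinant.det (Sigma_hat A J (T w)) = (1 / real n) ^ p * Determinant.det (S_of A J (T w))"
    unfolding Sh using S by simp
  show "0 < Determinant.det (Sigma_hat A J (T w))" unfolding dSh using dS n0 by simp
  show "inv_mat (Sigma_hat A J (T w)) = real n \<cdot>\<^sub>m inv_mat (S_of A J (T w))"
    unfolding Sh using inv_mat_smult[OF S, of "1 / real n"] dS n0 by simp
  have "ln (Determinant.det (Sigma_hat A J (T w))) = real p * ln (1 / real n) + ln (Determinant.det (S_of A J (T w)))"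
    unfolding dSh using dS n0 by (simp add: ln_mult ln_realpow)
  also have "ln (Determinant.det (S_of A J (T w))) = 2 * ln (Determinant.det (lower_mat p L)) + ln (Determinant.det (D.S 0 w))"
    unfolding S_of_T using inv_congruence(2)[OF L D.S_carrier d] D.det_S0_pos[OF d] det_Lm(2)[OF L] by (simp add: ln_mult ln_realpow)
  finally show "ln (Determinant.det (Sigma_hat A J (T w))) = ln (Determinant.det (D.S 0 w)) + (2 * ln (Determinant.det (lower_mat p L)) - real p * ln (real n))"
    using n0 by (simp add: ln_div)
qed

text \<open>The prediction error is L applied to wt - Del, so \<open>quad_congruence\<close> removes
  L; the factor n stems from the inverse of S_J / n.\<close>

lemma ln_plugin_T:
  assumes g: "good w"
  shows "0 < plugin_pdf A J P d (T w) (T wt)"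
    "- 2 * ln (plugin_pdf A J P d (T w) (T wt)) =
      real n * ln (Determinant.det (Sigma_hat A J (T w))) + real n * real p * ln (2 * pi) + real n * loss vM wt w"
proof -
  have d: "Determinant.det (D.S 0 w) \<noteq> 0" using g by (simp add: good_def)
  have AB: "AJ * Bhat A J P d (T w) \<in> carrier_mat n p" using AJ Bhat_carrier[OF T_carrier[of w]] by simp
  have pl: "plugin_pdf A J P d (T w) (T wt) = matnormal_pdf (AJ * Bhat A J P d (T w)) (Sigma_hat A J (T w)) (T wt)"
    by (simp add: plugin_pdf_def model_pdf_def)
  note ln = ln_matnormal_pdf[OF AB T_carrier Sigma_hat_T(1,2)[OF d]]
  show "0 < plugin_pdf A J P d (T w) (T wt)" unfolding pl by (rule ln(1))
  have iS: "inv_mat (S_of A J (T w)) \<in> carrier_mat p p" using S_of_carrier[OF T_carrier[of w]] by simp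
  have diff: "T wt $$ (a, j) - (AJ * Bhat A J P d (T w)) $$ (a, j) = (\<Sum>q<p. L j q * (wt (a, q) - Del vM w a q))"
    if aj: "a < n" "j < p" for a j
  proof -
    have "M $$ (a, j) - (\<Sum>i<m. e i a * ((1 - beta / zz vM i w) * (\<Sum>l<p. L j l * yy vM i w l)))
      = (\<Sum>i<m. \<Sum>l<p. L j l * (e i a * (vM i l - (1 - beta / zz vM i w) * yy vM i w l)))"
      unfolding M_eq[OF aj] sum_subtractf[symmetric] sum_distrib_left
      by (intro sum.cong refl) (simp add: algebra_simps)
    also have "\<dots> = (\<Sum>i<m. \<Sum>l<p. L j l * - (e i a * del vM i w l))"
      by (intro sum.cong refl) (simp add: del_def yy_def algebra_simps)
    also have "\<dots> = (\<Sum>l<p. L j l * - Del vM w a l)"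
      unfolding Del_def by (subst sum.swap) (simp add: sum_distrib_left sum_negf)
    finally show ?thesis
      using aj by (simp add: ABhat_T[OF g] T_index right_diff_distrib sum_subtractf sum_negf)
  qed
  have "(\<Sum>i<n. \<Sum>j<p. \<Sum>l<p. (T wt $$ (i, j) - (AJ * Bhat A J P d (T w)) $$ (i, j)) * inv_mat (Sigma_hat A J (T w)) $$ (j, l) *
      (T wt $$ (i, l) - (AJ * Bhat A J P d (T w)) $$ (i, l)))
     = (\<Sum>i<n. \<Sum>j<p. \<Sum>l<p. real n * ((\<Sum>q<p. L j q * (wt (i, q) - Del vM w i q)) * inv_mat (S_of A J (T w)) $$ (j, l) *
      (\<Sum>q<p. L l q * (wt (i, q) - Del vM w i q))))"
  proof (intro sum.cong refl)
    fix i j l assume ijl: "i \<in> {..<n}" "j \<in> {..<p}" "l \<in> {..<p}"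
    then have "inv_mat (Sigma_hat A J (T w)) $$ (j, l) = real n * inv_mat (S_of A J (T w)) $$ (j, l)"
      unfolding Sigma_hat_T(3)[OF d] using carrier_matD[OF iS] by simp
    moreover have "T wt $$ (i, j) - (AJ * Bhat A J P d (T w)) $$ (i, j) = (\<Sum>q<p. L j q * (wt (i, q) - Del vM w i q))"
      "T wt $$ (i, l) - (AJ * Bhat A J P d (T w)) $$ (i, l) = (\<Sum>q<p. L l q * (wt (i, q) - Del vM w i q))"
      using ijl by (auto intro!: diff)
    moreover have "r * (real n * s) * t = real n * (r * s * t)" for r s t :: real by simp
    ultimately show "(T wt $$ (i, j) - (AJ * Bhat A J P d (T w)) $$ (i, j)) * inv_mat (Sigma_hat A J (T w)) $$ (j, l) *
      (T wt $$ (i, l) - (AJ * Bhat A J P d (T w)) $$ (i, l)) =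
      real n * ((\<Sum>q<p. L j q * (wt (i, q) - Del vM w i q)) * inv_mat (S_of A J (T w)) $$ (j, l) *
      (\<Sum>q<p. L l q * (wt (i, q) - Del vM w i q)))" by (simp only:)
  qed
  also have "\<dots> = (\<Sum>i<n. real n * (\<Sum>j<p. \<Sum>l<p. (\<Sum>q<p. L j q * (wt (i, q) - Del vM w i q)) * inv_mat (S_of A J (T w)) $$ (j, l) *
      (\<Sum>q<p. L l q * (wt (i, q) - Del vM w i q))))"
    unfolding sum_distrib_left[symmetric] ..
  also have "\<dots> = (\<Sum>i<n. real n * (\<Sum>j<p. \<Sum>l<p. (wt (i, j) - Del vM w i j) * inv_mat (D.S 0 w) $$ (j, l) * (wt (i, l) - Del vM w i l)))"
    unfolding S_of_T quad_congruence[OF L D.S_carrier d] ..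
  also have "\<dots> = real n * loss vM wt w"
    unfolding loss_def sum_distrib_left[symmetric] by (intro arg_cong2[where f="(*)"] refl sum.cong) (simp add: D.R_def)
  finally show "- 2 * ln (plugin_pdf A J P d (T w) (T wt)) =
      real n * ln (Determinant.det (Sigma_hat A J (T w))) + real n * real p * ln (2 * pi) + real n * loss vM wt w"
    unfolding pl ln(2) by simp
qed

end

lemma AE_pair_snd:
  assumes "sigma_finite_measure N" and "AE w in N. Q w"
  shows "AE z in M \<Otimes>\<^sub>M N. Q (snd z)"
proof -
  interpret N: sigma_finite_measure N by fact
  obtain Z where Z: "{w \<in> space N. \<not> Q w} \<subseteq> Z" "Z \<in> sets N" "emeasure N Z = 0"
    using AE_E[OF assms(2)] by blast
  show ?thesis
  proof (rule AE_I)
    show "{z \<in> space (M \<Otimes>\<^sub>M N). \<not> Q (snd z)} \<subseteq> space M \<times> Z"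
      using Z(1) by (auto simp: space_pair_measure)
    show "emeasure (M \<Otimes>\<^sub>M N) (space M \<times> Z) = 0"
      using Z by (simp add: N.emeasure_pair_measure_Times)
    show "space M \<times> Z \<in> sets (M \<Otimes>\<^sub>M N)" using Z by simp
  qed
qed

lemma mat_meas_matnormal_pdf:
  assumes F: "mat_meas N n p F" and Y: "mat_meas N n p Y" and C: "mat_meas N p p C"
  shows "(\<lambda>x. matnormal_pdf (F x) (C x) (Y x)) \<in> borel_measurable N"
proof -
  have "(\<lambda>x. \<Prod>i<n. exp (- (\<Sum>j<p. \<Sum>l<p. (Y x $$ (i, j) - F x $$ (i, j)) * inv_mat (C x) $$ (j, l) * (Y x $$ (i, l) - F x $$ (i, l))) / 2)
      / sqrt ((2 * pi) ^ p * Determinant.det (C x))) \<in> borel_measurable N"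
    using mat_meas_entry[OF F] mat_meas_entry[OF Y] mat_meas_entry[OF mat_meas_inv[OF C]] mat_meas_det[OF C]
    by (intro borel_measurable_prod borel_measurable_divide borel_measurable_exp[THEN measurable_compose[rotated]]
        borel_measurable_uminus borel_measurable_sum borel_measurable_times borel_measurable_diff borel_measurable_const
        borel_measurable_sqrt[THEN measurable_compose[rotated]]) auto
  then show ?thesis
    by (rule measurable_cong[THEN iffD1, rotated])
      (simp add: matnormal_pdf_eq[OF mat_meas_carrier[OF F] mat_meas_carrier[OF Y] mat_meas_carrier[OF C]])
qed

section \<open>Measurability of the criterion and of the plug-in density\<close>

context design
begin

lemma C_of_eq:
  assumes Y: "Y \<in> carrier_mat n p"
  shows "C_of A J P d Y = mat_diag m (\<lambda>i. \<Sum>j<p. \<Sum>l<p.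
    X_of A J P d Y $$ (i, j) * inv_mat (S_of A J Y) $$ (j, l) * X_of A J P d Y $$ (i, l))"
  unfolding C_of_def m_def[symmetric] mat_diag_def
  using carrier_matD[OF X_of_carrier[OF Y]] carrier_matD[OF inv_mat_carrier[OF S_of_carrier[OF Y]]]
  by (intro eq_matI) (auto simp: scalar_prod_def atLeast0LessThan sum_distrib_left mult.assoc)

lemma mat_meas_X: "mat_meas N n p Y \<Longrightarrow> mat_meas N m p (\<lambda>x. X_of A J P d (Y x))"
  unfolding X_of_def m_def[symmetric] using AJ Pm(1)
  by (intro mat_meas_mult[where s=n] mat_meas_mult[where s=m] mat_meas_const) auto

lemma mat_meas_S: "mat_meas N n p Y \<Longrightarrow> mat_meas N p p (\<lambda>x. S_of A J (Y x))"
  unfolding S_of_eq using H by (intro mat_meas_mult[where s=n] mat_meas_const mat_meas_transpose minus_carrier_mat)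

text \<open>Measurability of the criterion is stated relative to any measurable space on which
  the statistics \<open>X\<close> and \<open>S\<close> are measurable, because it is also needed for the
  sigma-algebra they generate.\<close>

context
  fixes N :: "'a measure" and Y :: "'a \<Rightarrow> real mat"
  assumes Y: "\<And>x. x \<in> space N \<Longrightarrow> Y x \<in> carrier_mat n p"
    and X: "mat_meas N m p (\<lambda>x. X_of A J P d (Y x))" and S: "mat_meas N p p (\<lambda>x. S_of A J (Y x))"
begin

lemma mat_meas_C: "mat_meas N m m (\<lambda>x. C_of A J P d (Y x))"
proof (rule mat_meas_cong)
  show "mat_meas N m m (\<lambda>x. mat_diag m (\<lambda>i. \<Sum>j<p. \<Sum>l<p.
    X_of A J P d (Y x) $$ (i, j) * inv_mat (S_of A J (Y x)) $$ (j, l) * X_of A J P d (Y x) $$ (i, l)))"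
    by (intro mat_meas_mat_diag borel_measurable_sum borel_measurable_times mat_meas_entry[OF X] mat_meas_entry[OF mat_meas_inv[OF S]]) auto
qed (rule C_of_eq[OF Y])

lemma Lambda_carrier: "Lambda_mat n p J d \<in> carrier_mat m m"
  by (simp add: Lambda_mat_def m_def)

lemma measurable_zklic: "(\<lambda>x. zklic A J P d (Y x)) \<in> borel_measurable N"
proof -
  have "(\<lambda>x. real n * ln (Determinant.det ((1 / real n) \<cdot>\<^sub>m S_of A J (Y x))) + real n * real p * ln (2 * pi)
    + real n * real p * (real n + real (card J)) / (real n - real (card J) - real p - 1)
    - real n * ((real p - 2) / (real n - real (card J) - real p + 1))
        * trace_mat (Lambda_mat n p J d * inv_mat (C_of A J P d (Y x)))) \<in> borel_measurable N"
    by (intro borel_measurable_diff borel_measurable_add borel_measurable_times borel_measurable_const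
        borel_measurable_ln mat_meas_det[OF mat_meas_smult[OF S]]
        mat_meas_trace[OF mat_meas_mult[OF mat_meas_const[OF Lambda_carrier] mat_meas_inv[OF mat_meas_C]]])
  then show ?thesis
    by (rule measurable_cong[THEN iffD1, rotated]) (use Y in \<open>auto simp: zklic_def Let_def\<close>)
qed

lemma mat_meas_Bhat: "mat_meas N m p (\<lambda>x. Bhat A J P d (Y x))"
proof (rule mat_meas_cong)
  show "mat_meas N m p (\<lambda>x. P * (1\<^sub>m m - Lambda_mat n p J d * inv_mat (C_of A J P d (Y x))) * X_of A J P d (Y x))"
    using Pm(1) Lambda_carrier
    by (intro mat_meas_mult[where s=m] mat_meas_minus mat_meas_inv mat_meas_C X mat_meas_const) auto
qed (rule Bhat_eq[OF Y])

end

lemma measurable_plugin: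
  "(\<lambda>z. plugin_pdf A J P d (snd z) (fst z)) \<in> borel_measurable (lborel_mat n p \<Otimes>\<^sub>M lborel_mat n p)"
proof -
  let ?N = "lborel_mat n p \<Otimes>\<^sub>M lborel_mat n p"
  have Y: "mat_meas ?N n p snd" "mat_meas ?N n p fst" using mat_meas_compose[OF mat_meas_lborel_mat measurable_snd] mat_meas_compose[OF mat_meas_lborel_mat measurable_fst] by auto
  have B: "mat_meas ?N m p (\<lambda>z. Bhat A J P d (snd z))"
    by (rule mat_meas_Bhat[OF mat_meas_carrier[OF Y(1)] mat_meas_X[OF Y(1)] mat_meas_S[OF Y(1)]])
  have Sh: "mat_meas ?N p p (\<lambda>z. Sigma_hat A J (snd z))"
  proof (rule mat_meas_cong[OF mat_meas_smult[OF mat_meas_S[OF Y(1)], of "1 / real n"]])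
    fix z assume "z \<in> space ?N"
    from carrier_matD[OF mat_meas_carrier[OF Y(1) this]]
    show "Sigma_hat A J (snd z) = (1 / real n) \<cdot>\<^sub>m S_of A J (snd z)" by (simp add: Sigma_hat_def)
  qed
  show ?thesis
    unfolding plugin_pdf_def model_pdf_def
    by (rule mat_meas_matnormal_pdf[OF mat_meas_mult[OF mat_meas_const[OF AJ] B] Y(2) Sh])
qed

end

section \<open>Expectations of the criterion and of the risk\<close>

context design_law
begin

abbreviation law :: "real mat measure" where "law \<equiv> matnormal M S"
abbreviation lpdf :: "real mat \<Rightarrow> real" where "lpdf \<equiv> matnormal_pdf M S"

lemma law: "law = distr D.\<nu> (lborel_mat n p) T"
  unfolding D.I_def by (rule matnormal_eq_distr[OF M L])

lemma T_meas [measurable]: "T \<in> measurable D.\<nu> (lborel_mat n p)"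
  using measurable_transform[OF M L] by (simp add: D.I_def measurable_cong_sets[OF sets_gaussM refl])

lemma S_carrier: "S \<in> carrier_mat p p" by (rule Lm(3)[OF L])

lemma measurable_lpdf: "lpdf \<in> borel_measurable (lborel_mat n p)"
  by (rule measurable_matnormal_pdf[OF M S_carrier])

lemma prob_law: "prob_space law"
  unfolding law by (rule D.nu.prob_space_distr) simp

definition ln_c :: real where "ln_c = (real n * real p * ln (2 * pi) + real n * ln (Determinant.det S)) / 2"

lemma ln_lpdf_T: "0 < lpdf (T w)" "ln (lpdf (T w)) = - (\<Sum>i<n. \<Sum>q<p. w (i, q) * w (i, q)) / 2 - ln_c"
proof -
  note ln = ln_matnormal_pdf[OF M T_carrier S_carrier det_S_pos[OF L]]
  show "0 < lpdf (T w)" by (rule ln(1))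
  have "(\<Sum>i<n. \<Sum>j<p. \<Sum>l<p. (T w $$ (i, j) - M $$ (i, j)) * inv_mat S $$ (j, l) * (T w $$ (i, l) - M $$ (i, l)))
     = (\<Sum>i<n. \<Sum>j<p. \<Sum>l<p. (\<Sum>q<p. L j q * w (i, q)) * inv_mat S $$ (j, l) * (\<Sum>q<p. L l q * w (i, q)))"
    by (intro sum.cong refl) (simp add: T_index)
  also have "\<dots> = (\<Sum>i<n. \<Sum>q<p. w (i, q) * w (i, q))"
    by (intro sum.cong refl quad_transform[OF L])
  finally show "ln (lpdf (T w)) = - (\<Sum>i<n. \<Sum>q<p. w (i, q) * w (i, q)) / 2 - ln_c"
    unfolding ln(2) ln_c_def by simp
qed

lemma ln_lpdf_T_integrable: "integrable D.\<nu> (\<lambda>w. ln (lpdf (T w)))"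
proof -
  have "integrable D.\<nu> (\<lambda>w. w (i, q) * w (i, q))" if "i < n" "q < p" for i q
    using that by (intro D.integrable_poly polybd_mult polybd_coord borel_measurable_times measurable_component_singleton; simp add: D.I_def)
  then show ?thesis unfolding ln_lpdf_T(2)
    by (intro Bochner_Integration.integrable_diff integrable_divide Bochner_Integration.integrable_minus Bochner_Integration.integrable_sum) auto
qed

lemma ln_lpdf_expectation: "(\<integral>Y. ln (lpdf Y) \<partial>law) = (\<integral>w. ln (lpdf (T w)) \<partial>D.\<nu>)"
  unfolding law using measurable_lpdf by (subst integral_distr) auto

lemma p_cond: "2 \<le> p \<or> m = 0"
  using dims(2) m0 by (cases "p = 1") auto

text \<open>The part shared by the criterion and minus twice the log predictive density. Its
  expectation appears on both sides and cancels, so integrability is all that is established about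
  it.\<close>

definition ln_det_T :: "(nat \<times> nat \<Rightarrow> real) \<Rightarrow> real" where
  "ln_det_T w = real n * (ln (Determinant.det (D.S 0 w)) + (2 * ln (Determinant.det (lower_mat p L)) - real p * ln (real n)))
      + real n * real p * ln (2 * pi)"

lemma ln_det_T_integrable: "integrable D.\<nu> ln_det_T"
  unfolding ln_det_T_def
  by (intro Bochner_Integration.integrable_add integrable_mult_right D.ln_det_integrable[OF Nb[OF dims']] D.nu.integrable_const)

definition E_const :: real where
  "E_const = real n * real p * (real n + real m) / (real n - real m - real p - 1)"

lemma zklic_integrable: "integrable law (zklic A J P d)"
  and zklic_expectation: "(\<integral>Y. zklic A J P d Y \<partial>law) =
    (\<integral>w. ln_det_T w \<partial>D.\<nu>) + E_const - real n * beta * (\<Sum>i<m. \<integral>w. beta / zz vM i w \<partial>D.\<nu>)"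
proof -
  note mY = mat_meas_lborel_mat[of n p]
  have meas: "zklic A J P d \<in> borel_measurable (lborel_mat n p)"
    by (rule measurable_zklic[OF mat_meas_carrier[OF mY] mat_meas_X[OF mY] mat_meas_S[OF mY]])
  have mT: "(\<lambda>w. zklic A J P d (T w)) \<in> borel_measurable D.\<nu>" using measurable_compose[OF T_meas meas] .
  let ?g = "\<lambda>w. ln_det_T w + E_const - real n * beta * (\<Sum>i<m. beta / zz vM i w)"
  note iz = loss_expectation(3)[OF dims' p_cond, of _ vM]
  have ig: "integrable D.\<nu> ?g"
    by (intro Bochner_Integration.integrable_add Bochner_Integration.integrable_diff integrable_mult_right Bochner_Integration.integrable_sum
        ln_det_T_integrable D.nu.integrable_const iz) auto
  have AE: "AE w in D.\<nu>. zklic A J P d (T w) = ?g w"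
    using AE_good
  proof eventually_elim
    case (elim w)
    then show ?case using Sigma_hat_T(4)[of w] by (simp add: zklic_T[OF elim] ln_det_T_def E_const_def good_def)
  qed
  have "integrable D.\<nu> (\<lambda>w. zklic A J P d (T w))"
    using integrable_cong_AE[OF mT borel_measurable_integrable[OF ig] AE] ig by blast
  then show "integrable law (zklic A J P d)"
    unfolding law using meas by (subst integrable_distr_eq) auto
  have "(\<integral>Y. zklic A J P d Y \<partial>law) = (\<integral>w. zklic A J P d (T w) \<partial>D.\<nu>)"
    unfolding law using meas by (subst integral_distr) auto
  also have "\<dots> = integral\<^sup>L D.\<nu> ?g"
    by (rule integral_cong_AE[OF mT borel_measurable_integrable[OF ig] AE])
  also have "\<dots> = (\<integral>w. ln_det_T w \<partial>D.\<nu>) + E_const - real n * beta * (\<Sum>i<m. \<integral>w. beta / zz vM i w \<partial>D.\<nu>)"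
  proof -
    have "integrable D.\<nu> (\<lambda>w. \<Sum>i<m. beta / zz vM i w)" using iz by (intro Bochner_Integration.integrable_sum) auto
    moreover have "(\<integral>w. (\<Sum>i<m. beta / zz vM i w) \<partial>D.\<nu>) = (\<Sum>i<m. \<integral>w. beta / zz vM i w \<partial>D.\<nu>)"
      using iz by (intro Bochner_Integration.integral_sum) auto
    ultimately show ?thesis using ln_det_T_integrable by (simp add: D.nu.prob_space)
  qed
  finally show "(\<integral>Y. zklic A J P d Y \<partial>law) =
    (\<integral>w. ln_det_T w \<partial>D.\<nu>) + E_const - real n * beta * (\<Sum>i<m. \<integral>w. beta / zz vM i w \<partial>D.\<nu>)" .
qed

text \<open>On the event \<open>good\<close> the integrand splits into the true log density of the
  new data, half of \<open>ln_det_T\<close> and n / 2 times the loss. Subtracting the expectation of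
  the first and doubling leaves that of the criterion.\<close>

lemma kl_integrable: "integrable (law \<Otimes>\<^sub>M law) (\<lambda>z. ln (lpdf (fst z) / plugin_pdf A J P d (snd z) (fst z)))"
  and kl_expectation: "2 * ((\<integral>z. ln (lpdf (fst z) / plugin_pdf A J P d (snd z) (fst z)) \<partial>(law \<Otimes>\<^sub>M law)) - (\<integral>Y. ln (lpdf Y) \<partial>law))
     = (\<integral>Y. zklic A J P d Y \<partial>law)"
proof -
  let ?K = "\<lambda>z. ln (lpdf (fst z) / plugin_pdf A J P d (snd z) (fst z))"
  let ?N = "lborel_mat n p \<Otimes>\<^sub>M lborel_mat n p"
  let ?TT = "\<lambda>(x, y). (T x, T y)"
  let ?g = "\<lambda>z. ln (lpdf (T (fst z))) + (ln_det_T (snd z) + real n * loss vM (fst z) (snd z)) / 2"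
  interpret PP: pair_prob_space D.\<nu> D.\<nu> ..
  have sf: "sigma_finite_measure law" using prob_law prob_space_imp_sigma_finite by blast
  have pair: "law \<Otimes>\<^sub>M law = distr (D.\<nu> \<Otimes>\<^sub>M D.\<nu>) ?N ?TT"
    using sf unfolding law by (intro pair_measure_distr) simp_all
  have meas: "?K \<in> borel_measurable ?N"
    using measurable_plugin measurable_compose[OF measurable_fst measurable_lpdf]
    by (intro borel_measurable_ln borel_measurable_divide) auto
  have mTT: "?TT \<in> measurable (D.\<nu> \<Otimes>\<^sub>M D.\<nu>) ?N" by measurable
  have mT: "(\<lambda>z. ?K (?TT z)) \<in> borel_measurable (D.\<nu> \<Otimes>\<^sub>M D.\<nu>)" using measurable_compose[OF mTT meas] .
  have i1: "integrable (D.\<nu> \<Otimes>\<^sub>M D.\<nu>) (\<lambda>z. ln (lpdf (T (fst z))))"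
    "(\<integral>z. ln (lpdf (T (fst z))) \<partial>(D.\<nu> \<Otimes>\<^sub>M D.\<nu>)) = (\<integral>w. ln (lpdf (T w)) \<partial>D.\<nu>)"
    using pair_integrable_mult[OF D.nu.prob_space_axioms D.nu.prob_space_axioms ln_lpdf_T_integrable, of "\<lambda>_. 1"]
    by (auto simp: D.nu.prob_space)
  have i2: "integrable (D.\<nu> \<Otimes>\<^sub>M D.\<nu>) (\<lambda>z. ln_det_T (snd z))"
    "(\<integral>z. ln_det_T (snd z) \<partial>(D.\<nu> \<Otimes>\<^sub>M D.\<nu>)) = (\<integral>w. ln_det_T w \<partial>D.\<nu>)"
    using pair_integrable_mult[OF D.nu.prob_space_axioms D.nu.prob_space_axioms _ ln_det_T_integrable, of "\<lambda>_. 1"]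
    by (auto simp: D.nu.prob_space)
  note lo = loss_expectation(1,2)[OF dims' p_cond, of vM]
  have ig: "integrable (D.\<nu> \<Otimes>\<^sub>M D.\<nu>) ?g"
    by (intro Bochner_Integration.integrable_add integrable_divide integrable_mult_right i1 i2 lo)
  have AE: "AE z in D.\<nu> \<Otimes>\<^sub>M D.\<nu>. ?K (?TT z) = ?g z"
    using AE_pair_snd[OF D.nu.sigma_finite_measure_axioms AE_good]
  proof eventually_elim
    case (elim z)
    obtain x y where z: "z = (x, y)" by (cases z)
    with elim have g: "good y" by simp
    have "?K (?TT z) = ln (lpdf (T x)) - ln (plugin_pdf A J P d (T y) (T x))"
      using ln_lpdf_T(1)[of x] ln_plugin_T(1)[OF g, of x] by (simp add: z ln_div)
    also have "\<dots> = ?g z"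
      using ln_plugin_T(2)[OF g, of x] Sigma_hat_T(4)[of y] g by (simp add: z ln_det_T_def good_def)
    finally show ?case .
  qed
  have "integrable (D.\<nu> \<Otimes>\<^sub>M D.\<nu>) (\<lambda>z. ?K (?TT z))"
    using integrable_cong_AE[OF mT borel_measurable_integrable[OF ig] AE] ig by blast
  then show "integrable (law \<Otimes>\<^sub>M law) ?K"
    unfolding pair by (subst integrable_distr_eq[OF mTT meas])
  have "(\<integral>z. ?K z \<partial>(law \<Otimes>\<^sub>M law)) = (\<integral>z. ?K (?TT z) \<partial>(D.\<nu> \<Otimes>\<^sub>M D.\<nu>))"
    unfolding pair by (rule integral_distr[OF mTT meas])
  also have "\<dots> = integral\<^sup>L (D.\<nu> \<Otimes>\<^sub>M D.\<nu>) ?g"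
    by (rule integral_cong_AE[OF mT borel_measurable_integrable[OF ig] AE])
  also have "\<dots> = (\<integral>Y. ln (lpdf Y) \<partial>law) + ((\<integral>w. ln_det_T w \<partial>D.\<nu>) + real n * (\<integral>z. loss vM (fst z) (snd z) \<partial>(D.\<nu> \<Otimes>\<^sub>M D.\<nu>))) / 2"
    using i1 i2 lo(1) by (simp add: ln_lpdf_expectation)
  finally have *: "(\<integral>z. ?K z \<partial>(law \<Otimes>\<^sub>M law)) = (\<integral>Y. ln (lpdf Y) \<partial>law) + ((\<integral>w. ln_det_T w \<partial>D.\<nu>) + real n * (\<integral>z. loss vM (fst z) (snd z) \<partial>(D.\<nu> \<Otimes>\<^sub>M D.\<nu>))) / 2" .
  show "2 * ((\<integral>z. ?K z \<partial>(law \<Otimes>\<^sub>M law)) - (\<integral>Y. ln (lpdf Y) \<partial>law)) = (\<integral>Y. zklic A J P d Y \<partial>law)"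
  proof -
    define c where "c = real p * (real n + real m) / (real n - real m - real p - 1)"
    have "E_const = real n * c" by (simp add: E_const_def c_def)
    then show ?thesis unfolding * zklic_expectation lo(2) c_def[symmetric] by (simp add: field_simps)
  qed
qed

end

subsection \<open>Unbiased estimators and multiplicative classes\<close>

text \<open>\<open>Z\<close> is the conditional expectation of \<open>\<delta>\<close>, so Jensen's inequality applies.\<close>

lemma estimator_variance_le:
  fixes Z \<delta> :: "'a \<Rightarrow> real"
  assumes M: "prob_space M" and sub: "subalgebra M N"
    and int: "integrable M Z" "integrable M \<delta>" and Z: "Z \<in> borel_measurable N"
    and eq: "\<And>E. E \<in> sets N \<Longrightarrow> (\<integral>x\<in>E. \<delta> x \<partial>M) = (\<integral>x\<in>E. Z x \<partial>M)"
  shows "estimator_variance M Z \<le> estimator_variance M \<delta>"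
proof (cases "estimator_variance M \<delta> = \<infinity>")
  case False
  interpret prob_space M by fact
  interpret finite_measure_subalgebra M N using sub by unfold_locales
  define c where "c = integral\<^sup>L M \<delta>"
  define q where "q x = (x - c)\<^sup>2" for x :: real
  have mean: "integral\<^sup>L M Z = c"
  proof -
    have "space M \<in> sets N" using sub sets.top[of N] by (simp add: subalgebra_def)
    from eq[OF this] show ?thesis using int by (simp add: c_def set_integral_space)
  qed
  have fin: "integrable M (\<lambda>x. q (\<delta> x))"
    using False int(2)[THEN borel_measurable_integrable] unfolding estimator_variance_def q_def c_def
    by (intro integrableI_nonneg) (auto simp: top.not_eq_extremum)
  have ce: "AE x in M. real_cond_exp M N \<delta> x = Z x"
    by (rule real_cond_exp_charact[OF eq int(2,1) Z])
  have convex: "convex_on UNIV q"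
    unfolding q_def by (rule convex_on_realI[where f'="\<lambda>x. 2 * (x - c)"]) (auto intro!: derivative_eq_intros)
  have qm: "q \<in> borel_measurable borel" unfolding q_def by measurable
  have le: "AE x in M. q (Z x) \<le> real_cond_exp M N (\<lambda>x. q (\<delta> x)) x"
    using real_cond_exp_jensens_inequality(2)[OF int(2) _ disjI2[OF disjI2[OF disjI2[OF refl]]] fin convex qm] ce by auto
  have iq: "integrable M (real_cond_exp M N (\<lambda>x. q (\<delta> x)))" and
    Eq: "integral\<^sup>L M (real_cond_exp M N (\<lambda>x. q (\<delta> x))) = (\<integral>x. q (\<delta> x) \<partial>M)"
    using real_cond_exp_int[OF fin] by auto
  have "estimator_variance M Z = (\<integral>\<^sup>+x. ennreal (q (Z x)) \<partial>M)"
    unfolding estimator_variance_def mean q_def ..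
  also have "\<dots> \<le> (\<integral>\<^sup>+x. ennreal (real_cond_exp M N (\<lambda>x. q (\<delta> x)) x) \<partial>M)"
    by (rule nn_integral_mono_AE) (use le in eventually_elim, auto intro: ennreal_leI)
  also have "\<dots> = ennreal (\<integral>x. q (\<delta> x) \<partial>M)"
    unfolding Eq[symmetric] by (rule nn_integral_eq_integral[OF iq]) (use le in eventually_elim, auto simp: q_def intro: order_trans[rotated])
  also have "\<dots> = (\<integral>\<^sup>+x. ennreal (q (\<delta> x)) \<partial>M)"
    by (rule nn_integral_eq_integral[OF fin, symmetric]) (simp add: q_def)
  also have "\<dots> = estimator_variance M \<delta>" unfolding estimator_variance_def q_def c_def ..
  finally show ?thesis .
qed simp

section \<open>Orthogonality to a multiplicative class and to the sigma-algebra it generates\<close>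

locale mult_class =
  fixes \<Omega> :: "'a set" and F :: "('a \<Rightarrow> real) set"
  assumes one: "(\<lambda>_. 1) \<in> F"
    and mult: "f \<in> F \<Longrightarrow> g \<in> F \<Longrightarrow> (\<lambda>x. f x * g x) \<in> F"
    and range: "f \<in> F \<Longrightarrow> x \<in> \<Omega> \<Longrightarrow> 0 \<le> f x \<and> f x \<le> 1"
begin

definition gens :: "'a set set" where
  "gens = {{x \<in> \<Omega>. a < f x} | f a. f \<in> F}"

text \<open>Finite intersections of generators, the pi-system for Dynkin's theorem.\<close>

inductive_set cyls :: "'a set set" where
  cyls_space: "\<Omega> \<in> cyls"
| cyls_Int: "E \<in> cyls \<Longrightarrow> f \<in> F \<Longrightarrow> E \<inter> {x \<in> \<Omega>. a < f x} \<in> cyls"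

lemma cyls_subset: "cyls \<subseteq> Pow \<Omega>"
proof
  fix E assume "E \<in> cyls" then show "E \<in> Pow \<Omega>" by induction auto
qed

lemma Int_stable_cyls: "Int_stable cyls"
proof (rule Int_stableI)
  fix E E' assume E: "E \<in> cyls" and "E' \<in> cyls"
  from this(2) show "E \<inter> E' \<in> cyls"
  proof induction
    case cyls_space
    then show ?case using E cyls_subset by (simp add: Int_absorb2 subset_iff Pow_def)
  next
    case (cyls_Int E' f a)
    from cyls.cyls_Int[OF this(3,2), of a] show ?case by (simp add: Int_assoc)
  qed
qed

lemma sigma_gens_cyls: "sigma_sets \<Omega> gens \<subseteq> sigma_sets \<Omega> cyls"
proof (rule sigma_sets_mono', rule subsetI)
  fix E assume "E \<in> gens"
  then obtain f a where E: "E = {x \<in> \<Omega>. a < f x}" "f \<in> F" by (auto simp: gens_def)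
  from cyls.cyls_Int[OF cyls.cyls_space E(2), of a] show "E \<in> cyls" by (simp add: E(1) Int_def)
qed

lemma measurable_gens: "f \<in> F \<Longrightarrow> f \<in> borel_measurable (sigma \<Omega> gens)"
proof (rule borel_measurableI_greater)
  fix a assume "f \<in> F"
  then have "{x \<in> \<Omega>. a < f x} \<in> gens" unfolding gens_def by blast
  moreover have "gens \<subseteq> Pow \<Omega>" by (auto simp: gens_def)
  ultimately show "{x \<in> space (sigma \<Omega> gens). a < f x} \<in> sets (sigma \<Omega> gens)"
    by (simp add: space_measure_of)
qed

context
  fixes M :: "'a measure" and h :: "'a \<Rightarrow> real"
  assumes space_M: "space M = \<Omega>"
    and F_meas: "\<And>f. f \<in> F \<Longrightarrow> f \<in> borel_measurable M"
    and h: "integrable M h"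
    and orth: "\<And>f. f \<in> F \<Longrightarrow> (\<integral>x. f x * h x \<partial>M) = 0"
begin

text \<open>The integral has to vanish for g times every member of the class. This makes the
  property stable under multiplication by members and hence under polynomials in them.\<close>

definition ann :: "('a \<Rightarrow> real) \<Rightarrow> bool" where
  "ann g \<longleftrightarrow> g \<in> borel_measurable M \<and> (\<exists>C. \<forall>x\<in>\<Omega>. \<bar>g x\<bar> \<le> C) \<and>
     (\<forall>f\<in>F. (\<integral>x. g x * (f x * h x) \<partial>M) = 0)"

lemma ann_integrable:
  assumes "ann g" "f \<in> F" shows "integrable M (\<lambda>x. g x * (f x * h x))"
proof -
  obtain C where C: "\<And>x. x \<in> \<Omega> \<Longrightarrow> \<bar>g x\<bar> \<le> C" and g: "g \<in> borel_measurable M" using assms(1) unfolding ann_def by blast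
  show ?thesis
  proof (rule Bochner_Integration.integrable_bound[OF integrable_mult_right[OF h, of C]])
    show "(\<lambda>x. g x * (f x * h x)) \<in> borel_measurable M"
      using g F_meas[OF assms(2)] h by (auto intro!: borel_measurable_times)
    have "\<bar>g x * (f x * h x)\<bar> \<le> \<bar>C * h x\<bar>" if "x \<in> \<Omega>" for x
    proof -
      have "\<bar>g x\<bar> * (\<bar>f x\<bar> * \<bar>h x\<bar>) \<le> C * (1 * \<bar>h x\<bar>)"
        using C[OF that] range[OF assms(2) that] by (intro mult_mono) auto
      also have "\<dots> \<le> \<bar>C\<bar> * \<bar>h x\<bar>" by (simp add: mult_right_mono)
      finally show ?thesis by (simp add: abs_mult)
    qed
    then show "AE x in M. norm (g x * (f x * h x)) \<le> norm (C * h x)" by (intro AE_I2) (simp add: space_M)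
  qed
qed

lemma ann_1: "ann (\<lambda>_. 1)"
  unfolding ann_def using orth by (auto intro: exI[of _ 1])

text \<open>Dominated convergence with a multiple of |h| as majorant; the approximations below have
  to keep a uniform bound for this reason.\<close>

lemma ann_lim:
  assumes g: "\<And>k. ann (g k)" "\<And>k x. x \<in> \<Omega> \<Longrightarrow> \<bar>g k x\<bar> \<le> C"
    and lim: "\<And>x. x \<in> \<Omega> \<Longrightarrow> (\<lambda>k. g k x) \<longlonglongrightarrow> g' x"
  shows "ann g'"
  unfolding ann_def
proof (intro conjI ballI)
  have gm: "g k \<in> borel_measurable M" for k using g(1) unfolding ann_def by blast
  show g': "g' \<in> borel_measurable M"
    by (rule borel_measurable_LIMSEQ_real[of M g, OF _ gm]) (simp add: lim space_M)
  show "\<exists>C. \<forall>x\<in>\<Omega>. \<bar>g' x\<bar> \<le> C"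
  proof (intro exI ballI)
    fix x assume x: "x \<in> \<Omega>"
    show "\<bar>g' x\<bar> \<le> C" by (rule tendsto_upperbound[OF tendsto_rabs[OF lim[OF x]]]) (use g(2)[OF x] in auto)
  qed
  fix f assume f: "f \<in> F"
  have fm: "f \<in> borel_measurable M" by (rule F_meas[OF f])
  have "(\<lambda>k. \<integral>x. g k x * (f x * h x) \<partial>M) \<longlonglongrightarrow> (\<integral>x. g' x * (f x * h x) \<partial>M)"
  proof (rule integral_dominated_convergence)
    show "integrable M (\<lambda>x. \<bar>C\<bar> * \<bar>h x\<bar>)" using h by simp
    show "AE x in M. (\<lambda>k. g k x * (f x * h x)) \<longlonglongrightarrow> g' x * (f x * h x)"
      by (intro AE_I2 tendsto_mult_right lim) (simp add: space_M)
    have "\<bar>g k x * (f x * h x)\<bar> \<le> \<bar>C\<bar> * \<bar>h x\<bar>" if "x \<in> \<Omega>" for x k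
    proof -
      have "\<bar>g k x\<bar> * (\<bar>f x\<bar> * \<bar>h x\<bar>) \<le> \<bar>C\<bar> * (1 * \<bar>h x\<bar>)"
        using g(2)[OF that, of k] range[OF f that] by (intro mult_mono) auto
      then show ?thesis by (simp add: abs_mult)
    qed
    then show "AE x in M. norm (g k x * (f x * h x)) \<le> \<bar>C\<bar> * \<bar>h x\<bar>" for k by (intro AE_I2) (simp add: space_M)
  qed (use g' gm fm h in auto)
  moreover have "(\<integral>x. g k x * (f x * h x) \<partial>M) = 0" for k using g(1) f unfolding ann_def by blast
  ultimately show "(\<integral>x. g' x * (f x * h x) \<partial>M) = 0" using LIMSEQ_unique[OF _ tendsto_const] by simp
qed

lemma ann_lincomb:
  assumes "ann g" "ann g'" shows "ann (\<lambda>x. c * g x + c' * g' x)"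
  unfolding ann_def
proof (intro conjI ballI)
  show "(\<lambda>x. c * g x + c' * g' x) \<in> borel_measurable M" using assms unfolding ann_def by auto
  obtain C C' where C: "\<And>x. x \<in> \<Omega> \<Longrightarrow> \<bar>g x\<bar> \<le> C" "\<And>x. x \<in> \<Omega> \<Longrightarrow> \<bar>g' x\<bar> \<le> C'"
    using assms unfolding ann_def by blast
  have "\<bar>c * g x + c' * g' x\<bar> \<le> \<bar>c\<bar> * C + \<bar>c'\<bar> * C'" if "x \<in> \<Omega>" for x
    using abs_triangle_ineq[of "c * g x" "c' * g' x"] mult_left_mono[OF C(1)[OF that], of "\<bar>c\<bar>"] mult_left_mono[OF C(2)[OF that], of "\<bar>c'\<bar>"]
    by (simp add: abs_mult)
  then show "\<exists>C. \<forall>x\<in>\<Omega>. \<bar>c * g x + c' * g' x\<bar> \<le> C" by blast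
  fix f assume f: "f \<in> F"
  have "(\<integral>x. (c * g x + c' * g' x) * (f x * h x) \<partial>M) = (\<integral>x. c * (g x * (f x * h x)) + c' * (g' x * (f x * h x)) \<partial>M)"
    by (simp add: algebra_simps)
  also have "\<dots> = 0"
    using ann_integrable[OF assms(1) f] ann_integrable[OF assms(2) f] assms f unfolding ann_def by simp
  finally show "(\<integral>x. (c * g x + c' * g' x) * (f x * h x) \<partial>M) = 0" .
qed

lemma ann_mult:
  assumes "ann g" "k \<in> F" shows "ann (\<lambda>x. g x * k x)"
  unfolding ann_def
proof (intro conjI ballI)
  show "(\<lambda>x. g x * k x) \<in> borel_measurable M" using assms F_meas unfolding ann_def by auto
  obtain C where C: "\<And>x. x \<in> \<Omega> \<Longrightarrow> \<bar>g x\<bar> \<le> C" using assms unfolding ann_def by blast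
  have "\<bar>g x * k x\<bar> \<le> C" if "x \<in> \<Omega>" for x
    using mult_mono[OF C[OF that], of "\<bar>k x\<bar>" 1] range[OF assms(2) that] C[OF that] by (auto simp: abs_mult)
  then show "\<exists>C. \<forall>x\<in>\<Omega>. \<bar>g x * k x\<bar> \<le> C" by blast
  fix f assume f: "f \<in> F"
  have "\<forall>f\<in>F. (\<integral>x. g x * (f x * h x) \<partial>M) = 0" using assms(1) unfolding ann_def by blast
  from bspec[OF this mult[OF assms(2) f]] have "(\<integral>x. g x * ((k x * f x) * h x) \<partial>M) = 0" .
  then show "(\<integral>x. g x * k x * (f x * h x) \<partial>M) = 0" by (simp add: mult.assoc)
qed

lemma ann_mult_1m:
  assumes "ann g" "k \<in> F" shows "ann (\<lambda>x. g x * (1 - k x))"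
  using ann_lincomb[OF assms(1) ann_mult[OF assms], of 1 "-1"] by (simp add: algebra_simps)

text \<open>Bernstein polynomials combine products of powers of k and 1 - k, and multiplication by
  either factor preserves annihilators.\<close>

lemma ann_Bernstein:
  assumes "ann g" "k \<in> F" shows "ann (\<lambda>x. g x * (\<Sum>i\<in>X. c i * Bernstein N i (k x)))"
proof -
  have a1: "ann (\<lambda>x. g x * (1 - k x) ^ j)" for j
  proof (induction j)
    case (Suc j) from ann_mult_1m[OF this assms(2)] show ?case by (simp add: mult_ac)
  qed (use assms in simp)
  have a2: "ann (\<lambda>x. g x * (1 - k x) ^ j * k x ^ i)" for i j
  proof (induction i)
    case (Suc i) from ann_mult[OF this assms(2)] show ?case by (simp add: mult_ac)
  qed (use a1 in simp)
  have "finite X \<Longrightarrow> ann (\<lambda>x. g x * (\<Sum>i\<in>X. c i * Bernstein N i (k x)))"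
  proof (induction X rule: finite_induct)
    case empty
    show ?case using ann_lincomb[OF assms(1) assms(1), of 0 0] by simp
  next
    case (insert i X)
    have "ann (\<lambda>x. c i * real (N choose i) * (g x * (1 - k x) ^ (N - i) * k x ^ i) + 1 * (g x * (\<Sum>i\<in>X. c i * Bernstein N i (k x))))"
      by (rule ann_lincomb[OF a2 insert.IH])
    then show ?case using insert.hyps by (simp add: Bernstein_def algebra_simps)
  qed
  moreover have "ann (\<lambda>x. g x * (\<Sum>i\<in>X. c i * Bernstein N i (k x)))" if "infinite X"
    using ann_lincomb[OF assms(1) assms(1), of 0 0] that by simp
  ultimately show ?thesis by blast
qed

text \<open>The values of k lie in the unit interval, where the Bernstein approximations converge
  uniformly and are thus uniformly bounded.\<close>

lemma ann_continuous:
  assumes g: "ann g" "k \<in> F" and \<phi>: "continuous_on {0..1} \<phi>" "\<And>t. t \<in> {0..1} \<Longrightarrow> \<bar>\<phi> t\<bar> \<le> 1"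
  shows "ann (\<lambda>x. g x * \<phi> (k x))"
proof -
  obtain C where C: "\<And>x. x \<in> \<Omega> \<Longrightarrow> \<bar>g x\<bar> \<le> C" using g unfolding ann_def by blast
  have "\<exists>N. \<forall>t\<in>{0..1}. \<bar>\<phi> t - (\<Sum>i\<le>N. \<phi> (real i / real N) * Bernstein N i t)\<bar> < 1 / real (Suc r)" for r
  proof -
    obtain N where "\<forall>n x. N \<le> n \<and> x \<in> {0..1} \<longrightarrow> \<bar>\<phi> x - (\<Sum>k\<le>n. \<phi> (real k / real n) * Bernstein n k x)\<bar> < 1 / real (Suc r)"
      using Bernstein_Weierstrass[OF \<phi>(1), of "1 / real (Suc r)"] by auto
    then show ?thesis by (intro exI[of _ N]) blast
  qed
  then obtain N where N: "\<And>r t. t \<in> {0..1} \<Longrightarrow> \<bar>\<phi> t - (\<Sum>i\<le>N r. \<phi> (real i / real (N r)) * Bernstein (N r) i t)\<bar> < 1 / real (Suc r)"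
    by metis
  define b where "b r t = (\<Sum>i\<le>N r. \<phi> (real i / real (N r)) * Bernstein (N r) i t)" for r t
  have b: "\<bar>\<phi> t - b r t\<bar> < 1 / real (Suc r)" if "t \<in> {0..1}" for r t using N[OF that] by (simp add: b_def)
  have kx: "k x \<in> {0..1}" if "x \<in> \<Omega>" for x using range[OF g(2) that] by simp
  show ?thesis
  proof (rule ann_lim)
    show "ann (\<lambda>x. g x * b r (k x))" for r unfolding b_def by (rule ann_Bernstein[OF g])
    show "\<bar>g x * b r (k x)\<bar> \<le> C * 2" if "x \<in> \<Omega>" for r x
    proof -
      have "1 / real (Suc r) \<le> 1" by simp
      then have "\<bar>b r (k x)\<bar> \<le> 2" using b[OF kx[OF that], of r] \<phi>(2)[OF kx[OF that]] by linarith
      then show ?thesis using C[OF that] by (simp add: abs_mult mult_mono)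
    qed
    show "(\<lambda>r. g x * b r (k x)) \<longlonglongrightarrow> g x * \<phi> (k x)" if "x \<in> \<Omega>" for x
    proof (intro tendsto_mult_left)
      have "(\<lambda>r. b r (k x) - \<phi> (k x)) \<longlonglongrightarrow> 0"
      proof (rule tendsto_rabs_zero_cancel, rule tendsto_sandwich[OF _ _ tendsto_const LIMSEQ_inverse_real_of_nat])
        show "\<forall>\<^sub>F r in sequentially. \<bar>b r (k x) - \<phi> (k x)\<bar> \<le> inverse (real (Suc r))"
          using b[OF kx[OF that]] by (intro always_eventually allI) (simp add: abs_minus_commute inverse_eq_divide less_imp_le)
      qed simp
      from tendsto_add[OF this tendsto_const[of "\<phi> (k x)"]] show "(\<lambda>r. b r (k x)) \<longlonglongrightarrow> \<phi> (k x)" by simp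
    qed
  qed
qed

text \<open>The ramps min 1 (max 0 (r (t - a))) are continuous, take values in the unit interval and
  converge to the indicator of a < t.\<close>

lemma ann_indicator:
  assumes g: "ann g" "k \<in> F" shows "ann (\<lambda>x. g x * (if a < k x then 1 else 0))"
proof -
  obtain C where C: "\<And>x. x \<in> \<Omega> \<Longrightarrow> \<bar>g x\<bar> \<le> C" using g unfolding ann_def by blast
  define \<phi> where "\<phi> r t = min 1 (max 0 (real r * (t - a)))" for r :: nat and t :: real
  have \<phi>1: "\<bar>\<phi> r t\<bar> \<le> 1" for r t by (auto simp: \<phi>_def)
  show ?thesis
  proof (rule ann_lim)
    show "ann (\<lambda>x. g x * \<phi> r (k x))" for r
      unfolding \<phi>_def by (rule ann_continuous[OF g]) (auto intro!: continuous_intros)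
    show "\<bar>g x * \<phi> r (k x)\<bar> \<le> C" if "x \<in> \<Omega>" for r x
      using mult_mono[OF C[OF that] \<phi>1[of r "k x"]] C[OF that] by (auto simp: abs_mult)
    show "(\<lambda>r. g x * \<phi> r (k x)) \<longlonglongrightarrow> g x * (if a < k x then 1 else 0)" for x
    proof (intro tendsto_mult_left)
      show "(\<lambda>r. \<phi> r (k x)) \<longlonglongrightarrow> (if a < k x then 1 else 0)"
      proof (cases "a < k x")
        case True
        obtain R :: nat where R: "1 < real R * (k x - a)" using reals_Archimedean3[of "k x - a"] True by auto
        have "\<phi> r (k x) = 1" if "R \<le> r" for r
        proof -
          have "real R * (k x - a) \<le> real r * (k x - a)" using that True by (intro mult_right_mono) auto
          then show ?thesis using R by (simp add: \<phi>_def)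
        qed
        then show ?thesis using True by (intro tendsto_eventually) (auto simp: eventually_sequentially)
      next
        case False
        have "real r * (k x - a) \<le> 0" for r :: nat using False by (intro mult_nonneg_nonpos) auto
        then have "\<phi> r (k x) = 0" for r by (simp add: \<phi>_def max_absorb1)
        then show ?thesis using False by simp
      qed
    qed
  qed
qed

lemma ann_cyls: "E \<in> cyls \<Longrightarrow> ann (indicator E)"
proof (induction rule: cyls.induct)
  case cyls_space
  show ?case by (rule ann_lim[where g="\<lambda>_ _. 1" and C=1]) (auto intro: ann_1)
next
  case (cyls_Int E f a)
  from ann_indicator[OF cyls_Int.IH cyls_Int.hyps(2), of a] have *: "ann (\<lambda>x. indicator E x * (if a < f x then 1 else 0))" .
  show ?case
    by (rule ann_lim[where g="\<lambda>_. \<lambda>x. indicator E x * (if a < f x then 1 else 0)" and C=1])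
      (use * in \<open>auto simp: indicator_def\<close>)
qed

lemma sigma_gens_sets: "sigma_sets \<Omega> gens \<subseteq> sets M"
proof -
  have "gens \<subseteq> sets M"
  proof
    fix E assume "E \<in> gens"
    then obtain f a where "E = {x \<in> \<Omega>. a < f x}" "f \<in> F" by (auto simp: gens_def)
    then show "E \<in> sets M" using F_meas by (simp add: space_M[symmetric])
  qed
  then show ?thesis using sets.sigma_sets_subset[of gens M] by (simp add: space_M)
qed

lemma cyls_sets: "cyls \<subseteq> sets M"
proof
  fix E assume "E \<in> cyls"
  then show "E \<in> sets M"
    by induction (use F_meas in \<open>auto simp: space_M[symmetric]\<close>)
qed

text \<open>Dynkin's theorem, starting from the indicators of the pi-system. Complements are covered
  because h has integral 0, the constant 1 being in the class.\<close>

lemma orth_sigma: "E \<in> sigma_sets \<Omega> gens \<Longrightarrow> (\<integral>x\<in>E. h x \<partial>M) = 0"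
proof -
  assume "E \<in> sigma_sets \<Omega> gens"
  then have "E \<in> sigma_sets \<Omega> cyls" using sigma_gens_cyls by blast
  from Int_stable_cyls cyls_subset this show ?thesis
  proof (induction rule: sigma_sets_induct_disjoint)
    case (basic E)
    then show ?case using ann_cyls[OF basic] one unfolding ann_def set_lebesgue_integral_def by fastforce
  next
    case empty
    show ?case by (simp add: set_lebesgue_integral_def)
  next
    case (compl E)
    have E: "E \<in> sets M" using compl(1) sets.sigma_sets_subset[OF cyls_sets] by (auto simp: space_M)
    have 0: "integral\<^sup>L M h = 0" using orth[OF one] by simp
    have i: "set_integrable M E h" "set_integrable M (\<Omega> - E) h"
      using h E by (auto simp: set_integrable_def space_M[symmetric] intro!: integrable_mult_indicator[of _ M h, simplified])
    have "(\<integral>x\<in>E \<union> (\<Omega> - E). h x \<partial>M) = (\<integral>x\<in>E. h x \<partial>M) + (\<integral>x\<in>\<Omega> - E. h x \<partial>M)"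
      by (rule set_integral_Un[OF _ i]) auto
    moreover have "E \<union> (\<Omega> - E) = space M" using sets.sets_into_space[OF E] by (auto simp: space_M)
    ultimately show ?case using compl(2) 0 h by (simp add: set_integral_space)
  next
    case (union X)
    have X: "X i \<in> sets M" for i using union(2) sets.sigma_sets_subset[OF cyls_sets] by (auto simp: space_M)
    have "set_integrable M (\<Union>i. X i) h"
      using h X unfolding set_integrable_def by (intro integrable_mult_indicator) auto
    from lebesgue_integral_countable_add[OF X _ this] union(1)
    have "(\<integral>x\<in>(\<Union>i. X i). h x \<partial>M) = (\<Sum>i. (\<integral>x\<in>X i. h x \<partial>M))" by (simp add: disjoint_family_on_def)
    then show ?case using union(3) by simp
  qed
qed

end

end

section \<open>Positive definite and semidefinite matrices\<close>

lemma quad_form_eq: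
  fixes K :: "real mat"
  assumes "K \<in> carrier_mat p p" "v \<in> carrier_vec p"
  shows "v \<bullet> (K *\<^sub>v v) = (\<Sum>j<p. \<Sum>l<p. K $$ (j, l) * v $ j * v $ l)"
  using assms by (simp add: scalar_prod_def atLeast0LessThan sum_distrib_left mult_ac)

lemma pos_def_inv:
  assumes S: "pos_def_mat p S"
  shows "pos_def_mat p (inv_mat S)" "inv_mat (inv_mat S) = S" "0 < Determinant.det S"
    "S * inv_mat S = 1\<^sub>m p" "inv_mat S * S = 1\<^sub>m p"
proof -
  have Sc: "S \<in> carrier_mat p p" "transpose_mat S = S" and
    pos: "\<And>v. v \<in> carrier_vec p \<Longrightarrow> v \<noteq> 0\<^sub>v p \<Longrightarrow> 0 < v \<bullet> (S *\<^sub>v v)"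
    using S unfolding pos_def_mat_def by blast+
  obtain L where "lower_factor p S L" using pos_def_lower_factor[OF S] .
  then show d: "0 < Determinant.det S" by (rule det_S_pos)
  then have d': "Determinant.det S \<noteq> 0" by simp
  show SI: "S * inv_mat S = 1\<^sub>m p" and IS: "inv_mat S * S = 1\<^sub>m p" by (rule inv_mat_right[OF Sc(1) d'])+
  have Ic: "inv_mat S \<in> carrier_mat p p" using Sc(1) by simp
  show "inv_mat (inv_mat S) = S" by (rule inv_mat_unique(1)[OF Ic Sc(1) IS])
  have Isym: "transpose_mat (inv_mat S) = inv_mat S" by (rule inv_mat_sym[OF Sc d'])
  show "pos_def_mat p (inv_mat S)"
    unfolding pos_def_mat_def
  proof (intro conjI ballI impI Ic Isym)
    fix v :: "real Matrix.vec" assume v: "v \<in> carrier_vec p" "v \<noteq> 0\<^sub>v p"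
    define w where "w = inv_mat S *\<^sub>v v"
    have w: "w \<in> carrier_vec p" using Ic v by (simp add: w_def)
    have Sw: "S *\<^sub>v w = v"
      unfolding w_def assoc_mult_mat_vec[OF Sc(1) Ic v(1), symmetric] SI using v by simp
    have "w \<noteq> 0\<^sub>v p" using Sw v Sc(1) by auto
    from pos[OF w this] show "0 < v \<bullet> (inv_mat S *\<^sub>v v)"
      unfolding Sw w_def[symmetric] using comm_scalar_prod[OF w v(1)] by simp
  qed
qed

text \<open>The precision matrices allowed in tilts: added to an inverse covariance they leave it
  positive definite, and matrices of rank one are included.\<close>

definition psd :: "nat \<Rightarrow> real mat \<Rightarrow> bool" where
  "psd p K \<longleftrightarrow> K \<in> carrier_mat p p \<and> transpose_mat K = K \<and> (\<forall>v\<in>carrier_vec p. 0 \<le> v \<bullet> (K *\<^sub>v v))"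

lemma add_quad_form:
  fixes K K' :: "real mat"
  assumes "K \<in> carrier_mat p p" "K' \<in> carrier_mat p p" "v \<in> carrier_vec p"
  shows "v \<bullet> ((K + K') *\<^sub>v v) = v \<bullet> (K *\<^sub>v v) + v \<bullet> (K' *\<^sub>v v)"
  unfolding add_mult_distrib_mat_vec[OF assms] using assms by (intro scalar_prod_add_distrib[of _ p]) auto

lemma pos_def_add_psd:
  assumes "pos_def_mat p K" "psd p K'" shows "pos_def_mat p (K + K')"
  using assms add_quad_form[of K p K'] transpose_add[of K p p K'] unfolding pos_def_mat_def psd_def
  by (auto intro: add_pos_nonneg)

lemma psd_add:
  assumes "psd p K" "psd p K'" shows "psd p (K + K')"
  using assms add_quad_form[of K p K'] transpose_add[of K p p K'] unfolding psd_def by auto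

subsection \<open>The exponential family\<close>

definition expo :: "nat \<Rightarrow> nat \<Rightarrow> real mat \<Rightarrow> real mat \<Rightarrow> real \<Rightarrow> real mat \<Rightarrow> real" where
  "expo n p K N c Y = exp (- (\<Sum>a<n. \<Sum>j<p. \<Sum>l<p. K $$ (j, l) * Y $$ (a, j) * Y $$ (a, l)) / 2
     + (\<Sum>a<n. \<Sum>j<p. N $$ (a, j) * Y $$ (a, j)) + c)"

lemma expo_mult:
  assumes "K \<in> carrier_mat p p" "K' \<in> carrier_mat p p" "N \<in> carrier_mat n p" "N' \<in> carrier_mat n p"
  shows "expo n p K N c Y * expo n p K' N' c' Y = expo n p (K + K') (N + N') (c + c') Y"
proof -
  have "(\<Sum>a<n. \<Sum>j<p. \<Sum>l<p. (K + K') $$ (j, l) * Y $$ (a, j) * Y $$ (a, l))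
    = (\<Sum>a<n. \<Sum>j<p. \<Sum>l<p. K $$ (j, l) * Y $$ (a, j) * Y $$ (a, l)) + (\<Sum>a<n. \<Sum>j<p. \<Sum>l<p. K' $$ (j, l) * Y $$ (a, j) * Y $$ (a, l))"
    unfolding sum.distrib[symmetric] using carrier_matD[OF assms(2)] by (intro sum.cong refl) (simp add: distrib_right)
  moreover have "(\<Sum>a<n. \<Sum>j<p. (N + N') $$ (a, j) * Y $$ (a, j)) = (\<Sum>a<n. \<Sum>j<p. N $$ (a, j) * Y $$ (a, j)) + (\<Sum>a<n. \<Sum>j<p. N' $$ (a, j) * Y $$ (a, j))"
    unfolding sum.distrib[symmetric] using carrier_matD[OF assms(4)] by (intro sum.cong refl) (simp add: distrib_right)
  ultimately show ?thesis unfolding expo_def exp_add[symmetric] by (simp add: field_simps)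
qed

lemma measurable_expo: "expo n p K N c \<in> borel_measurable (lborel_mat n p)"
  unfolding expo_def
  by (intro borel_measurable_exp[THEN measurable_compose[rotated]] borel_measurable_add borel_measurable_sum
      borel_measurable_times borel_measurable_const borel_measurable_divide borel_measurable_uminus measurable_mat_entry) auto

lemma matnormal_pdf_expo:
  assumes M: "M \<in> carrier_mat n p" and S: "pos_def_mat p S"
  obtains c where "\<And>Y. Y \<in> carrier_mat n p \<Longrightarrow> matnormal_pdf M S Y = expo n p (inv_mat S) (M * inv_mat S) c Y"
proof
  define K where "K = inv_mat S"
  have Sc: "S \<in> carrier_mat p p" and K: "K \<in> carrier_mat p p" "transpose_mat K = K"
    using S pos_def_inv(1)[OF S] unfolding pos_def_mat_def K_def by blast+
  have sym: "K $$ (j, l) = K $$ (l, j)" if "j < p" "l < p" for j l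
    using arg_cong[OF K(2), of "\<lambda>X. X $$ (j, l)"] K(1) that by simp
  define q where "q = (\<Sum>a<n. \<Sum>j<p. \<Sum>l<p. M $$ (a, j) * K $$ (j, l) * M $$ (a, l))"
  define c where "c = - q / 2 - (real n * real p * ln (2 * pi) + real n * ln (Determinant.det S)) / 2"
  fix Y :: "real mat" assume Y: "Y \<in> carrier_mat n p"
  note ln = ln_matnormal_pdf[OF M Y Sc pos_def_inv(3)[OF S]]
  have MK: "(M * K) $$ (a, l) = (\<Sum>j<p. M $$ (a, j) * K $$ (j, l))" if "a < n" "l < p" for a l
    using that carrier_matD[OF M] carrier_matD[OF K(1)] by (simp add: scalar_prod_def atLeast0LessThan)
  have row: "(\<Sum>j<p. \<Sum>l<p. (Y $$ (a, j) - M $$ (a, j)) * K $$ (j, l) * (Y $$ (a, l) - M $$ (a, l)))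
      = (\<Sum>j<p. \<Sum>l<p. K $$ (j, l) * Y $$ (a, j) * Y $$ (a, l)) - 2 * (\<Sum>l<p. (M * K) $$ (a, l) * Y $$ (a, l))
        + (\<Sum>j<p. \<Sum>l<p. M $$ (a, j) * K $$ (j, l) * M $$ (a, l))" if a: "a < n" for a
  proof -
    have 1: "(\<Sum>l<p. (M * K) $$ (a, l) * Y $$ (a, l)) = (\<Sum>j<p. \<Sum>l<p. M $$ (a, j) * K $$ (j, l) * Y $$ (a, l))"
      by (subst sum.swap) (simp add: MK a sum_distrib_right)
    have 2: "(\<Sum>l<p. (M * K) $$ (a, l) * Y $$ (a, l)) = (\<Sum>j<p. \<Sum>l<p. Y $$ (a, j) * K $$ (j, l) * M $$ (a, l))"
      by (intro sum.cong refl) (simp add: MK a sum_distrib_right, intro sum.cong refl, simp add: sym)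
    have "(\<Sum>j<p. \<Sum>l<p. (Y $$ (a, j) - M $$ (a, j)) * K $$ (j, l) * (Y $$ (a, l) - M $$ (a, l)))
      = (\<Sum>j<p. \<Sum>l<p. K $$ (j, l) * Y $$ (a, j) * Y $$ (a, l)) - (\<Sum>j<p. \<Sum>l<p. M $$ (a, j) * K $$ (j, l) * Y $$ (a, l))
        - (\<Sum>j<p. \<Sum>l<p. Y $$ (a, j) * K $$ (j, l) * M $$ (a, l)) + (\<Sum>j<p. \<Sum>l<p. M $$ (a, j) * K $$ (j, l) * M $$ (a, l))"
      unfolding sum_subtractf[symmetric] sum.distrib[symmetric] by (intro sum.cong refl) (simp add: algebra_simps)
    then show ?thesis unfolding 1[symmetric] 2[symmetric] by simp
  qed
  have tot: "(\<Sum>a<n. \<Sum>j<p. \<Sum>l<p. (Y $$ (a, j) - M $$ (a, j)) * K $$ (j, l) * (Y $$ (a, l) - M $$ (a, l)))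
      = (\<Sum>a<n. \<Sum>j<p. \<Sum>l<p. K $$ (j, l) * Y $$ (a, j) * Y $$ (a, l)) - 2 * (\<Sum>a<n. \<Sum>l<p. (M * K) $$ (a, l) * Y $$ (a, l)) + q"
    unfolding q_def sum_distrib_left[of 2] sum_subtractf[symmetric] sum.distrib[symmetric]
    by (rule sum.cong[OF refl]) (simp add: row sum.distrib sum_subtractf sum_distrib_left[symmetric])
  have "ln (matnormal_pdf M S Y) = - (\<Sum>a<n. \<Sum>j<p. \<Sum>l<p. K $$ (j, l) * Y $$ (a, j) * Y $$ (a, l)) / 2
     + (\<Sum>a<n. \<Sum>j<p. (M * K) $$ (a, j) * Y $$ (a, j)) + c"
    unfolding ln(2) K_def[symmetric] tot c_def by (simp add: field_simps)
  then show "matnormal_pdf M S Y = expo n p (inv_mat S) (M * inv_mat S) c Y"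
    unfolding expo_def K_def[symmetric] using exp_ln[OF ln(1)] by simp
qed

text \<open>Tilting by a member of the exponential family moves the parameters within the model: the
  natural parameters \<open>\<Sigma>\<inverse>\<close> and \<open>M \<Sigma>\<inverse>\<close> are shifted.\<close>

lemma matnormal_tilt:
  assumes M: "M \<in> carrier_mat n p" and S: "pos_def_mat p S" and K: "psd p K" and N: "N \<in> carrier_mat n p"
  obtains S' C where "pos_def_mat p S'" "0 < C"
    "\<And>Y. Y \<in> carrier_mat n p \<Longrightarrow> matnormal_pdf M S Y * expo n p K N c Y = C * matnormal_pdf ((M * inv_mat S + N) * S') S' Y"
proof -
  note I = pos_def_inv(1)[OF S]
  note K1 = pos_def_add_psd[OF I K]
  define S' where "S' = inv_mat (inv_mat S + K)"
  have S': "pos_def_mat p S'" unfolding S'_def by (rule pos_def_inv(1)[OF K1])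
  have iS': "inv_mat S' = inv_mat S + K" unfolding S'_def by (rule pos_def_inv(2)[OF K1])
  have Kc: "K \<in> carrier_mat p p" and Ic: "inv_mat S \<in> carrier_mat p p" and Sc': "S' \<in> carrier_mat p p"
    using K I S' unfolding psd_def pos_def_mat_def by blast+
  have MI: "M * inv_mat S \<in> carrier_mat n p" using M Ic by simp
  have MN: "M * inv_mat S + N \<in> carrier_mat n p" using MI N by simp
  define M' where "M' = (M * inv_mat S + N) * S'"
  have M': "M' \<in> carrier_mat n p" unfolding M'_def using MN Sc' by simp
  have MK: "M' * inv_mat S' = M * inv_mat S + N"
    unfolding M'_def assoc_mult_mat[OF MN Sc' inv_mat_carrier[OF Sc']] pos_def_inv(4)[OF S'] by (rule right_mult_one_mat[OF MN])
  obtain c0 where c0: "\<And>Y. Y \<in> carrier_mat n p \<Longrightarrow> matnormal_pdf M S Y = expo n p (inv_mat S) (M * inv_mat S) c0 Y"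
    using matnormal_pdf_expo[OF M S] by blast
  obtain c1 where c1: "\<And>Y. Y \<in> carrier_mat n p \<Longrightarrow> matnormal_pdf M' S' Y = expo n p (inv_mat S') (M' * inv_mat S') c1 Y"
    using matnormal_pdf_expo[OF M' S'] by blast
  have "matnormal_pdf M S Y * expo n p K N c Y = exp (c0 + c - c1) * matnormal_pdf M' S' Y" if Y: "Y \<in> carrier_mat n p" for Y
  proof -
    have "matnormal_pdf M S Y * expo n p K N c Y = expo n p (inv_mat S + K) (M * inv_mat S + N) (c0 + c) Y"
      unfolding c0[OF Y] by (rule expo_mult[OF Ic Kc MI N])
    also have "\<dots> = exp (c0 + c - c1) * matnormal_pdf M' S' Y"
      unfolding c1[OF Y] MK unfolding iS' expo_def exp_add[symmetric] by (simp add: algebra_simps)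
    finally show ?thesis .
  qed
  then show ?thesis using that[OF S', of "exp (c0 + c - c1)"] unfolding M'_def by simp
qed

lemma matnormal_integral:
  assumes M: "M \<in> carrier_mat n p" and S: "pos_def_mat p S" and f: "f \<in> borel_measurable (lborel_mat n p)"
  shows "(\<integral>Y. f Y \<partial>matnormal M S) = (\<integral>Y. matnormal_pdf M S Y * f Y \<partial>lborel_mat n p)"
proof -
  have Sc: "S \<in> carrier_mat p p" using S unfolding pos_def_mat_def by blast
  have "AE Y in lborel_mat n p. 0 \<le> matnormal_pdf M S Y"
    using ln_matnormal_pdf(1)[OF M _ Sc pos_def_inv(3)[OF S]] by (intro AE_I2) (simp add: space_lborel_mat less_imp_le)
  from integral_density[OF f measurable_matnormal_pdf[OF M Sc] this] show ?thesis
    using carrier_matD[OF M] by (simp add: matnormal_def)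
qed

lemma sets_matnormal: "M \<in> carrier_mat n p \<Longrightarrow> sets (matnormal M S) = sets (lborel_mat n p)"
  and space_matnormal: "M \<in> carrier_mat n p \<Longrightarrow> space (matnormal M S) = carrier_mat n p"
  by (simp_all add: matnormal_def space_lborel_mat)

text \<open>The factor \<open>C\<close> can stay unspecified, since it will multiply an integral
  that vanishes.\<close>

lemma matnormal_tilt_integral:
  assumes M: "M \<in> carrier_mat n p" and S: "pos_def_mat p S" and K: "psd p K" and N: "N \<in> carrier_mat n p"
    and h: "h \<in> borel_measurable (lborel_mat n p)"
  obtains S' C where "pos_def_mat p S'"
    "(\<integral>Y. expo n p K N c Y * h Y \<partial>matnormal M S) = C * (\<integral>Y. h Y \<partial>matnormal ((M * inv_mat S + N) * S') S')"
proof -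
  obtain S' C where S': "pos_def_mat p S'" and
    eq: "\<And>Y. Y \<in> carrier_mat n p \<Longrightarrow> matnormal_pdf M S Y * expo n p K N c Y = C * matnormal_pdf ((M * inv_mat S + N) * S') S' Y"
    using matnormal_tilt[OF M S K N] by metis
  have c: "inv_mat S \<in> carrier_mat p p" "S' \<in> carrier_mat p p" using pos_def_inv(1)[OF S] S' unfolding pos_def_mat_def by blast+
  have M': "(M * inv_mat S + N) * S' \<in> carrier_mat n p" using M N c by (intro mult_carrier_mat[of _ n p _ p] add_carrier_mat)
  have "(\<integral>Y. expo n p K N c Y * h Y \<partial>matnormal M S) = (\<integral>Y. matnormal_pdf M S Y * (expo n p K N c Y * h Y) \<partial>lborel_mat n p)"
    using h measurable_expo by (intro matnormal_integral[OF M S] borel_measurable_times)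
  also have "\<dots> = (\<integral>Y. C * (matnormal_pdf ((M * inv_mat S + N) * S') S' Y * h Y) \<partial>lborel_mat n p)"
  proof (rule Bochner_Integration.integral_cong[OF refl])
    fix Y assume "Y \<in> space (lborel_mat n p)"
    then show "matnormal_pdf M S Y * (expo n p K N c Y * h Y) = C * (matnormal_pdf ((M * inv_mat S + N) * S') S' Y * h Y)"
      using eq[of Y] by (simp add: space_lborel_mat mult.assoc[symmetric])
  qed
  also have "\<dots> = C * (\<integral>Y. h Y \<partial>matnormal ((M * inv_mat S + N) * S') S')"
    unfolding matnormal_integral[OF M' S' h] by simp
  finally show ?thesis using that[OF S'] by blast
qed

text \<open>This is 2 u u^T; the 2 offsets the 1/2 in \<open>expo\<close>, so that the tilt is exp
  of minus |Y u|^2.\<close>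

definition rank1 :: "nat \<Rightarrow> (nat \<Rightarrow> real) \<Rightarrow> real mat" where
  "rank1 p u = Matrix.mat p p (\<lambda>(j, l). 2 * u j * u l)"

lemma rank1_carrier: "rank1 p u \<in> carrier_mat p p" by (simp add: rank1_def)

lemma two_one_sum: "j < p \<Longrightarrow> (\<Sum>l<p. (2 \<cdot>\<^sub>m 1\<^sub>m p) $$ (j, l) * x j * x l) = 2 * (x j)\<^sup>2"
  for x :: "nat \<Rightarrow> real"
proof -
  assume j: "j < p"
  have "(\<Sum>l<p. (2 \<cdot>\<^sub>m 1\<^sub>m p) $$ (j, l) * x j * x l) = (\<Sum>l<p. if l = j then 2 * (x j)\<^sup>2 else 0)"
    using j by (intro sum.cong refl) (auto simp: power2_eq_square)
  then show ?thesis using j by simp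
qed

lemma psd_rank1: "psd p (rank1 p u)"
proof -
  have "0 \<le> v \<bullet> (rank1 p u *\<^sub>v v)" if v: "v \<in> carrier_vec p" for v
  proof -
    have "v \<bullet> (rank1 p u *\<^sub>v v) = (\<Sum>j<p. \<Sum>l<p. 2 * ((u j * v $ j) * (u l * v $ l)))"
      unfolding quad_form_eq[OF rank1_carrier v] by (intro sum.cong refl) (simp add: rank1_def)
    also have "\<dots> = 2 * (\<Sum>j<p. u j * v $ j)\<^sup>2"
      unfolding power2_eq_square sum_product unfolding sum_distrib_left ..
    finally show ?thesis by simp
  qed
  then show ?thesis by (auto simp: psd_def rank1_def mult_ac intro!: eq_matI)
qed

lemma psd_two: "psd p (2 \<cdot>\<^sub>m 1\<^sub>m p)"
proof -
  have "0 \<le> v \<bullet> ((2 \<cdot>\<^sub>m 1\<^sub>m p) *\<^sub>v v)" if v: "v \<in> carrier_vec p" for v :: "real Matrix.vec"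
  proof -
    have "v \<bullet> ((2 \<cdot>\<^sub>m 1\<^sub>m p) *\<^sub>v v) = (\<Sum>j<p. \<Sum>l<p. (2 \<cdot>\<^sub>m 1\<^sub>m p) $$ (j, l) * v $ j * v $ l)"
      by (rule quad_form_eq[OF _ v]) simp
    also have "\<dots> = (\<Sum>j<p. 2 * (v $ j)\<^sup>2)" by (intro sum.cong refl two_one_sum) simp
    finally show ?thesis by (simp add: sum_nonneg)
  qed
  then show ?thesis by (auto simp: psd_def intro!: eq_matI)
qed

lemma expo_two: "expo n p (2 \<cdot>\<^sub>m 1\<^sub>m p) N c Y = exp (- (\<Sum>a<n. \<Sum>j<p. (Y $$ (a, j))\<^sup>2) + (\<Sum>a<n. \<Sum>j<p. N $$ (a, j) * Y $$ (a, j)) + c)"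
proof -
  have "(\<Sum>a<n. \<Sum>j<p. \<Sum>l<p. (2 \<cdot>\<^sub>m 1\<^sub>m p) $$ (j, l) * Y $$ (a, j) * Y $$ (a, l)) = 2 * (\<Sum>a<n. \<Sum>j<p. (Y $$ (a, j))\<^sup>2)"
    unfolding sum_distrib_left by (intro sum.cong refl two_one_sum[where x="\<lambda>j. Y $$ (_, j)"]) simp
  then show ?thesis by (simp add: expo_def)
qed

lemma expo_rank1: "expo n p (rank1 p u) (0\<^sub>m n p) 0 Y = exp (- (\<Sum>a<n. (\<Sum>j<p. u j * Y $$ (a, j))\<^sup>2))"
proof -
  have "(\<Sum>j<p. \<Sum>l<p. rank1 p u $$ (j, l) * Y $$ (a, j) * Y $$ (a, l)) = 2 * (\<Sum>j<p. u j * Y $$ (a, j))\<^sup>2" for a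
    by (simp add: rank1_def power2_eq_square sum_product sum_distrib_left mult_ac)
  then show ?thesis by (simp add: expo_def sum_distrib_left[symmetric])
qed

subsection \<open>Completeness and minimum variance\<close>

context design
begin

text \<open>A linear part of the form A_J eta keeps the tilted mean in the column space of A_J. The
  bound by 1 is the range condition of \<open>mult_class\<close>, and \<open>c\<close> gives the
  freedom to meet it.\<close>

definition tilts :: "(real mat \<Rightarrow> real) set" where
  "tilts = {expo n p K (AJ * \<eta>) c | K \<eta> c. psd p K \<and> \<eta> \<in> carrier_mat m p \<and>
     (\<forall>Y\<in>carrier_mat n p. expo n p K (AJ * \<eta>) c Y \<le> 1)}"

lemma AJ0: "AJ * 0\<^sub>m m p = 0\<^sub>m n p" using AJ by simp

lemma psd_0: "psd p (0\<^sub>m p p)"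
  by (auto simp: psd_def scalar_prod_def)

sublocale T: mult_class "carrier_mat n p" tilts
proof
  have "expo n p (0\<^sub>m p p) (AJ * 0\<^sub>m m p) 0 = (\<lambda>_. 1)" unfolding AJ0 by (simp add: expo_def fun_eq_iff)
  then show "(\<lambda>_. 1) \<in> tilts" unfolding tilts_def mem_Collect_eq
    by (intro exI[of _ "0\<^sub>m p p"] exI[of _ "0\<^sub>m m p"] exI[of _ 0] conjI psd_0) auto
next
  fix f g assume "f \<in> tilts" "g \<in> tilts"
  then obtain K \<eta> c K' \<eta>' c' where f: "f = expo n p K (AJ * \<eta>) c" "psd p K" "\<eta> \<in> carrier_mat m p" "\<forall>Y\<in>carrier_mat n p. f Y \<le> 1"
    and g: "g = expo n p K' (AJ * \<eta>') c'" "psd p K'" "\<eta>' \<in> carrier_mat m p" "\<forall>Y\<in>carrier_mat n p. g Y \<le> 1"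
    unfolding tilts_def by blast
  have Kc: "K \<in> carrier_mat p p" "K' \<in> carrier_mat p p" using f g unfolding psd_def by blast+
  have fg: "(\<lambda>x. f x * g x) = expo n p (K + K') (AJ * (\<eta> + \<eta>')) (c + c')"
    unfolding mult_add_distrib_mat[OF AJ f(3) g(3)] f(1) g(1)
    using expo_mult[OF Kc mult_carrier_mat[OF AJ f(3)] mult_carrier_mat[OF AJ g(3)]] by (simp add: fun_eq_iff)
  have "\<forall>Y\<in>carrier_mat n p. f Y * g Y \<le> 1"
    using f(4) g(4) by (auto simp: f(1) g(1) expo_def intro!: mult_le_one)
  then show "(\<lambda>x. f x * g x) \<in> tilts"
    unfolding tilts_def mem_Collect_eq
    by (intro exI[of _ "K + K'"] exI[of _ "\<eta> + \<eta>'"] exI[of _ "c + c'"] conjI fg psd_add f(2) g(2) add_carrier_mat g(3))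
      (simp add: fg[symmetric, THEN fun_cong])
next
  fix f and Y :: "real mat" assume "f \<in> tilts" "Y \<in> carrier_mat n p"
  then show "0 \<le> f Y \<and> f Y \<le> 1" by (auto simp: tilts_def) (simp add: expo_def)
qed

abbreviation tilt_algebra :: "real mat measure" where "tilt_algebra \<equiv> sigma (carrier_mat n p) T.gens"

lemma space_tilt_algebra: "space tilt_algebra = carrier_mat n p" by (simp add: space_measure_of_conv)

lemma tilts_ln:
  assumes "f \<in> tilts" "\<And>Y. Y \<in> carrier_mat n p \<Longrightarrow> f Y = exp (g Y)" shows "g \<in> borel_measurable tilt_algebra"
proof -
  have "(\<lambda>Y. ln (f Y)) \<in> borel_measurable tilt_algebra" using T.measurable_gens[OF assms(1)] by simp
  then show ?thesis by (rule measurable_cong[THEN iffD1, rotated]) (simp add: assms(2) space_tilt_algebra)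
qed

text \<open>The constant \<open>c\<close> completes the square, which keeps the tilt below \<open>1\<close>.\<close>

lemma AtY_tilt_algebra: "mat_meas tilt_algebra m p (\<lambda>Y. transpose_mat AJ * Y)"
proof (rule mat_measI)
  show "transpose_mat AJ * Y \<in> carrier_mat m p" if "Y \<in> space tilt_algebra" for Y using that AJ by (auto simp: space_tilt_algebra)
  fix i j assume ij: "i < m" "j < p"
  define \<eta> where "\<eta> = Matrix.mat m p (\<lambda>(i', j'). if i' = i \<and> j' = j then 1 else 0 :: real)"
  have \<eta>: "\<eta> \<in> carrier_mat m p" by (simp add: \<eta>_def)
  define N where "N = AJ * \<eta>"
  define c where "c = - (\<Sum>a<n. \<Sum>j<p. (N $$ (a, j))\<^sup>2 / 4)"
  have le: "- (\<Sum>a<n. \<Sum>j<p. (Y $$ (a, j))\<^sup>2) + (\<Sum>a<n. \<Sum>j<p. N $$ (a, j) * Y $$ (a, j)) + c \<le> 0" for Y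
  proof -
    have "- (\<Sum>a<n. \<Sum>j<p. (Y $$ (a, j))\<^sup>2) + (\<Sum>a<n. \<Sum>j<p. N $$ (a, j) * Y $$ (a, j)) + c
      = (\<Sum>a<n. \<Sum>j<p. - (Y $$ (a, j) - N $$ (a, j) / 2)\<^sup>2)"
      unfolding c_def sum_negf[symmetric] sum.distrib[symmetric]
      by (intro sum.cong refl) (simp add: power2_eq_square field_simps)
    also have "\<dots> \<le> 0" by (intro sum_nonpos) simp
    finally show ?thesis .
  qed
  have "expo n p (2 \<cdot>\<^sub>m 1\<^sub>m p) N c \<in> tilts"
    unfolding tilts_def mem_Collect_eq N_def
    by (intro exI[of _ "2 \<cdot>\<^sub>m 1\<^sub>m p"] exI[of _ \<eta>] exI[of _ c] conjI refl psd_two \<eta>)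
      (use le[unfolded N_def] in \<open>simp add: expo_two\<close>)
  from tilts_ln[OF this expo_two]
  have 1: "(\<lambda>Y. - (\<Sum>a<n. \<Sum>j<p. (Y $$ (a, j))\<^sup>2) + (\<Sum>a<n. \<Sum>j<p. N $$ (a, j) * Y $$ (a, j)) + c) \<in> borel_measurable tilt_algebra" .
  have "expo n p (2 \<cdot>\<^sub>m 1\<^sub>m p) (AJ * 0\<^sub>m m p) 0 \<in> tilts"
    unfolding tilts_def mem_Collect_eq
    by (intro exI[of _ "2 \<cdot>\<^sub>m 1\<^sub>m p"] exI[of _ "0\<^sub>m m p"] exI[of _ 0] conjI refl psd_two)
      (auto simp: AJ0 expo_two intro!: sum_nonneg)
  from tilts_ln[OF this expo_two]
  have 2: "(\<lambda>Y. - (\<Sum>a<n. \<Sum>j<p. (Y $$ (a, j))\<^sup>2)) \<in> borel_measurable tilt_algebra" by (simp add: AJ0)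
  have N: "N $$ (a, j') = (if j' = j then AJ $$ (a, i) else 0)" if "a < n" "j' < p" for a j'
  proof -
    have "N $$ (a, j') = (\<Sum>i'<m. AJ $$ (a, i') * (if i' = i \<and> j' = j then 1 else 0))"
      unfolding N_def using that carrier_matD[OF AJ] by (simp add: scalar_prod_def atLeast0LessThan \<eta>_def)
    also have "\<dots> = (\<Sum>i'<m. if i' = i then (if j' = j then AJ $$ (a, i) else 0) else 0)"
      by (intro sum.cong refl) auto
    finally show ?thesis using ij by simp
  qed
  \<comment> \<open>The difference of the logarithms of the two tilts leaves the linear part, which
    for this choice of eta is the (i, j) entry of A_J^T Y.\<close>
  have "(\<lambda>Y. (- (\<Sum>a<n. \<Sum>j<p. (Y $$ (a, j))\<^sup>2) + (\<Sum>a<n. \<Sum>j<p. N $$ (a, j) * Y $$ (a, j)) + c)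
    - - (\<Sum>a<n. \<Sum>j<p. (Y $$ (a, j))\<^sup>2) - c) \<in> borel_measurable tilt_algebra"
    by (intro borel_measurable_diff 1 2 borel_measurable_const)
  then show "(\<lambda>Y. (transpose_mat AJ * Y) $$ (i, j)) \<in> borel_measurable tilt_algebra"
  proof (rule measurable_cong[THEN iffD1, rotated])
    fix Y assume "Y \<in> space tilt_algebra"
    then have Y: "Y \<in> carrier_mat n p" by (simp add: space_tilt_algebra)
    have "(\<Sum>a<n. \<Sum>j'<p. N $$ (a, j') * Y $$ (a, j')) = (\<Sum>a<n. \<Sum>j'<p. if j' = j then AJ $$ (a, i) * Y $$ (a, j) else 0)"
      by (intro sum.cong refl) (auto simp: N)
    also have "\<dots> = (transpose_mat AJ * Y) $$ (i, j)"
      unfolding transpose_mult_index[OF AJ Y ij] using ij by simp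
    finally show "(- (\<Sum>a<n. \<Sum>j<p. (Y $$ (a, j))\<^sup>2) + (\<Sum>a<n. \<Sum>j<p. N $$ (a, j) * Y $$ (a, j)) + c)
      - - (\<Sum>a<n. \<Sum>j<p. (Y $$ (a, j))\<^sup>2) - c = (transpose_mat AJ * Y) $$ (i, j)" by simp
  qed
qed

text \<open>Tilts of rank one give |Y u|^2 for every u, and polarisation with e_j + e_l and e_j -
  e_l yields the entries of Y^T Y, the diagonal included.\<close>

lemma YtY_tilt_algebra: "mat_meas tilt_algebra p p (\<lambda>Y. transpose_mat Y * Y)"
proof (rule mat_measI)
  show "transpose_mat Y * Y \<in> carrier_mat p p" if "Y \<in> space tilt_algebra" for Y using that by (auto simp: space_tilt_algebra)
  have q: "(\<lambda>Y. \<Sum>a<n. (\<Sum>j<p. u j * Y $$ (a, j))\<^sup>2) \<in> borel_measurable tilt_algebra" for u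
  proof -
    have "expo n p (rank1 p u) (AJ * 0\<^sub>m m p) 0 \<in> tilts"
      unfolding tilts_def mem_Collect_eq
      by (intro exI[of _ "rank1 p u"] exI[of _ "0\<^sub>m m p"] exI[of _ 0] conjI refl psd_rank1)
        (auto simp: AJ0 expo_rank1 intro!: sum_nonneg)
    from tilts_ln[OF this, unfolded AJ0, OF expo_rank1] show ?thesis
      using borel_measurable_uminus_eq[of "\<lambda>Y. \<Sum>a<n. (\<Sum>j<p. u j * Y $$ (a, j))\<^sup>2" tilt_algebra] by simp
  qed
  fix j l assume jl: "j < p" "l < p"
  define u where "u s r = (if r = j then 1 else 0) + s * (if r = l then 1 else 0 :: real)" for s r
  have u: "(\<Sum>r<p. u s r * Y $$ (a, r)) = Y $$ (a, j) + s * Y $$ (a, l)" for s a and Y :: "real mat"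
  proof -
    have "(\<Sum>r<p. u s r * Y $$ (a, r)) = (\<Sum>r<p. if r = j then Y $$ (a, r) else 0) + s * (\<Sum>r<p. if r = l then Y $$ (a, r) else 0)"
      unfolding u_def sum_distrib_left sum.distrib[symmetric] by (intro sum.cong refl) (auto simp: distrib_right)
    then show ?thesis using jl by simp
  qed
  have "(\<lambda>Y. ((\<Sum>a<n. (\<Sum>r<p. u 1 r * Y $$ (a, r))\<^sup>2) - (\<Sum>a<n. (\<Sum>r<p. u (-1) r * Y $$ (a, r))\<^sup>2)) / 4) \<in> borel_measurable tilt_algebra"
    by (intro borel_measurable_divide borel_measurable_diff q borel_measurable_const)
  then show "(\<lambda>Y. (transpose_mat Y * Y) $$ (j, l)) \<in> borel_measurable tilt_algebra"
  proof (rule measurable_cong[THEN iffD1, rotated])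
    fix Y assume "Y \<in> space tilt_algebra"
    then have Y: "Y \<in> carrier_mat n p" by (simp add: space_tilt_algebra)
    have "(\<Sum>a<n. (\<Sum>r<p. u 1 r * Y $$ (a, r))\<^sup>2) - (\<Sum>a<n. (\<Sum>r<p. u (-1) r * Y $$ (a, r))\<^sup>2)
      = (\<Sum>a<n. 4 * (Y $$ (a, j) * Y $$ (a, l)))"
      unfolding u sum_subtractf[symmetric] by (intro sum.cong refl) (simp add: power2_eq_square algebra_simps)
    then show "((\<Sum>a<n. (\<Sum>r<p. u 1 r * Y $$ (a, r))\<^sup>2) - (\<Sum>a<n. (\<Sum>r<p. u (-1) r * Y $$ (a, r))\<^sup>2)) / 4 = (transpose_mat Y * Y) $$ (j, l)"
      unfolding transpose_mult_index[OF Y Y jl] by (simp add: sum_distrib_left[symmetric])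
  qed
qed

lemma X_of_tilt_algebra: "mat_meas tilt_algebra m p (\<lambda>Y. X_of A J P d Y)"
proof (rule mat_meas_cong)
  show "mat_meas tilt_algebra m p (\<lambda>Y. mat_diag m d * transpose_mat P * (transpose_mat AJ * Y))"
    using Pm(2) by (intro mat_meas_mult[where s=m] mat_meas_const AtY_tilt_algebra) auto
  fix Y assume "Y \<in> space tilt_algebra"
  then have Y: "Y \<in> carrier_mat n p" by (simp add: space_tilt_algebra)
  have W: "mat_diag m d * transpose_mat P \<in> carrier_mat m m" using mult_carrier_mat[OF mat_diag_dim Pm(2)] .
  have At: "transpose_mat AJ \<in> carrier_mat m n" using AJ by simp
  show "X_of A J P d Y = mat_diag m d * transpose_mat P * (transpose_mat AJ * Y)"
    unfolding X_of_def m_def[symmetric] by (rule assoc_mult_mat[OF W At Y])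
qed

text \<open>S_J is Y^T Y - (A_J^T Y)^T G (A_J^T Y), a function of the two statistics already shown
  to be measurable.\<close>

lemma S_of_tilt_algebra: "mat_meas tilt_algebra p p (\<lambda>Y. S_of A J Y)"
proof (rule mat_meas_cong)
  show "mat_meas tilt_algebra p p (\<lambda>Y. transpose_mat Y * Y - transpose_mat (transpose_mat AJ * Y) * G * (transpose_mat AJ * Y))"
    using G(2) by (intro mat_meas_minus YtY_tilt_algebra mat_meas_mult[where s=m] mat_meas_transpose AtY_tilt_algebra mat_meas_const)
  fix Y assume "Y \<in> space tilt_algebra"
  then have Y: "Y \<in> carrier_mat n p" by (simp add: space_tilt_algebra)
  have At: "transpose_mat AJ \<in> carrier_mat m n" and Yt: "transpose_mat Y \<in> carrier_mat p n" using AJ Y by auto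
  have AY: "transpose_mat AJ * Y \<in> carrier_mat m p" using At Y by simp
  have AG: "AJ * G \<in> carrier_mat n m" using AJ G(2) by simp
  have HY: "H * Y \<in> carrier_mat n p" using H Y by simp
  have "S_of A J Y = transpose_mat Y * ((1\<^sub>m n - H) * Y)"
    unfolding S_of_eq by (rule assoc_mult_mat[OF Yt minus_carrier_mat[OF H] Y])
  also have "(1\<^sub>m n - H) * Y = Y - H * Y"
    using minus_mult_distrib_mat[OF one_carrier_mat H Y] Y by simp
  also have "transpose_mat Y * (Y - H * Y) = transpose_mat Y * Y - transpose_mat Y * (H * Y)"
    by (rule mult_minus_distrib_mat[OF Yt Y HY])
  also have "H * Y = AJ * (G * (transpose_mat AJ * Y))"
    unfolding H_def assoc_mult_mat[OF AG At Y] by (rule assoc_mult_mat[OF AJ G(2) AY])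
  also have "transpose_mat Y * (AJ * (G * (transpose_mat AJ * Y))) = transpose_mat Y * AJ * (G * (transpose_mat AJ * Y))"
    by (rule assoc_mult_mat[OF Yt AJ mult_carrier_mat[OF G(2) AY], symmetric])
  also have "\<dots> = transpose_mat Y * AJ * G * (transpose_mat AJ * Y)"
    by (rule assoc_mult_mat[OF mult_carrier_mat[OF Yt AJ] G(2) AY, symmetric])
  also have "transpose_mat Y * AJ = transpose_mat (transpose_mat AJ * Y)"
    unfolding transpose_mult[OF At Y] by simp
  finally show "S_of A J Y = transpose_mat Y * Y - transpose_mat (transpose_mat AJ * Y) * G * (transpose_mat AJ * Y)" .
qed

lemma zklic_tilt_algebra: "zklic A J P d \<in> borel_measurable tilt_algebra"
  by (rule measurable_zklic[OF _ X_of_tilt_algebra S_of_tilt_algebra]) (simp add: space_tilt_algebra)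

text \<open>This rewrites the mean of a smaller true model with coefficients for all columns of
  \<open>J\<close>, so that its tilts can be described within the model \<open>J\<close>.\<close>

lemma H_mean:
  assumes "J0 \<subseteq> J" "B \<in> carrier_mat (card J0) p"
  shows "cols_of A J0 * B = AJ * (G * (transpose_mat AJ * (cols_of A J0 * B)))"
proof -
  define M where "M = cols_of A J0 * B"
  have M: "M \<in> carrier_mat n p" unfolding M_def using cols_of_carrier[OF assms(1)] assms(2) by simp
  have At: "transpose_mat AJ \<in> carrier_mat m n" using AJ by simp
  have IH: "1\<^sub>m n - H \<in> carrier_mat n n" by (rule minus_carrier_mat[OF H])
  have AG: "AJ * G \<in> carrier_mat n m" using AJ G(2) by simp
  have "H * M = M"
  proof (rule eq_matI)
    fix a j assume "a < dim_row M" "j < dim_col M"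
    then have aj: "a < n" "j < p" using M by auto
    have "((1\<^sub>m n - H) * M) $$ (a, j) = (\<Sum>b<n. (1\<^sub>m n - H) $$ (a, b) * M $$ (b, j))"
      using aj carrier_matD[OF M] carrier_matD[OF IH] by (simp add: scalar_prod_def atLeast0LessThan del: index_minus_mat)
    also have "\<dots> = (\<Sum>b<n. Qf a b * M $$ (b, j))" using aj by (intro sum.cong refl) (simp only: Qf_index lessThan_iff)
    also have "\<dots> = 0" unfolding M_def using aj by (intro Qf_mean[OF assms])
    finally have "(M - H * M) $$ (a, j) = 0" using minus_mult_distrib_mat[OF one_carrier_mat H M] M by simp
    then show "(H * M) $$ (a, j) = M $$ (a, j)" using aj M H by simp
  qed (use M H in auto)
  then show ?thesis
    unfolding H_def M_def[symmetric] assoc_mult_mat[OF AG At M] assoc_mult_mat[OF AJ G(2) mult_carrier_mat[OF At M]] by simp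
qed

lemma tilts_orthogonal:
  assumes \<theta>: "(J0, B, S) \<in> true_params p J" and f: "f \<in> tilts"
    and hm: "h \<in> borel_measurable (lborel_mat n p)"
    and h: "\<And>J0 B S. (J0, B, S) \<in> true_params p J \<Longrightarrow> (\<integral>Y. h Y \<partial>model_law A J0 B S) = 0"
  shows "(\<integral>Y. f Y * h Y \<partial>model_law A J0 B S) = 0"
proof -
  have J0: "J0 \<subseteq> J" and B: "B \<in> carrier_mat (card J0) p" and S: "pos_def_mat p S"
    using \<theta> by (auto simp: true_params_def)
  define M where "M = cols_of A J0 * B"
  have M: "M \<in> carrier_mat n p" unfolding M_def using cols_of_carrier[OF J0] B by simp
  obtain K \<eta> c where f: "f = expo n p K (AJ * \<eta>) c" "psd p K" "\<eta> \<in> carrier_mat m p"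
    using f unfolding tilts_def by blast
  obtain S' C where S': "pos_def_mat p S'" and
    eq: "(\<integral>Y. f Y * h Y \<partial>matnormal M S) = C * (\<integral>Y. h Y \<partial>matnormal ((M * inv_mat S + AJ * \<eta>) * S') S')"
    unfolding f(1) using matnormal_tilt_integral[OF M S f(2) mult_carrier_mat[OF AJ f(3)] hm] by metis
  define B0 where "B0 = G * (transpose_mat AJ * M)"
  have At: "transpose_mat AJ \<in> carrier_mat m n" using AJ by simp
  have B0: "B0 \<in> carrier_mat m p" unfolding B0_def using G(2) At M by (intro mult_carrier_mat[of _ m m] mult_carrier_mat[of _ m n])
  have Ic: "inv_mat S \<in> carrier_mat p p" "S' \<in> carrier_mat p p" using pos_def_inv(1)[OF S] S' unfolding pos_def_mat_def by blast+
  have BI: "B0 * inv_mat S \<in> carrier_mat m p" using B0 Ic by simp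
  have "M * inv_mat S = AJ * (B0 * inv_mat S)"
    using H_mean[OF J0 B] unfolding M_def[symmetric] B0_def[symmetric] by (metis assoc_mult_mat[OF AJ B0 Ic(1)])
  then have "(M * inv_mat S + AJ * \<eta>) * S' = AJ * (B0 * inv_mat S + \<eta>) * S'"
    by (simp add: mult_add_distrib_mat[OF AJ BI f(3)])
  also have "\<dots> = AJ * ((B0 * inv_mat S + \<eta>) * S')"
    by (rule assoc_mult_mat[OF AJ add_carrier_mat[OF f(3)] Ic(2)])
  finally have *: "matnormal ((M * inv_mat S + AJ * \<eta>) * S') S' = model_law A J ((B0 * inv_mat S + \<eta>) * S') S'"
    by (simp add: model_law_def)
  have "(J, (B0 * inv_mat S + \<eta>) * S', S') \<in> true_params p J"
    using S' Ic f(3) BI by (auto simp: true_params_def m_def[symmetric] intro!: mult_carrier_mat[of _ m p] add_carrier_mat)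
  from h[OF this] show ?thesis using eq unfolding * model_law_def M_def[symmetric] by simp
qed

text \<open>The variance is compared under one law, yet unbiasedness enters at all parameters: it is
  what makes h orthogonal to every tilt under this one law.\<close>

lemma zklic_min_variance:
  assumes \<theta>: "(J0, B, S) \<in> true_params p J" and prob: "prob_space (model_law A J0 B S)"
    and Z: "\<And>J0 B S. (J0, B, S) \<in> true_params p J \<Longrightarrow> integrable (model_law A J0 B S) (zklic A J P d)"
    and \<delta>: "\<And>J0 B S. (J0, B, S) \<in> true_params p J \<Longrightarrow> integrable (model_law A J0 B S) \<delta>"
    and eq: "\<And>J0 B S. (J0, B, S) \<in> true_params p J \<Longrightarrow>
      integral\<^sup>L (model_law A J0 B S) \<delta> = integral\<^sup>L (model_law A J0 B S) (zklic A J P d)"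
  shows "estimator_variance (model_law A J0 B S) (zklic A J P d) \<le> estimator_variance (model_law A J0 B S) \<delta>"
proof -
  have J0: "J0 \<subseteq> J" and B: "B \<in> carrier_mat (card J0) p" using \<theta> by (auto simp: true_params_def)
  have M: "cols_of A J0 * B \<in> carrier_mat n p" using cols_of_carrier[OF J0] B by simp
  note law = sets_matnormal[OF M, of S, folded model_law_def] space_matnormal[OF M, of S, folded model_law_def]
  let ?L = "model_law A J0 B S"
  define h where "h Y = \<delta> Y - zklic A J P d Y" for Y
  have ih: "integrable (model_law A J0 B S) h" if "(J0, B, S) \<in> true_params p J" for J0 B S
    unfolding h_def using Z[OF that] \<delta>[OF that] by simp
  have mh: "h \<in> borel_measurable (lborel_mat n p)"
    using borel_measurable_integrable[OF ih[OF \<theta>]] law(1) by (simp cong: measurable_cong_sets)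
  have h0: "(\<integral>Y. h Y \<partial>model_law A J0 B S) = 0" if "(J0, B, S) \<in> true_params p J" for J0 B S
    unfolding h_def using Z[OF that] \<delta>[OF that] eq[OF that] by simp
  have fm: "f \<in> borel_measurable ?L" if "f \<in> tilts" for f
    using that measurable_expo law(1) by (auto simp: tilts_def cong: measurable_cong_sets)
  have orth: "(\<integral>Y. f Y * h Y \<partial>?L) = 0" if "f \<in> tilts" for f
    using tilts_orthogonal[OF \<theta> that mh h0] .
  have gens: "sets tilt_algebra = sigma_sets (carrier_mat n p) T.gens"
    by (rule sets_measure_of) (auto simp: T.gens_def)
  show ?thesis
  proof (rule estimator_variance_le[OF prob _ Z[OF \<theta>] \<delta>[OF \<theta>] zklic_tilt_algebra])
    show "subalgebra ?L tilt_algebra"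
      using T.sigma_gens_sets[OF law(2) fm ih[OF \<theta>] orth] gens by (simp add: subalgebra_def law(2) space_tilt_algebra)
    fix E assume E: "E \<in> sets tilt_algebra"
    then have E0: "(\<integral>Y\<in>E. h Y \<partial>?L) = 0"
      using T.orth_sigma[OF law(2) fm ih[OF \<theta>] orth] gens by simp
    have EL: "E \<in> sets ?L" using T.sigma_gens_sets[OF law(2) fm ih[OF \<theta>] orth] gens E by auto
    have i: "set_integrable ?L E \<delta>" "set_integrable ?L E (zklic A J P d)"
      unfolding set_integrable_def
      by (rule integrable_mult_indicator[OF EL \<delta>[OF \<theta>]], rule integrable_mult_indicator[OF EL Z[OF \<theta>]])
    show "(\<integral>Y\<in>E. \<delta> Y \<partial>?L) = (\<integral>Y\<in>E. zklic A J P d Y \<partial>?L)"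
      using E0 set_integral_diff(2)[OF i] unfolding h_def by simp
  qed
qed

end

theorem theorem6:
  fixes A P :: "real mat" and d :: "nat \<Rightarrow> real" and n p k :: nat and J :: "nat set"
  assumes A: "A \<in> carrier_mat n k" "vec_space.rank n A = k"
    and dims: "p + k + 1 < n" "0 < p" "p \<noteq> 1 \<or> J = {}"
    and J: "J \<subseteq> {..<k}"
    and P: "P \<in> carrier_mat (card J) (card J)" "transpose_mat P * P = 1\<^sub>m (card J)"
    and D: "transpose_mat P * gram_inv A J * P = mat_diag (card J) d"
    and d_decreasing: "\<And>i j. i \<le> j \<Longrightarrow> j < card J \<Longrightarrow> d j \<le> d i"
  shows "(\<forall>(J\<^sub>0, B, S) \<in> true_params p J.
            integrable (model_law A J\<^sub>0 B S \<Otimes>\<^sub>M model_law A J\<^sub>0 B S)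
              (kl_integrand A J\<^sub>0 B S (plugin_pdf A J P d))) \<and>
         umvu_estimator (true_params p J)
           (\<lambda>(J\<^sub>0, B, S). model_law A J\<^sub>0 B S)
           (\<lambda>(J\<^sub>0, B, S).
              2 * (kl_risk A J\<^sub>0 B S (plugin_pdf A J P d) - exp_log_true_pdf A J\<^sub>0 B S))
           (zklic A J P d)"
proof -
  interpret design A P d n p k J using A dims J P D by unfold_locales
  define risk where "risk J0 B S = 2 * (kl_risk A J0 B S (plugin_pdf A J P d) - exp_log_true_pdf A J0 B S)" for J0 B S
  have facts: "prob_space (model_law A J0 B S) \<and>
      integrable (model_law A J0 B S \<Otimes>\<^sub>M model_law A J0 B S) (kl_integrand A J0 B S (plugin_pdf A J P d)) \<and>
      integrable (model_law A J0 B S) (zklic A J P d) \<and>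
      integral\<^sup>L (model_law A J0 B S) (zklic A J P d) = risk J0 B S"
    if \<theta>: "(J0, B, S) \<in> true_params p J" for J0 B S
  proof -
    have J0: "J0 \<subseteq> J" and B: "B \<in> carrier_mat (card J0) p" and S: "pos_def_mat p S"
      using \<theta> by (auto simp: true_params_def)
    obtain L where L: "lower_factor p S L" using pos_def_lower_factor[OF S] .
    have M: "cols_of A J0 * B \<in> carrier_mat n p" using cols_of_carrier[OF J0] B by simp
    \<comment> \<open>Mean and triangular factor depend on the parameter, so the white-noise
      representation is set up anew for each parameter.\<close>
    interpret L: design_law A P d n p k J "cols_of A J0 * B" S L
      by unfold_locales (use M L Qf_mean[OF J0 B] in auto)
    have kl: "kl_integrand A J0 B S (plugin_pdf A J P d) =
      (\<lambda>z. ln (matnormal_pdf (cols_of A J0 * B) S (fst z) / plugin_pdf A J P d (snd z) (fst z)))"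
      by (auto simp: kl_integrand_def model_pdf_def fun_eq_iff)
    show ?thesis
      using L.prob_law L.kl_integrable L.zklic_integrable L.kl_expectation
      by (simp add: kl model_law_def risk_def kl_risk_def exp_log_true_pdf_def model_pdf_def)
  qed
  have "umvu_estimator (true_params p J) (\<lambda>(J0, B, S). model_law A J0 B S) (\<lambda>(J0, B, S). risk J0 B S) (zklic A J P d)"
    unfolding umvu_estimator_def
  proof (intro conjI allI impI ballI)
    show "unbiased_estimator (true_params p J) (\<lambda>(J0, B, S). model_law A J0 B S) (\<lambda>(J0, B, S). risk J0 B S) (zklic A J P d)"
      using facts by (auto simp: unbiased_estimator_def)
    fix \<delta> \<theta>
    assume \<delta>: "unbiased_estimator (true_params p J) (\<lambda>(J0, B, S). model_law A J0 B S) (\<lambda>(J0, B, S). risk J0 B S) \<delta>"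
      and \<theta>: "\<theta> \<in> true_params p J"
    obtain J0 B S where [simp]: "\<theta> = (J0, B, S)" by (cases \<theta>)
    have "integrable (model_law A J0 B S) \<delta>" "integral\<^sup>L (model_law A J0 B S) \<delta> = risk J0 B S"
      if "(J0, B, S) \<in> true_params p J" for J0 B S
      using \<delta> that by (auto simp: unbiased_estimator_def)
    then show "estimator_variance (case \<theta> of (J0, B, S) \<Rightarrow> model_law A J0 B S) (zklic A J P d)
        \<le> estimator_variance (case \<theta> of (J0, B, S) \<Rightarrow> model_law A J0 B S) \<delta>"
      using zklic_min_variance[of J0 B S \<delta>] facts \<theta> by simp
  qed
  then show ?thesis using facts by (auto simp: risk_def)
qed

end
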